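(* Let $n\geq 4$ be even, and let $X$ be a closed oriented surface of genus $g\geq 2$. Then continuous principal $\mathrm{PO}(n)$-bundles over $X$ are classified, up to isomorphism, by the invariants $$(\mu_1,\mu_2)\in\left(\{0\}\times\{0,1,\omega_n\}\right)\cup\left(\left((\mathbb{Z}/2)^{2g}\setminus\{0\}\right)\times\mathbb{Z}/2\right),$$ i.e. $E\mapsto(\mu_1(E),\mu_2(E))$ induces a bijection from the set of isomorphism classes of continuous principal $\mathrm{PO}(n)$-bundles over $X$ onto this set (where for $\mu_1\ne 0$ the factor $\mathbb{Z}/2$ is $\{0,\omega_n\}$).
   Context: $\mathrm{PO}(n)=\mathrm{O}(n)/\{\pm I_n\}$. For $n$ even $\pi_0\mathrm{PO}(n)=\mathbb{Z}/2$, with identity component $\mathrm{PSO}(n)=\mathrm{SO}(n)/\{\pm I_n\}$. The group $\pi_1\mathrm{PO}(n)$ is identified with the kernel of the covering $\mathrm{Pin}(n)\to\mathrm{O}(n)\to\mathrm{PO}(n)$, which as a set is $\{1,-1,\omega_n,-\omega_n\}$, $\omega_n=e_1\cdots e_n$ in the Clifford algebra; it is isomorphic to $\mathbb{Z}/2\times\mathbb{Z}/2$ if $n\equiv0\bmod 4$ and to $\mathbb{Z}/4$ if $n\equiv 2\bmod 4$. It is written additively as $\{0,1,\omega_n,-\omega_n\}$ (so $1\in\mathrm{Pin}(n)$ becomes $0$ and $-1\in\mathrm{Pin}(n)$ becomes $1$). $\pi_0\mathrm{PO}(n)$ acts on it by conjugation; the nontrivial element fixes $0,1$ and exchanges $\omega_n$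 and $-\omega_n$. For a continuous principal $\mathrm{PO}(n)$-bundle $E$ on $X$, $\mu_1(E)\in H^1(X,\pi_0\mathrm{PO}(n))\cong\mathrm{Hom}(\pi_1X,\mathbb{Z}/2)\cong(\mathbb{Z}/2)^{2g}$ is the class induced by $\mathrm{PO}(n)\to\pi_0\mathrm{PO}(n)$. Let $\Gamma_{\mu_1}\subset\pi_1\mathrm{PO}(n)$ be the subgroup generated by all $\gamma_2-\gamma_1\cdot\gamma_2$ with $\gamma_2\in\pi_1\mathrm{PO}(n)$ and $\gamma_1$ in the image of $\mu_1(E):\pi_1X\to\pi_0\mathrm{PO}(n)$; so $\Gamma_{\mu_1}=0$ if $\mu_1=0$ and $\Gamma_{\mu_1}=\{0,1\}$ if $\mu_1\ne0$. The invariant $\mu_2(E)\in(\pi_1\mathrm{PO}(n)/\Gamma_{\mu_1})/\pi_0\mathrm{PO}(n)$ takes values in $\{0,1,\omega_n\}$ if $\mu_1=0$ and in $\{0,\omega_n\}\cong\mathbb{Z}/2$ if $\mu_1\neq 0$ (in the latter case $0$ denotes the class of $0$ and $1$, and $\omega_n$ the class of $\pm\omega_n$). It is defined as follows. Write $X$ as the quotient $\pi:P\to X$ of a regular $4g$-gon with sides identified by $\prod A_jB_jA_j^{-1}B_j^{-1}$; let $c$ be the centre of $P$, $U=\pi(P\setminus\{c\})$ and $V=\pi(B(c,\epsilon))$ a small disc. Trivialize $E|_V$, and trivialize $\pi^*(E|_U)$ so that the identifications over the sides of $P$ are constant elements of $\{[I_n],[r]\}$ (prescribed by $\mu_1$),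 where $r$ is a fixed reflection; the gluing of $E|_U$ and $E|_V$ over $U\cap V\simeq S^1$ is then a loop in $\mathrm{PO}(n)$, which (in adequate trivializations) lies in $\mathrm{PSO}(n)$ and gives $\rho_0\in\pi_1\mathrm{PO}(n)$; $\mu_2(E)$ is the class of $\rho_0$. *)

theory Defs
  imports
    "HOL-Analysis.Analysis"
    "HOL-Algebra.Coset"
    "HOL-Algebra.Generated_Groups"
    "HOL-Library.Equipollence"
    "HOL-Library.Z2"
begin

section \<open>Quotient topologies\<close>

definition quotient_topology :: "'a topology \<Rightarrow> ('a \<Rightarrow> 'b) \<Rightarrow> 'b topology" where
  "quotient_topology X q =
     topology (\<lambda>U. U \<subseteq> q ` topspace X \<and> openin X {x \<in> topspace X. q x \<in> U})"

lemma openin_quotient_topology: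
  "openin (quotient_topology X q) U \<longleftrightarrow>
     U \<subseteq> q ` topspace X \<and> openin X {x \<in> topspace X. q x \<in> U}"
proof -
  have "istopology (\<lambda>U. U \<subseteq> q ` topspace X \<and> openin X {x \<in> topspace X. q x \<in> U})"
    unfolding istopology_def
  proof (intro conjI allI impI)
    fix S T
    assume S: "S \<subseteq> q ` topspace X \<and> openin X {x \<in> topspace X. q x \<in> S}"
      and T: "T \<subseteq> q ` topspace X \<and> openin X {x \<in> topspace X. q x \<in> T}"
    show "S \<inter> T \<subseteq> q ` topspace X" using S by blast
    have "openin X ({x \<in> topspace X. q x \<in> S} \<inter> {x \<in> topspace X. q x \<in> T})"
      using S T by (intro openin_Int) auto
    moreover have "{x \<in> topspace X. q x \<in> S} \<inter> {x \<in> topspace X. q x \<in> T}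
        = {x \<in> topspace X. q x \<in> S \<inter> T}" by blast
    ultimately show "openin X {x \<in> topspace X. q x \<in> S \<inter> T}" by (rule back_subst)
  next
    fix K
    assume K: "\<forall>S\<in>K. S \<subseteq> q ` topspace X \<and> openin X {x \<in> topspace X. q x \<in> S}"
    show "\<Union>K \<subseteq> q ` topspace X" using K by blast
    have "openin X (\<Union>((\<lambda>S. {x \<in> topspace X. q x \<in> S}) ` K))"
      using K by (intro openin_Union) blast
    moreover have "\<Union>((\<lambda>S. {x \<in> topspace X. q x \<in> S}) ` K) = {x \<in> topspace X. q x \<in> \<Union>K}"
      by blast
    ultimately show "openin X {x \<in> topspace X. q x \<in> \<Union>K}" by (rule back_subst)
  qed
  then show ?thesis by (simp add: quotient_topology_def topology_inverse')
qed

lemma topspace_quotient_topology: "topspace (quotient_topology X q) = q ` topspace X"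
proof (rule antisym)
  have "openin (quotient_topology X q) (topspace (quotient_topology X q))" by (rule openin_topspace)
  then show "topspace (quotient_topology X q) \<subseteq> q ` topspace X"
    unfolding openin_quotient_topology by (rule conjunct1)
  have "{x \<in> topspace X. q x \<in> q ` topspace X} = topspace X" by blast
  then have "openin (quotient_topology X q) (q ` topspace X)"
    unfolding openin_quotient_topology by (metis openin_topspace order_refl)
  then show "q ` topspace X \<subseteq> topspace (quotient_topology X q)" by (rule openin_subset)
qed


section \<open>Principal bundles\<close>

record ('e, 'x, 'g) bundle_data =
  total_space :: "'e topology"
  bundle_proj :: "'e \<Rightarrow> 'x"
  bundle_act :: "'e \<Rightarrow> 'g \<Rightarrow> 'e"

definition trivialization ::
    "'g monoid \<Rightarrow> 'g topology \<Rightarrow> 'x topology \<Rightarrow> ('e, 'x, 'g) bundle_data \<Rightarrow> 'x set \<Rightarrow>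
      ('x \<times> 'g \<Rightarrow> 'e) \<Rightarrow> bool" where
  "trivialization G T X E W \<phi> \<longleftrightarrow>
     W \<subseteq> topspace X \<and>
     homeomorphic_map (prod_topology (subtopology X W) T)
       (subtopology (total_space E) {e \<in> topspace (total_space E). bundle_proj E e \<in> W}) \<phi> \<and>
     (\<forall>x\<in>W. \<forall>a\<in>carrier G. bundle_proj E (\<phi> (x, a)) = x \<and>
        (\<forall>b\<in>carrier G. \<phi> (x, a \<otimes>\<^bsub>G\<^esub> b) = bundle_act E (\<phi> (x, a)) b))"

text \<open>The action is a right action; that it is free and transitive on the fibres follows
  from local triviality.\<close>

definition principal_bundle ::
    "'g monoid \<Rightarrow> 'g topology \<Rightarrow> 'x topology \<Rightarrow> ('e, 'x, 'g) bundle_data \<Rightarrow> bool" where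
  "principal_bundle G T X E \<longleftrightarrow>
     continuous_map (total_space E) X (bundle_proj E) \<and>
     continuous_map (prod_topology (total_space E) T) (total_space E) (\<lambda>(e, a). bundle_act E e a) \<and>
     (\<forall>e\<in>topspace (total_space E). bundle_act E e \<one>\<^bsub>G\<^esub> = e \<and>
        (\<forall>a\<in>carrier G. bundle_proj E (bundle_act E e a) = bundle_proj E e \<and>
           (\<forall>b\<in>carrier G. bundle_act E (bundle_act E e a) b = bundle_act E e (a \<otimes>\<^bsub>G\<^esub> b)))) \<and>
     (\<forall>x\<in>topspace X. \<exists>W \<phi>. openin X W \<and> x \<in> W \<and> trivialization G T X E W \<phi>)"

text \<open>Isomorphisms cover the identity of the base.\<close>

definition bundle_isomorphic ::
    "'g monoid \<Rightarrow> ('e, 'x, 'g) bundle_data \<Rightarrow> ('f, 'x, 'g) bundle_data \<Rightarrow> bool" where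
  "bundle_isomorphic G E E' \<longleftrightarrow>
     (\<exists>f. homeomorphic_map (total_space E) (total_space E') f \<and>
        (\<forall>e\<in>topspace (total_space E). bundle_proj E' (f e) = bundle_proj E e \<and>
           (\<forall>a\<in>carrier G. f (bundle_act E e a) = bundle_act E' (f e) a)))"

definition bundle_iso_rel ::
    "'g monoid \<Rightarrow> 'g topology \<Rightarrow> 'x topology \<Rightarrow> ('e, 'x, 'g) bundle_data rel" where
  "bundle_iso_rel G T X = {(E, E').
     principal_bundle G T X E \<and> principal_bundle G T X E' \<and> bundle_isomorphic G E E'}"

definition pullback_bundle ::
    "'y topology \<Rightarrow> ('y \<Rightarrow> 'x) \<Rightarrow> ('e, 'x, 'g) bundle_data \<Rightarrow> ('y \<times> 'e, 'y, 'g) bundle_data" where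
  "pullback_bundle Y f E =
     \<lparr> total_space = subtopology (prod_topology Y (total_space E)) {(y, e). f y = bundle_proj E e},
       bundle_proj = fst,
       bundle_act = (\<lambda>(y, e) a. (y, bundle_act E e a)) \<rparr>"


section \<open>The group PO(n)\<close>

type_synonym 'n sq_matrix = "real^'n^'n"

definition orthogonal_group :: "'n::finite sq_matrix monoid" where
  "orthogonal_group = \<lparr> carrier = {A. orthogonal_matrix A}, monoid.mult = (**), one = mat 1 \<rparr>"

definition PO :: "'n::finite sq_matrix set monoid" where
  "PO = orthogonal_group Mod {mat 1, - mat 1}"

definition PO_class :: "'n::finite sq_matrix \<Rightarrow> 'n sq_matrix set" where
  "PO_class A = {mat 1, - mat 1} #>\<^bsub>orthogonal_group\<^esub> A"

definition PO_topology :: "'n::finite sq_matrix set topology" where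
  "PO_topology = quotient_topology (top_of_set {A. orthogonal_matrix A}) PO_class"

definition PSO :: "'n::finite sq_matrix set set" where
  "PSO = PO_class ` {A. rotation_matrix A}"

text \<open>The projection to \<open>\<pi>\<^sub>0 PO(n) = \<int>/2\<close> for even \<open>n\<close>, when \<open>PSO(n)\<close> is the identity
  component and its complement is the other one.\<close>

definition PO_component :: "'n::finite sq_matrix set \<Rightarrow> bit" where
  "PO_component a = (if a \<in> PSO then 0 else 1)"

definition hyperplane_reflection :: "'n::finite sq_matrix \<Rightarrow> bool" where
  "hyperplane_reflection A \<longleftrightarrow>
     (\<exists>v. norm v = 1 \<and> (\<forall>x. A *v x = x - (2 * (v \<bullet> x)) *\<^sub>R v))"


section \<open>The Clifford algebra, Pin(n), and \<open>\<pi>\<^sub>1 PO(n)\<close>\<close>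

text \<open>The Clifford algebra has the basis \<open>e\<^sub>S\<close>, for \<open>S\<close> a set of indices, where \<open>e\<^sub>S\<close> is the
  product of the \<open>e\<^sub>i\<close> with \<open>i \<in> S\<close> in increasing order. The convention is \<open>e\<^sub>i e\<^sub>i = -1\<close>:
  in \<open>e\<^sub>S e\<^sub>T = \<plusminus> e\<^sub>U\<close>, with \<open>U\<close> the symmetric difference of \<open>S\<close> and \<open>T\<close>, every pair
  \<open>s > t\<close> contributes a sign from a transposition and every pair \<open>s = t\<close> one from
  the square.\<close>

type_synonym 'n clifford = "real^('n set)"

definition cl_basis :: "'n::finite set \<Rightarrow> 'n clifford" where
  "cl_basis S = axis S 1"

definition cl_sign :: "'n::{finite,linorder} set \<Rightarrow> 'n set \<Rightarrow> real" where
  "cl_sign S T = (- 1) ^ card {(s, t). s \<in> S \<and> t \<in> T \<and> t \<le> s}"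

definition cl_mult ::
    "'n::{finite,linorder} clifford \<Rightarrow> 'n clifford \<Rightarrow> 'n clifford" where
  "cl_mult x y =
     (\<Sum>S\<in>UNIV. \<Sum>T\<in>UNIV. (x $ S * y $ T * cl_sign S T) *\<^sub>R cl_basis ((S - T) \<union> (T - S)))"

definition cl_vec :: "real^'n \<Rightarrow> 'n clifford" where
  "cl_vec v = (\<Sum>i\<in>UNIV. (v $ i) *\<^sub>R cl_basis {i})"

definition cl_grade_involution :: "'n::finite clifford \<Rightarrow> 'n clifford" where
  "cl_grade_involution x = (\<chi> S. (- 1) ^ card S * x $ S)"

definition cl_one :: "'n::finite clifford" where
  "cl_one = cl_basis {}"

definition cl_omega :: "'n::finite clifford" where
  "cl_omega = cl_basis UNIV"

text \<open>\<open>Pin(n)\<close> consists of the products of unit vectors; it is closed under inverses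
  because \<open>v (-v) = 1\<close> for a unit vector \<open>v\<close>.\<close>

inductive_set pin_set :: "'n::{finite,linorder} clifford set" where
  one: "cl_one \<in> pin_set"
| mult: "norm v = 1 \<Longrightarrow> x \<in> pin_set \<Longrightarrow> cl_mult (cl_vec v) x \<in> pin_set"

definition Pin :: "'n::{finite,linorder} clifford monoid" where
  "Pin = \<lparr> carrier = pin_set, monoid.mult = cl_mult, one = cl_one \<rparr>"

text \<open>The covering \<open>Pin(n) \<rightarrow> O(n)\<close> is the twisted adjoint representation, under which a unit
  vector acts as the reflection in its orthogonal hyperplane.\<close>

definition pin_to_O :: "'n::{finite,linorder} clifford \<Rightarrow> 'n sq_matrix" where
  "pin_to_O p = matrix (\<lambda>v.
     \<chi> i. (cl_grade_involution p \<otimes>\<^bsub>Pin\<^esub> cl_vec v \<otimes>\<^bsub>Pin\<^esub> inv\<^bsub>Pin\<^esub> p) $ {i})"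

definition pin_to_PO :: "'n::{finite,linorder} clifford \<Rightarrow> 'n sq_matrix set" where
  "pin_to_PO p = PO_class (pin_to_O p)"

definition pi1_PO :: "'n::{finite,linorder} clifford set" where
  "pi1_PO = kernel Pin PO pin_to_PO"

text \<open>The identification of homotopy classes of loops with elements of the kernel of
  \<open>Pin(n) \<rightarrow> PO(n)\<close>: the loop \<open>\<rho>\<close> represents \<open>z\<close> if it has a lift to \<open>Pin(n)\<close> from some \<open>p\<close>
  to \<open>p z\<close>. A loop in \<open>PSO(n)\<close> need not start at the identity; its \<open>z\<close> does not depend on
  the lift, since even elements of \<open>Pin(n)\<close> commute with the kernel.\<close>

definition represents_pi1 ::
    "(real \<Rightarrow> 'n::{finite,linorder} sq_matrix set) \<Rightarrow> 'n clifford \<Rightarrow> bool" where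
  "represents_pi1 \<rho> z \<longleftrightarrow> z \<in> pi1_PO \<and>
     (\<exists>c. pathin (top_of_set pin_set) c \<and> (\<forall>t\<in>{0..1}. pin_to_PO (c t) = \<rho> t) \<and>
          c 1 = c 0 \<otimes>\<^bsub>Pin\<^esub> z)"


section \<open>The surface\<close>

text \<open>The regular \<open>4g\<close>-gon has centre \<open>0\<close>; its sides, traversed counterclockwise, spell
  \<open>\<Prod>j<g. A\<^sub>j B\<^sub>j A\<^sub>j\<inverse> B\<^sub>j\<inverse>\<close>, so that sides \<open>4j\<close> and \<open>4j + 2\<close> (and likewise \<open>4j + 1\<close> and
  \<open>4j + 3\<close>) are identified with reversal of the parameter.\<close>

definition polygon_vertex :: "nat \<Rightarrow> nat \<Rightarrow> complex" where
  "polygon_vertex g k = cis (2 * pi * real k / real (4 * g))"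

definition polygon :: "nat \<Rightarrow> complex set" where
  "polygon g = convex hull (polygon_vertex g ` {..<4 * g})"

definition polygon_side :: "nat \<Rightarrow> nat \<Rightarrow> real \<Rightarrow> complex" where
  "polygon_side g k = linepath (polygon_vertex g k) (polygon_vertex g (Suc k))"

definition side_pairing :: "nat \<Rightarrow> complex rel" where
  "side_pairing g =
     {(polygon_side g (4 * j + i) t, polygon_side g (4 * j + i + 2) (1 - t)) | i j t.
        i < 2 \<and> j < g \<and> t \<in> {0..1}}"

text \<open>\<open>X\<close> is the closed oriented surface of genus \<open>g\<close>, written as a quotient of the polygon.
  The equivalence relation generated by the side pairing identifies all the vertices.\<close>

definition closed_surface_presentation ::
    "nat \<Rightarrow> 'x topology \<Rightarrow> (complex \<Rightarrow> 'x) \<Rightarrow> bool" where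
  "closed_surface_presentation g X q \<longleftrightarrow>
     quotient_map (top_of_set (polygon g)) X q \<and>
     (\<forall>x\<in>polygon g. \<forall>y\<in>polygon g.
        q x = q y \<longleftrightarrow> (x, y) \<in> (side_pairing g \<union> (side_pairing g)\<inverse>)\<^sup>*)"

text \<open>The loops \<open>A\<^sub>0, B\<^sub>0, A\<^sub>1, B\<^sub>1, \<dots>\<close> that generate the fundamental group.\<close>

definition generator_loop :: "nat \<Rightarrow> (complex \<Rightarrow> 'x) \<Rightarrow> nat \<Rightarrow> real \<Rightarrow> 'x" where
  "generator_loop g q k t = q (polygon_side g (4 * (k div 2) + k mod 2) t)"


section \<open>The invariant \<open>\<mu>\<^sub>1\<close>\<close>

text \<open>The principal \<open>\<pi>\<^sub>0 PO(n)\<close>-bundle associated with \<open>E\<close> is the double covering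
  \<open>E/PSO(n)\<close> of the base; the class \<open>\<mu>\<^sub>1(E)\<close> in \<open>Hom(\<pi>\<^sub>1 X, \<int>/2)\<close> is its monodromy.\<close>

definition PSO_quotient ::
    "('e, 'x, 'n::finite sq_matrix set) bundle_data \<Rightarrow> 'e set topology" where
  "PSO_quotient E = quotient_topology (total_space E) (\<lambda>e. bundle_act E e ` PSO)"

definition component_monodromy ::
    "('e, 'x, 'n::finite sq_matrix set) bundle_data \<Rightarrow> (real \<Rightarrow> 'x) \<Rightarrow> bit" where
  "component_monodromy E \<gamma> =
     (if \<exists>c. pathin (PSO_quotient E) c \<and> (\<forall>t\<in>{0..1}. bundle_proj E ` c t = {\<gamma> t}) \<and> c 1 = c 0
      then 0 else 1)"

text \<open>\<open>(\<int>/2)\<^bsup>2g\<^esup>\<close>, identified with \<open>Hom(\<pi>\<^sub>1 X, \<int>/2)\<close> by evaluation on the generators.\<close>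

definition Z2_tuples :: "nat \<Rightarrow> (nat \<Rightarrow> bit) set" where
  "Z2_tuples g = {..<2 * g} \<rightarrow>\<^sub>E UNIV"

definition Z2_zero :: "nat \<Rightarrow> nat \<Rightarrow> bit" where
  "Z2_zero g = (\<lambda>k\<in>{..<2 * g}. 0)"

definition mu1 ::
    "nat \<Rightarrow> (complex \<Rightarrow> 'x) \<Rightarrow> ('e, 'x, 'n::finite sq_matrix set) bundle_data \<Rightarrow> nat \<Rightarrow> bit" where
  "mu1 g q E = (\<lambda>k\<in>{..<2 * g}. component_monodromy E (generator_loop g q k))"


section \<open>The invariant \<open>\<mu>\<^sub>2\<close>\<close>

definition pin_conj ::
    "'n::{finite,linorder} clifford \<Rightarrow> 'n clifford \<Rightarrow> 'n clifford" where
  "pin_conj p z = p \<otimes>\<^bsub>Pin\<^esub> z \<otimes>\<^bsub>Pin\<^esub> inv\<^bsub>Pin\<^esub> p"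

text \<open>The image of \<open>\<pi>\<^sub>1 X\<close> under the homomorphism to \<open>\<int>/2\<close> with values \<open>m\<close> on the generators.\<close>

definition mu1_image :: "nat \<Rightarrow> (nat \<Rightarrow> bit) \<Rightarrow> bit set" where
  "mu1_image g m = insert 0 (m ` {..<2 * g})"

text \<open>The action of \<open>\<pi>\<^sub>0 PO(n)\<close> on \<open>\<pi>\<^sub>1 PO(n)\<close> is conjugation by elements of \<open>Pin(n)\<close> above
  the component in question. The group \<open>\<pi>\<^sub>1 PO(n)\<close> is written multiplicatively here: its
  additively written elements \<open>0, 1, \<omega>\<^sub>n, -\<omega>\<^sub>n\<close> are the Clifford elements
  \<open>1, -1, \<omega>\<^sub>n, -\<omega>\<^sub>n\<close>.\<close>

definition Gamma_mu1 ::
    "nat \<Rightarrow> (nat \<Rightarrow> bit) \<Rightarrow> 'n::{finite,linorder} clifford set" where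
  "Gamma_mu1 g m = generate Pin
     {z \<otimes>\<^bsub>Pin\<^esub> inv\<^bsub>Pin\<^esub> (pin_conj p z) | z p.
        z \<in> pi1_PO \<and> p \<in> carrier Pin \<and> PO_component (pin_to_PO p) \<in> mu1_image g m}"

text \<open>The class of \<open>z\<close> in \<open>(\<pi>\<^sub>1 PO(n) / \<Gamma>) / \<pi>\<^sub>0 PO(n)\<close>, as an orbit of cosets.\<close>

definition mu2_class ::
    "nat \<Rightarrow> (nat \<Rightarrow> bit) \<Rightarrow> 'n::{finite,linorder} clifford \<Rightarrow> 'n clifford set set" where
  "mu2_class g m z =
     {pin_conj p ` (Gamma_mu1 g m #>\<^bsub>Pin\<^esub> z) | p. p \<in> carrier Pin}"

text \<open>A trivialization of the pullback of \<open>E\<close> to the punctured polygon for which the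
  identifications over the sides are constants in \<open>{[I], [r]}\<close>. Which of the two occurs is
  forced by \<open>E\<close>, as they lie in different components of \<open>PO(n)\<close>.\<close>

definition adapted_trivialization ::
    "nat \<Rightarrow> (complex \<Rightarrow> 'x) \<Rightarrow> 'n::finite sq_matrix \<Rightarrow> ('e, 'x, 'n sq_matrix set) bundle_data \<Rightarrow>
      (complex \<times> 'n sq_matrix set \<Rightarrow> complex \<times> 'e) \<Rightarrow> bool" where
  "adapted_trivialization g q r E \<tau> \<longleftrightarrow>
     trivialization PO PO_topology (top_of_set (polygon g - {0}))
       (pullback_bundle (top_of_set (polygon g - {0})) q E) (polygon g - {0}) \<tau> \<and>
     (\<forall>j<g. \<forall>i<2. \<exists>h\<in>{PO_class (mat 1), PO_class r}. \<forall>t\<in>{0..1}.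
        snd (\<tau> (polygon_side g (4 * j + i + 2) (1 - t), \<one>\<^bsub>PO\<^esub>)) =
        bundle_act E (snd (\<tau> (polygon_side g (4 * j + i) t, \<one>\<^bsub>PO\<^esub>))) h)"

text \<open>\<open>\<rho>\<close> is the gluing, along a circle of radius \<open>\<delta>\<close> around the centre, of the trivialization
  \<open>\<tau>\<close> outside the centre with a trivialization \<open>\<sigma>\<close> over a small disc \<open>V\<close>.\<close>

definition gluing_loop ::
    "nat \<Rightarrow> 'x topology \<Rightarrow> (complex \<Rightarrow> 'x) \<Rightarrow> 'n::finite sq_matrix \<Rightarrow>
      ('e, 'x, 'n sq_matrix set) bundle_data \<Rightarrow> (real \<Rightarrow> 'n sq_matrix set) \<Rightarrow> bool" where
  "gluing_loop g X q r E \<rho> \<longleftrightarrow>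
     (\<exists>\<tau> \<sigma> \<epsilon> \<delta>. adapted_trivialization g q r E \<tau> \<and>
        0 < \<delta> \<and> \<delta> < \<epsilon> \<and> ball 0 \<epsilon> \<subseteq> interior (polygon g) \<and>
        trivialization PO PO_topology X E (q ` ball 0 \<epsilon>) \<sigma> \<and>
        (\<forall>t\<in>{0..1}. \<rho> t \<in> PSO \<and>
           snd (\<tau> (\<delta> *\<^sub>R cis (2 * pi * t), \<one>\<^bsub>PO\<^esub>)) =
           bundle_act E (\<sigma> (q (\<delta> *\<^sub>R cis (2 * pi * t)), \<one>\<^bsub>PO\<^esub>)) (\<rho> t)))"

definition mu2 ::
    "nat \<Rightarrow> 'x topology \<Rightarrow> (complex \<Rightarrow> 'x) \<Rightarrow> 'n::{finite,linorder} sq_matrix \<Rightarrow>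
      ('e, 'x, 'n sq_matrix set) bundle_data \<Rightarrow> 'n clifford set set" where
  "mu2 g X q r E =
     (THE y. \<exists>\<rho> z. gluing_loop g X q r E \<rho> \<and> represents_pi1 \<rho> z \<and> y = mu2_class g (mu1 g q E) z)"

text \<open>\<open>{0} \<times> {0, 1, \<omega>\<^sub>n}\<close> together with \<open>((\<int>/2)\<^bsup>2g\<^esup> - {0}) \<times> {0, \<omega>\<^sub>n}\<close>.\<close>

definition invariant_values ::
    "nat \<Rightarrow> ((nat \<Rightarrow> bit) \<times> 'n::{finite,linorder} clifford set set) set" where
  "invariant_values g =
     {Z2_zero g} \<times> mu2_class g (Z2_zero g) ` {cl_one, - cl_one, cl_omega} \<union>
     (SIGMA m : Z2_tuples g - {Z2_zero g}. mu2_class g m ` {cl_one, cl_omega})"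

end

theory Submission
  imports Defs
begin

text \<open>Pulled back to the polygon, a bundle is trivial. A trivialization outside the centre whose
  side identifications are constants in \<open>{[I], [r]}\<close> amounts to a section over the whole polygon
  together with a map \<open>f\<close> from the punctured polygon to \<open>PO(n)\<close>, and \<open>\<rho>\<^sub>0\<close> is read off a lift to
  \<open>Pin(n)\<close> of \<open>f\<close> along a loop around the centre. Two such choices differ by a map to \<open>PO(n)\<close>
  that is equivariant under the side pairing. Along the four sides of a block
  \<open>A\<^sub>j B\<^sub>j A\<^sub>j\<inverse> B\<^sub>j\<inverse>\<close> the lift of an equivariant map returns to its start up to sign, so
  that its winding is \<open>\<plusminus>1\<close>, and \<open>1\<close> if \<open>\<mu>\<^sub>1 = 0\<close>; if \<open>\<mu>\<^sub>1 \<noteq> 0\<close>, a path from \<open>1\<close> to \<open>\<omega>\<close> along a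
  pair of sides identified by \<open>r\<close> gives an equivariant map of winding \<open>-1\<close>. A constant odd change
  of \<open>f\<close> exchanges \<open>\<omega>\<close> and \<open>-\<omega>\<close>. Hence the class of \<open>\<rho>\<^sub>0\<close> is well defined. If it agrees for two
  bundles, the choices can be made with equal windings, and then the comparison of the two
  trivializations extends over the centre because \<open>Spin(n)\<close> is simply connected.
  All values are attained by gluing flat charts with a chart around the centre that is
  twisted by the given loop.\<close>

section \<open>The Clifford algebra and Pin(n)\<close>

text \<open>The invariant \<open>mu2\<close> depends on choices of trivializations, and the
  difficulty is to control how they change the loop. Everything is therefore expressed by lifts to
  Pin(n) along the boundary of the polygon. The decisive point is that the gluing elements are
  commuting involutions in O(n): there the kernel element picked up over a pair of sides becomes a
  sign, and each such sign enters twice around a block, so that an equivariant map cannot have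
  winding omega or -omega. The winding -1 is realised exactly when some pair of sides is identified
  by \<open>r\<close>, because conjugation by a lift of \<open>r\<close> sends omega to -omega; the
  same relation generates \<open>Gamma_mu1\<close>. For the existence of adapted trivializations the
  obstacle is that all 4g vertices are one point of X, so that the values at the vertices must
  satisfy all side identifications at once. Lifting needs only local sections and a continuous
  division; hence one lifting theorem serves the bundles, the covering Pin(n) -> PO(n) and the
  fibrations of Spin groups over spheres.\<close>

notation cl_mult (infixl "\<star>" 70)

section \<open>The Clifford algebra as a twisted group algebra of the subsets under symmetric
  difference\<close>

lemma prod_symdiff:
  fixes f :: "'a \<Rightarrow> 'b::comm_ring_1"
  assumes "finite S" "finite T" "\<And>x. f x * f x = 1"
  shows "prod f ((S - T) \<union> (T - S)) = prod f S * prod f T"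
proof -
  have S: "prod f S = prod f (S - T) * prod f (S \<inter> T)"
    using assms by (subst prod.union_disjoint[symmetric]) (auto intro!: arg_cong2[of _ _ _ _ prod])
  have T: "prod f T = prod f (T - S) * prod f (S \<inter> T)"
    using assms by (subst prod.union_disjoint[symmetric]) (auto intro!: arg_cong2[of _ _ _ _ prod])
  have "prod f (S \<inter> T) * prod f (S \<inter> T) = 1"
    using assms(3) by (simp flip: prod.distrib)
  then have "prod f S * prod f T = prod f (S - T) * prod f (T - S)"
    unfolding S T by (metis mult.assoc mult.commute mult_1)
  also have "\<dots> = prod f ((S - T) \<union> (T - S))"
    using assms by (subst prod.union_disjoint) auto
  finally show ?thesis by simp
qed

lemma cl_sign_prod:
  fixes S T :: "'n::{finite,linorder} set"
  shows "cl_sign S T = (\<Prod>s\<in>S. \<Prod>t\<in>T. if t \<le> s then -1 else 1)"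
proof -
  have "(\<Prod>s\<in>S. \<Prod>t\<in>T. if t \<le> s then -1 else (1::real)) = (\<Prod>(s,t)\<in>S \<times> T. if t \<le> s then -1 else 1)"
    by (simp add: prod.cartesian_product)
  also have "\<dots> = (\<Prod>p\<in>{p\<in>S \<times> T. snd p \<le> fst p}. -1)"
    unfolding case_prod_beta by (subst prod.inter_filter[symmetric]) auto
  also have "{p\<in>S \<times> T. snd p \<le> fst p} = {(s, t). s \<in> S \<and> t \<in> T \<and> t \<le> s}"
    by auto
  finally show ?thesis by (simp add: cl_sign_def)
qed

lemma cl_sign_square [simp]: "cl_sign S T * cl_sign S T = 1"
  by (simp add: cl_sign_def flip: power_add)

text \<open>Elements common to S and T contribute each sign twice, so only the symmetric difference
  matters. Together with the version for the right argument this makes \<open>cl_sign\<close> a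
  bicharacter on the group of subsets; bicharacters are 2-cocycles, which is what associativity
  needs.\<close>

lemma cl_sign_symdiff_left:
  "cl_sign ((S - T) \<union> (T - S)) U = cl_sign S U * cl_sign T U"
  unfolding cl_sign_prod
  by (subst prod_symdiff) (auto simp flip: prod.distrib intro!: prod.neutral)

lemma cl_sign_symdiff_right:
  "cl_sign U ((S - T) \<union> (T - S)) = cl_sign U S * cl_sign U T"
  unfolding cl_sign_prod prod.distrib[symmetric]
  by (intro prod.cong refl prod_symdiff) auto

lemma bilinear_cl_mult: "bilinear (\<star>)"
  unfolding bilinear_def linear_iff cl_mult_def
  by (auto simp: algebra_simps sum.distrib scaleR_sum_right intro!: sum.cong)

interpretation cl: bounded_bilinear "(\<star>) :: 'n::{finite,linorder} clifford \<Rightarrow> _"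
  using bilinear_cl_mult by (simp add: bilinear_conv_bounded_bilinear)

lemma cl_Basis: "(Basis :: 'n::finite clifford set) = range cl_basis"
  by (auto simp: cl_basis_def Basis_vec_def)

lemma cl_basis_nth: "cl_basis S $ T = (if T = S then 1 else 0)"
  by (simp add: cl_basis_def axis_def)

lemma linear_eq_on_cl_basis:
  fixes f h :: "'n::finite clifford \<Rightarrow> 'b::real_vector"
  assumes "linear f" "linear h" "\<And>S. f (cl_basis S) = h (cl_basis S)"
  shows "f x = h x"
  using linear_eq_stdbasis[OF assms(1,2)] assms(3) by (metis cl_Basis imageE)

lemma cl_basis_mult:
  "cl_basis S \<star> cl_basis T = cl_sign S T *\<^sub>R cl_basis ((S - T) \<union> (T - S))"
proof -
  have "cl_basis S \<star> cl_basis T = (\<Sum>U\<in>UNIV. \<Sum>V\<in>UNIV. if U = S \<and> V = T then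
       cl_sign S T *\<^sub>R cl_basis ((S - T) \<union> (T - S)) else 0)"
    unfolding cl_mult_def cl_basis_nth by (intro sum.cong) auto
  also have "\<dots> = (\<Sum>U\<in>UNIV. if U = S then cl_sign S T *\<^sub>R cl_basis ((S - T) \<union> (T - S)) else 0)"
    by (intro sum.cong) auto
  also have "\<dots> = cl_sign S T *\<^sub>R cl_basis ((S - T) \<union> (T - S))"
    by simp
  finally show ?thesis .
qed

lemma cl_linear_left: "linear (\<lambda>x. x \<star> y)"
  by (simp add: linear_iff cl.add_left cl.scaleR_left)

lemma cl_linear_right: "linear (\<lambda>y. x \<star> y)"
  by (simp add: linear_iff cl.add_right cl.scaleR_right)

text \<open>On basis elements both sides carry the sign
  \<open>cl_sign S T * cl_sign S U * cl_sign T U\<close>, since \<open>cl_sign\<close> is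
  multiplicative in each argument. Linearity gives the rest, one factor at a time.\<close>

lemma cl_assoc: "(x \<star> y) \<star> z = x \<star> (y \<star> z)"
proof -
  have basis: "(cl_basis S \<star> cl_basis T) \<star> cl_basis U = cl_basis S \<star> (cl_basis T \<star> cl_basis U)"
    for S T U :: "'n::{finite,linorder} set"
  proof -
    let ?d = "\<lambda>A B :: 'n set. (A - B) \<union> (B - A)"
    have "?d (?d S T) U = ?d S (?d T U)" by blast
    then show ?thesis
      by (simp add: cl_basis_mult cl.scaleR_left cl.scaleR_right cl_sign_symdiff_left
          cl_sign_symdiff_right mult_ac)
  qed
  have 1: "(cl_basis S \<star> cl_basis T) \<star> z = cl_basis S \<star> (cl_basis T \<star> z)" for S T
    by (rule linear_eq_on_cl_basis[of "\<lambda>z. (cl_basis S \<star> cl_basis T) \<star> z"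
          "\<lambda>z. cl_basis S \<star> (cl_basis T \<star> z)" z])
      (auto simp: linear_iff cl.add_right cl.scaleR_right basis)
  have 2: "(cl_basis S \<star> y) \<star> z = cl_basis S \<star> (y \<star> z)" for S
    by (rule linear_eq_on_cl_basis[of "\<lambda>y. (cl_basis S \<star> y) \<star> z"
          "\<lambda>y. cl_basis S \<star> (y \<star> z)" y])
      (auto simp: linear_iff cl.add_right cl.add_left cl.scaleR_left cl.scaleR_right 1)
  show ?thesis
    by (rule linear_eq_on_cl_basis[of "\<lambda>x. (x \<star> y) \<star> z"
          "\<lambda>x. x \<star> (y \<star> z)" x])
      (auto simp: linear_iff cl.add_right cl.add_left cl.scaleR_left cl.scaleR_right 2)
qed

lemma cl_sign_empty [simp]: "cl_sign {} S = 1" "cl_sign S {} = 1"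
  by (simp_all add: cl_sign_def)

lemma cl_one_left [simp]: "cl_one \<star> x = x"
  by (rule linear_eq_on_cl_basis[of "\<lambda>x. cl_one \<star> x" "\<lambda>x. x"])
    (auto simp: linear_iff cl.add_right cl.scaleR_right cl_one_def cl_basis_mult)

lemma cl_one_right [simp]: "x \<star> cl_one = x"
  by (rule linear_eq_on_cl_basis[of "\<lambda>x. x \<star> cl_one" "\<lambda>x. x"])
    (auto simp: linear_iff cl.add_left cl.scaleR_left cl_one_def cl_basis_mult)

lemma linear_cl_vec: "linear cl_vec"
  by (simp add: linear_iff cl_vec_def scaleR_add_left sum.distrib scaleR_sum_right)

lemma cl_vec_simps [simp]:
  "cl_vec (v + w) = cl_vec v + cl_vec w" "cl_vec (v - w) = cl_vec v - cl_vec w"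
  "cl_vec (a *\<^sub>R v) = a *\<^sub>R cl_vec v" "cl_vec (- v) = - cl_vec v" "cl_vec 0 = 0"
  by (simp_all only: linear_add[OF linear_cl_vec] linear_diff[OF linear_cl_vec]
      linear_cmul[OF linear_cl_vec] linear_neg[OF linear_cl_vec] linear_0[OF linear_cl_vec])

lemma cl_vec_axis: "cl_vec (axis i 1) = cl_basis {i}"
proof -
  have "cl_vec (axis i 1) = (\<Sum>j\<in>UNIV. if j = i then cl_basis {i} else 0)"
    unfolding cl_vec_def by (intro sum.cong) (auto simp: axis_def)
  then show ?thesis by simp
qed

lemma cl_vec_nth: "cl_vec v $ S = (\<Sum>i\<in>UNIV. if S = {i} then v $ i else 0)"
  unfolding cl_vec_def by (simp add: cl_basis_nth if_distrib cong: if_cong)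

lemma cl_vec_nth_sing [simp]: "cl_vec v $ {i} = v $ i"
  by (simp add: cl_vec_nth)

lemma cl_sign_sing: "cl_sign {i} {j} = (if j \<le> i then -1 else 1)"
  by (simp add: cl_sign_prod)

lemma linear_eq_on_axis:
  fixes f h :: "real^'n \<Rightarrow> 'b::real_vector"
  assumes "linear f" "linear h" "\<And>i. f (axis i 1) = h (axis i 1)"
  shows "f x = h x"
  using linear_eq_stdbasis[OF assms(1,2)] assms(3) by (auto simp: Basis_vec_def)

lemma cl_vec_anticommute:
  "cl_vec v \<star> cl_vec w + cl_vec w \<star> cl_vec v = (- 2 * (v \<bullet> w)) *\<^sub>R cl_one"
proof -
  have basis: "cl_vec (axis i 1) \<star> cl_vec (axis j 1) + cl_vec (axis j 1) \<star> cl_vec (axis i 1)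
      = (- 2 * (axis i 1 \<bullet> (axis j 1 :: (real,'a) vec))) *\<^sub>R cl_one" for i j
  proof (cases "i = j")
    case True
    then show ?thesis
      by (simp add: cl_vec_axis cl_basis_mult cl_sign_sing cl_one_def inner_axis_axis
          flip: scaleR_2)
  next
    case False
    then have "({i} - {j}) \<union> ({j} - {i}) = ({j} - {i}) \<union> ({i} - {j})" by auto
    then show ?thesis using False
      by (auto simp: cl_vec_axis cl_basis_mult cl_sign_sing cl_one_def inner_axis_axis)
  qed
  have 1: "cl_vec (axis i 1) \<star> cl_vec w + cl_vec w \<star> cl_vec (axis i 1)
      = (- 2 * (axis i 1 \<bullet> w)) *\<^sub>R cl_one" for i
    by (rule linear_eq_on_axis[of "\<lambda>w. cl_vec (axis i 1) \<star> cl_vec w + cl_vec w \<star> cl_vec (axis i 1)"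
         "\<lambda>w. (- 2 * (axis i 1 \<bullet> w)) *\<^sub>R cl_one"])
      (simp_all add: linear_iff cl.add_left cl.add_right cl.scaleR_left cl.scaleR_right basis algebra_simps inner_commute)
  show ?thesis
  proof (rule linear_eq_on_axis[of "\<lambda>v. cl_vec v \<star> cl_vec w + cl_vec w \<star> cl_vec v"
         "\<lambda>v. (- 2 * (v \<bullet> w)) *\<^sub>R cl_one"])
    show "linear (\<lambda>v. cl_vec v \<star> cl_vec w + cl_vec w \<star> cl_vec v)"
      by (simp add: linear_iff cl.add_left cl.add_right cl.scaleR_left cl.scaleR_right algebra_simps)
    show "linear (\<lambda>v. (- 2 * (v \<bullet> w)) *\<^sub>R cl_one)"
      by (simp add: linear_iff inner_add_left algebra_simps)
  qed (rule 1)
qed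

lemma cl_vec_square: "cl_vec v \<star> cl_vec v = (- (v \<bullet> v)) *\<^sub>R cl_one"
proof -
  have "2 *\<^sub>R (cl_vec v \<star> cl_vec v) = 2 *\<^sub>R ((- (v \<bullet> v)) *\<^sub>R cl_one)"
    using cl_vec_anticommute[of v v] by (simp add: scaleR_2)
  then show ?thesis by (metis scaleR_cancel_left zero_neq_numeral)
qed

lemma cl_vec_mult_self: "norm v = 1 \<Longrightarrow> cl_vec v \<star> cl_vec v = - cl_one"
  by (simp add: cl_vec_square dot_square_norm)

lemma cl_vec_unit_left: "norm v = 1 \<Longrightarrow> cl_vec v \<star> (cl_vec v \<star> x) = - x"
  by (simp add: cl_vec_mult_self cl.minus_left flip: cl_assoc)

lemma inner_cl_basis: "cl_basis S \<bullet> cl_basis T = (if S = T then 1 else 0)"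
  by (simp add: cl_basis_def inner_axis_axis)

text \<open>On basis elements this is the change of \<open>cl_sign {i}\<close> when i is added to or
  removed from the set, that is, the relation \<open>e_i e_i = -1\<close>. It makes unit vectors act
  isometrically, so that Pin(n) lies in the unit sphere.\<close>

lemma inner_cl_vec_mult: "(cl_vec v \<star> x) \<bullet> y = - (x \<bullet> (cl_vec v \<star> y))"
proof -
  have b: "(cl_basis {i} \<star> cl_basis S) \<bullet> cl_basis T = - (cl_basis S \<bullet> (cl_basis {i} \<star> cl_basis T))"
    for i :: 'a and S T
  proof -
    have "({i} - S) \<union> (S - {i}) = T \<longleftrightarrow> S = ({i} - T) \<union> (T - {i})" by blast
    moreover have "cl_sign {i} S = - cl_sign {i} T" if "S = ({i} - T) \<union> (T - {i})"
      using that cl_sign_symdiff_right[of "{i}" "{i}" T] by (simp add: cl_sign_sing)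
    ultimately show ?thesis
      by (simp add: cl_basis_mult inner_cl_basis)
  qed
  have 0: "(cl_basis {i} \<star> cl_basis S) \<bullet> y = - (cl_basis S \<bullet> (cl_basis {i} \<star> y))" for i :: 'a and S
    by (rule linear_eq_on_cl_basis[of "\<lambda>y. (cl_basis {i} \<star> cl_basis S) \<bullet> y"
          "\<lambda>y. - (cl_basis S \<bullet> (cl_basis {i} \<star> y))"])
      (simp_all add: linear_iff inner_add_right cl.add_right cl.scaleR_right b)
  have 1: "(cl_basis {i} \<star> x) \<bullet> y = - (x \<bullet> (cl_basis {i} \<star> y))" for i :: 'a
    by (rule linear_eq_on_cl_basis[of "\<lambda>x. (cl_basis {i} \<star> x) \<bullet> y"
          "\<lambda>x. - (x \<bullet> (cl_basis {i} \<star> y))"])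
      (simp_all add: linear_iff inner_add_left cl.add_right cl.scaleR_right 0)
  show ?thesis
    by (rule linear_eq_on_axis[of "\<lambda>v. (cl_vec v \<star> x) \<bullet> y" "\<lambda>v. - (x \<bullet> (cl_vec v \<star> y))"])
      (simp_all add: linear_iff inner_add_left inner_add_right cl.add_left cl.scaleR_left 1 cl_vec_axis)
qed

lemma norm_cl_vec_mult:
  assumes "norm v = 1"
  shows "norm (cl_vec v \<star> x) = norm x"
proof -
  have "(cl_vec v \<star> x) \<bullet> (cl_vec v \<star> x) = x \<bullet> x"
    using assms by (simp add: inner_cl_vec_mult cl_vec_unit_left)
  then show ?thesis by (simp add: norm_eq)
qed

text \<open>Clifford conjugation. The factor \<open>cl_sign S S\<close> is the value of the square
  of \<open>e_S\<close>, so that each basis element is sent to its inverse.\<close>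

definition cl_conj :: "'n::{finite,linorder} clifford \<Rightarrow> 'n clifford" where
  "cl_conj x = (\<chi> S. cl_sign S S * x $ S)"

lemma linear_cl_conj: "linear cl_conj"
  by (auto simp: linear_iff cl_conj_def vec_eq_iff algebra_simps)

lemma cl_conj_basis: "cl_conj (cl_basis S) = cl_sign S S *\<^sub>R cl_basis S"
  by (auto simp: cl_conj_def vec_eq_iff cl_basis_nth)

lemma cl_conj_mult: "cl_conj (x \<star> y) = cl_conj y \<star> cl_conj x"
proof -
  have b: "cl_conj (cl_basis S \<star> cl_basis T) = cl_conj (cl_basis T) \<star> cl_conj (cl_basis S)"
    for S T :: "'a set"
  proof -
    have "T - S \<union> (S - T) = S - T \<union> (T - S)" by blast
    moreover have "cl_sign S T * (cl_sign S S * (cl_sign S T * (cl_sign T S * cl_sign T T)))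
       = (cl_sign S T * cl_sign S T) * (cl_sign S S * (cl_sign T S * cl_sign T T))"
      by (simp only: mult_ac)
    ultimately show ?thesis
      by (simp add: cl_basis_mult cl_conj_basis linear_cmul[OF linear_cl_conj] cl.scaleR_left
          cl.scaleR_right cl_sign_symdiff_left cl_sign_symdiff_right mult_ac del: cl_sign_square)
       (simp add: mult.assoc[symmetric])
  qed
  have 0: "cl_conj (cl_basis S \<star> y) = cl_conj y \<star> cl_conj (cl_basis S)" for S
    by (rule linear_eq_on_cl_basis[of "\<lambda>y. cl_conj (cl_basis S \<star> y)"
          "\<lambda>y. cl_conj y \<star> cl_conj (cl_basis S)"])
      (simp_all add: linear_iff linear_add[OF linear_cl_conj] linear_cmul[OF linear_cl_conj]
         cl.add_right cl.scaleR_right cl.add_left cl.scaleR_left b)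
  show ?thesis
    by (rule linear_eq_on_cl_basis[of "\<lambda>x. cl_conj (x \<star> y)" "\<lambda>x. cl_conj y \<star> cl_conj x"])
      (simp_all add: linear_iff linear_add[OF linear_cl_conj] linear_cmul[OF linear_cl_conj]
         cl.add_right cl.scaleR_right cl.add_left cl.scaleR_left 0)
qed

lemma cl_conj_vec: "cl_conj (cl_vec v) = - cl_vec v"
  by (rule linear_eq_on_axis[of "\<lambda>v. cl_conj (cl_vec v)" "\<lambda>v. - cl_vec v"])
    (simp_all add: linear_iff linear_add[OF linear_cl_conj] linear_cmul[OF linear_cl_conj]
      cl_vec_axis cl_conj_basis cl_sign_sing)

lemma cl_conj_one [simp]: "cl_conj cl_one = cl_one"
  by (simp add: cl_one_def cl_conj_basis)

lemma linear_cl_grade: "linear cl_grade_involution"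
  by (auto simp: linear_iff cl_grade_involution_def vec_eq_iff algebra_simps)

lemma cl_grade_basis: "cl_grade_involution (cl_basis S) = (-1) ^ card S *\<^sub>R cl_basis S"
  by (auto simp: cl_grade_involution_def vec_eq_iff cl_basis_nth)

lemma cl_grade_mult: "cl_grade_involution (x \<star> y) = cl_grade_involution x \<star> cl_grade_involution y"
proof -
  have pm: "(-1::real) ^ card S = (\<Prod>s\<in>S. -1)" for S :: "'a set" by simp
  have b: "cl_grade_involution (cl_basis S \<star> cl_basis T) =
     cl_grade_involution (cl_basis S) \<star> cl_grade_involution (cl_basis T)" for S T :: "'a set"
  proof -
    have "(-1::real) ^ card (S - T \<union> (T - S)) = (-1) ^ card S * (-1) ^ card T"
      unfolding pm by (rule prod_symdiff) auto
    then show ?thesis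
      by (simp add: cl_basis_mult cl_grade_basis linear_cmul[OF linear_cl_grade] cl.scaleR_left
          cl.scaleR_right)
  qed
  have 0: "cl_grade_involution (cl_basis S \<star> y) = cl_grade_involution (cl_basis S) \<star> cl_grade_involution y" for S
    by (rule linear_eq_on_cl_basis[of "\<lambda>y. cl_grade_involution (cl_basis S \<star> y)"
          "\<lambda>y. cl_grade_involution (cl_basis S) \<star> cl_grade_involution y"])
      (simp_all add: linear_iff linear_add[OF linear_cl_grade] linear_cmul[OF linear_cl_grade]
         cl.add_right cl.scaleR_right cl.add_left cl.scaleR_left b)
  show ?thesis
    by (rule linear_eq_on_cl_basis[of "\<lambda>x. cl_grade_involution (x \<star> y)"
        "\<lambda>x. cl_grade_involution x \<star> cl_grade_involution y"])
      (simp_all add: linear_iff linear_add[OF linear_cl_grade] linear_cmul[OF linear_cl_grade]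
         cl.add_right cl.scaleR_right cl.add_left cl.scaleR_left 0)
qed

lemma cl_grade_vec: "cl_grade_involution (cl_vec v) = - cl_vec v"
  by (rule linear_eq_on_axis[of "\<lambda>v. cl_grade_involution (cl_vec v)" "\<lambda>v. - cl_vec v"])
    (simp_all add: linear_iff linear_add[OF linear_cl_grade] linear_cmul[OF linear_cl_grade]
      cl_vec_axis cl_grade_basis)

lemma cl_grade_one [simp]: "cl_grade_involution cl_one = cl_one"
  by (simp add: cl_one_def cl_grade_basis)

text \<open>The Pin group of the coordinate subspace with index set S. These subgroups carry the
  inductions on the dimension: the factorization of orthogonal matrices into reflections and the
  fibrations of Spin groups.\<close>

inductive_set pin_sub :: "'n::{finite,linorder} set \<Rightarrow> 'n clifford set" for S where
  one: "cl_one \<in> pin_sub S"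
| mult: "norm v = 1 \<Longrightarrow> (\<And>i. i \<notin> S \<Longrightarrow> v $ i = 0) \<Longrightarrow> x \<in> pin_sub S \<Longrightarrow> cl_vec v \<star> x \<in> pin_sub S"

lemma pin_sub_UNIV: "pin_sub UNIV = pin_set"
proof (intro equalityI subsetI)
  show "x \<in> pin_set" if "x \<in> pin_sub UNIV" for x using that by induct (auto intro: pin_set.intros)
  show "x \<in> pin_sub UNIV" if "x \<in> pin_set" for x using that by induct (auto intro: pin_sub.intros)
qed

lemma pin_sub_mono: "S \<subseteq> T \<Longrightarrow> pin_sub S \<subseteq> pin_sub T"
proof
  show "x \<in> pin_sub T" if "S \<subseteq> T" "x \<in> pin_sub S" for x
    using that(2) by induct (use that(1) in \<open>auto intro!: pin_sub.intros\<close>)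
qed

lemma pin_sub_subset: "pin_sub S \<subseteq> pin_set"
  using pin_sub_mono[of S UNIV] by (simp add: pin_sub_UNIV)

lemma pin_sub_mult: "x \<in> pin_sub S \<Longrightarrow> y \<in> pin_sub S \<Longrightarrow> x \<star> y \<in> pin_sub S"
  by (induct rule: pin_sub.induct) (auto simp: cl_assoc intro: pin_sub.intros)

lemma pin_sub_vec: "norm v = 1 \<Longrightarrow> (\<And>i. i \<notin> S \<Longrightarrow> v $ i = 0) \<Longrightarrow> cl_vec v \<in> pin_sub S"
  using pin_sub.mult[OF _ _ pin_sub.one, of v S] by simp

lemma cl_conj_minus: "cl_conj (- x) = - cl_conj x"
  by (simp add: linear_neg[OF linear_cl_conj])

text \<open>Conjugation reverses products and sends a unit vector v to -v, which is its inverse;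
  hence it inverts every product of unit vectors.\<close>

lemma pin_sub_conj: "x \<in> pin_sub S \<Longrightarrow> cl_conj x \<in> pin_sub S \<and> cl_conj x \<star> x = cl_one \<and> x \<star> cl_conj x = cl_one"
proof (induct rule: pin_sub.induct)
  case one
  then show ?case by (simp add: pin_sub.one)
next
  case (mult v x)
  have "cl_conj x \<star> cl_vec (- v) \<in> pin_sub S"
    using mult by (intro pin_sub_mult pin_sub_vec) auto
  moreover have "cl_conj x \<star> cl_vec (- v) \<star> (cl_vec v \<star> x) = cl_one"
    using mult by (simp add: cl_assoc cl.minus_left cl.minus_right cl_vec_unit_left)
  moreover have "cl_vec v \<star> x \<star> (cl_conj x \<star> cl_vec (- v)) = cl_one"
  proof -
    have "cl_vec v \<star> x \<star> (cl_conj x \<star> cl_vec (- v)) = cl_vec v \<star> ((x \<star> cl_conj x) \<star> cl_vec (- v))"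
      by (simp only: cl_assoc)
    then show ?thesis using mult by (simp add: cl.minus_right cl_vec_mult_self)
  qed
  ultimately show ?case
    by (simp add: cl_conj_mult cl_conj_vec)
qed

lemma pin_mult: "x \<in> pin_set \<Longrightarrow> y \<in> pin_set \<Longrightarrow> x \<star> y \<in> pin_set"
  using pin_sub_mult[of x UNIV y] by (simp add: pin_sub_UNIV)

lemma pin_conj_closed: "x \<in> pin_set \<Longrightarrow> cl_conj x \<in> pin_set"
  using pin_sub_conj[of x UNIV] by (simp add: pin_sub_UNIV)

lemma pin_conj_left [simp]: "x \<in> pin_set \<Longrightarrow> cl_conj x \<star> x = cl_one"
  using pin_sub_conj[of x UNIV] by (simp add: pin_sub_UNIV)

lemma pin_conj_right [simp]: "x \<in> pin_set \<Longrightarrow> x \<star> cl_conj x = cl_one"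
  using pin_sub_conj[of x UNIV] by (simp add: pin_sub_UNIV)

lemma pin_conj_left' [simp]: "x \<in> pin_set \<Longrightarrow> cl_conj x \<star> (x \<star> y) = y"
  by (simp flip: cl_assoc)

lemma pin_conj_right' [simp]: "x \<in> pin_set \<Longrightarrow> x \<star> (cl_conj x \<star> y) = y"
  by (simp flip: cl_assoc)

lemma norm_pin: "x \<in> pin_set \<Longrightarrow> norm x = 1"
  by (induct rule: pin_set.induct) (auto simp: norm_cl_vec_mult cl_one_def cl_basis_def)

lemma pin_vec: "norm v = 1 \<Longrightarrow> cl_vec v \<in> pin_set"
  using pin_set.mult[OF _ pin_set.one, of v] by simp

lemma pin_minus:
  assumes "x \<in> pin_set"
  shows "- x \<in> pin_set"
proof -
  obtain v :: "(real, 'a) vec" where "norm v = 1" using norm_axis_1 by blast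
  \<comment> \<open>A repeated unit vector contributes the factor -1.\<close>
  then show ?thesis
    using pin_set.mult[of v "cl_vec v \<star> x"] pin_set.mult[of v x] assms by (simp add: cl_vec_unit_left)
qed

lemma Pin_simps [simp]: "carrier Pin = pin_set" "x \<otimes>\<^bsub>Pin\<^esub> y = x \<star> y" "\<one>\<^bsub>Pin\<^esub> = cl_one"
  by (simp_all add: Pin_def)

lemma group_Pin: "group (Pin :: 'n::{finite,linorder} clifford monoid)"
  by (rule groupI) (auto simp: cl_assoc pin_mult pin_set.one intro!: bexI[OF _ pin_conj_closed])

lemma inv_Pin: "x \<in> pin_set \<Longrightarrow> inv\<^bsub>Pin\<^esub> x = cl_conj x"
  using group.inv_equality[OF group_Pin, of "cl_conj x" x] by (simp add: pin_conj_closed)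

section \<open>The twisted adjoint representation\<close>

definition hrefl :: "real^'n \<Rightarrow> real^'n \<Rightarrow> real^'n" where
  "hrefl v w = w - (2 * (v \<bullet> w)) *\<^sub>R v"

text \<open>Only the coefficients at singletons are read off. For p in Pin(n) nothing is lost,
  because the product is a vector by \<open>cl_vec_twisted_adj\<close>.\<close>

definition twisted_adj :: "'n::{finite,linorder} clifford \<Rightarrow> (real, 'n) vec \<Rightarrow> (real, 'n) vec" where
  "twisted_adj p w = (\<chi> i. (cl_grade_involution p \<star> cl_vec w \<star> cl_conj p) $ {i})"

lemma cl_vec_hrefl:
  assumes "norm v = 1"
  shows "cl_vec v \<star> cl_vec w \<star> cl_vec v = cl_vec (hrefl v w)"
proof -
  have "cl_vec v \<star> cl_vec w = (- 2 * (v \<bullet> w)) *\<^sub>R cl_one - cl_vec w \<star> cl_vec v"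
    using cl_vec_anticommute[of v w] by (simp add: algebra_simps)
  then have "cl_vec v \<star> cl_vec w \<star> cl_vec v = (- 2 * (v \<bullet> w)) *\<^sub>R cl_vec v - cl_vec w \<star> (cl_vec v \<star> cl_vec v)"
    by (simp add: cl.diff_left cl.scaleR_left cl.minus_left cl_assoc)
  then show ?thesis
    using assms by (simp add: cl_vec_mult_self cl.minus_right hrefl_def)
qed

lemma twisted_adj_eqI:
  "cl_vec u = cl_grade_involution p \<star> cl_vec w \<star> cl_conj p \<Longrightarrow> twisted_adj p w = u"
  unfolding twisted_adj_def by (drule sym) (simp add: vec_eq_iff)

text \<open>A further factor v acts by w -> v w v, as the signs of the grade involution and of the
  conjugation at v cancel; \<open>cl_vec_hrefl\<close> identifies this with a reflection.\<close>

lemma cl_vec_twisted_adj: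
  assumes "p \<in> pin_set"
  shows "cl_vec (twisted_adj p w) = cl_grade_involution p \<star> cl_vec w \<star> cl_conj p"
  using assms
proof (induct arbitrary: w)
  case one
  then have "twisted_adj cl_one w = w" by (intro twisted_adj_eqI) simp
  then show ?case by simp
next
  case (mult v x)
  have "cl_grade_involution (cl_vec v \<star> x) \<star> cl_vec w \<star> cl_conj (cl_vec v \<star> x)
      = cl_vec v \<star> cl_vec (twisted_adj x w) \<star> cl_vec v"
    by (simp add: mult cl_grade_mult cl_conj_mult cl_grade_vec cl_conj_vec cl.minus_left
        cl.minus_right cl_assoc)
  also have "\<dots> = cl_vec (hrefl v (twisted_adj x w))"
    by (rule cl_vec_hrefl[OF mult.hyps(1)])
  finally have *: "cl_vec (hrefl v (twisted_adj x w))
      = cl_grade_involution (cl_vec v \<star> x) \<star> cl_vec w \<star> cl_conj (cl_vec v \<star> x)" by simp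
  show ?case
    unfolding twisted_adj_eqI[OF *] by (rule *)
qed

lemma twisted_adj_one [simp]: "twisted_adj cl_one w = w"
  by (intro twisted_adj_eqI) simp

lemma twisted_adj_mult:
  assumes "p \<in> pin_set" "q \<in> pin_set"
  shows "twisted_adj (p \<star> q) w = twisted_adj p (twisted_adj q w)"
  by (intro twisted_adj_eqI)
    (simp add: cl_vec_twisted_adj assms cl_grade_mult cl_conj_mult cl_assoc)

lemma twisted_adj_vec: "norm v = 1 \<Longrightarrow> twisted_adj (cl_vec v) w = hrefl v w"
  by (intro twisted_adj_eqI)
    (simp add: cl_grade_vec cl_conj_vec cl.minus_left cl.minus_right flip: cl_vec_hrefl)

lemma linear_twisted_adj: "linear (twisted_adj p)"
  by (simp add: linear_iff twisted_adj_def cl.add_left cl.add_right cl.scaleR_left cl.scaleR_right vec_eq_iff)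

lemma hrefl_inner: "norm v = 1 \<Longrightarrow> hrefl v x \<bullet> hrefl v y = x \<bullet> y"
  by (simp add: hrefl_def inner_diff_left inner_diff_right inner_commute dot_square_norm algebra_simps)

lemma hrefl_hrefl: "norm v = 1 \<Longrightarrow> hrefl v (hrefl v x) = x"
  by (simp add: hrefl_def inner_diff_right dot_square_norm)

lemma twisted_adj_inner:
  assumes "p \<in> pin_set"
  shows "twisted_adj p x \<bullet> twisted_adj p y = x \<bullet> y"
  using assms by induct (simp_all add: twisted_adj_mult pin_vec twisted_adj_vec hrefl_inner)

lemma orthogonal_twisted_adj:
  "p \<in> pin_set \<Longrightarrow> orthogonal_transformation (twisted_adj p)"
  by (simp add: orthogonal_transformation_def linear_twisted_adj twisted_adj_inner)

lemma pin_to_O_eq: "p \<in> pin_set \<Longrightarrow> pin_to_O p = matrix (twisted_adj p)"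
  unfolding pin_to_O_def twisted_adj_def by (simp add: inv_Pin)

lemma pin_to_O_apply: "p \<in> pin_set \<Longrightarrow> pin_to_O p *v w = twisted_adj p w"
  by (simp add: pin_to_O_eq matrix_works linear_twisted_adj)

lemma orthogonal_pin_to_O: "p \<in> pin_set \<Longrightarrow> orthogonal_matrix (pin_to_O p)"
  by (metis orthogonal_transformation_matrix orthogonal_twisted_adj pin_to_O_eq)

lemma pin_to_O_eqI: "p \<in> pin_set \<Longrightarrow> (\<And>w. twisted_adj p w = A *v w) \<Longrightarrow> pin_to_O p = A"
  by (simp add: matrix_eq pin_to_O_apply)

lemma pin_to_O_mult: "p \<in> pin_set \<Longrightarrow> q \<in> pin_set \<Longrightarrow> pin_to_O (p \<star> q) = pin_to_O p ** pin_to_O q"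
  by (intro pin_to_O_eqI) (simp_all add: pin_mult twisted_adj_mult pin_to_O_apply flip: matrix_vector_mul_assoc)

lemma pin_to_O_one: "pin_to_O cl_one = mat 1"
  by (intro pin_to_O_eqI) (simp_all add: pin_set.one)

definition refl_matrix :: "(real, 'n) vec \<Rightarrow> 'n::finite sq_matrix" where
  "refl_matrix v = matrix (hrefl v)"

lemma linear_hrefl: "linear (hrefl v)"
  by (simp add: linear_iff hrefl_def inner_add_right algebra_simps)

lemma refl_matrix_apply: "refl_matrix v *v w = hrefl v w"
  by (simp add: refl_matrix_def matrix_works linear_hrefl)

lemma pin_to_O_vec: "norm v = 1 \<Longrightarrow> pin_to_O (cl_vec v) = refl_matrix v"
  by (intro pin_to_O_eqI) (simp_all add: pin_vec twisted_adj_vec refl_matrix_apply)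

lemma orthogonal_matrix_inner:
  assumes "orthogonal_matrix Q"
  shows "(Q *v x) \<bullet> (Q *v y) = x \<bullet> (y :: real^'n)"
proof -
  have "(Q *v x) \<bullet> (Q *v y) = (transpose Q *v (Q *v x)) \<bullet> y"
    by (simp only: transpose_matrix_vector dot_lmul_matrix)
  then show ?thesis
    using assms by (simp add: matrix_vector_mul_assoc orthogonal_matrix del: transpose_matrix_vector)
qed

lemma matrix_minus_apply: "(- A) *v w = - (A *v (w :: real^'n))"
  by (simp add: matrix_vector_mult_def vec_eq_iff sum_negf)

text \<open>A rotation that carries a coordinate axis to v conjugates the reflection to a diagonal
  matrix with a single entry -1.\<close>

lemma det_refl_matrix:
  fixes v :: "real^'n"
  assumes "norm v = 1" and True: "CARD('n) \<ge> 2"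
  shows "det (refl_matrix v) = -1"
proof -
  fix k :: 'n
  obtain Q :: "'n sq_matrix" where Q: "rotation_matrix Q" "Q *v axis k 1 = v"
    using rotation_matrix_exists_basis[OF True assms(1)] by blast
  then have orth: "orthogonal_matrix Q" and dQ: "det Q = 1" by (auto simp: rotation_matrix_def)
  have ip: "(Q *v x) \<bullet> (Q *v y) = x \<bullet> y" for x y
    by (rule orthogonal_matrix_inner[OF orth])
  have "refl_matrix v ** Q = Q ** refl_matrix (axis k 1)"
    by (simp add: matrix_eq refl_matrix_apply hrefl_def Q(2)[symmetric] ip matrix_vector_mult_diff_distrib
       matrix_vector_mult_scaleR flip: matrix_vector_mul_assoc)
  then have "det (refl_matrix v) = det (refl_matrix (axis k 1))"
    using dQ by (metis det_mul mult.commute mult_1)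
  also have "refl_matrix (axis k 1) $ i $ j = (if i = j then (if i = k then -1 else 1) else 0)" for i j
    by (simp add: refl_matrix_def matrix_def hrefl_def inner_axis_axis) (simp add: axis_def)
  then have "det (refl_matrix (axis k 1)) = (\<Prod>i\<in>UNIV. if i = k then -1 else 1)"
    by (subst det_diagonal) auto
  also have "\<dots> = -1" by (simp add: prod.If_cases)
  finally show ?thesis .
qed

lemma cl_grade_pin_cases:
  assumes "p \<in> pin_set"
  shows "cl_grade_involution p = p \<or> cl_grade_involution p = - p"
  using assms by induct (auto simp: cl_grade_mult cl_grade_vec cl.minus_left cl.minus_right)

text \<open>Evenness is expressed by the grading and not by the number of factors, so it is visibly
  a property of the element and independent of its factorization.\<close>

definition spin_set :: "'n::{finite,linorder} clifford set" where
  "spin_set = {p \<in> pin_set. cl_grade_involution p = p}"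

lemma pin_neq_minus: "p \<in> pin_set \<Longrightarrow> p \<noteq> - p"
  by (drule norm_pin) (metis add.right_inverse norm_zero scaleR_2 scaleR_eq_0_iff zero_neq_numeral zero_neq_one)

lemma cl_grade_minus: "cl_grade_involution (- x) = - cl_grade_involution x"
  by (simp add: linear_neg[OF linear_cl_grade])

lemma odd_pin_iff: "p \<in> pin_set \<Longrightarrow> p \<notin> spin_set \<longleftrightarrow> cl_grade_involution p = - p"
  using cl_grade_pin_cases[of p] pin_neq_minus[of p] by (auto simp: spin_set_def)

lemma spin_mult_iff:
  assumes "p \<in> pin_set" "q \<in> pin_set"
  shows "p \<star> q \<in> spin_set \<longleftrightarrow> (p \<in> spin_set \<longleftrightarrow> q \<in> spin_set)"
  using cl_grade_pin_cases[OF assms(1)] cl_grade_pin_cases[OF assms(2)]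
    pin_neq_minus[OF assms(1)] pin_neq_minus[OF assms(2)] pin_neq_minus[OF pin_mult[OF assms]] assms
  by (auto simp: spin_set_def pin_mult cl_grade_mult cl.minus_left cl.minus_right)

lemma spin_vec: "norm v = 1 \<Longrightarrow> cl_vec v \<notin> spin_set"
  using pin_neq_minus[OF pin_vec[of v]] by (auto simp: spin_set_def cl_grade_vec)

lemma spin_one: "cl_one \<in> spin_set"
  by (simp add: spin_set_def pin_set.one)

lemma spin_subset: "spin_set \<subseteq> pin_set"
  by (auto simp: spin_set_def)

lemma det_pin_to_O:
  assumes "CARD('n) \<ge> 2" "p \<in> pin_set"
  shows "det (pin_to_O p :: 'n::{finite,linorder} sq_matrix) = (if p \<in> spin_set then 1 else -1)"
  using assms(2)
proof induct
  case one
  show ?case by (simp add: pin_to_O_one spin_one)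
next
  case (mult v x)
  then show ?case
    by (simp add: pin_to_O_mult pin_vec det_mul pin_to_O_vec det_refl_matrix[OF _ assms(1)]
        spin_mult_iff spin_vec)
qed

lemma cl_basis_nth_mult_sing:
  "(cl_basis {i} \<star> x) $ S = cl_sign {i} (({i} - S) \<union> (S - {i})) * x $ (({i} - S) \<union> (S - {i}))"
proof (rule linear_eq_on_cl_basis[of "\<lambda>x. (cl_basis {i} \<star> x) $ S" "\<lambda>x. cl_sign {i} (({i} - S) \<union> (S - {i})) * x $ (({i} - S) \<union> (S - {i}))"])
  fix T
  have "S = ({i} - T) \<union> (T - {i}) \<longleftrightarrow> T = ({i} - S) \<union> (S - {i})" by blast
  then show "(cl_basis {i} \<star> cl_basis T) $ S =
    cl_sign {i} (({i} - S) \<union> (S - {i})) * cl_basis T $ (({i} - S) \<union> (S - {i}))"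
    by (auto simp: cl_basis_mult cl_basis_nth)
qed (auto simp: linear_iff cl.add_right cl.scaleR_right algebra_simps)

lemma cl_basis_sing_commute:
  "cl_basis S \<star> cl_basis {i} = (if i \<in> S then - 1 else 1) *\<^sub>R (-1) ^ card S *\<^sub>R (cl_basis {i} \<star> cl_basis S)"
proof -
  have "cl_sign S {i} = (if i \<in> S then - 1 else 1) * (-1) ^ card S * cl_sign {i} S"
  proof -
    \<comment> \<open>For every s exactly one of the two inequalities holds, except for s = i, where
      both do.\<close>
    have "cl_sign S {i} * cl_sign {i} S = (\<Prod>s\<in>S. (if i \<le> s then -1 else 1) * (if s \<le> i then -1 else 1))"
      by (simp add: cl_sign_prod prod.distrib)
    also have "\<dots> = (\<Prod>s\<in>S. (if s = i then -1 else 1) * -1)"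
      by (intro prod.cong) auto
    also have "\<dots> = (if i \<in> S then - 1 else 1) * (-1) ^ card S"
      unfolding prod.distrib by simp
    finally have "cl_sign S {i} * (cl_sign {i} S * cl_sign {i} S) = (if i \<in> S then - 1 else 1) * (-1) ^ card S * cl_sign {i} S"
      by (simp only: mult.assoc[symmetric])
    then show ?thesis by simp
  qed
  moreover have "S - {i} \<union> ({i} - S) = {i} - S \<union> (S - {i})" by blast
  ultimately show ?thesis by (simp add: cl_basis_mult)
qed

lemma cl_sign_nonzero [simp]: "cl_sign S T \<noteq> 0"
  by (simp add: cl_sign_def)

text \<open>Moving \<open>e_i\<close> past \<open>e_S\<close> costs the sign
  \<open>(-1)^(card S)\<close>, which the grade involution removes, and one more sign if i lies in
  S. The latter detects the coefficients at sets containing i.\<close>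

lemma cl_grade_basis_commute:
  "cl_grade_involution x \<star> cl_basis {i} = cl_basis {i} \<star> (\<chi> S. (if i \<in> S then - 1 else 1) * x $ S)"
proof (rule linear_eq_on_cl_basis[of "\<lambda>x. cl_grade_involution x \<star> cl_basis {i}"
     "\<lambda>x. cl_basis {i} \<star> (\<chi> S. (if i \<in> S then - 1 else 1) * x $ S)"])
  have l: "linear (\<lambda>x :: 'a clifford. \<chi> S. (if i \<in> S then - 1 else 1) * x $ S)"
    by (auto simp: linear_iff vec_eq_iff algebra_simps)
  show "linear (\<lambda>x. cl_basis {i} \<star> (\<chi> S. (if i \<in> S then - 1 else 1) * x $ S))"
    using linear_compose[OF l cl_linear_right] by (simp add: o_def)
  show "linear (\<lambda>x. cl_grade_involution x \<star> cl_basis {i})"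
    using linear_compose[OF linear_cl_grade cl_linear_left] by (simp add: o_def)
  fix S
  have "(\<chi> T. (if i \<in> T then - 1 else 1) * cl_basis S $ T) = (if i \<in> S then - 1 else 1) *\<^sub>R cl_basis S"
    by (auto simp: vec_eq_iff cl_basis_nth)
  moreover have "(-1::real) ^ card S * (-1) ^ card S = 1" by (simp flip: power_add)
  ultimately show "cl_grade_involution (cl_basis S) \<star> cl_basis {i} =
      cl_basis {i} \<star> (\<chi> T. (if i \<in> T then - 1 else 1) * cl_basis S $ T)"
    by (simp add: cl_grade_basis cl.scaleR_left cl.scaleR_right cl_basis_sing_commute cl.minus_right)
qed

text \<open>Acting trivially means twisted commutation with every \<open>e_i\<close>. By
  \<open>cl_grade_basis_commute\<close> this equates each coefficient at a set containing i with its
  negative. Only the scalar part survives, and it has norm 1.\<close>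

lemma pin_to_O_kernel:
  assumes p: "p \<in> pin_set" and 1: "pin_to_O p = mat 1"
  shows "p = cl_one \<or> p = - cl_one"
proof -
  have c: "cl_grade_involution p \<star> cl_vec w = cl_vec w \<star> p" for w
  proof -
    have "twisted_adj p w = w"
      using 1 pin_to_O_apply[OF p, of w] by simp
    then have "cl_vec w = cl_grade_involution p \<star> cl_vec w \<star> cl_conj p"
      using cl_vec_twisted_adj[OF p, of w] by simp
    then have "cl_vec w \<star> p = cl_grade_involution p \<star> cl_vec w \<star> cl_conj p \<star> p" by simp
    then show ?thesis using p by (simp add: cl_assoc)
  qed
  have "p $ S = 0" if "i \<in> S" for i S
  proof -
    let ?d = "\<lambda>S. ({i} - S) \<union> (S - {i})"
    have "?d (?d S) = S" by blast
    have "cl_basis {i} \<star> (\<chi> S. (if i \<in> S then - 1 else 1) * p $ S) = cl_basis {i} \<star> p"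
      using c[of "axis i 1"] cl_grade_basis_commute[of p i] by (simp add: cl_vec_axis)
    then have "(cl_basis {i} \<star> (\<chi> S. (if i \<in> S then - 1 else 1) * p $ S)) $ (?d S) = (cl_basis {i} \<star> p) $ (?d S)"
      by simp
    then show "p $ S = 0"
      unfolding cl_basis_nth_mult_sing \<open>?d (?d S) = S\<close> using that by simp
  qed
  then have "p $ S = 0" if "S \<noteq> {}" for S using that by blast
  then have p_eq: "p = (p $ {}) *\<^sub>R cl_one"
    by (auto simp: vec_eq_iff cl_one_def cl_basis_nth)
  have "norm p = \<bar>p $ {}\<bar>"
    by (subst p_eq) (simp add: norm_pin[OF pin_set.one])
  then have "p $ {} = 1 \<or> p $ {} = -1"
    using norm_pin[OF p] by linarith
  then show ?thesis using p_eq by auto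
qed

lemma pin_to_O_minus: "p \<in> pin_set \<Longrightarrow> pin_to_O (- p) = pin_to_O p"
proof -
  have "twisted_adj (- p) = twisted_adj p"
    by (simp add: fun_eq_iff twisted_adj_def cl_grade_minus cl_conj_minus cl.minus_left cl.minus_right)
  then show "p \<in> pin_set \<Longrightarrow> pin_to_O (- p) = pin_to_O p" by (simp add: pin_to_O_eq pin_minus)
qed

lemma pin_to_O_conj: "p \<in> pin_set \<Longrightarrow> pin_to_O (cl_conj p) ** pin_to_O p = mat 1"
  by (simp add: pin_to_O_one pin_conj_closed flip: pin_to_O_mult)

lemma pin_to_O_eq_iff:
  assumes "p \<in> pin_set" "q \<in> pin_set"
  shows "pin_to_O p = pin_to_O q \<longleftrightarrow> q = p \<or> q = - p"
proof
  assume "pin_to_O p = pin_to_O q"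
  then have "pin_to_O (cl_conj p \<star> q) = mat 1"
    using assms pin_to_O_conj[OF assms(1)] by (simp add: pin_to_O_mult pin_conj_closed)
  then have "cl_conj p \<star> q = cl_one \<or> cl_conj p \<star> q = - cl_one"
    by (intro pin_to_O_kernel) (auto simp: pin_mult pin_conj_closed assms)
  then have "p \<star> (cl_conj p \<star> q) = p \<star> cl_one \<or> p \<star> (cl_conj p \<star> q) = p \<star> - cl_one"
    by metis
  then show "q = p \<or> q = - p" using assms by (simp add: cl.minus_right)
qed (use assms pin_to_O_minus[OF assms(1)] in auto)

text \<open>Words of bounded length form a compact set, as a continuous image of products of
  spheres. The bound on the length that suffices for Pin(n) up to sign comes from
  \<open>pin_sub_insert_repr\<close>.\<close>

primrec pin_words :: "nat \<Rightarrow> 'n::{finite,linorder} clifford set" where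
  "pin_words 0 = {cl_one}"
| "pin_words (Suc k) = pin_words k \<union> (\<lambda>(v, x). cl_vec v \<star> x) ` (sphere 0 1 \<times> pin_words k)"

lemma bounded_linear_cl_vec: "bounded_linear cl_vec"
  using linear_cl_vec by (simp add: linear_conv_bounded_linear)

lemma compact_pin_words: "compact (pin_words k)"
proof (induct k)
  case (Suc k)
  have "continuous_on (sphere 0 1 \<times> pin_words k) (\<lambda>(v, x). cl_vec v \<star> x)"
    unfolding case_prod_beta
    by (intro cl.continuous_on bounded_linear.continuous_on[OF bounded_linear_cl_vec] continuous_intros)
  then show ?case
    using Suc by (auto intro!: compact_Un compact_continuous_image compact_Times)
qed simp

lemma pin_words_subset: "pin_words k \<subseteq> pin_set"
  by (induct k) (auto simp: pin_set.one intro: pin_set.mult)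

text \<open>The theorem of Cartan and Dieudonne, with control of length and support. If A moves
  \<open>e_i\<close>, one reflection brings its image back; the remaining matrix fixes one more
  axis. The mirror vector is supported on the index set because A fixes the other axes and hence
  preserves their orthogonal complement.\<close>

lemma pin_sub_insert_repr:
  fixes A :: "'n::{finite,linorder} sq_matrix"
  assumes "finite S" "orthogonal_matrix A" "\<And>i. i \<notin> S \<Longrightarrow> A *v axis i 1 = axis i 1"
  shows "\<exists>p\<in>pin_sub S \<inter> pin_words (card S). pin_to_O p = A"
  using assms
proof (induct S arbitrary: A)
  case empty
  have "A *v x = mat 1 *v x" for x
    by (rule linear_eq_on_axis[of "(*v) A" "(*v) (mat 1)"]) (use empty in auto)
  then have "A = mat 1" by (simp add: matrix_eq)
  then show ?case using pin_sub.one pin_to_O_one by auto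
next
  case (insert i S)
  have words: "pin_words (card (insert i S)) = pin_words (card S) \<union>
      (\<lambda>(v, x). cl_vec v \<star> x) ` (sphere 0 1 \<times> pin_words (card S))"
    using insert.hyps by simp
  have ip: "(A *v x) \<bullet> (A *v y) = x \<bullet> y" for x y
    by (rule orthogonal_matrix_inner[OF insert.prems(1)])
  let ?u = "A *v axis i 1"
  have nu: "norm ?u = 1"
    using ip[of "axis i 1" "axis i 1"] by (simp add: norm_eq_1 inner_axis_axis)
  have u0: "?u \<bullet> axis j 1 = 0" if "j \<notin> insert i S" for j
    using ip[of "axis i 1" "axis j 1"] insert.prems(2)[OF that] that by (auto simp: inner_axis_axis)
  show ?case
  proof (cases "?u = axis i 1")
    case True
    then have "A *v axis j 1 = axis j 1" if "j \<notin> S" for j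
      using that insert.prems(2) by (cases "j = i") auto
    then show ?thesis
      using insert.hyps(3)[OF insert.prems(1)] pin_sub_mono[of S "insert i S"] unfolding words by blast
  next
    case False
    \<comment> \<open>The reflection along the difference of two unit vectors exchanges
      them.\<close>
    define d where "d = ?u - axis i 1"
    define v where "v = (1 / norm d) *\<^sub>R d"
    have d0: "norm d \<noteq> 0" using False by (simp add: d_def)
    then have nv: "norm v = 1" by (simp add: v_def)
    have vv: "v \<bullet> axis j 1 = 0" if "j \<notin> insert i S" for j
      using u0[OF that] that by (auto simp: v_def d_def inner_diff_left inner_axis_axis)
    then have v0: "v $ j = 0" if "j \<notin> insert i S" for j
      using that by (simp add: inner_axis)
    have dd: "d \<bullet> d = 2 - 2 * (?u \<bullet> axis i 1)"
      using nu by (simp add: d_def inner_diff_left inner_diff_right inner_axis_axis inner_commute norm_eq_1)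
    have du: "d \<bullet> ?u = 1 - ?u \<bullet> axis i 1"
      using nu by (simp add: d_def inner_diff_left norm_eq_1) (simp add: inner_diff_right norm_eq_1 inner_commute)
    have ndd: "norm d * norm d = d \<bullet> d" by (metis power2_norm_eq_inner power2_eq_square)
    have "hrefl v ?u = ?u - (2 * (d \<bullet> ?u) / (norm d * norm d)) *\<^sub>R d"
      by (simp add: hrefl_def v_def)
    also have "\<dots> = ?u - d"
    proof -
      have "2 * (d \<bullet> ?u) = norm d * norm d" by (simp add: ndd dd du)
      then show ?thesis using d0 by simp
    qed
    finally have ru: "hrefl v ?u = axis i 1" by (simp add: d_def)
    define B where "B = refl_matrix v ** A"
    have "orthogonal_matrix (refl_matrix v)"
      using orthogonal_pin_to_O[OF pin_vec[OF nv]] by (simp add: pin_to_O_vec nv)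
    then have oB: "orthogonal_matrix B"
      using insert.prems(1) by (simp add: B_def orthogonal_matrix_mul)
    have "B *v axis j 1 = axis j 1" if "j \<notin> S" for j
      using ru vv[of j] insert.prems(2)[of j] that
      by (cases "j = i") (auto simp: B_def refl_matrix_apply hrefl_def simp flip: matrix_vector_mul_assoc)
    from insert.hyps(3)[OF oB this] obtain p where p: "p \<in> pin_sub S" "p \<in> pin_words (card S)" "pin_to_O p = B" by blast
    then have p': "p \<in> pin_sub (insert i S)" "p \<in> pin_set"
      using pin_sub_mono[of S "insert i S"] pin_sub_subset by auto
    have "pin_to_O (cl_vec v \<star> p) = refl_matrix v ** refl_matrix v ** A"
      by (simp add: pin_to_O_mult pin_vec nv p' p pin_to_O_vec B_def matrix_mul_assoc)
    also have "\<dots> = A"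
      using nv by (simp add: matrix_eq refl_matrix_apply hrefl_hrefl flip: matrix_vector_mul_assoc)
    finally have "pin_to_O (cl_vec v \<star> p) = A" .
    moreover have "cl_vec v \<star> p \<in> pin_words (card (insert i S))"
      unfolding words using nv p(2) by force
    ultimately show ?thesis
      using pin_sub.mult[OF nv v0 p'(1)] by blast
  qed
qed

lemma pin_to_O_surj: "orthogonal_matrix A \<Longrightarrow> \<exists>p\<in>pin_set. pin_to_O p = A"
  using pin_sub_insert_repr[of UNIV A] by (auto simp: pin_sub_UNIV)

section \<open>The volume element and the compactness of Pin(n)\<close>

lemma cl_grade_omega: "even CARD('n::{finite,linorder}) \<Longrightarrow> cl_grade_involution (cl_omega :: 'n clifford) = cl_omega"
  by (simp add: cl_omega_def cl_grade_basis)

text \<open>An axis vector passes the n - 1 other factors of omega, an odd number.\<close>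

lemma cl_vec_omega:
  assumes "even CARD('n::{finite,linorder})"
  shows "cl_vec v \<star> cl_omega = - ((cl_omega :: 'n clifford) \<star> cl_vec v)"
proof (rule linear_eq_on_axis[of "\<lambda>v. cl_vec v \<star> cl_omega" "\<lambda>v. - (cl_omega \<star> cl_vec v)"])
  show "cl_vec (axis i 1) \<star> cl_omega = - ((cl_omega :: 'n clifford) \<star> cl_vec (axis i 1))" for i
    using assms by (simp add: cl_vec_axis cl_omega_def cl_basis_sing_commute)
qed (simp_all add: linear_iff cl.add_left cl.add_right cl.scaleR_left cl.scaleR_right)

text \<open>The sign stays open because the induction inserts the indices in no particular order,
  whereas \<open>cl_basis\<close> refers to the increasing one.\<close>

lemma cl_basis_pin_sub: "cl_basis S \<in> pin_sub S \<or> - cl_basis S \<in> pin_sub S"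
proof (induct S rule: finite_induct[OF finite])
  case 1
  then show ?case using pin_sub.one by (auto simp: cl_one_def)
next
  case (2 i S)
  have sub: "pin_sub S \<subseteq> pin_sub (insert i S)" by (rule pin_sub_mono) auto
  have v: "cl_vec (axis i 1) \<star> x \<in> pin_sub (insert i S)" if "x \<in> pin_sub S" for x
    using that sub by (intro pin_sub.mult) (auto simp: axis_def norm_eq_1 inner_vec_def if_distrib cong: if_cong)
  have "{i} - S \<union> (S - {i}) = insert i S" using 2 by auto
  then have "cl_basis (insert i S) = cl_sign {i} S *\<^sub>R (cl_basis {i} \<star> cl_basis S)"
    by (simp add: cl_basis_mult)
  moreover have "cl_sign {i} S = 1 \<or> cl_sign {i} S = -1"
    using cl_sign_square[of "{i}" S] by (simp add: square_eq_1_iff del: cl_sign_square)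
  ultimately show ?case
    using 2 v[of "cl_basis S"] v[of "- cl_basis S"] by (auto simp: cl_vec_axis cl.minus_right)
qed

lemma pin_omega: "cl_omega \<in> pin_set"
  using cl_basis_pin_sub[of UNIV] pin_minus[of "- cl_omega"] by (auto simp: pin_sub_UNIV cl_omega_def)

lemma omega_commute:
  assumes "even CARD('n::{finite,linorder})" "p \<in> pin_set"
  shows "p \<star> cl_omega = (if p \<in> spin_set then 1 else -1) *\<^sub>R ((cl_omega :: 'n clifford) \<star> p)"
  using assms(2)
proof induct
  case one
  show ?case by (simp add: spin_one)
next
  case (mult v x)
  have "cl_vec v \<star> x \<star> cl_omega = (if x \<in> spin_set then 1 else -1) *\<^sub>R (cl_vec v \<star> cl_omega \<star> x)"
    by (simp only: cl_assoc mult cl.scaleR_right)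
  then show ?case using mult
    by (simp add: cl_vec_omega[OF assms(1)] cl.minus_left cl_assoc spin_mult_iff pin_vec spin_vec)
qed

text \<open>Omega is even and anticommutes with vectors, so conjugation by it negates them. This is
  the reason why omega joins the kernel when O(n) is replaced by PO(n).\<close>

lemma pin_to_O_omega:
  assumes "even CARD('n::{finite,linorder})"
  shows "pin_to_O (cl_omega :: 'n clifford) = - mat 1"
proof (rule pin_to_O_eqI[OF pin_omega], rule twisted_adj_eqI)
  have "cl_omega \<star> cl_vec w \<star> cl_conj cl_omega = - (cl_vec w \<star> (cl_omega \<star> cl_conj (cl_omega :: 'n clifford)))" for w
    by (simp add: cl_vec_omega[OF assms] cl.minus_left flip: cl_assoc)
  moreover have "(- mat 1 :: 'n sq_matrix) *v w = - w" for w
    by (simp add: matrix_minus_apply)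
  ultimately show "cl_vec (- mat 1 *v w) = cl_grade_involution (cl_omega :: 'n clifford) \<star> cl_vec w \<star> cl_conj cl_omega" for w
    by (simp add: cl_grade_omega[OF assms] pin_omega)
qed

text \<open>Words of length at most n already reach every orthogonal matrix, and an element of
  Pin(n) is determined by its matrix up to sign.\<close>

lemma compact_pin_set: "compact (pin_set :: 'n::{finite,linorder} clifford set)"
proof -
  let ?K = "pin_words CARD('n) :: 'n clifford set"
  have "pin_set = ?K \<union> uminus ` ?K"
  proof (intro equalityI subsetI)
    fix p :: "'n clifford" assume p: "p \<in> pin_set"
    then obtain q where q: "q \<in> ?K" "pin_to_O q = pin_to_O p"
      using pin_sub_insert_repr[OF finite orthogonal_pin_to_O[OF p], of UNIV] by auto
    then have "p = q \<or> p = - q"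
      using pin_to_O_eq_iff[of q p] p pin_words_subset by blast
    then show "p \<in> ?K \<union> uminus ` ?K" using q by auto
  qed (use pin_words_subset pin_minus in auto)
  moreover have "compact (uminus ` ?K)"
    by (intro compact_negations compact_pin_words)
  ultimately show ?thesis using compact_Un[OF compact_pin_words] by metis
qed

section \<open>The covering of PO(n) by Pin(n)\<close>

lemma continuous_map_locally:
  assumes "\<And>y. y \<in> topspace Y \<Longrightarrow> \<exists>U. openin Y U \<and> y \<in> U \<and> continuous_map (subtopology Y U) Z f"
  shows "continuous_map Y Z f"
proof -
  from assms obtain U where U: "\<And>y. y \<in> topspace Y \<Longrightarrow> openin Y (U y) \<and> y \<in> U y \<and>
      continuous_map (subtopology Y (U y)) Z f" by metis
  show ?thesis
    by (rule pasting_lemma[of "topspace Y" Y U Z "\<lambda>_. f" f]) (use U in auto)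
qed

lemma continuous_map_const_subtopology_pair:
  assumes "continuous_map Y A f" "continuous_map Y B h" "continuous_map (prod_topology A B) Z (\<lambda>(a, b). k a b)"
  shows "continuous_map Y Z (\<lambda>y. k (f y) (h y))"
proof -
  have "continuous_map Y (prod_topology A B) (\<lambda>y. (f y, h y))"
    using assms by (simp add: continuous_map_pairedI)
  from continuous_map_compose[OF this assms(3)] show ?thesis by (simp add: o_def)
qed

lemma orthogonal_group_simps [simp]:
  "carrier orthogonal_group = {A. orthogonal_matrix A}"
  "A \<otimes>\<^bsub>orthogonal_group\<^esub> B = A ** B" "\<one>\<^bsub>orthogonal_group\<^esub> = mat 1"
  by (simp_all add: orthogonal_group_def)

lemma matrix_mult_minus: "A ** (- B) = - (A ** (B :: 'n::finite sq_matrix))" "(- A) ** B = - (A ** B)"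
  by (simp_all add: matrix_matrix_mult_def vec_eq_iff sum_negf)

lemma PO_class_eq: "PO_class A = {A, - A}"
  by (auto simp: PO_class_def r_coset_def matrix_mult_minus)

lemma carrier_PO: "carrier PO = PO_class ` {A. orthogonal_matrix A}"
  by (auto simp: PO_def FactGroup_def RCOSETS_def PO_class_def)

lemma PO_class_mult: "PO_class A \<otimes>\<^bsub>PO\<^esub> PO_class B = PO_class (A ** B)"
  by (auto simp: PO_def FactGroup_def set_mult_def PO_class_eq matrix_mult_minus)

lemma PO_one: "\<one>\<^bsub>PO\<^esub> = PO_class (mat 1)"
  by (simp add: PO_def FactGroup_def PO_class_eq)

lemma carrier_PO_pin: "carrier PO = pin_to_PO ` (pin_set :: 'n::{finite,linorder} clifford set)"
proof -
  have "{A :: 'n sq_matrix. orthogonal_matrix A} = pin_to_O ` pin_set"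
    using pin_to_O_surj orthogonal_pin_to_O by blast
  then show ?thesis by (simp add: carrier_PO pin_to_PO_def image_image)
qed

lemma PO_pinE:
  assumes "a \<in> carrier PO"
  obtains p where "p \<in> pin_set" "pin_to_PO p = a"
  using assms by (auto simp: carrier_PO_pin)

lemma pin_to_PO_closed [simp]: "p \<in> pin_set \<Longrightarrow> pin_to_PO p \<in> carrier PO"
  by (simp add: carrier_PO_pin)

lemma pin_to_PO_mult:
  "p \<in> pin_set \<Longrightarrow> q \<in> pin_set \<Longrightarrow> pin_to_PO p \<otimes>\<^bsub>PO\<^esub> pin_to_PO q = pin_to_PO (p \<star> q)"
  by (simp add: pin_to_PO_def PO_class_mult pin_to_O_mult)

lemma pin_to_PO_one: "pin_to_PO cl_one = \<one>\<^bsub>PO\<^esub>"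
  by (simp add: pin_to_PO_def pin_to_O_one PO_one)

text \<open>The axioms are transported from Pin(n) along the multiplicative surjection
  \<open>pin_to_PO\<close>.\<close>

lemma group_PO: "group (PO :: 'n::{finite,linorder} sq_matrix set monoid)"
proof (rule groupI)
  show "\<one>\<^bsub>PO\<^esub> \<in> carrier (PO :: 'n sq_matrix set monoid)"
    by (simp add: pin_set.one flip: pin_to_PO_one)
  fix a :: "'n sq_matrix set" assume a: "a \<in> carrier PO"
  then obtain p where p: "p \<in> pin_set" "pin_to_PO p = a" by (rule PO_pinE)
  show "\<exists>y\<in>carrier PO. y \<otimes>\<^bsub>PO\<^esub> a = \<one>\<^bsub>PO\<^esub>"
    using p by (intro bexI[of _ "pin_to_PO (cl_conj p)"])
      (auto simp: pin_to_PO_mult pin_conj_closed simp flip: pin_to_PO_one)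
  show "\<one>\<^bsub>PO\<^esub> \<otimes>\<^bsub>PO\<^esub> a = a"
    using p by (auto simp: pin_to_PO_mult pin_set.one simp flip: pin_to_PO_one)
  fix b :: "'n sq_matrix set" assume b: "b \<in> carrier PO"
  then obtain q where q: "q \<in> pin_set" "pin_to_PO q = b" by (rule PO_pinE)
  show "a \<otimes>\<^bsub>PO\<^esub> b \<in> carrier PO"
    using p q by (auto simp: pin_to_PO_mult pin_mult)
  fix c :: "'n sq_matrix set" assume c: "c \<in> carrier PO"
  then obtain u where u: "u \<in> pin_set" "pin_to_PO u = c" by (rule PO_pinE)
  show "a \<otimes>\<^bsub>PO\<^esub> b \<otimes>\<^bsub>PO\<^esub> c = a \<otimes>\<^bsub>PO\<^esub> (b \<otimes>\<^bsub>PO\<^esub> c)"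
    using p q u by (auto simp: pin_to_PO_mult pin_mult cl_assoc)
qed

interpretation PO: group "PO :: 'n::{finite,linorder} sq_matrix set monoid"
  by (rule group_PO)

lemma inv_PO: "p \<in> pin_set \<Longrightarrow> inv\<^bsub>PO\<^esub> (pin_to_PO p) = pin_to_PO (cl_conj p)"
  by (rule PO.inv_equality) (auto simp: pin_to_PO_mult pin_conj_closed pin_to_PO_one)

section \<open>The quotient topology of PO(n) and its local sections in Pin(n)\<close>

lemma topspace_PO: "topspace PO_topology = carrier PO"
  by (simp add: PO_topology_def topspace_quotient_topology carrier_PO)

lemma quotient_map_PO_class: "quotient_map (top_of_set {A. orthogonal_matrix A}) PO_topology PO_class"
  unfolding quotient_map_def topspace_PO carrier_PO
  by (auto simp: PO_topology_def openin_quotient_topology)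

lemma cl_conj_continuous: "continuous_on A cl_conj"
  using linear_cl_conj by (metis linear_continuous_on linear_conv_bounded_linear)

lemma cl_grade_continuous: "continuous_on A cl_grade_involution"
  using linear_cl_grade by (metis linear_continuous_on linear_conv_bounded_linear)

lemma pin_to_O_continuous: "continuous_on pin_set pin_to_O"
proof -
  have "continuous_on pin_set (\<lambda>p. matrix (twisted_adj p))"
    unfolding matrix_def twisted_adj_def
    by (intro continuous_intros cl.continuous_on cl_conj_continuous cl_grade_continuous)
  then show ?thesis by (simp add: pin_to_O_eq cong: continuous_on_cong)
qed

text \<open>A continuous surjection from a compact space to a Hausdorff space; this is what
  \<open>compact_pin_set\<close> is for.\<close>

lemma quotient_map_pin_to_O:
  "quotient_map (top_of_set (pin_set :: 'n::{finite,linorder} clifford set))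
     (top_of_set {A. orthogonal_matrix A}) pin_to_O"
proof (rule T1_Spaces.continuous_imp_quotient_map)
  show "compact_space (top_of_set (pin_set :: 'n clifford set))"
    by (simp add: compact_pin_set compact_space_subtopology)
  show "Hausdorff_space (top_of_set {A :: 'n sq_matrix. orthogonal_matrix A})"
    by (simp add: Hausdorff_space_subtopology)
  show "continuous_map (top_of_set pin_set) (top_of_set {A :: 'n sq_matrix. orthogonal_matrix A}) pin_to_O"
    using pin_to_O_continuous orthogonal_pin_to_O by auto
  show "pin_to_O ` topspace (top_of_set (pin_set :: 'n clifford set)) = topspace (top_of_set {A. orthogonal_matrix A})"
    using pin_to_O_surj orthogonal_pin_to_O by auto
qed

lemma quotient_map_pin_to_PO: "quotient_map (top_of_set pin_set) PO_topology pin_to_PO"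
  using quotient_map_compose[OF quotient_map_pin_to_O quotient_map_PO_class]
  by (simp add: o_def pin_to_PO_def[abs_def])

lemma continuous_pin_to_PO: "continuous_map (top_of_set pin_set) PO_topology pin_to_PO"
  by (rule quotient_imp_continuous_map[OF quotient_map_pin_to_PO])

definition pi1_elems :: "'n::{finite,linorder} clifford set" where
  "pi1_elems = {cl_one, - cl_one, cl_omega, - cl_omega}"

lemma pi1_elems_pin: "pi1_elems \<subseteq> pin_set"
  using pin_minus[OF pin_set.one] pin_minus[OF pin_omega] by (auto simp: pi1_elems_def pin_set.one pin_omega)

text \<open>The parameter \<open>dummy\<close> only carries the type \<open>'n\<close>.\<close>

locale even_dim =
  fixes dummy :: "'n::{finite,linorder} itself"
  assumes dim_ge: "CARD('n) \<ge> 4" and dim_even: "even CARD('n)"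
begin

abbreviation pin_path :: "(real \<Rightarrow> 'n clifford) \<Rightarrow> bool" where
  "pin_path \<equiv> continuous_map (top_of_set {0..1}) (top_of_set pin_set)"

lemma omega_square: "(cl_omega :: 'n clifford) \<star> cl_omega = cl_one \<or> (cl_omega :: 'n clifford) \<star> cl_omega = - cl_one"
proof -
  have "pin_to_O ((cl_omega :: 'n clifford) \<star> cl_omega) = mat 1"
    by (simp add: pin_to_O_mult pin_omega pin_to_O_omega[OF dim_even] matrix_mult_minus)
  then show ?thesis by (intro pin_to_O_kernel pin_mult pin_omega)
qed

text \<open>The two signs allowed in PO(n) are realised by right multiplication with omega, and the
  two lifts of a matrix differ by -1.\<close>

lemma pin_to_PO_eq_iff:
  assumes "p \<in> pin_set" "q \<in> pin_set"
  shows "pin_to_PO p = pin_to_PO q \<longleftrightarrow> (\<exists>z\<in>pi1_elems. (q :: 'n clifford) = p \<star> z)"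
proof -
  have "pin_to_PO p = pin_to_PO q \<longleftrightarrow> pin_to_O p = pin_to_O q \<or> pin_to_O p = - pin_to_O q"
    by (auto simp: pin_to_PO_def PO_class_eq doubleton_eq_iff)
  also have "\<dots> \<longleftrightarrow> pin_to_O p = pin_to_O q \<or> pin_to_O (p \<star> cl_omega) = pin_to_O q"
    using assms by (auto simp: pin_to_O_mult pin_omega pin_to_O_omega[OF dim_even] matrix_mult_minus
        minus_equation_iff[of "pin_to_O p"])
  also have "\<dots> \<longleftrightarrow> (\<exists>z\<in>pi1_elems. q = p \<star> z)"
    using assms by (auto simp: pin_to_O_eq_iff pin_mult pin_omega pi1_elems_def cl.minus_right)
  finally show ?thesis .
qed

lemma pi1_PO_eq: "pi1_PO = (pi1_elems :: 'n clifford set)"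
  using pin_to_PO_eq_iff[OF pin_set.one] pi1_elems_pin
  by (auto simp: pi1_PO_def kernel_def subset_iff simp flip: pin_to_PO_one)

lemma omega_spin: "(cl_omega :: 'n clifford) \<in> spin_set"
  by (simp add: spin_set_def pin_omega cl_grade_omega[OF dim_even])

lemma pi1_spin: "z \<in> pi1_elems \<Longrightarrow> (z :: 'n clifford) \<in> spin_set"
  using omega_spin spin_one pi1_elems_pin by (auto simp: pi1_elems_def spin_set_def cl_grade_minus)

lemma pi1_commute_spin: "z \<in> pi1_elems \<Longrightarrow> p \<in> spin_set \<Longrightarrow> (z :: 'n clifford) \<star> p = p \<star> z"
  using omega_commute[OF dim_even, of p] spin_subset
  by (auto simp: pi1_elems_def cl.minus_left cl.minus_right)

lemma pi1_mult: "z \<in> pi1_elems \<Longrightarrow> w \<in> pi1_elems \<Longrightarrow> (z :: 'n clifford) \<star> w \<in> pi1_elems"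
  using omega_square by (auto simp: pi1_elems_def cl.minus_left cl.minus_right)

lemma pin_to_PO_pi1: "z \<in> pi1_elems \<Longrightarrow> pin_to_PO z = pin_to_PO (cl_one :: 'n clifford)"
  using pi1_PO_eq by (auto simp: pi1_PO_def kernel_def pin_to_PO_one)

lemma PSO_pin_iff:
  assumes "p \<in> pin_set"
  shows "pin_to_PO p \<in> PSO \<longleftrightarrow> (p :: 'n clifford) \<in> spin_set"
proof
  have dim2: "CARD('n) \<ge> 2" using dim_ge by simp
  show "pin_to_PO p \<in> PSO" if "p \<in> spin_set"
    using det_pin_to_O[OF dim2 assms] orthogonal_pin_to_O[OF assms] that
    by (auto simp: PSO_def pin_to_PO_def rotation_matrix_def)
  assume "pin_to_PO p \<in> PSO"
  then obtain R where R: "rotation_matrix R" "pin_to_PO p = PO_class R" by (auto simp: PSO_def)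
  then obtain q where q: "q \<in> pin_set" "pin_to_O q = R"
    using pin_to_O_surj by (auto simp: rotation_matrix_def)
  then have "q \<in> spin_set"
    using det_pin_to_O[OF dim2 q(1)] R by (auto simp: rotation_matrix_def split: if_splits)
  have "pin_to_PO q = pin_to_PO p" using q R by (simp add: pin_to_PO_def)
  then obtain z where z: "z \<in> pi1_elems" "p = q \<star> z"
    using pin_to_PO_eq_iff[OF q(1) assms] by blast
  then show "p \<in> spin_set"
    using \<open>q \<in> spin_set\<close> spin_mult_iff[of q z] pi1_spin[OF z(1)] spin_subset by auto
qed

text \<open>The saturation of U is the union of its preimages under the four right translations by
  kernel elements.\<close>

lemma openin_pin_to_PO_image:
  assumes "openin (top_of_set (pin_set :: 'n clifford set)) U"
  shows "openin PO_topology (pin_to_PO ` U)"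
proof -
  have U: "U \<subseteq> pin_set" using openin_imp_subset[OF assms] .
  have pre: "openin (top_of_set pin_set) {p \<in> pin_set. p \<star> z \<in> U}" if "z \<in> pi1_elems" for z :: "'n clifford"
  proof -
    have "continuous_on pin_set (\<lambda>p. p \<star> z)"
      by (intro cl.continuous_on continuous_intros)
    moreover have "(\<lambda>p. p \<star> z) ` pin_set \<subseteq> pin_set"
      using that pi1_elems_pin by (auto intro: pin_mult)
    ultimately have "continuous_map (top_of_set pin_set) (top_of_set pin_set) (\<lambda>p. p \<star> z)"
      by auto
    from openin_continuous_map_preimage[OF this assms] show ?thesis by simp
  qed
  have "{p \<in> pin_set. pin_to_PO p \<in> pin_to_PO ` U} = (\<Union>z\<in>pi1_elems. {p \<in> pin_set. p \<star> z \<in> U})"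
    using U pin_to_PO_eq_iff by (auto simp: image_iff subset_iff) blast
  then have "openin (top_of_set pin_set) {p \<in> pin_set. pin_to_PO p \<in> pin_to_PO ` U}"
    using pre by auto
  moreover have "pin_to_PO ` U \<subseteq> carrier PO" using U by auto
  ultimately show ?thesis
    using quotient_map_pin_to_PO unfolding quotient_map_def topspace_PO by auto
qed

end

lemma norm_pin_mult: "p \<in> pin_set \<Longrightarrow> norm (p \<star> x) = norm x"
  by (induct rule: pin_set.induct) (auto simp: norm_cl_vec_mult cl_assoc)

context even_dim
begin

text \<open>Since left multiplication is isometric, right multiplication by a kernel element z moves
  every point of Pin(n) by the same distance, that from 1 to z. On a ball whose radius is half the
  smallest such distance, the projection is injective; being open, it has a continuous inverse
  there.\<close>

lemma PO_local_section:
  assumes "a \<in> carrier (PO :: 'n sq_matrix set monoid)"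
  obtains W s where "openin PO_topology W" "a \<in> W"
    "continuous_map (subtopology PO_topology W) (top_of_set pin_set) s"
    "\<And>b. b \<in> W \<Longrightarrow> s b \<in> pin_set \<and> pin_to_PO (s b) = b"
proof -
  obtain p where p: "p \<in> pin_set" "pin_to_PO p = a" using assms by (rule PO_pinE)
  have "finite (pi1_elems :: 'n clifford set)" by (simp add: pi1_elems_def)
  then obtain m where m: "m > 0" "\<And>z. z \<in> pi1_elems \<Longrightarrow> z \<noteq> cl_one \<Longrightarrow> m \<le> dist (cl_one :: 'n clifford) z"
    using finite_set_avoid by metis
  define U where "U = pin_set \<inter> ball p (m / 2)"
  have oU: "openin (top_of_set pin_set) U" by (simp add: U_def openin_open_Int)
  have inj: "inj_on pin_to_PO U"
  proof (rule inj_onI)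
    fix x y assume x: "x \<in> U" and y: "y \<in> U" and eq: "pin_to_PO x = pin_to_PO y"
    then obtain z where z: "z \<in> pi1_elems" "y = x \<star> z"
      using pin_to_PO_eq_iff[of x y] by (auto simp: U_def)
    have "dist x y < m"
      using x y dist_triangle_half_r[of p x m y] by (auto simp: U_def)
    moreover have "dist x y = dist cl_one z"
    proof -
      have "x - y = x \<star> (cl_one - z)" by (simp add: z cl.diff_right)
      then show ?thesis using x norm_pin_mult[of x "cl_one - z"] by (simp add: dist_norm U_def)
    qed
    ultimately have "z = cl_one" using m(2)[OF z(1)] by fastforce
    then show "x = y" using z by simp
  qed
  let ?W = "pin_to_PO ` U"
  have sub: "subtopology (top_of_set pin_set) U = top_of_set U"
    by (simp add: subtopology_subtopology U_def Int_absorb1)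
  have W: "openin PO_topology ?W" by (rule openin_pin_to_PO_image[OF oU])
  have "homeomorphic_map (top_of_set U) (subtopology PO_topology ?W) pin_to_PO"
  proof (rule bijective_open_imp_homeomorphic_map)
    show "continuous_map (top_of_set U) (subtopology PO_topology ?W) pin_to_PO"
      using continuous_map_from_subtopology[OF continuous_pin_to_PO, of U]
      by (auto simp: sub continuous_map_in_subtopology)
    show "open_map (top_of_set U) (subtopology PO_topology ?W) pin_to_PO"
      unfolding open_map_def
    proof (intro allI impI)
      fix V assume V: "openin (top_of_set U) V"
      then have "V \<subseteq> U" by (rule openin_imp_subset)
      moreover have "openin (top_of_set pin_set) V" using V oU openin_trans by blast
      ultimately show "openin (subtopology PO_topology ?W) (pin_to_PO ` V)"
        using openin_pin_to_PO_image[of V] by (auto simp: openin_subtopology intro!: exI[of _ "pin_to_PO ` V"])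
    qed
    show "pin_to_PO ` topspace (top_of_set U) = topspace (subtopology PO_topology ?W)"
      using openin_subset[OF W] by auto
    show "inj_on pin_to_PO (topspace (top_of_set U))" using inj by simp
  qed
  then obtain s where s: "homeomorphic_maps (top_of_set U) (subtopology PO_topology ?W) pin_to_PO s"
    using homeomorphic_map_maps by blast
  then have cs: "continuous_map (subtopology PO_topology ?W) (top_of_set U) s"
    and ps: "\<And>b. b \<in> ?W \<Longrightarrow> pin_to_PO (s b) = b"
    using openin_subset[OF W] by (auto simp: homeomorphic_maps_def)
  show thesis
  proof (rule that[OF W])
    show "a \<in> ?W" using p m(1) by (auto simp: U_def)
    have "continuous_map (subtopology PO_topology ?W) (subtopology (top_of_set pin_set) U) s"
      using cs sub by simp
    then show "continuous_map (subtopology PO_topology ?W) (top_of_set pin_set) s"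
      by (simp only: continuous_map_in_subtopology)
    show "s b \<in> pin_set \<and> pin_to_PO (s b) = b" if "b \<in> ?W" for b
    proof -
      have "b \<in> topspace (subtopology PO_topology ?W)" using that openin_subset[OF W] by auto
      then have "s b \<in> topspace (top_of_set U)"
        using continuous_map_image_subset_topspace[OF cs] by blast
      then show ?thesis using ps[OF that] by (simp add: U_def)
    qed
  qed
qed

text \<open>A product of quotient maps need not be a quotient map, so continuity is checked through
  local sections, where the multiplication is that of Pin(n).\<close>

lemma continuous_PO_mult:
  "continuous_map (prod_topology PO_topology PO_topology) PO_topology
     (\<lambda>(a, b). a \<otimes>\<^bsub>(PO :: 'n sq_matrix set monoid)\<^esub> b)"
proof (rule continuous_map_locally)
  fix y :: "'n sq_matrix set \<times> 'n sq_matrix set"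
  assume y: "y \<in> topspace (prod_topology PO_topology PO_topology)"
  then have f: "fst y \<in> carrier PO" and s: "snd y \<in> carrier PO" by (auto simp: topspace_PO)
  obtain W s where W: "openin PO_topology W" "fst y \<in> W"
    "continuous_map (subtopology PO_topology W) (top_of_set pin_set) s"
    "\<And>b. b \<in> W \<Longrightarrow> s b \<in> pin_set \<and> pin_to_PO (s b) = b"
    using PO_local_section[OF f] by blast
  obtain V t where V: "openin PO_topology V" "snd y \<in> V"
    "continuous_map (subtopology PO_topology V) (top_of_set pin_set) t"
    "\<And>b. b \<in> V \<Longrightarrow> t b \<in> pin_set \<and> pin_to_PO (t b) = b"
    using PO_local_section[OF s] by blast
  let ?P = "prod_topology (subtopology PO_topology W) (subtopology PO_topology V)"
  have s1: "continuous_map ?P (top_of_set pin_set) (\<lambda>x. s (fst x))"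
    using continuous_map_compose[OF continuous_map_fst W(3)] by (simp add: o_def)
  have t1: "continuous_map ?P (top_of_set pin_set) (\<lambda>x. t (snd x))"
    using continuous_map_compose[OF continuous_map_snd V(3)] by (simp add: o_def)
  have "continuous_on (pin_set \<times> pin_set) (\<lambda>x :: 'n clifford \<times> 'n clifford. fst x \<star> snd x)"
    by (intro cl.continuous_on continuous_intros)
  then have m: "continuous_map (prod_topology (top_of_set pin_set) (top_of_set pin_set)) (top_of_set pin_set)
     (\<lambda>(a, b). a \<star> (b :: 'n clifford))"
    by (auto simp: prod_topology_subtopology_eu case_prod_unfold intro: pin_mult)
  have "continuous_map ?P PO_topology (\<lambda>x. pin_to_PO (s (fst x) \<star> t (snd x)))"
    using continuous_map_compose[OF continuous_map_const_subtopology_pair[OF s1 t1 m] continuous_pin_to_PO]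
    by (simp add: o_def)
  moreover have "pin_to_PO (s (fst x) \<star> t (snd x)) = (case x of (a, b) \<Rightarrow> a \<otimes>\<^bsub>PO\<^esub> b)"
    if "x \<in> topspace ?P" for x
    using that W(4)[of "fst x"] V(4)[of "snd x"] by (auto simp flip: pin_to_PO_mult)
  ultimately have "continuous_map ?P PO_topology (\<lambda>(a, b). a \<otimes>\<^bsub>PO\<^esub> b)"
    by (rule continuous_map_eq)
  moreover have "?P = subtopology (prod_topology PO_topology PO_topology) (W \<times> V)"
    by (simp add: subtopology_Times)
  moreover have "openin (prod_topology PO_topology PO_topology) (W \<times> V)"
    using W V by (simp add: openin_prod_Times_iff)
  moreover have "y \<in> W \<times> V" using W V by (cases y) auto
  ultimately show "\<exists>U. openin (prod_topology PO_topology PO_topology) U \<and> y \<in> U \<and>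
     continuous_map (subtopology (prod_topology PO_topology PO_topology) U) PO_topology
       (\<lambda>(a, b). a \<otimes>\<^bsub>(PO :: 'n sq_matrix set monoid)\<^esub> b)" by metis
qed

lemma continuous_PO_inv:
  "continuous_map PO_topology PO_topology (\<lambda>a. inv\<^bsub>(PO :: 'n sq_matrix set monoid)\<^esub> a)"
proof (rule continuous_map_locally)
  fix y :: "'n sq_matrix set" assume "y \<in> topspace PO_topology"
  then have f: "y \<in> carrier PO" by (auto simp: topspace_PO)
  obtain W s where W: "openin PO_topology W" "y \<in> W"
    "continuous_map (subtopology PO_topology W) (top_of_set pin_set) s"
    "\<And>b. b \<in> W \<Longrightarrow> s b \<in> pin_set \<and> pin_to_PO (s b) = b"
    using PO_local_section[OF f] by blast
  have c: "continuous_map (top_of_set pin_set) (top_of_set pin_set) cl_conj"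
    by (auto simp: cl_conj_continuous pin_conj_closed)
  have "continuous_map (subtopology PO_topology W) PO_topology (\<lambda>x. pin_to_PO (cl_conj (s x)))"
    using continuous_map_compose[OF continuous_map_compose[OF W(3) c] continuous_pin_to_PO]
    by (simp add: o_def)
  moreover have "pin_to_PO (cl_conj (s x)) = inv\<^bsub>PO\<^esub> x"
    if "x \<in> topspace (subtopology PO_topology W)" for x
    using that W(4)[of x] inv_PO[of "s x"] by auto
  ultimately have "continuous_map (subtopology PO_topology W) PO_topology (\<lambda>a. inv\<^bsub>PO\<^esub> a)"
    by (rule continuous_map_eq)
  then show "\<exists>U. openin PO_topology U \<and> y \<in> U \<and>
     continuous_map (subtopology PO_topology U) PO_topology (\<lambda>a. inv\<^bsub>(PO :: 'n sq_matrix set monoid)\<^esub> a)"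
    using W by blast
qed

end

section \<open>Lifting over discs\<close>

text \<open>This covers both bundles and the map from \<open>Pin(n)\<close> to \<open>PO(n)\<close>: all that lifting needs is
  local sections and a continuous division of points of the same fibre.\<close>

locale fibred =
  fixes TE :: "'e topology" and X :: "'x topology" and T :: "'g topology"
    and prj :: "'e \<Rightarrow> 'x" and act :: "'e \<Rightarrow> 'g \<Rightarrow> 'e" and dv :: "'e \<Rightarrow> 'e \<Rightarrow> 'g"
  assumes prj_cont: "continuous_map TE X prj"
    and act_cont: "continuous_map (prod_topology TE T) TE (\<lambda>(e, a). act e a)"
    and act_prj: "\<And>e a. e \<in> topspace TE \<Longrightarrow> a \<in> topspace T \<Longrightarrow> prj (act e a) = prj e"
    and dv_act: "\<And>e e'. e \<in> topspace TE \<Longrightarrow> e' \<in> topspace TE \<Longrightarrow> prj e = prj e' \<Longrightarrow>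
        act e (dv e e') = e'"
    and dv_cont: "continuous_map (subtopology (prod_topology TE TE) {(e, e'). prj e = prj e'}) T
        (\<lambda>(e, e'). dv e e')"
    and local_section: "\<And>x. x \<in> topspace X \<Longrightarrow> \<exists>W s. openin X W \<and> x \<in> W \<and>
        continuous_map (subtopology X W) TE s \<and> (\<forall>y\<in>W. prj (s y) = y)"
begin

lemma dv_continuous:
  assumes "continuous_map Y TE u" "continuous_map Y TE v" "\<And>y. y \<in> topspace Y \<Longrightarrow> prj (u y) = prj (v y)"
  shows "continuous_map Y T (\<lambda>y. dv (u y) (v y))"
proof -
  have "continuous_map Y (subtopology (prod_topology TE TE) {(e, e'). prj e = prj e'}) (\<lambda>y. (u y, v y))"
    using assms by (auto simp: continuous_map_in_subtopology continuous_map_pairedI)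
  from continuous_map_compose[OF this dv_cont] show ?thesis by (simp add: o_def)
qed

lemma act_continuous:
  assumes "continuous_map Y TE u" "continuous_map Y T a"
  shows "continuous_map Y TE (\<lambda>y. act (u y) (a y))"
  using continuous_map_const_subtopology_pair[OF assms act_cont] .

definition lifts :: "('a::t2_space \<Rightarrow> 'x) \<Rightarrow> 'a set \<Rightarrow> bool" where
  "lifts f A \<longleftrightarrow> (\<exists>S. continuous_map (top_of_set A) TE S \<and> (\<forall>y\<in>A. prj (S y) = f y))"

text \<open>On the overlap the two lifts differ by a function with values in the structure group.
  The retraction extends this function over B, and acting with it corrects the second lift.\<close>

lemma lifts_glue:
  fixes f :: "'a::t2_space \<Rightarrow> 'x"
  assumes A: "lifts f A" and B: "lifts f B" and cl: "closed A" "closed B"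
    and r: "continuous_on B \<rho>" "\<And>y. y \<in> B \<Longrightarrow> \<rho> y \<in> A \<inter> B" "\<And>y. y \<in> A \<inter> B \<Longrightarrow> \<rho> y = y"
  shows "lifts f (A \<union> B)"
proof -
  from A obtain S where S: "continuous_map (top_of_set A) TE S" "\<And>y. y \<in> A \<Longrightarrow> prj (S y) = f y"
    by (auto simp: lifts_def)
  from B obtain S' where S': "continuous_map (top_of_set B) TE S'" "\<And>y. y \<in> B \<Longrightarrow> prj (S' y) = f y"
    by (auto simp: lifts_def)
  have rA: "continuous_map (top_of_set B) (top_of_set A) \<rho>" and rB: "continuous_map (top_of_set B) (top_of_set B) \<rho>"
    using r by auto
  define d where "d y = dv (S' (\<rho> y)) (S (\<rho> y))" for y
  have d: "continuous_map (top_of_set B) T d"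
    unfolding d_def
  proof (rule dv_continuous)
    show "continuous_map (top_of_set B) TE (\<lambda>y. S' (\<rho> y))" "continuous_map (top_of_set B) TE (\<lambda>y. S (\<rho> y))"
      using continuous_map_compose[OF rB S'(1)] continuous_map_compose[OF rA S(1)] by (simp_all add: o_def)
    show "prj (S' (\<rho> y)) = prj (S (\<rho> y))" if "y \<in> topspace (top_of_set B)" for y
      using r(2)[of y] that S(2) S'(2) by auto
  qed
  define S'' where "S'' y = act (S' y) (d y)" for y
  have cS'': "continuous_map (top_of_set B) TE S''"
    unfolding S''_def by (rule act_continuous[OF S'(1) d])
  have in_top: "S' y \<in> topspace TE" "d y \<in> topspace T" if "y \<in> B" for y
    using continuous_map_image_subset_topspace[OF S'(1)] continuous_map_image_subset_topspace[OF d] that by auto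
  have SA: "S y \<in> topspace TE" if "y \<in> A" for y
    using continuous_map_image_subset_topspace[OF S(1)] that by auto
  have pS'': "prj (S'' y) = f y" if "y \<in> B" for y
    unfolding S''_def using in_top[OF that] S'(2)[OF that] by (simp add: act_prj)
  have agree: "S'' y = S y" if "y \<in> A" "y \<in> B" for y
    using that r(3)[of y] in_top SA S(2) S'(2) by (simp add: S''_def d_def dv_act)
  define R where "R y = (if y \<in> A then S y else S'' y)" for y
  have "continuous_map (top_of_set (A \<union> B)) TE R"
  proof (rule pasting_lemma_closed[of "{True, False}" "top_of_set (A \<union> B)" "\<lambda>b. if b then A else B" TE "\<lambda>b. if b then S else S''"])
    show "closedin (top_of_set (A \<union> B)) (if i then A else B)" if "i \<in> {True, False}" for i
      using cl by (auto simp: closed_subset)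
    show "continuous_map (subtopology (top_of_set (A \<union> B)) (if i then A else B)) TE (if i then S else S'')"
      if "i \<in> {True, False}" for i
      using S(1) cS'' by (auto simp: subtopology_subtopology Int_absorb1)
    show "(if i then S else S'') x = (if j then S else S'') x"
      if "i \<in> {True, False}" "j \<in> {True, False}"
        "x \<in> topspace (top_of_set (A \<union> B)) \<inter> (if i then A else B) \<inter> (if j then A else B)" for i j x
      using that agree by (auto split: if_splits)
    show "\<exists>j. j \<in> {True, False} \<and> x \<in> (if j then A else B) \<and> R x = (if j then S else S'') x"
      if "x \<in> topspace (top_of_set (A \<union> B))" for x
      using that by (auto simp: R_def)
  qed simp
  moreover have "\<forall>y\<in>A \<union> B. prj (R y) = f y"
    using S(2) pS'' by (auto simp: R_def)
  ultimately show ?thesis unfolding lifts_def by blast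
qed

lemma lifts_mono: "lifts f A \<Longrightarrow> B \<subseteq> A \<Longrightarrow> lifts f B"
  unfolding lifts_def by (meson continuous_map_from_subtopology_mono subsetD)

end

section \<open>Lifting over squares by subdivision\<close>

definition crect :: "real \<Rightarrow> real \<Rightarrow> real \<Rightarrow> real \<Rightarrow> complex set" where
  "crect a b c d = {z. a \<le> Re z \<and> Re z \<le> b \<and> c \<le> Im z \<and> Im z \<le> d}"

lemma closed_crect: "closed (crect a b c d)"
  unfolding crect_def by (intro closed_Collect_conj closed_Collect_le continuous_intros)

lemma crect_cbox: "crect a b c d = cbox (Complex a c) (Complex b d)"
  by (auto simp: crect_def cbox_def Basis_complex_def)

context fibred
begin

text \<open>The upper rectangle retracts to the common edge by replacing the imaginary part with
  d.\<close>

lemma lifts_hglue: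
  assumes "lifts f (crect a b c d)" "lifts f (crect a b d e)" "c \<le> d" "d \<le> e"
  shows "lifts f (crect a b c e)"
proof -
  have "lifts f (crect a b c d \<union> crect a b d e)"
    by (rule lifts_glue[OF assms(1,2) closed_crect closed_crect, of "\<lambda>z. Complex (Re z) d"])
      (use assms in \<open>auto simp: crect_def complex_eq_iff Complex_eq intro!: continuous_intros\<close>)
  moreover have "crect a b c d \<union> crect a b d e = crect a b c e"
    using assms by (auto simp: crect_def)
  ultimately show ?thesis by simp
qed

lemma lifts_vglue:
  assumes "lifts f (crect a b d e)" "lifts f (crect b c d e)" "a \<le> b" "b \<le> c"
  shows "lifts f (crect a c d e)"
proof -
  have "lifts f (crect a b d e \<union> crect b c d e)"
    by (rule lifts_glue[OF assms(1,2) closed_crect closed_crect, of "\<lambda>z. Complex b (Im z)"])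
      (use assms in \<open>auto simp: crect_def complex_eq_iff Complex_eq intro!: continuous_intros\<close>)
  moreover have "crect a b d e \<union> crect b c d e = crect a c d e"
    using assms by (auto simp: crect_def)
  ultimately show ?thesis by simp
qed

lemma lifts_crect:
  assumes f: "continuous_map euclidean X f" and h: "h > 0"
    and cell: "\<And>i j. i < N \<Longrightarrow> j < N \<Longrightarrow>
       lifts f (crect (a + real i * h) (a + real (Suc i) * h) (c + real j * h) (c + real (Suc j) * h))"
  shows "N > 0 \<Longrightarrow> lifts f (crect a (a + real N * h) c (c + real N * h))"
proof -
  have strip: "lifts f (crect (a + real i * h) (a + real (Suc i) * h) c (c + real (Suc j) * h))"
    if "i < N" "j < N" for i j
    using that(2)
  proof (induct j)
    case 0
    then show ?case using cell[OF that(1), of 0] by simp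
  next
    case (Suc j)
    then have "lifts f (crect (a + real i * h) (a + real (Suc i) * h) c (c + real (Suc j) * h))" by simp
    from lifts_hglue[OF this cell[OF that(1) Suc.prems]] h show ?case by (simp add: algebra_simps)
  qed
  have "lifts f (crect a (a + real (Suc i) * h) c (c + real N * h))" if "i < N" for i
    using that
  proof (induct i)
    case 0
    then show ?case using strip[of 0 "N - 1"] by simp
  next
    case (Suc i)
    then have "lifts f (crect a (a + real (Suc i) * h) c (c + real N * h))" by simp
    from lifts_vglue[OF this] strip[OF Suc.prems, of "N - 1"] Suc.prems h show ?case by (simp add: algebra_simps)
  qed
  from this[of "N - 1"] show "N > 0 \<Longrightarrow> lifts f (crect a (a + real N * h) c (c + real N * h))" by simp
qed

lemma lifts_local:
  assumes f: "continuous_map euclidean X f"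
  shows "\<exists>U. open U \<and> y \<in> U \<and> lifts f U"
proof -
  have "f y \<in> topspace X" using continuous_map_image_subset_topspace[OF f] by auto
  then obtain W s where W: "openin X W" "f y \<in> W" "continuous_map (subtopology X W) TE s" "\<forall>y\<in>W. prj (s y) = y"
    using local_section by blast
  let ?U = "{y. f y \<in> W}"
  have "open ?U" using openin_continuous_map_preimage[OF f W(1)] by simp
  moreover have "continuous_map (top_of_set ?U) (subtopology X W) f"
    using continuous_map_from_subtopology[OF f] by (auto simp: continuous_map_in_subtopology)
  from continuous_map_compose[OF this W(3)] have "lifts f ?U"
    using W(4) unfolding lifts_def by (intro exI[of _ "s \<circ> f"]) auto
  ultimately show ?thesis using W(2) by blast
qed

text \<open>A Lebesgue number of the cover by open sets with lifts gives a grid all of whose cells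
  have lifts; the cells are then glued along their edges.\<close>

lemma lifts_cbox:
  fixes f :: "complex \<Rightarrow> 'x"
  assumes f: "continuous_map euclidean X f" and M: "M > 0"
  shows "lifts f (crect (- M) M (- M) M)"
proof -
  let ?C = "{U. open U \<and> lifts f U}"
  have "compact (crect (- M) M (- M) M)" by (simp add: crect_cbox)
  moreover have "?C \<noteq> {}" using lifts_local[OF f] by blast
  moreover have "crect (- M) M (- M) M \<subseteq> \<Union>?C" using lifts_local[OF f] by blast
  ultimately obtain e where e: "e > 0" "\<And>T. T \<subseteq> crect (- M) M (- M) M \<Longrightarrow> diameter T < e \<Longrightarrow> \<exists>B\<in>?C. T \<subseteq> B"
    using Lebesgue_number_lemma[of "crect (- M) M (- M) M" ?C] by (metis (no_types, lifting) mem_Collect_eq)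
  \<comment> \<open>This N makes four times the mesh h smaller than the Lebesgue number e, while a
    cell has diameter at most 2 h.\<close>
  obtain N :: nat where N: "real N > 8 * M / e" using reals_Archimedean2 by blast
  have N0: "N > 0" using N M e(1) by (cases N) (auto simp: field_simps zero_less_divide_iff not_less)
  define h where "h = 2 * M / real N"
  have h: "h > 0" using M N0 by (simp add: h_def)
  have Nh: "real N * h = 2 * M" using N0 by (simp add: h_def)
  have he: "4 * h < e" using N N0 e(1) by (simp add: h_def field_simps)
  have "lifts f (crect (- M) (- M + real N * h) (- M) (- M + real N * h))"
  proof (rule lifts_crect[OF f h _ N0])
    fix i j assume i: "i < N" and j: "j < N"
    let ?T = "crect (- M + real i * h) (- M + real (Suc i) * h) (- M + real j * h) (- M + real (Suc j) * h)"
    have "real (Suc i) * h \<le> real N * h" "real (Suc j) * h \<le> real N * h"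
      using i j h by (intro mult_right_mono; simp)+
    then have "?T \<subseteq> crect (- M) M (- M) M"
      using h unfolding Nh crect_def by (auto intro: order_trans[rotated] add_increasing2)
    moreover have "diameter ?T \<le> 2 * h"
    proof (rule diameter_le)
      show "?T \<noteq> {} \<or> 0 \<le> 2 * h" using h by simp
      fix x y assume xy: "x \<in> ?T" "y \<in> ?T"
      have "\<bar>Re (x - y)\<bar> \<le> h" "\<bar>Im (x - y)\<bar> \<le> h"
        using xy by (auto simp: crect_def algebra_simps)
      then show "norm (x - y) \<le> 2 * h" using cmod_le[of "x - y"] by linarith
    qed
    ultimately obtain B where "B \<in> ?C" "?T \<subseteq> B" using e(2)[of ?T] he h by fastforce
    then show "lifts f ?T" using lifts_mono by blast
  qed
  then show ?thesis by (simp add: Nh)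
qed

text \<open>Composition with the nearest-point projection extends f to the whole plane, which
  reduces a compact convex set to a square containing it.\<close>

lemma lift_exists:
  fixes f :: "complex \<Rightarrow> 'x"
  assumes D: "compact D" "convex D" and f: "continuous_map (top_of_set D) X f"
  obtains S where "continuous_map (top_of_set D) TE S" "\<And>y. y \<in> D \<Longrightarrow> prj (S y) = f y"
proof (cases "D = {}")
  case True
  then show thesis using that[of undefined] by (auto simp: continuous_map_def openin_subtopology)
next
  case False
  let ?c = "closest_point D"
  have "continuous_map euclidean (top_of_set D) ?c"
    using continuous_on_closest_point[of D UNIV] D False closest_point_in_set[of D]
    by (auto simp: compact_imp_closed continuous_map_in_subtopology)
  from continuous_map_compose[OF this f] have fc: "continuous_map euclidean X (f \<circ> ?c)" .
  obtain B where B: "B > 0" "\<And>x. x \<in> D \<Longrightarrow> norm x \<le> B"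
    using compact_imp_bounded[OF D(1)] bounded_pos by blast
  have "D \<subseteq> crect (- B) B (- B) B"
  proof
    fix x assume "x \<in> D"
    then show "x \<in> crect (- B) B (- B) B"
      using B(2)[of x] abs_Re_le_cmod[of x] abs_Im_le_cmod[of x] by (auto simp: crect_def)
  qed
  with lifts_cbox[OF fc B(1)] have "lifts (f \<circ> ?c) D" by (rule lifts_mono)
  then obtain S where "continuous_map (top_of_set D) TE S" "\<And>y. y \<in> D \<Longrightarrow> prj (S y) = f (?c y)"
    by (auto simp: lifts_def)
  then show thesis using that[of S] closest_point_self by metis
qed

corollary path_lift_exists:
  assumes f: "continuous_map (top_of_set {0..1::real}) X f"
  obtains S where "continuous_map (top_of_set {0..1}) TE S" "\<And>t. t \<in> {0..1} \<Longrightarrow> prj (S t) = f t"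
proof -
  let ?D = "crect 0 1 0 0"
  have "continuous_map (top_of_set ?D) (top_of_set {0..1}) Re"
    by (auto simp: crect_def intro: continuous_intros)
  from continuous_map_compose[OF this f] have "continuous_map (top_of_set ?D) X (f \<circ> Re)" .
  then obtain S where S: "continuous_map (top_of_set ?D) TE S" "\<And>y. y \<in> ?D \<Longrightarrow> prj (S y) = f (Re y)"
    using lift_exists[of ?D "f \<circ> Re"] by (auto simp: crect_cbox)
  have "continuous_map (top_of_set {0..1}) (top_of_set ?D) complex_of_real"
    by (auto simp: crect_def intro: continuous_intros)
  from continuous_map_compose[OF this S(1)] S(2) show thesis
    by (intro that[of "S \<circ> complex_of_real"]) (auto simp: crect_def)
qed

end

section \<open>Spin(n) is connected and simply connected\<close>

text \<open>Vanishing of the fundamental group at every base point, put without base points as the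
  extension property that is applied later.\<close>

definition disc_extensible :: "'a::real_normed_vector set \<Rightarrow> bool" where
  "disc_extensible Y \<longleftrightarrow> (\<forall>f. continuous_on (sphere (0::complex) 1) f \<and> f ` sphere 0 1 \<subseteq> Y \<longrightarrow>
     (\<exists>F. continuous_on (cball 0 1) F \<and> F ` cball 0 1 \<subseteq> Y \<and> (\<forall>x\<in>sphere 0 1. F x = f x)))"

lemma disc_extensibleE:
  assumes "disc_extensible Y" "continuous_map (top_of_set (sphere (0::complex) 1)) (top_of_set Y) f"
  obtains F where "continuous_map (top_of_set (cball 0 1)) (top_of_set Y) F"
    "\<And>x. x \<in> sphere 0 1 \<Longrightarrow> F x = f x"
proof -
  have "continuous_on (sphere 0 1) f \<and> f ` sphere 0 1 \<subseteq> Y" using assms(2) by auto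
  with assms(1)[unfolded disc_extensible_def, rule_format, of f] obtain F where
    "continuous_on (cball 0 1) F" "F ` cball 0 1 \<subseteq> Y" "\<forall>x\<in>sphere 0 1. F x = f x" by blast
  then show thesis by (intro that[of F]) auto
qed

definition coord_sphere :: "'m set \<Rightarrow> (real^'m) set" where
  "coord_sphere A = {v. norm v = 1 \<and> (\<forall>i. i \<notin> A \<longrightarrow> v $ i = 0)}"

text \<open>The sphere has dimension at least 2, so a loop in it is null-homotopic, and a
  null-homotopic map on the circle extends to the disc. The sphere enters as the relative frontier
  of the unit ball of the subspace V.\<close>

lemma disc_extensible_coord_sphere:
  fixes A :: "'m::finite set"
  assumes "card A \<ge> 3"
  shows "disc_extensible (coord_sphere A)"
  unfolding disc_extensible_def
proof (intro allI impI)
  fix f :: "complex \<Rightarrow> real^'m"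
  assume f: "continuous_on (sphere 0 1) f \<and> f ` sphere 0 1 \<subseteq> coord_sphere A"
  define V where "V = {v :: real^'m. \<forall>i. i \<notin> A \<longrightarrow> v $ i = 0}"
  have V: "subspace V" by (auto simp: V_def subspace_def)
  have "V = {x. \<forall>i\<in>Basis. i \<notin> (\<lambda>i. axis i 1) ` A \<longrightarrow> x \<bullet> i = 0}"
    by (auto simp: V_def Basis_vec_def inner_axis axis_eq_axis)
  moreover have "card ((\<lambda>i. axis i 1 :: real^'m) ` A) = card A"
    by (intro card_image inj_onI) (simp add: axis_eq_axis)
  ultimately have dimV: "dim V = card A"
    using dim_substandard[of "(\<lambda>i. axis i 1 :: real^'m) ` A"] by (auto simp: Basis_vec_def)
  let ?T = "cball 0 1 \<inter> V"
  have clV: "closed V" by (rule closed_subspace[OF V])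
  have aT: "aff_dim ?T = card A"
  proof -
    have "0 \<in> V \<inter> interior (cball 0 1)" using subspace_0[OF V] by simp
    then have "V \<inter> interior (cball 0 1) \<noteq> {}" by blast
    then show ?thesis
      using aff_dim_convex_Int_nonempty_interior[of V "cball 0 1"] V dimV
      by (simp add: Int_commute subspace_imp_convex aff_dim_subspace)
  qed
  have "rel_interior ?T = ball 0 1 \<inter> V"
  proof -
    have "0 \<in> interior (cball 0 1) \<inter> V" using subspace_0[OF V] by simp
    then have "interior (cball 0 1) \<inter> V \<noteq> {}" by blast
    from rel_interior_convex_Int_affine[OF _ subspace_imp_affine[OF V] this] show ?thesis by simp
  qed
  moreover have "closed ?T" using clV by (intro closed_Int) auto
  ultimately have fT: "rel_frontier ?T = coord_sphere A"
    by (auto simp: rel_frontier_def coord_sphere_def V_def)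
  have fS: "rel_frontier (cball (0::complex) 1) = sphere 0 1"
    by (simp add: rel_frontier_nonempty_interior)
  have "aff_dim (cball (0::complex) 1) = 2"
    by (simp add: aff_dim_cball)
  then obtain c where "homotopic_with_canon (\<lambda>z. True) (sphere 0 1) (coord_sphere A) f (\<lambda>x. c)"
    using inessential_spheremap_lowdim_gen[of "cball (0::complex) 1" ?T f] f assms aT V
    unfolding fT fS by (auto simp: convex_Int subspace_imp_convex bounded_Int)
  then show "\<exists>F. continuous_on (cball 0 1) F \<and> F ` cball 0 1 \<subseteq> coord_sphere A \<and> (\<forall>x\<in>sphere 0 1. F x = f x)"
    using nullhomotopic_from_sphere_extension[of 0 1 "coord_sphere A" f] by blast
qed

section \<open>Spin(3) as a three-dimensional sphere\<close>

definition spin_sub :: "'n::{finite,linorder} set \<Rightarrow> 'n clifford set" where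
  "spin_sub S = pin_sub S \<inter> spin_set"

lemma norm_cl_conj [simp]: "norm (cl_conj x) = norm x"
proof -
  have "cl_conj x \<bullet> cl_conj x = x \<bullet> x"
    unfolding inner_vec_def
  proof (intro sum.cong refl)
    fix S
    have "cl_conj x $ S \<bullet> cl_conj x $ S = (cl_sign S S * cl_sign S S) * (x $ S * x $ S)"
      by (simp add: cl_conj_def del: cl_sign_square)
    then show "cl_conj x $ S \<bullet> cl_conj x $ S = x $ S \<bullet> x $ S" by simp
  qed
  then show ?thesis by (simp add: norm_eq)
qed

lemma norm_mult_cl_vec: "norm v = 1 \<Longrightarrow> norm (x \<star> cl_vec v) = norm x"
proof -
  assume "norm v = 1"
  then have "norm (cl_conj (x \<star> cl_vec v)) = norm (cl_conj x)"
    by (simp add: cl_conj_mult cl_conj_vec cl.minus_left norm_cl_vec_mult del: norm_cl_conj)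
  then show ?thesis by simp
qed

lemma cl_nth_mult_basis_sing:
  "(x \<star> cl_basis {i}) $ S = cl_sign (({i} - S) \<union> (S - {i})) {i} * x $ (({i} - S) \<union> (S - {i}))"
proof (rule linear_eq_on_cl_basis[of "\<lambda>x. (x \<star> cl_basis {i}) $ S" "\<lambda>x. cl_sign (({i} - S) \<union> (S - {i})) {i} * x $ (({i} - S) \<union> (S - {i}))"])
  fix T
  have "S = (T - {i}) \<union> ({i} - T) \<longleftrightarrow> T = ({i} - S) \<union> (S - {i})" by blast
  then show "(cl_basis T \<star> cl_basis {i}) $ S =
    cl_sign (({i} - S) \<union> (S - {i})) {i} * cl_basis T $ (({i} - S) \<union> (S - {i}))"
    by (auto simp: cl_basis_mult cl_basis_nth)
qed (auto simp: linear_iff cl.add_left cl.scaleR_left algebra_simps)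

lemma cl_nth_mult_vec:
  "(x \<star> cl_vec w) $ S = (\<Sum>i\<in>UNIV. w $ i * (cl_sign (({i} - S) \<union> (S - {i})) {i} * x $ (({i} - S) \<union> (S - {i}))))"
  unfolding cl_vec_def by (simp only: cl.sum_right cl.scaleR_right sum_component vector_scaleR_component real_scaleR_def cl_nth_mult_basis_sing)

lemma cl_nth_vec_mult:
  "(cl_vec w \<star> x) $ S = (\<Sum>i\<in>UNIV. w $ i * (cl_sign {i} (({i} - S) \<union> (S - {i})) * x $ (({i} - S) \<union> (S - {i}))))"
  unfolding cl_vec_def by (simp only: cl.sum_left cl.scaleR_left sum_component vector_scaleR_component real_scaleR_def cl_basis_nth_mult_sing)

lemma pin_sub_support: "x \<in> pin_sub S \<Longrightarrow> \<not> T \<subseteq> S \<Longrightarrow> x $ T = 0"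
proof (induct arbitrary: T rule: pin_sub.induct)
  case one
  then show ?case by (auto simp: cl_one_def cl_basis_nth)
next
  case (mult v x)
  show ?case
    unfolding cl_nth_vec_mult
  proof (intro sum.neutral ballI)
    fix i
    show "v $ i * (cl_sign {i} (({i} - T) \<union> (T - {i})) * x $ (({i} - T) \<union> (T - {i}))) = 0"
    proof (cases "i \<in> S")
      case True
      then have "\<not> ({i} - T) \<union> (T - {i}) \<subseteq> S" using mult.prems by auto
      then show ?thesis using mult.hyps by simp
    qed (use mult.hyps in simp)
  qed
qed

text \<open>Two coordinates suffice: rotate the pair (c i, c j) by a right angle and normalize. The
  sum is later the top coefficient of a Clifford product.\<close>

lemma unit_orthogonal_exists:
  fixes c :: "'n::finite \<Rightarrow> real"
  assumes "i \<in> S" "j \<in> S" "i \<noteq> j"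
  obtains w :: "real^'n" where "norm w = 1" "\<And>m. m \<notin> S \<Longrightarrow> w $ m = 0" "(\<Sum>m\<in>UNIV. w $ m * c m) = 0"
proof (cases "c i = 0")
  case True
  have "(\<Sum>m\<in>UNIV. (axis i 1 :: real^'n) $ m * c m) = (\<Sum>m\<in>UNIV. if m = i then c i else 0)"
    by (intro sum.cong) (auto simp: axis_def)
  with True show thesis by (intro that[of "axis i 1"]) (use assms in \<open>auto simp: norm_axis_1\<close>, auto simp: axis_def)
next
  case False
  define u :: "real^'n" where "u = axis i (c j) - axis j (c i)"
  have "u $ j \<noteq> 0" using False assms by (simp add: u_def axis_def)
  then have "norm u \<noteq> 0" by auto
  have "(\<Sum>m\<in>UNIV. u $ m * c m) = (\<Sum>m\<in>UNIV. if m = i then c j * c i else 0) - (\<Sum>m\<in>UNIV. if m = j then c i * c j else 0)"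
    unfolding sum_subtractf[symmetric] by (intro sum.cong) (auto simp: u_def axis_def assms(3))
  then have u0: "(\<Sum>m\<in>UNIV. u $ m * c m) = 0" by simp
  have "(\<Sum>m\<in>UNIV. ((1 / norm u) *\<^sub>R u) $ m * c m) = (1 / norm u) * (\<Sum>m\<in>UNIV. u $ m * c m)"
    unfolding sum_distrib_left by (intro sum.cong) (auto simp: mult_ac)
  with u0 show thesis
    by (intro that[of "(1 / norm u) *\<^sub>R u"])
      (use \<open>norm u \<noteq> 0\<close> assms in \<open>auto simp: u_def axis_def\<close>)
qed

text \<open>For the converse inclusion, let x be an even unit element in dimension 3. A unit vector
  w can be chosen such that the odd element x w has no component at S; what remains is a unit vector
  v, and x = (-v) w because w w = -1.\<close>

lemma spin_sub_card3:
  fixes S :: "'n::{finite,linorder} set"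
  assumes "card S = 3"
  shows "spin_sub S = coord_sphere {T. T \<subseteq> S \<and> even (card T)}"
proof (intro equalityI subsetI)
  fix x assume x: "x \<in> spin_sub S"
  then have xs: "x \<in> pin_sub S" "cl_grade_involution x = x" "x \<in> pin_set"
    by (auto simp: spin_sub_def spin_set_def)
  have "x $ T = 0" if "odd (card T)" for T
  proof -
    have "(- 1) ^ card T * x $ T = x $ T"
      using arg_cong[OF xs(2), of "\<lambda>y. y $ T"] by (simp add: cl_grade_involution_def)
    then show ?thesis using that by simp
  qed
  then show "x \<in> coord_sphere {T. T \<subseteq> S \<and> even (card T)}"
    using pin_sub_support[OF xs(1)] norm_pin[OF xs(3)] by (auto simp: coord_sphere_def)
next
  fix x assume x: "x \<in> coord_sphere {T. T \<subseteq> S \<and> even (card T)}"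
  then have nx: "norm x = 1" and x0: "\<And>T. \<not> (T \<subseteq> S \<and> even (card T)) \<Longrightarrow> x $ T = 0"
    by (auto simp: coord_sphere_def)
  obtain i j where ij: "i \<in> S" "j \<in> S" "i \<noteq> j"
    using assms by (metis card_2_iff' card_3_iff insertCI)
  \<comment> \<open>The sum is the coefficient at S of x w, by
    \<open>cl_nth_mult_vec\<close>.\<close>
  obtain w where w: "norm w = 1" "\<And>m. m \<notin> S \<Longrightarrow> w $ m = 0"
    "(\<Sum>m\<in>UNIV. w $ m * (cl_sign (({m} - S) \<union> (S - {m})) {m} * x $ (({m} - S) \<union> (S - {m})))) = 0"
    using unit_orthogonal_exists[OF ij, of "\<lambda>m. cl_sign (({m} - S) \<union> (S - {m})) {m} * x $ (({m} - S) \<union> (S - {m}))"]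
    by blast
  define y where "y = x \<star> cl_vec w"
  have yS: "y $ S = 0" using w(3) by (simp add: y_def cl_nth_mult_vec)
  have y0: "y $ T = 0" if "\<nexists>m. m \<in> S \<and> T = {m}" for T
  proof (cases "T = S")
    case False
    show ?thesis
      unfolding y_def cl_nth_mult_vec
    proof (intro sum.neutral ballI)
      fix m
      let ?U = "({m} - T) \<union> (T - {m})"
      have "\<not> (?U \<subseteq> S \<and> even (card ?U))" if "m \<in> S"
      proof
        assume U: "?U \<subseteq> S \<and> even (card ?U)"
        then have TS: "T \<subset> S" using that False by blast
        then have c: "card T < 3" using assms psubset_card_mono[of S T] by simp
        have "odd (card T)"
        proof (cases "m \<in> T")
          case True
          then have "?U = T - {m}" by blast
          moreover have "card T \<ge> 1" using True card_gt_0_iff[of T] finite[of T] by (metis One_nat_def Suc_leI empty_iff)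
          ultimately show ?thesis using U True by (auto simp: card_Diff_singleton)
        next
          case f: False
          then have "?U = insert m T" by blast
          then show ?thesis using U f by simp
        qed
        with c have "card T = 1" by presburger
        then obtain m' where "T = {m'}" by (rule card_1_singletonE)
        with TS \<open>\<nexists>m. m \<in> S \<and> T = {m}\<close> show False by auto
      qed
      then show "w $ m * (cl_sign ?U {m} * x $ ?U) = 0"
        using w(2)[of m] x0[of ?U] by (cases "m \<in> S") auto
    qed
  qed (use yS in simp)
  define v where "v = (\<chi> m. y $ {m})"
  have yv: "y = cl_vec v"
  proof (subst vec_eq_iff, intro allI)
    fix T
    show "y $ T = cl_vec v $ T"
    proof (cases "\<exists>m. T = {m}")
      case True
      then show ?thesis by (auto simp: v_def)
    next
      case False
      then have "cl_vec v $ T = 0" by (auto simp: cl_vec_nth intro!: sum.neutral)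
      then show ?thesis using y0[of T] False by auto
    qed
  qed
  have "norm y = 1" using nx w(1) by (simp add: y_def norm_mult_cl_vec)
  moreover have nv: "norm (cl_vec v) = norm v" for v :: "(real, 'n) vec"
  proof -
    have "(norm (cl_vec v))\<^sup>2 = (norm v)\<^sup>2"
    proof (cases "v = 0")
      case False
      define u where "u = (1 / norm v) *\<^sub>R v"
      have u: "norm u = 1" using False by (simp add: u_def)
      have "norm (cl_vec u) = 1" by (rule norm_pin[OF pin_vec[OF u]])
      then show ?thesis using False by (simp add: u_def field_simps)
    qed simp
    then show ?thesis by simp
  qed
  ultimately have v1: "norm v = 1" using yv by simp
  have v0: "v $ m = 0" if "m \<notin> S" for m
    using y0[of "{m}"] that by (auto simp: v_def)
  have "x = cl_vec (- v) \<star> cl_vec w"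
  proof -
    have "cl_vec v \<star> cl_vec w = x \<star> (cl_vec w \<star> cl_vec w)"
      using yv by (simp add: y_def flip: cl_assoc)
    then show ?thesis using w(1) by (simp add: cl_vec_mult_self cl.minus_left cl.minus_right)
  qed
  moreover have "cl_vec (- v) \<star> cl_vec w \<in> pin_sub S"
    by (intro pin_sub_mult pin_sub_vec) (use v0 v1 w in auto)
  moreover have "cl_vec (- v) \<star> cl_vec w \<in> spin_set"
    using v1 w(1) spin_vec[of "-v"] spin_vec[of w] by (subst spin_mult_iff) (auto simp: pin_vec simp del: cl_vec_simps)
  ultimately show "x \<in> spin_sub S" by (simp add: spin_sub_def)
qed

lemma disc_extensible_spin_sub3:
  fixes S :: "'n::{finite,linorder} set"
  assumes "card S = 3"
  shows "disc_extensible (spin_sub S)"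
  unfolding spin_sub_card3[OF assms]
proof (rule disc_extensible_coord_sphere)
  obtain i j k where S: "S = {i, j, k}" "i \<noteq> j" "j \<noteq> k" "i \<noteq> k"
    using assms by (metis card_3_iff)
  \<comment> \<open>Three of the four even subsets of S are enough for the bound.\<close>
  have "card {{}, {i, j}, {i, k}} = 3" using S by (auto simp: doubleton_eq_iff)
  moreover have "{{}, {i, j}, {i, k}} \<subseteq> {T. T \<subseteq> S \<and> even (card T)}"
    using S by auto
  ultimately show "3 \<le> card {T. T \<subseteq> S \<and> even (card T)}"
    using card_mono[of "{T. T \<subseteq> S \<and> even (card T)}" "{{}, {i, j}, {i, k}}"] by simp
qed

text \<open>The mirror is the perpendicular bisector of the two unit vectors.\<close>

lemma hrefl_move:
  fixes x a :: "real^'n"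
  assumes "norm x = 1" "norm a = 1" "x \<noteq> a"
  defines "v \<equiv> (1 / norm (x - a)) *\<^sub>R (x - a)"
  shows "norm v = 1" "hrefl v a = x"
proof -
  have n0: "norm (x - a) \<noteq> 0" using assms(3) by simp
  then show "norm v = 1" by (simp add: v_def)
  have "(norm (x - a))\<^sup>2 = (x - a) \<bullet> (x - a)" by (rule power2_norm_eq_inner)
  also have "\<dots> = - (2 * ((x - a) \<bullet> a))"
    using assms(1,2) by (simp add: inner_diff_left inner_diff_right norm_eq_1 inner_commute)
  finally have "2 * ((x - a) \<bullet> a) = - (norm (x - a))\<^sup>2" by simp
  moreover have "v \<bullet> a = ((x - a) \<bullet> a) / norm (x - a)" by (simp add: v_def)
  ultimately have "2 * (v \<bullet> a) * (1 / norm (x - a)) = - 1"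
    using n0 by (simp add: power2_eq_square)
  then have "(2 * (v \<bullet> a)) *\<^sub>R v = - (x - a)"
    by (simp add: v_def)
  then show "hrefl v a = x" by (simp add: hrefl_def)
qed

section \<open>The fibration of a Spin group over the sphere\<close>

lemma twisted_adj_continuous: "continuous_on A (\<lambda>p. twisted_adj p w)"
  unfolding twisted_adj_def
  by (intro continuous_intros cl.continuous_on cl_conj_continuous cl_grade_continuous)

lemma pin_sub_fixes_outside:
  assumes "p \<in> pin_sub S" "i \<notin> S"
  shows "twisted_adj p (axis i 1) = axis i 1"
  using assms(1)
proof induct
  case (mult v x)
  then show ?case
    using assms(2) pin_sub_subset[of S]
    by (auto simp: twisted_adj_mult pin_vec twisted_adj_vec hrefl_def inner_axis)
qed simp

lemma pin_sub_outside_component: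
  assumes "p \<in> pin_sub S" "i \<notin> S"
  shows "twisted_adj p w $ i = w $ i"
proof -
  have "twisted_adj p w \<bullet> twisted_adj p (axis i 1) = w \<bullet> axis i 1"
    using assms(1) pin_sub_subset by (intro twisted_adj_inner) auto
  then show ?thesis by (simp add: pin_sub_fixes_outside[OF assms] inner_axis)
qed

lemma pin_sub_minus: "p \<in> pin_sub S \<Longrightarrow> S \<noteq> {} \<Longrightarrow> - p \<in> pin_sub S"
proof -
  assume p: "p \<in> pin_sub S" and "S \<noteq> {}"
  then obtain i where "i \<in> S" by blast
  then have "cl_vec (axis i 1) \<star> (cl_vec (axis i 1) \<star> p) \<in> pin_sub S"
    using p by (intro pin_sub.mult) (auto simp: axis_def norm_axis_1[unfolded axis_def])
  then show ?thesis by (simp add: cl_vec_unit_left norm_axis_1)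
qed

text \<open>The matrix of p fixes all axes outside S, so the factorization into reflections produces
  an element of the smaller group with the same matrix. It agrees with p up to sign, and the smaller
  group contains the sign.\<close>

lemma pin_sub_stabilizer:
  fixes S :: "'n::{finite,linorder} set"
  assumes "p \<in> pin_sub (insert n S)" "twisted_adj p (axis n 1) = axis n 1" "S \<noteq> {}"
  shows "p \<in> pin_sub S"
proof -
  have p: "p \<in> pin_set" using assms(1) pin_sub_subset by auto
  have "\<exists>q\<in>pin_sub S \<inter> pin_words (card S). pin_to_O q = pin_to_O p"
  proof (rule pin_sub_insert_repr[OF finite orthogonal_pin_to_O[OF p]])
    show "pin_to_O p *v axis i 1 = axis i 1" if "i \<notin> S" for i
      using that assms(2) pin_sub_fixes_outside[OF assms(1), of i] pin_to_O_apply[OF p] by (cases "i = n") auto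
  qed
  then obtain q where q: "q \<in> pin_sub S" "pin_to_O q = pin_to_O p" by blast
  then have "p = q \<or> p = - q" using pin_to_O_eq_iff[of q p] p pin_sub_subset by blast
  then show ?thesis using q pin_sub_minus[OF _ assms(3)] by auto
qed

lemma spin_sub_mult: "p \<in> spin_sub S \<Longrightarrow> q \<in> spin_sub S \<Longrightarrow> p \<star> q \<in> spin_sub S"
  using pin_sub_subset[of S] spin_mult_iff[of p q] by (auto simp: spin_sub_def pin_sub_mult)

lemma spin_sub_conj: "p \<in> spin_sub S \<Longrightarrow> cl_conj p \<in> spin_sub S"
  using pin_sub_subset[of S] pin_sub_conj[of p S] spin_mult_iff[of "cl_conj p" p] spin_one
  by (auto simp: spin_sub_def pin_conj_closed subset_iff)

lemma spin_sub_mono: "S \<subseteq> T \<Longrightarrow> spin_sub S \<subseteq> spin_sub T"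
  using pin_sub_mono by (auto simp: spin_sub_def)

lemma spin_sub_pin: "p \<in> spin_sub S \<Longrightarrow> p \<in> pin_set"
  using pin_sub_subset by (auto simp: spin_sub_def)

lemma spin_sub_vec2:
  assumes "norm v = 1" "norm w = 1" "\<And>i. i \<notin> S \<Longrightarrow> v $ i = 0" "\<And>i. i \<notin> S \<Longrightarrow> w $ i = 0"
  shows "cl_vec v \<star> cl_vec w \<in> spin_sub S"
  using assms by (auto simp: spin_sub_def spin_mult_iff pin_vec spin_vec intro!: pin_sub_mult pin_sub_vec)

text \<open>The projection is the orbit map of \<open>e_n\<close>, with the stabilizer as structure
  group. Local sections are products of two unit vectors, so that they are even.\<close>

lemma fibred_spin:
  fixes S :: "'n::{finite,linorder} set"
  assumes n: "n \<notin> S" and S: "S \<noteq> {}"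
  shows "fibred (top_of_set (spin_sub (insert n S))) (top_of_set (coord_sphere (insert n S)))
     (top_of_set (spin_sub S)) (\<lambda>p. twisted_adj p (axis n 1)) (\<star>) (\<lambda>p q. cl_conj p \<star> q)"
proof
  let ?e = "axis n 1 :: (real, 'n) vec" and ?S = "insert n S"
  have sub: "spin_sub S \<subseteq> spin_sub ?S" by (rule spin_sub_mono) auto
  have e0: "?e $ i = 0" if "i \<notin> ?S" for i using that by (simp add: axis_def)
  have sph: "twisted_adj p ?e \<in> coord_sphere ?S" if "p \<in> spin_sub ?S" for p
  proof -
    have "norm (twisted_adj p ?e) = 1"
      using twisted_adj_inner[OF spin_sub_pin[OF that], of ?e ?e] by (simp add: norm_eq_1 inner_axis_axis)
    then show ?thesis
      using that e0 pin_sub_outside_component[of p ?S _ ?e] by (auto simp: coord_sphere_def spin_sub_def)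
  qed
  then show "continuous_map (top_of_set (spin_sub ?S)) (top_of_set (coord_sphere ?S)) (\<lambda>p. twisted_adj p ?e)"
    by (auto simp: twisted_adj_continuous)
  have "continuous_on (spin_sub ?S \<times> spin_sub S) (\<lambda>x. fst x \<star> snd x)"
    by (intro cl.continuous_on continuous_intros)
  then show "continuous_map (prod_topology (top_of_set (spin_sub ?S)) (top_of_set (spin_sub S)))
     (top_of_set (spin_sub ?S)) (\<lambda>(e, a). e \<star> a)"
    using spin_sub_mult[of _ ?S] sub by (auto simp: prod_topology_subtopology_eu case_prod_unfold)
  show "twisted_adj (p \<star> a) ?e = twisted_adj p ?e"
    if "p \<in> topspace (top_of_set (spin_sub ?S))" "a \<in> topspace (top_of_set (spin_sub S))" for p a
    using that n pin_sub_fixes_outside[of a S n] spin_sub_pin[of p] spin_sub_pin[of a]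
    by (auto simp: twisted_adj_mult spin_sub_def)
  show "p \<star> (cl_conj p \<star> q) = q"
    if "p \<in> topspace (top_of_set (spin_sub ?S))" for p q
    using that spin_sub_pin[of p ?S] by simp
  have dvS: "cl_conj p \<star> q \<in> spin_sub S"
    if p: "p \<in> spin_sub ?S" and q: "q \<in> spin_sub ?S" and eq: "twisted_adj p ?e = twisted_adj q ?e" for p q
  proof -
    have pp: "p \<in> pin_set" "q \<in> pin_set" using p q spin_sub_pin[of _ ?S] by blast+
    have r: "cl_conj p \<star> q \<in> spin_sub ?S" using p q by (intro spin_sub_mult spin_sub_conj)
    have "twisted_adj (cl_conj p \<star> q) ?e = twisted_adj (cl_conj p \<star> p) ?e"
      using pp eq by (simp add: twisted_adj_mult pin_conj_closed del: pin_conj_left)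
    also have "\<dots> = ?e" using pp by simp
    finally have "twisted_adj (cl_conj p \<star> q) ?e = ?e" .
    from pin_sub_stabilizer[OF _ this S] have "cl_conj p \<star> q \<in> pin_sub S"
      using r by (simp add: spin_sub_def)
    then show ?thesis using r by (simp add: spin_sub_def)
  qed
  have "continuous_on (spin_sub ?S \<times> spin_sub ?S) (\<lambda>x. cl_conj (fst x) \<star> snd x)"
    by (intro cl.continuous_on continuous_intros continuous_on_compose2[OF cl_conj_continuous[of UNIV]]) auto
  then have dvc: "continuous_map (prod_topology (top_of_set (spin_sub ?S)) (top_of_set (spin_sub ?S)))
      euclidean (\<lambda>x. cl_conj (fst x) \<star> snd x)"
    by (simp add: prod_topology_subtopology_eu)
  show "continuous_map (subtopology (prod_topology (top_of_set (spin_sub ?S)) (top_of_set (spin_sub ?S)))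
      {(p, q). twisted_adj p ?e = twisted_adj q ?e}) (top_of_set (spin_sub S)) (\<lambda>(p, q). cl_conj p \<star> q)"
    unfolding case_prod_unfold
    by (intro continuous_map_into_subtopology continuous_map_from_subtopology[OF dvc]) (auto intro: dvS)
  fix x assume "x \<in> topspace (top_of_set (coord_sphere ?S))"
  then have nx: "norm x = 1" and x0: "\<And>i. i \<notin> ?S \<Longrightarrow> x $ i = 0" by (auto simp: coord_sphere_def)
  have loc: "\<exists>W s. openin (top_of_set (coord_sphere ?S)) W \<and> x \<in> W \<and>
     continuous_map (subtopology (top_of_set (coord_sphere ?S)) W) (top_of_set (spin_sub ?S)) s \<and>
     (\<forall>y\<in>W. twisted_adj (s y) ?e = y)"
    if k: "norm k = 1" "\<And>i. i \<notin> ?S \<Longrightarrow> k $ i = 0" and a: "hrefl k ?e = a" and xa: "x \<noteq> a" for k a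
  proof -
    let ?W = "coord_sphere ?S - {a}"
    \<comment> \<open>The factor \<open>k\<close> moves \<open>e_n\<close> to a, and the reflection
      along y - a moves a to y. This is defined as long as y differs from a.\<close>
    define s where "s y = cl_vec ((1 / norm (y - a)) *\<^sub>R (y - a)) \<star> cl_vec k" for y
    have na: "norm a = 1"
      using hrefl_inner[OF k(1), of ?e ?e] by (simp add: a norm_eq_1 inner_axis_axis)
    have a0: "a $ i = 0" if "i \<notin> ?S" for i
      using k(2)[OF that] e0[OF that] by (simp add: hrefl_def flip: a)
    have W: "norm y = 1" "y \<noteq> a" "\<And>i. i \<notin> ?S \<Longrightarrow> y $ i = 0" if "y \<in> ?W" for y
      using that by (auto simp: coord_sphere_def)
    note mv = hrefl_move[OF W(1) na W(2)]
    have 1: "openin (top_of_set (coord_sphere ?S)) ?W" by (simp add: openin_delete)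
    have 2: "x \<in> ?W" using nx x0 xa by (auto simp: coord_sphere_def)
    have "continuous_on ?W s"
      unfolding s_def by (intro cl.continuous_on bounded_linear.continuous_on[OF bounded_linear_cl_vec]
          continuous_intros) auto
    moreover have "s y \<in> spin_sub ?S" if "y \<in> ?W" for y
      unfolding s_def using mv(1)[OF that that] k W(3)[OF that] a0 by (intro spin_sub_vec2) auto
    ultimately have 3: "continuous_map (subtopology (top_of_set (coord_sphere ?S)) ?W) (top_of_set (spin_sub ?S)) s"
      by (auto simp: subtopology_subtopology Int_absorb1)
    have 4: "twisted_adj (s y) ?e = y" if "y \<in> ?W" for y
      unfolding s_def using mv[OF that that] k(1) by (simp add: twisted_adj_mult pin_vec twisted_adj_vec a del: cl_vec_simps)
    show ?thesis using 1 2 3 4 by blast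
  qed
  show "\<exists>W s. openin (top_of_set (coord_sphere ?S)) W \<and> x \<in> W \<and>
     continuous_map (subtopology (top_of_set (coord_sphere ?S)) W) (top_of_set (spin_sub ?S)) s \<and>
     (\<forall>y\<in>W. twisted_adj (s y) ?e = y)"
  proof (cases "x = ?e")
    case True
    have "hrefl ?e ?e = - ?e" by (simp add: hrefl_def inner_axis_axis scaleR_2)
    moreover have "?e \<noteq> - ?e" by (simp add: vec_eq_iff axis_def)
    ultimately show ?thesis using loc[of ?e "- ?e"] e0 True by (auto simp: norm_axis_1)
  next
    case False
    obtain j where "j \<in> S" using S by blast
    then have "hrefl (axis j 1) ?e = ?e" using n by (auto simp: hrefl_def inner_axis_axis)
    moreover have "axis j (1::real) $ i = 0" if "i \<notin> ?S" for i
      using that \<open>j \<in> S\<close> by (auto simp: axis_def)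
    ultimately show ?thesis using loc[of "axis j 1" ?e] False by (simp add: norm_axis_1)
  qed
qed

text \<open>A loop is projected to the sphere, extended over the disc there and lifted back. On the
  circle the lift differs from the loop by a loop in the fibre, whose extension over the disc
  corrects the lift.\<close>

lemma disc_extensible_spin_step:
  fixes S :: "'n::{finite,linorder} set"
  assumes n: "n \<notin> S" and S: "card S \<ge> 2" and ext: "disc_extensible (spin_sub S)"
  shows "disc_extensible (spin_sub (insert n S))"
  unfolding disc_extensible_def
proof (intro allI impI)
  let ?S = "insert n S" and ?p = "\<lambda>p. twisted_adj p (axis n 1) :: (real, 'n) vec"
  have "S \<noteq> {}" using S by auto
  then interpret fibred "top_of_set (spin_sub ?S)" "top_of_set (coord_sphere ?S)"
     "top_of_set (spin_sub S)" ?p "(\<star>)" "\<lambda>p q. cl_conj p \<star> q"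
    by (rule fibred_spin[OF n])
  fix f :: "complex \<Rightarrow> 'n clifford"
  assume f: "continuous_on (sphere 0 1) f \<and> f ` sphere 0 1 \<subseteq> spin_sub ?S"
  then have fm: "continuous_map (top_of_set (sphere 0 1)) (top_of_set (spin_sub ?S)) f" by auto
  have "continuous_map (top_of_set (sphere 0 1)) (top_of_set (coord_sphere ?S)) (?p \<circ> f)"
    by (rule continuous_map_compose[OF fm prj_cont])
  moreover have "card ?S \<ge> 3" using S n by simp
  ultimately obtain g where g: "continuous_map (top_of_set (cball 0 1)) (top_of_set (coord_sphere ?S)) g"
    "\<And>x. x \<in> sphere 0 1 \<Longrightarrow> g x = ?p (f x)"
    using disc_extensibleE[OF disc_extensible_coord_sphere] by (metis (no_types, lifting) comp_apply)
  then obtain L where L: "continuous_map (top_of_set (cball 0 1)) (top_of_set (spin_sub ?S)) L"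
    "\<And>y. y \<in> cball 0 1 \<Longrightarrow> ?p (L y) = g y"
    using lift_exists[OF compact_cball convex_cball g(1)] by blast
  have Ls: "continuous_map (top_of_set (sphere 0 1)) (top_of_set (spin_sub ?S)) L"
    using L(1) by (rule continuous_map_from_subtopology_mono) auto
  have "continuous_map (top_of_set (sphere 0 1)) (top_of_set (spin_sub S)) (\<lambda>y. cl_conj (L y) \<star> f y)"
    by (rule dv_continuous[OF Ls fm]) (use L(2) g(2) in auto)
  from disc_extensibleE[OF ext this] obtain D where
    Dm: "continuous_map (top_of_set (cball 0 1)) (top_of_set (spin_sub S)) D"
    and D: "\<And>x. x \<in> sphere 0 1 \<Longrightarrow> D x = cl_conj (L x) \<star> f x" by blast
  have F: "continuous_map (top_of_set (cball 0 1)) (top_of_set (spin_sub ?S)) (\<lambda>y. L y \<star> D y)"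
    by (rule act_continuous[OF L(1) Dm])
  have "L x \<star> D x = f x" if "x \<in> sphere 0 1" for x
  proof -
    have "L x \<in> spin_sub ?S" using L(1) that by (auto simp: Pi_iff)
    then show ?thesis using D[OF that] spin_sub_pin[of "L x" ?S] by simp
  qed
  with F show "\<exists>F. continuous_on (cball 0 1) F \<and> F ` cball 0 1 \<subseteq> spin_sub ?S \<and> (\<forall>x\<in>sphere 0 1. F x = f x)"
    by (intro exI[of _ "\<lambda>y. L y \<star> D y"]) auto
qed

text \<open>The induction starts at \<open>Spin(3) = S\<^sup>3\<close> and uses the fibrations of \<open>Spin(k + 1)\<close> over \<open>S\<^sup>k\<close>
  with fibre \<open>Spin(k)\<close>.\<close>

lemma disc_extensible_spin_sub:
  fixes S :: "'n::{finite,linorder} set"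
  assumes "card S \<ge> 3"
  shows "disc_extensible (spin_sub S)"
proof -
  have "disc_extensible (spin_sub S)" if "card S = k + 3" for k and S :: "'n set"
    using that
  proof (induct k arbitrary: S)
    case 0
    then show ?case using disc_extensible_spin_sub3 by simp
  next
    case (Suc k)
    then obtain n T where "S = insert n T" "n \<notin> T" "card T = k + 3"
      by (metis add_Suc card_Suc_eq)
    then show ?case using disc_extensible_spin_step[of n T] Suc.hyps[of T] by auto
  qed
  from this[of S "card S - 3"] assms show ?thesis by simp
qed

lemma spin_sub_UNIV: "spin_sub UNIV = spin_set"
  using spin_subset by (auto simp: spin_sub_def pin_sub_UNIV)

lemma disc_extensible_spin:
  "CARD('n::{finite,linorder}) \<ge> 3 \<Longrightarrow> disc_extensible (spin_set :: 'n clifford set)"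
  using disc_extensible_spin_sub[of "UNIV :: 'n set"] by (simp add: spin_sub_UNIV)

text \<open>Induction over words passes through odd elements, which cannot be joined to 1 inside
  Spin(n). For these the claim is made after multiplication by an arbitrary unit vector.\<close>

lemma spin_path_component:
  fixes p :: "'n::{finite,linorder} clifford"
  assumes dim: "CARD('n) \<ge> 2" and p: "p \<in> pin_set"
  shows "(p \<in> spin_set \<longrightarrow> path_component spin_set cl_one p) \<and>
     (p \<notin> spin_set \<longrightarrow> (\<forall>w. norm w = 1 \<longrightarrow> path_component spin_set cl_one (cl_vec w \<star> p)))"
  using p
proof induct
  case one
  then show ?case using spin_one by (auto intro: path_component_refl)
next
  case (mult v x)
  have px: "cl_vec v \<star> x \<in> spin_set \<longleftrightarrow> x \<notin> spin_set"
    using mult by (simp add: spin_mult_iff pin_vec spin_vec)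
  have "path_component spin_set cl_one (cl_vec w \<star> (cl_vec v \<star> x))" if x: "x \<in> spin_set" and w: "norm w = 1" for w
  proof -
    have "path_connected (sphere (0::(real,'n) vec) 1)"
      using dim by (intro path_connected_sphere) simp
    then obtain \<gamma> where \<gamma>: "path \<gamma>" "path_image \<gamma> \<subseteq> sphere 0 1" "pathstart \<gamma> = - v" "pathfinish \<gamma> = w"
      using w mult.hyps(1) unfolding path_connected_def by (metis dist_0_norm mem_sphere norm_minus_cancel)
    \<comment> \<open>Moving the first vector along the sphere from -v to w deforms (-v) v x = x
      into w v x.\<close>
    have "path_component spin_set (cl_vec (- v) \<star> (cl_vec v \<star> x)) (cl_vec w \<star> (cl_vec v \<star> x))"
      unfolding path_component_def
    proof (intro exI[of _ "\<lambda>t. cl_vec (\<gamma> t) \<star> (cl_vec v \<star> x)"] conjI)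
      show "path (\<lambda>t. cl_vec (\<gamma> t) \<star> (cl_vec v \<star> x))"
        unfolding path_def
        by (intro cl.continuous_on bounded_linear.continuous_on[OF bounded_linear_cl_vec] continuous_intros
            \<gamma>(1)[unfolded path_def])
      have "norm (\<gamma> t) = 1" if "t \<in> {0..1}" for t
        using \<gamma>(2) that by (auto simp: path_image_def image_subset_iff)
      then show "path_image (\<lambda>t. cl_vec (\<gamma> t) \<star> (cl_vec v \<star> x)) \<subseteq> spin_set"
        using px x mult by (auto simp: path_image_def spin_mult_iff pin_vec spin_vec pin_mult)
    qed (use \<gamma>(3,4) in \<open>auto simp: pathstart_def pathfinish_def\<close>)
    moreover have "cl_vec (- v) \<star> (cl_vec v \<star> x) = x"
      using mult by (simp add: cl.minus_left cl_vec_unit_left)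
    ultimately show ?thesis using x mult.hyps by (auto intro: path_component_trans)
  qed
  then show ?case using px mult by blast
qed

lemma path_connected_spin:
  "CARD('n::{finite,linorder}) \<ge> 2 \<Longrightarrow> path_connected (spin_set :: 'n clifford set)"
  using spin_path_component spin_subset unfolding path_connected_component
  by (meson path_component_sym path_component_trans subsetD)

section \<open>Lifts along the covering Pin(n) -> PO(n)\<close>

context even_dim
begin

lemma fibred_pin:
  "fibred (top_of_set (pin_set :: 'n clifford set)) PO_topology (top_of_set pi1_elems) pin_to_PO (\<star>)
     (\<lambda>p q. cl_conj p \<star> q)"
proof
  show "continuous_map (top_of_set pin_set) PO_topology (pin_to_PO :: 'n clifford \<Rightarrow> _)"
    by (rule continuous_pin_to_PO)
  have "continuous_on (pin_set \<times> pi1_elems) (\<lambda>x :: 'n clifford \<times> 'n clifford. fst x \<star> snd x)"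
    by (intro cl.continuous_on continuous_intros)
  then show "continuous_map (prod_topology (top_of_set pin_set) (top_of_set pi1_elems))
      (top_of_set pin_set) (\<lambda>(e, a). e \<star> (a :: 'n clifford))"
    by (auto simp: prod_topology_subtopology_eu case_prod_unfold intro!: pin_mult
        dest: subsetD[OF pi1_elems_pin])
  fix p q :: "'n clifford"
  show "pin_to_PO (p \<star> q) = pin_to_PO p"
    if "p \<in> topspace (top_of_set pin_set)" "q \<in> topspace (top_of_set pi1_elems)"
    using that pin_to_PO_eq_iff[of p "p \<star> q"] pi1_elems_pin pin_mult[of p q] by auto
  show "p \<star> (cl_conj p \<star> q) = q" if "p \<in> topspace (top_of_set pin_set)"
    using that by simp
next
  have "continuous_on (pin_set \<times> pin_set) (\<lambda>x :: 'n clifford \<times> 'n clifford. cl_conj (fst x) \<star> snd x)"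
    by (intro cl.continuous_on continuous_intros continuous_on_compose2[OF cl_conj_continuous[of UNIV]]) auto
  then have dvc: "continuous_map (prod_topology (top_of_set pin_set) (top_of_set pin_set))
      euclidean (\<lambda>x :: 'n clifford \<times> 'n clifford. cl_conj (fst x) \<star> snd x)"
    by (simp add: prod_topology_subtopology_eu)
  have "cl_conj p \<star> q \<in> pi1_elems" if "p \<in> pin_set" "q \<in> pin_set" "pin_to_PO p = pin_to_PO q" for p q :: "'n clifford"
    using that pin_to_PO_eq_iff[of p q] by auto
  then show "continuous_map (subtopology (prod_topology (top_of_set pin_set) (top_of_set pin_set))
      {(p, q). pin_to_PO p = pin_to_PO q}) (top_of_set pi1_elems) (\<lambda>(p, q). cl_conj p \<star> (q :: 'n clifford))"
    unfolding case_prod_unfold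
    by (intro continuous_map_into_subtopology continuous_map_from_subtopology[OF dvc]) auto
next
  fix x :: "'n sq_matrix set" assume "x \<in> topspace PO_topology"
  then have "x \<in> carrier PO" by (simp add: topspace_PO)
  from PO_local_section[OF this] show "\<exists>W s. openin PO_topology W \<and> x \<in> W \<and>
      continuous_map (subtopology PO_topology W) (top_of_set (pin_set :: 'n clifford set)) s \<and>
      (\<forall>y\<in>W. pin_to_PO (s y) = y)"
    by metis
qed

sublocale pin: fibred "top_of_set (pin_set :: 'n clifford set)" PO_topology "top_of_set pi1_elems"
    pin_to_PO "(\<star>)" "\<lambda>p q. cl_conj p \<star> q"
  by (rule fibred_pin)

text \<open>The quotient of two lifts is a continuous map from a connected set to the four kernel
  elements.\<close>

lemma pin_lift_unique:
  fixes F F' :: "'a::topological_space \<Rightarrow> 'n clifford"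
  assumes A: "connected A" and F: "continuous_map (top_of_set A) (top_of_set pin_set) F"
    and F': "continuous_map (top_of_set A) (top_of_set pin_set) F'"
    and eq: "\<And>x. x \<in> A \<Longrightarrow> pin_to_PO (F x) = pin_to_PO (F' x)"
  obtains z where "z \<in> pi1_elems" "\<And>x. x \<in> A \<Longrightarrow> F' x = F x \<star> z"
proof (cases "A = {}")
  case True
  then show thesis using that[of cl_one] by (auto simp: pi1_elems_def)
next
  case False
  have d: "continuous_map (top_of_set A) (top_of_set pi1_elems) (\<lambda>x. cl_conj (F x) \<star> F' x)"
    by (rule pin.dv_continuous[OF F F']) (use eq in auto)
  then have c: "continuous_on A (\<lambda>x. cl_conj (F x) \<star> F' x)"
    and im: "(\<lambda>x. cl_conj (F x) \<star> F' x) ` A \<subseteq> pi1_elems" by auto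
  have "finite (pi1_elems :: 'n clifford set)" by (simp add: pi1_elems_def)
  then have fin: "finite ((\<lambda>x. cl_conj (F x) \<star> F' x) ` A)" using im finite_subset by blast
  have "(\<lambda>x. cl_conj (F x) \<star> F' x) constant_on A"
  proof (cases "\<exists>z. (\<lambda>x. cl_conj (F x) \<star> F' x) ` A = {z}")
    case False
    have "connected ((\<lambda>x. cl_conj (F x) \<star> F' x) ` A)" by (rule connected_continuous_image[OF c A])
    then have "(\<lambda>x. cl_conj (F x) \<star> F' x) ` A = {} \<or> (\<exists>z. (\<lambda>x. cl_conj (F x) \<star> F' x) ` A = {z})"
      using fin connected_finite_iff_sing by blast
    with False \<open>A \<noteq> {}\<close> show ?thesis by auto
  qed (auto simp: constant_on_def image_def)
  then obtain z where z: "\<And>x. x \<in> A \<Longrightarrow> cl_conj (F x) \<star> F' x = z" by (auto simp: constant_on_def)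
  have "F x \<in> pin_set" if "x \<in> A" for x using F that by auto
  then have "F' x = F x \<star> z" if "x \<in> A" for x using z[OF that] that by (metis pin_conj_right')
  moreover have "z \<in> pi1_elems" using False im z by auto
  ultimately show thesis using that by blast
qed

text \<open>Lifts p and q of the two points have the same parity, so
  \<open>q \<star> cl_conj p\<close> is joined to 1 in Spin(n); the path is multiplied by p and
  projected.\<close>

lemma PO_path_exists:
  assumes "a \<in> carrier (PO :: 'n sq_matrix set monoid)" "b \<in> carrier PO" "a \<in> PSO \<longleftrightarrow> b \<in> PSO"
  obtains c where "continuous_map (top_of_set {0..1::real}) PO_topology c" "c 0 = a" "c 1 = b"
proof -
  obtain p :: "'n clifford" where p: "p \<in> pin_set" "pin_to_PO p = a" using assms(1) by (rule PO_pinE)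
  obtain q :: "'n clifford" where q: "q \<in> pin_set" "pin_to_PO q = b" using assms(2) by (rule PO_pinE)
  have "q \<star> cl_conj p \<in> spin_set \<longleftrightarrow> cl_conj p \<star> p \<in> spin_set"
    using p q assms(3) PSO_pin_iff by (simp add: spin_mult_iff pin_conj_closed del: pin_conj_left) blast
  then have r: "q \<star> cl_conj p \<in> spin_set" using p spin_one by simp
  have "path_connected (spin_set :: 'n clifford set)" using dim_ge by (intro path_connected_spin) simp
  then obtain \<gamma> where \<gamma>: "path \<gamma>" "path_image \<gamma> \<subseteq> spin_set" "\<gamma> 0 = cl_one" "\<gamma> 1 = q \<star> cl_conj p"
    using r spin_one unfolding path_connected_def pathstart_def pathfinish_def by metis
  have "continuous_on {0..1} (\<lambda>t. \<gamma> t \<star> p)"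
    by (intro cl.continuous_on continuous_intros \<gamma>(1)[unfolded path_def])
  moreover have "\<gamma> t \<star> p \<in> pin_set" if "t \<in> {0..1}" for t
    using \<gamma>(2) that p
    by (auto simp: path_image_def image_subset_iff intro!: pin_mult subsetD[OF spin_subset, of "\<gamma> t"])
  ultimately have "continuous_map (top_of_set {0..1}) (top_of_set pin_set) (\<lambda>t. \<gamma> t \<star> p)" by auto
  from continuous_map_compose[OF this continuous_pin_to_PO] show thesis
    by (intro that[of "\<lambda>t. pin_to_PO (\<gamma> t \<star> p)"]) (use \<gamma> p q in \<open>auto simp: o_def cl_assoc\<close>)
qed

end

section \<open>The polygon\<close>

locale surface_polygon =
  fixes g :: nat
  assumes genus: "g \<ge> 2"
begin

definition ang :: real where "ang = 2 * pi / real (4 * g)"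

text \<open>With \<open>coefB\<close>, the coordinates of y in the real basis given by the vertices
  k and k + 1, by Cramer's rule; the determinant of this basis is \<open>sin ang\<close>.\<close>

definition coefA :: "nat \<Rightarrow> complex \<Rightarrow> real" where
  "coefA k y = - Im (cnj (cis (real (Suc k) * ang)) * y) / sin ang"

definition coefB :: "nat \<Rightarrow> complex \<Rightarrow> real" where
  "coefB k y = Im (cnj (cis (real k * ang)) * y) / sin ang"

definition sector :: "nat \<Rightarrow> complex set" where
  "sector k = {y. y \<noteq> 0 \<and> coefA k y \<ge> 0 \<and> coefB k y \<ge> 0}"

text \<open>The parameter of the point in which the ray through y meets the side k.\<close>

definition side_param :: "nat \<Rightarrow> complex \<Rightarrow> real" where
  "side_param k y = coefB k y / (coefA k y + coefB k y)"

lemma ang_bounds: "0 < ang" "ang \<le> pi / 4" "real (4 * g) * ang = 2 * pi"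
  using genus by (auto simp: ang_def field_simps)

lemma sin_ang: "sin ang > 0"
  using ang_bounds pi_gt_zero by (intro sin_gt_zero) auto

lemma vertex_eq: "polygon_vertex g k = cis (real k * ang)"
  by (simp add: polygon_vertex_def ang_def mult_ac)

lemma vertex_decomp: "y = of_real (coefA k y) * polygon_vertex g k + of_real (coefB k y) * polygon_vertex g (Suc k)"
proof -
  let ?a = "real k * ang"
  have S: "sin ang = sin (ang + ?a) * cos ?a - cos (ang + ?a) * sin ?a"
    using sin_diff[of "ang + ?a" ?a] by simp
  have e: "real (Suc k) * ang = ang + ?a" by (simp add: algebra_simps)
  have "of_real (sin ang) * y = of_real (- Im (cnj (cis (real (Suc k) * ang)) * y)) * cis ?a +
      of_real (Im (cnj (cis ?a) * y)) * cis (real (Suc k) * ang)"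
    unfolding e by (simp add: complex_eq_iff) (simp add: S algebra_simps)
  then have "y = (of_real (- Im (cnj (cis (real (Suc k) * ang)) * y)) * cis ?a +
      of_real (Im (cnj (cis ?a) * y)) * cis (real (Suc k) * ang)) / of_real (sin ang)"
    using sin_ang by (metis nonzero_mult_div_cancel_left of_real_eq_0_iff less_irrefl)
  then show ?thesis
    unfolding vertex_eq coefA_def coefB_def by (simp add: add_divide_distrib)
qed

lemma coef_linear:
  "coefA k (x + y) = coefA k x + coefA k y" "coefB k (x + y) = coefB k x + coefB k y"
  "coefA k (of_real c * y) = c * coefA k y" "coefB k (of_real c * y) = c * coefB k y"
  "coefA k 0 = 0" "coefB k 0 = 0"
  by (simp_all add: coefA_def coefB_def algebra_simps add_divide_distrib diff_divide_distrib)

lemma coef_cis: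
  "coefA k (of_real r * cis t) = r * sin (real (Suc k) * ang - t) / sin ang"
  "coefB k (of_real r * cis t) = r * sin (t - real k * ang) / sin ang"
  by (simp_all add: coefA_def coefB_def sin_diff algebra_simps)

lemma coef_vertex:
  "coefA k (polygon_vertex g k) = 1" "coefB k (polygon_vertex g k) = 0"
  "coefA k (polygon_vertex g (Suc k)) = 0" "coefB k (polygon_vertex g (Suc k)) = 1"
  using coef_cis[of k 1 "real k * ang"] coef_cis[of k 1 "real (Suc k) * ang"] sin_ang
  by (simp_all add: vertex_eq algebra_simps)

lemma side_eq: "polygon_side g k t = of_real (1 - t) * polygon_vertex g k + of_real t * polygon_vertex g (Suc k)"
  by (simp add: polygon_side_def linepath_def scaleR_conv_of_real)

lemma coef_side: "coefA k (polygon_side g k t) = 1 - t" "coefB k (polygon_side g k t) = t"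
  unfolding side_eq coef_linear coef_vertex by simp_all

lemma vertex_periodic: "polygon_vertex g (k + 4 * g) = polygon_vertex g k"
proof -
  have "real (k + 4 * g) * ang = real k * ang + 2 * pi"
    using ang_bounds(3) by (simp add: distrib_right)
  then show ?thesis unfolding vertex_eq by (simp add: complex_eq_iff)
qed

lemma vertex_4g: "polygon_vertex g (4 * g) = polygon_vertex g 0"
  using vertex_periodic[of 0] by simp

lemma side_ends: "polygon_side g k 0 = polygon_vertex g k" "polygon_side g k 1 = polygon_vertex g (Suc k)"
  by (simp_all add: side_eq)

lemma sum_coef_pos:
  assumes "y \<in> sector k"
  shows "coefA k y + coefB k y > 0"
proof -
  have "coefA k y \<noteq> 0 \<or> coefB k y \<noteq> 0"
    using vertex_decomp[of y k] assms by (auto simp: sector_def)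
  then show ?thesis using assms by (auto simp: sector_def)
qed

lemma side_in_sector: "t \<in> {0..1} \<Longrightarrow> polygon_side g k t \<in> sector k"
proof -
  assume t: "t \<in> {0..1}"
  have "polygon_side g k t \<noteq> 0"
    using coef_side[of k t] coef_linear(5,6)[of k] by force
  with t show ?thesis by (simp add: sector_def coef_side)
qed

lemma side_param_side: "side_param k (polygon_side g k t) = t"
  by (simp add: side_param_def coef_side)

lemma side_param_range: "y \<in> sector k \<Longrightarrow> side_param k y \<in> {0..1}"
  using sum_coef_pos[of y k] by (auto simp: side_param_def sector_def field_simps)

lemma polar_form:
  assumes "y \<noteq> 0"
  obtains r t where "r > 0" "0 \<le> t" "t < 2 * pi" "y = of_real r * cis t"
proof (rule that[of "norm y" "Arg2pi y"])
  show "y = of_real (norm y) * cis (Arg2pi y)"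
    by (metis Arg2pi_eq cis_conv_exp)
qed (use assms Arg2pi_ge_0 Arg2pi_lt_2pi in auto)

text \<open>Membership is a condition on two sines. The extra disjunct is due to the normalization
  of the angle: the ray at angle 0 also closes the last sector.\<close>

lemma sector_polar_iff:
  assumes r: "r > 0" and t: "0 \<le> t" "t < 2 * pi" and k: "k < 4 * g"
  shows "of_real r * cis t \<in> sector k \<longleftrightarrow>
    (real k * ang \<le> t \<and> t \<le> real (Suc k) * ang) \<or> (Suc k = 4 * g \<and> t = 0)"
proof -
  let ?x = "t - real k * ang"
  have e: "real (Suc k) * ang - t = ang - ?x" by (simp add: algebra_simps)
  have "of_real r * cis t \<in> sector k \<longleftrightarrow> sin (ang - ?x) \<ge> 0 \<and> sin ?x \<ge> 0"
    using r sin_ang unfolding sector_def by (simp add: coef_cis e zero_le_divide_iff zero_le_mult_iff del: of_nat_Suc)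
  also have "\<dots> \<longleftrightarrow> (0 \<le> ?x \<and> ?x \<le> ang) \<or> (Suc k = 4 * g \<and> t = 0)"
  proof
    assume *: "sin (ang - ?x) \<ge> 0 \<and> sin ?x \<ge> 0"
    have "real (Suc k) * ang \<le> real (4 * g) * ang"
      using k ang_bounds(1) by (intro mult_right_mono) auto
    then have k2: "real k * ang \<le> 2 * pi - ang" unfolding ang_bounds(3) by (simp add: algebra_simps)
    have kp: "0 \<le> real k * ang" using ang_bounds(1) by simp
    show "(0 \<le> ?x \<and> ?x \<le> ang) \<or> (Suc k = 4 * g \<and> t = 0)"
    proof (cases "?x \<ge> 0")
      case True
      have "?x \<le> pi"
      proof (rule ccontr)
        assume "\<not> ?x \<le> pi"
        then have "sin ?x < 0" using t kp by (intro sin_lt_zero) auto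
        with * show False by simp
      qed
      moreover have "?x \<le> ang"
      proof (rule ccontr)
        assume a: "\<not> ?x \<le> ang"
        then have "sin (?x - ang) > 0" using \<open>?x \<le> pi\<close> ang_bounds(1) by (intro sin_gt_zero) auto
        then show False using * sin_minus[of "?x - ang"] by simp
      qed
      ultimately show ?thesis using True by simp
    next
      case False
      \<comment> \<open>For negative x a full turn is added. The result is at least
        \<open>ang\<close>, and the two sines bound it from above by pi and then by
        \<open>ang\<close>; equality leaves only t = 0 in the last sector.\<close>
      have x2: "?x + 2 * pi \<ge> ang" using k2 t by linarith
      have s1: "sin (?x + 2 * pi) \<ge> 0" using * by simp
      have "?x + 2 * pi \<le> pi"
      proof (rule ccontr)
        assume "\<not> ?x + 2 * pi \<le> pi"
        then have "sin (?x + 2 * pi) < 0" using False by (intro sin_lt_zero) auto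
        with s1 show False by simp
      qed
      have "?x + 2 * pi \<le> ang"
      proof (rule ccontr)
        assume a: "\<not> ?x + 2 * pi \<le> ang"
        then have "sin (?x + 2 * pi - ang) > 0"
          using \<open>?x + 2 * pi \<le> pi\<close> ang_bounds(1) by (intro sin_gt_zero) auto
        moreover have "sin (?x + 2 * pi - ang) = - sin (ang - ?x)"
          using sin_minus[of "ang - ?x"] sin_periodic[of "?x - ang"] by (simp add: algebra_simps)
        ultimately show False using * by simp
      qed
      then have "t = 0" "real (Suc k) * ang = 2 * pi" using x2 k2 t by (auto simp: algebra_simps)
      moreover have "Suc k = 4 * g"
      proof -
        have "real (Suc k) * ang = real (4 * g) * ang" using \<open>real (Suc k) * ang = 2 * pi\<close> ang_bounds(3) by simp
        then show ?thesis using ang_bounds(1) by (metis mult_right_cancel less_irrefl of_nat_eq_iff)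
      qed
      ultimately show ?thesis by simp
    qed
  next
    assume "(0 \<le> ?x \<and> ?x \<le> ang) \<or> (Suc k = 4 * g \<and> t = 0)"
    then show "sin (ang - ?x) \<ge> 0 \<and> sin ?x \<ge> 0"
    proof
      assume "0 \<le> ?x \<and> ?x \<le> ang"
      then show ?thesis using ang_bounds pi_gt_zero by (intro conjI sin_ge_zero) auto
    next
      assume a: "Suc k = 4 * g \<and> t = 0"
      then have "(1 + real k) * ang = 2 * pi" using ang_bounds(3) by (metis of_nat_Suc)
      then have "?x = ang - 2 * pi" using conjunct2[OF a] by (simp add: algebra_simps)
      then show ?thesis using sin_ang by (simp add: sin_diff)
    qed
  qed
  finally show ?thesis by (simp add: algebra_simps)
qed

lemma sector_cover:
  assumes "y \<noteq> 0"
  shows "\<exists>k<4 * g. y \<in> sector k"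
proof -
  obtain r t where rt: "r > 0" "0 \<le> t" "t < 2 * pi" "y = of_real r * cis t" using polar_form[OF assms] .
  define k where "k = nat \<lfloor>t / ang\<rfloor>"
  have "real k = of_int \<lfloor>t / ang\<rfloor>" using rt ang_bounds(1) by (simp add: k_def)
  then have k: "real k \<le> t / ang" "t / ang < real (Suc k)"
    unfolding of_nat_Suc by linarith+
  then have kt: "real k * ang \<le> t" "t \<le> real (Suc k) * ang"
    using ang_bounds(1) by (auto simp: field_simps)
  have "real k * ang < real (4 * g) * ang" using kt(1) rt(3) ang_bounds(3) by simp
  then have "k < 4 * g" using ang_bounds(1) by (metis mult_less_cancel_right_pos of_nat_less_iff)
  then show ?thesis using sector_polar_iff[OF rt(1-3)] kt rt(4) by blast
qed

text \<open>In terms of the angle the sectors are consecutive closed intervals, so two of them share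
  at most one boundary ray. The second alternative is the ray at angle 0.\<close>

lemma sector_overlap:
  assumes "k < l" "l < 4 * g" "y \<in> sector k" "y \<in> sector l"
  shows "(l = Suc k \<and> side_param k y = 1 \<and> side_param l y = 0) \<or>
     (k = 0 \<and> Suc l = 4 * g \<and> side_param k y = 0 \<and> side_param l y = 1)"
proof -
  have "y \<noteq> 0" using assms by (simp add: sector_def)
  then obtain r t where rt: "r > 0" "0 \<le> t" "t < 2 * pi" "y = of_real r * cis t" using polar_form by blast
  have k: "real k * ang \<le> t" "t \<le> real (Suc k) * ang"
    using assms sector_polar_iff[OF rt(1-3), of k] rt(4) by auto
  have le: "real (Suc k) * ang \<le> real l * ang"
    using assms(1) ang_bounds(1) by (intro mult_right_mono) auto
  from assms(2,4) sector_polar_iff[OF rt(1-3), of l] rt(4)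
  consider "real l * ang \<le> t" | "Suc l = 4 * g" "t = 0" by auto
  then show ?thesis
  proof cases
    case 1
    then have t: "t = real (Suc k) * ang" "t = real l * ang" using k le by auto
    then have "Suc k = l" using ang_bounds(1) by (metis mult_right_cancel less_irrefl of_nat_eq_iff)
    moreover have "side_param k y = 1"
      using sin_ang rt(1) by (simp add: side_param_def rt(4) coef_cis t(1)) (simp add: algebra_simps)
    moreover have "side_param l y = 0" by (simp add: side_param_def rt(4) coef_cis t(2))
    ultimately show ?thesis by simp
  next
    case 2
    have "real k * ang = 0" using k(1) 2 ang_bounds(1) by (metis antisym mult_nonneg_nonneg of_nat_0_le_iff less_imp_le)
    then have "k = 0" using ang_bounds(1) by simp
    moreover have "side_param k y = 0"
      unfolding side_param_def rt(4) coef_cis using 2 \<open>k = 0\<close> by simp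
    moreover have "side_param l y = 1"
    proof -
      have e: "real (Suc l) * ang = 2 * pi" using 2(1) ang_bounds(3) by metis
      have "coefA l y = 0" unfolding rt(4) coef_cis e 2(2) by simp
      then show ?thesis using sum_coef_pos[OF assms(4)] by (simp add: side_param_def)
    qed
    ultimately show ?thesis using 2 by simp
  qed
qed

lemma sector_cis:
  assumes "k < 4 * g" "u \<in> {0..1}"
  shows "cis ((real k + u) * ang) \<in> sector k"
    "side_param k (cis ((real k + u) * ang)) = sin (u * ang) / (sin ((1 - u) * ang) + sin (u * ang))"
proof -
  have c: "coefA k (cis ((real k + u) * ang)) = sin ((1 - u) * ang) / sin ang"
    "coefB k (cis ((real k + u) * ang)) = sin (u * ang) / sin ang"
    using coef_cis[of k 1 "(real k + u) * ang"] by (simp_all add: algebra_simps)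
  have "u * ang \<le> 1 * ang" "(1 - u) * ang \<le> 1 * ang"
    using assms ang_bounds(1) by (intro mult_right_mono; auto)+
  then have "u * ang \<le> pi" "(1 - u) * ang \<le> pi"
    using ang_bounds(2) pi_gt_zero by linarith+
  moreover have "0 \<le> u * ang" "0 \<le> (1 - u) * ang"
    using assms ang_bounds(1) by auto
  ultimately have "sin (u * ang) \<ge> 0" "sin ((1 - u) * ang) \<ge> 0"
    by (auto intro!: sin_ge_zero)
  then show "cis ((real k + u) * ang) \<in> sector k"
    using sin_ang by (simp add: sector_def c)
  show "side_param k (cis ((real k + u) * ang)) = sin (u * ang) / (sin ((1 - u) * ang) + sin (u * ang))"
    using sin_ang by (simp add: side_param_def c flip: add_divide_distrib)
qed

lemma coef_continuous: "continuous_on A (coefA k)" "continuous_on A (coefB k)"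
  unfolding coefA_def[abs_def] coefB_def[abs_def] by (intro continuous_intros; use sin_ang in auto)+

text \<open>Paths prescribed on the sides and matching at the vertices become a map on the punctured
  plane that is constant along rays. Maps with prescribed boundary behaviour are built in this way
  throughout.\<close>

lemma radial_extension:
  assumes c: "\<And>k. k < 4 * g \<Longrightarrow> continuous_map (top_of_set {0..1}) Y (c k)"
    and match: "\<And>k. k < 4 * g \<Longrightarrow> c k 1 = c (Suc k mod (4 * g)) 0"
  obtains f where "continuous_map (top_of_set (- {0})) Y f"
    "\<And>k y. k < 4 * g \<Longrightarrow> y \<in> sector k \<Longrightarrow> f y = c k (side_param k y)"
proof -
  have closed: "closedin (top_of_set (- {0})) (sector k)" for k
  proof -
    have "closed {y. coefA k y \<ge> 0}" "closed {y. coefB k y \<ge> 0}"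
      using closed_Collect_le[OF continuous_on_const coef_continuous(1)]
        closed_Collect_le[OF continuous_on_const coef_continuous(2)] by auto
    moreover have "sector k = - {0} \<inter> ({y. coefA k y \<ge> 0} \<inter> {y. coefB k y \<ge> 0})"
      by (auto simp: sector_def)
    ultimately show ?thesis by (auto intro!: closedin_closed_Int)
  qed
  have sub: "sector k \<subseteq> - {0}" for k by (auto simp: sector_def)
  have cont: "continuous_map (subtopology (top_of_set (- {0})) (sector k)) Y (\<lambda>y. c k (side_param k y))"
    if "k < 4 * g" for k
  proof -
    have "continuous_on (sector k) (side_param k)"
      unfolding side_param_def[abs_def] using sum_coef_pos
      by (intro continuous_intros coef_continuous) fastforce
    then have "continuous_map (top_of_set (sector k)) (top_of_set {0..1}) (side_param k)"
      using side_param_range by auto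
    from continuous_map_compose[OF this c[OF that]] show ?thesis
      using sub[of k] by (simp add: o_def subtopology_subtopology Int_absorb1)
  qed
  have agree: "c k (side_param k y) = c l (side_param l y)"
    if "k < 4 * g" "l < 4 * g" "y \<in> sector k" "y \<in> sector l" for k l y
  proof -
    have *: "c k (side_param k y) = c l (side_param l y)"
      if "k < l" "l < 4 * g" "y \<in> sector k" "y \<in> sector l" for k l
      using sector_overlap[OF that] match[of k] match[of l] that(1,2) by auto
    consider "k < l" | "k = l" | "l < k" by linarith
    then show ?thesis
    proof cases
      case 1 then show ?thesis using * that by blast
    next
      case 3 then show ?thesis using *[of l k] that by simp
    qed simp
  qed
  show thesis
  proof (rule pasting_lemma_exists_closed[of "{..<4 * g}" "top_of_set (- {0})" sector Y "\<lambda>k y. c k (side_param k y)"])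
    show "topspace (top_of_set (- {0})) \<subseteq> \<Union> (sector ` {..<4 * g})"
      using sector_cover by fastforce
    show "closedin (top_of_set (- {0})) (sector k)" for k by (rule closed)
    show "continuous_map (subtopology (top_of_set (- {0})) (sector k)) Y (\<lambda>y. c k (side_param k y))"
      if "k \<in> {..<4 * g}" for k using cont that by simp
    show "c k (side_param k y) = c l (side_param l y)"
      if "k \<in> {..<4 * g}" "l \<in> {..<4 * g}" "y \<in> topspace (top_of_set (- {0})) \<inter> sector k \<inter> sector l" for k l y
      using agree[of k l y] that by simp
    fix f assume f: "continuous_map (top_of_set (- {0})) Y f"
      "\<And>x k. k \<in> {..<4 * g} \<Longrightarrow> x \<in> topspace (top_of_set (- {0})) \<inter> sector k \<Longrightarrow> f x = c k (side_param k x)"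
    show thesis
    proof (rule that[OF f(1)])
      show "f y = c k (side_param k y)" if "k < 4 * g" "y \<in> sector k" for k y
        using f(2)[of k y] that sub[of k] by auto
    qed
  qed simp
qed

section \<open>The polygon as a convex set\<close>

lemma convex_sum_three:
  fixes x y z :: "'a::real_vector"
  assumes "convex C" "x \<in> C" "y \<in> C" "z \<in> C" "0 \<le> a" "0 \<le> b" "0 \<le> c" "a + b + c = (1::real)"
  shows "a *\<^sub>R x + b *\<^sub>R y + c *\<^sub>R z \<in> C"
proof -
  have "C = convex hull C" using assms(1) by (simp add: hull_same)
  have "a *\<^sub>R x + b *\<^sub>R y + c *\<^sub>R z \<in> convex hull {x, y, z}"
    using assms by (auto simp: convex_hull_3)
  also have "\<dots> \<subseteq> C" using assms by (intro hull_minimal) auto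
  finally show ?thesis .
qed

lemma vertex_mod: "polygon_vertex g (k mod (4 * g)) = polygon_vertex g k"
proof -
  have "polygon_vertex g (j + n * (4 * g)) = polygon_vertex g j" for j n
  proof (induct n)
    case (Suc n)
    have "j + Suc n * (4 * g) = (j + n * (4 * g)) + 4 * g" by simp
    then show ?case using Suc vertex_periodic by metis
  qed simp
  from this[of "k mod (4 * g)" "k div (4 * g)"] show ?thesis by (simp only: mod_div_mult_eq)
qed

lemma vertex_in_polygon: "polygon_vertex g k \<in> polygon g"
proof -
  have "polygon_vertex g (k mod (4 * g)) \<in> polygon g"
    unfolding polygon_def using genus by (intro hull_inc imageI) simp
  then show ?thesis by (simp add: vertex_mod)
qed

lemma compact_polygon: "compact (polygon g)"
  unfolding polygon_def by (intro compact_convex_hull finite_imp_compact) simp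

lemma convex_polygon: "convex (polygon g)"
  by (simp add: polygon_def)

lemma zero_in_polygon: "0 \<in> polygon g"
proof -
  have "real (2 * g) * ang = pi" using ang_bounds(3) by simp
  then have "polygon_vertex g (2 * g) = - polygon_vertex g 0"
    unfolding vertex_eq by simp
  then have "(1/2) *\<^sub>R polygon_vertex g 0 + (1/2) *\<^sub>R polygon_vertex g (2 * g) = 0" by simp
  then show ?thesis
    using convexD[OF convex_polygon vertex_in_polygon[of 0] vertex_in_polygon[of "2 * g"], of "1/2" "1/2"] by simp
qed

lemma sector_in_polygon:
  assumes "y \<in> sector k" "coefA k y + coefB k y \<le> 1"
  shows "y \<in> polygon g"
proof -
  have "coefA k y *\<^sub>R polygon_vertex g k + coefB k y *\<^sub>R polygon_vertex g (Suc k) +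
      (1 - coefA k y - coefB k y) *\<^sub>R 0 \<in> polygon g"
    using assms by (intro convex_sum_three convex_polygon vertex_in_polygon zero_in_polygon) (auto simp: sector_def)
  then show ?thesis using vertex_decomp[of y k] by (simp add: scaleR_conv_of_real)
qed

lemma side_in_polygon: "t \<in> {0..1} \<Longrightarrow> polygon_side g k t \<in> polygon g"
  by (rule sector_in_polygon[OF side_in_sector]) (simp_all add: coef_side)

lemma cball_in_polygon: "\<exists>e>0. cball 0 e \<subseteq> polygon g"
proof (intro exI conjI subsetI)
  \<comment> \<open>Both coordinates are bounded by \<open>norm y / sin ang\<close>, so this radius
    keeps each of them at most 1/2.\<close>
  show "sin ang / 2 > 0" using sin_ang by simp
  fix y :: complex assume y: "y \<in> cball 0 (sin ang / 2)"
  show "y \<in> polygon g"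
  proof (cases "y = 0")
    case False
    then obtain k where k: "y \<in> sector k" using sector_cover by blast
    have "\<bar>Im (cnj (cis t) * y)\<bar> \<le> norm y" for t
      using abs_Im_le_cmod[of "cnj (cis t) * y"] by (simp add: norm_mult)
    then have b: "\<bar>Im (cnj (cis t) * y)\<bar> \<le> sin ang / 2" for t
      using y by (meson dual_order.trans mem_cball_0)
    have "coefA k y \<le> 1 / 2" "coefB k y \<le> 1 / 2"
      unfolding coefA_def coefB_def pos_divide_le_eq[OF sin_ang]
      using b[of "real (Suc k) * ang"] b[of "real k * ang"] by linarith+
    then show ?thesis by (intro sector_in_polygon[OF k]) simp
  qed (simp add: zero_in_polygon)
qed

text \<open>The sum of the coordinates is the linear functional with value 1 on the side k. At the
  vertex j it equals \<open>cos x / cos (ang / 2)\<close>, and no vertex has a direction closer than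
  \<open>ang / 2\<close> to the midpoint of a side.\<close>

lemma coef_sum_vertex_le:
  assumes "k < 4 * g" "j < 4 * g"
  shows "coefA k (polygon_vertex g j) + coefB k (polygon_vertex g j) \<le> 1"
proof -
  \<comment> \<open>The angle from the vertex j to the midpoint of the side k.\<close>
  define x where "x = (real k - real j) * ang + ang / 2"
  have 1: "coefA k (polygon_vertex g j) + coefB k (polygon_vertex g j) = (sin (x + ang / 2) - sin (x - ang / 2)) / sin ang"
    using coef_cis[of k 1 "real j * ang"] sin_minus[of "x - ang / 2"]
    by (simp add: vertex_eq x_def algebra_simps flip: add_divide_distrib diff_divide_distrib)
  have 2: "sin (x + ang / 2) - sin (x - ang / 2) = 2 * cos x * sin (ang / 2)"
    by (simp add: sin_add sin_diff)
  have 3: "sin ang = 2 * sin (ang / 2) * cos (ang / 2)"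
    using sin_double[of "ang / 2"] by simp
  have s: "sin (ang / 2) > 0" "cos (ang / 2) > 0"
    using ang_bounds pi_gt_zero by (auto intro!: sin_gt_zero cos_gt_zero)
  have "cos x \<le> cos (ang / 2)"
  proof -
    have bound: "ang / 2 \<le> \<bar>x\<bar> \<and> \<bar>x\<bar> \<le> 2 * pi - ang / 2"
    proof -
      have "real (4 * g) * ang = 2 * pi" by (rule ang_bounds(3))
      consider "k \<ge> j" | "Suc k \<le> j" by linarith
      then show ?thesis
      proof cases
        case 1
        have "0 \<le> (real k - real j) * ang" using 1 ang_bounds(1) by simp
        moreover have "(real k - real j) * ang \<le> (real (4 * g) - 1) * ang"
          using assms ang_bounds(1) by (intro mult_right_mono) auto
        ultimately show ?thesis
          using ang_bounds(1,3) by (auto simp: x_def left_diff_distrib)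
      next
        case 2
        have "1 * ang \<le> (real j - real k) * ang"
          using 2 ang_bounds(1) by (intro mult_right_mono) auto
        moreover have "(real j - real k) * ang \<le> real (4 * g) * ang"
          using assms ang_bounds(1) by (intro mult_right_mono) auto
        moreover have "x = - ((real j - real k) * ang) + ang / 2" by (simp add: x_def algebra_simps)
        ultimately show ?thesis using ang_bounds(1,3) by linarith
      qed
    qed
    show ?thesis
    proof (cases "\<bar>x\<bar> \<le> pi")
      case True
      then have "cos \<bar>x\<bar> \<le> cos (ang / 2)"
        using bound ang_bounds(1) by (intro cos_monotone_0_pi_le) auto
      then show ?thesis by simp
    next
      case False
      then have "cos (2 * pi - \<bar>x\<bar>) \<le> cos (ang / 2)"
        using bound ang_bounds(1) by (intro cos_monotone_0_pi_le) auto
      then show ?thesis by (simp add: cos_diff)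
    qed
  qed
  then show ?thesis
    unfolding 1 2 3 using s by (simp add: divide_simps)
qed

lemma coef_sum_le:
  assumes "k < 4 * g" "y \<in> polygon g"
  shows "coefA k y + coefB k y \<le> 1"
proof -
  have "convex {y. coefA k y + coefB k y \<le> 1}"
  proof (rule convexI)
    fix x y u v assume xy: "x \<in> {y. coefA k y + coefB k y \<le> 1}" "y \<in> {y. coefA k y + coefB k y \<le> 1}"
      and uv: "(0::real) \<le> u" "0 \<le> v" "u + v = 1"
    have "coefA k (u *\<^sub>R x + v *\<^sub>R y) + coefB k (u *\<^sub>R x + v *\<^sub>R y)
       = u * (coefA k x + coefB k x) + v * (coefA k y + coefB k y)"
      unfolding scaleR_conv_of_real coef_linear by (simp add: algebra_simps)
    also have "\<dots> \<le> u * 1 + v * 1" using xy uv by (intro add_mono mult_left_mono) auto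
    finally show "u *\<^sub>R x + v *\<^sub>R y \<in> {y. coefA k y + coefB k y \<le> 1}" using uv by simp
  qed
  moreover have "polygon_vertex g ` {..<4 * g} \<subseteq> {y. coefA k y + coefB k y \<le> 1}"
    using coef_sum_vertex_le[OF assms(1)] by auto
  ultimately have "polygon g \<subseteq> {y. coefA k y + coefB k y \<le> 1}"
    unfolding polygon_def by (rule hull_minimal[rotated])
  then show ?thesis using assms(2) by blast
qed

text \<open>Scaling a point of the side by 1 + d violates the half-plane inequality of
  \<open>coef_sum_le\<close> for every positive d.\<close>

lemma side_not_interior:
  assumes "k < 4 * g" "t \<in> {0..1}"
  shows "polygon_side g k t \<notin> interior (polygon g)"
proof
  let ?s = "polygon_side g k t"
  assume "?s \<in> interior (polygon g)"
  then obtain e where e: "e > 0" "ball ?s e \<subseteq> polygon g" using mem_interior by blast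
  define d where "d = e / (2 * (norm ?s + 1))"
  have n: "norm ?s + 1 > 0" using norm_ge_zero[of ?s] by linarith
  then have d: "d > 0" using e by (simp add: d_def)
  have "d * norm ?s < e"
  proof -
    have "d * norm ?s \<le> d * (norm ?s + 1)" using d by simp
    also have "\<dots> = e / 2" unfolding d_def using n
by (auto simp: field_simps)
    finally show ?thesis using e by simp
  qed
  moreover have "?s - of_real (1 + d) * ?s = of_real (- d) * ?s" by (simp add: algebra_simps)
  then have "dist ?s (of_real (1 + d) * ?s) = d * norm ?s"
    unfolding dist_norm using d by (simp add: norm_mult)
  ultimately have "of_real (1 + d) * ?s \<in> polygon g" using e(2) by auto
  from coef_sum_le[OF assms(1) this] show False
    unfolding coef_linear coef_side using d by (simp add: algebra_simps)
qed

section \<open>Radial projection to the boundary, and the boundary loop\<close>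

definition bdry :: "complex \<Rightarrow> complex" where
  "bdry = (SOME f. continuous_map (top_of_set (- {0})) euclidean f \<and>
     (\<forall>k<4 * g. \<forall>y\<in>sector k. f y = polygon_side g k (side_param k y)))"

lemma bdry_props:
  "continuous_on (- {0}) bdry"
  "\<And>k y. k < 4 * g \<Longrightarrow> y \<in> sector k \<Longrightarrow> bdry y = polygon_side g k (side_param k y)"
proof -
  have c: "continuous_map (top_of_set {0..1}) euclidean (polygon_side g k)" for k
    by (auto simp: polygon_side_def)
  have m: "polygon_side g k 1 = polygon_side g (Suc k mod (4 * g)) 0" for k
    by (simp add: side_ends vertex_mod)
  obtain f where "continuous_map (top_of_set (- {0})) euclidean f"
    "\<And>k y. k < 4 * g \<Longrightarrow> y \<in> sector k \<Longrightarrow> f y = polygon_side g k (side_param k y)"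
    using radial_extension[of euclidean "polygon_side g", OF c m] by blast
  then have "\<exists>f. continuous_map (top_of_set (- {0})) euclidean f \<and>
     (\<forall>k<4 * g. \<forall>y\<in>sector k. f y = polygon_side g k (side_param k y))" by blast
  from someI_ex[OF this, folded bdry_def] show "continuous_on (- {0}) bdry"
    "\<And>k y. k < 4 * g \<Longrightarrow> y \<in> sector k \<Longrightarrow> bdry y = polygon_side g k (side_param k y)" by auto
qed

lemma bdry_radial:
  assumes "y \<noteq> 0"
  shows "\<exists>c>0. bdry y = of_real c * y" "bdry y \<in> polygon g - {0}"
proof -
  obtain k where k: "k < 4 * g" "y \<in> sector k" using sector_cover[OF assms] by blast
  let ?N = "coefA k y + coefB k y"
  have N: "?N > 0" by (rule sum_coef_pos[OF k(2)])
  have "of_real ?N * bdry y = y"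
  proof -
    have "of_real ?N * bdry y = of_real (?N * (1 - side_param k y)) * polygon_vertex g k +
       of_real (?N * side_param k y) * polygon_vertex g (Suc k)"
      by (simp add: bdry_props(2)[OF k] side_eq algebra_simps)
    moreover have "?N * (1 - side_param k y) = coefA k y" "?N * side_param k y = coefB k y"
      using N by (auto simp: side_param_def field_simps)
    ultimately show ?thesis using vertex_decomp[of y k] by simp
  qed
  then have "bdry y = of_real (1 / ?N) * y"
    using N by (simp add: field_simps del: of_real_add)
  then show "\<exists>c>0. bdry y = of_real c * y" using N by (intro exI[of _ "1 / ?N"]) simp
  then have "bdry y \<noteq> 0" using assms by auto
  then show "bdry y \<in> polygon g - {0}"
    using side_in_polygon[OF side_param_range[OF k(2)], of k] bdry_props(2)[OF k] by auto
qed

text \<open>At constant angular speed the boundary loop runs along each side with the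
  parametrization \<open>reparam\<close>, which commutes with the reversal of the side.\<close>

definition bloop :: "real \<Rightarrow> complex" where
  "bloop t = bdry (cis (2 * pi * t))"

definition reparam :: "real \<Rightarrow> real" where
  "reparam u = sin (u * ang) / (sin ((1 - u) * ang) + sin (u * ang))"

lemma bloop_continuous: "continuous_on A bloop"
proof -
  have "continuous_on A (bdry \<circ> (\<lambda>t. cis (2 * pi * t)))"
    by (intro continuous_on_compose continuous_intros continuous_on_subset[OF bdry_props(1)])
      auto
  then show ?thesis by (simp add: o_def bloop_def[abs_def])
qed

lemma bloop_in: "bloop t \<in> polygon g - {0}"
  unfolding bloop_def by (rule bdry_radial(2)) simp

lemma bloop_side:
  assumes "k < 4 * g" "u \<in> {0..1}"
  shows "bloop ((real k + u) / real (4 * g)) = polygon_side g k (reparam u)"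
proof -
  have "2 * pi * ((real k + u) / real (4 * g)) = (real k + u) * ang"
    by (simp add: ang_def)
  then have "bloop ((real k + u) / real (4 * g)) = bdry (cis ((real k + u) * ang))"
    unfolding bloop_def by metis
  then show ?thesis
    using bdry_props(2)[OF assms(1) sector_cis(1)[OF assms]] sector_cis(2)[OF assms]
    by (simp add: reparam_def)
qed

lemma reparam_props:
  "reparam 0 = 0" "reparam 1 = 1" "u \<in> {0..1} \<Longrightarrow> reparam u \<in> {0..1}"
  "u \<in> {0..1} \<Longrightarrow> reparam (1 - u) = 1 - reparam u" "continuous_on {0..1} reparam"
proof -
  have pos: "sin ((1 - u) * ang) + sin (u * ang) > 0 \<and> sin ((1 - u) * ang) \<ge> 0 \<and> sin (u * ang) \<ge> 0" if "u \<in> {0..1}" for u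
  proof -
    have k: "0 < 4 * g" using genus by simp
    have c: "coefA 0 (cis ((real 0 + u) * ang)) = sin ((1 - u) * ang) / sin ang"
      "coefB 0 (cis ((real 0 + u) * ang)) = sin (u * ang) / sin ang"
      using coef_cis[of 0 1 "(real 0 + u) * ang"] by (simp_all add: algebra_simps)
    have "sin ((1 - u) * ang) / sin ang + sin (u * ang) / sin ang > 0"
      "sin ((1 - u) * ang) / sin ang \<ge> 0" "sin (u * ang) / sin ang \<ge> 0"
      using sum_coef_pos[OF sector_cis(1)[OF k that]] sector_cis(1)[OF k that] c by (auto simp: sector_def)
    then show ?thesis using sin_ang by (auto simp: zero_le_divide_iff zero_less_divide_iff simp flip: add_divide_distrib)
  qed
  show "reparam 0 = 0" "reparam 1 = 1" using sin_ang by (auto simp: reparam_def)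
  show "reparam u \<in> {0..1}" "reparam (1 - u) = 1 - reparam u" if "u \<in> {0..1}"
    using pos[OF that] by (auto simp: reparam_def field_simps)
  show "continuous_on {0..1} reparam"
    unfolding reparam_def[abs_def] using pos by (intro continuous_intros) force
qed

end

section \<open>Winding of maps from the punctured polygon to PO(n)\<close>

locale pin_polygon = even_dim dummy + surface_polygon g
  for dummy :: "'n::{finite,linorder} itself" and g :: nat
begin

abbreviation pstar :: "complex set" where "pstar \<equiv> polygon g - {0}"

text \<open>The map may take values outside PSO(n). The element z does not depend on the lift: lifts
  differ by a right factor in the kernel, and the kernel is abelian.\<close>

definition winding :: "(complex \<Rightarrow> 'n sq_matrix set) \<Rightarrow> 'n clifford \<Rightarrow> bool" where
  "winding f z \<longleftrightarrow> z \<in> pi1_elems \<and>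
     (\<exists>F. continuous_map (top_of_set {0..1}) (top_of_set pin_set) F \<and>
        (\<forall>t\<in>{0..1}. pin_to_PO (F t) = f (bloop t)) \<and> F 1 = F 0 \<star> z)"

text \<open>Conjugation by an odd element of Pin(n), on the four kernel elements.\<close>

definition pi1_flip :: "'n clifford \<Rightarrow> 'n clifford" where
  "pi1_flip z = (if z = cl_omega \<or> z = - cl_omega then - z else z)"

lemma cl_one_neq_omega: "(cl_one :: 'n clifford) \<noteq> cl_omega" "(cl_one :: 'n clifford) \<noteq> - cl_omega"
proof -
  have "(UNIV :: 'n set) \<noteq> {}" by simp
  then have "(cl_one :: 'n clifford) $ {} \<noteq> cl_omega $ {}" "(cl_one :: 'n clifford) $ {} \<noteq> (- cl_omega) $ {}"
    by (auto simp: cl_one_def cl_omega_def cl_basis_nth)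
  then show "(cl_one :: 'n clifford) \<noteq> cl_omega" "(cl_one :: 'n clifford) \<noteq> - cl_omega" by metis+
qed

lemma pi1_flip_simps [simp]:
  "pi1_flip cl_one = cl_one" "pi1_flip (- cl_one) = - cl_one"
  "pi1_flip cl_omega = - cl_omega" "pi1_flip (- cl_omega) = cl_omega"
  using cl_one_neq_omega by (auto simp: pi1_flip_def minus_equation_iff)

lemma pi1_flip_closed: "z \<in> pi1_elems \<Longrightarrow> pi1_flip z \<in> pi1_elems"
  by (auto simp: pi1_elems_def)

lemma pi1_flip_flip: "z \<in> pi1_elems \<Longrightarrow> pi1_flip (pi1_flip z) = z"
  by (auto simp: pi1_elems_def)

lemma pi1_commute_pin:
  assumes "z \<in> pi1_elems" "p \<in> pin_set"
  shows "z \<star> p = p \<star> (if p \<in> spin_set then z else pi1_flip z)"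
  using assms(1) omega_commute[OF dim_even assms(2)]
  by (auto simp: pi1_elems_def cl.minus_left cl.minus_right)

lemma pi1_commute: "z \<in> pi1_elems \<Longrightarrow> w \<in> pi1_elems \<Longrightarrow> (z :: 'n clifford) \<star> w = w \<star> z"
  using pi1_commute_spin pi1_spin by blast

lemma pi1_pin: "z \<in> pi1_elems \<Longrightarrow> (z :: 'n clifford) \<in> pin_set"
  using pi1_elems_pin by auto

lemma pin_cancel: "p \<in> pin_set \<Longrightarrow> p \<star> x = p \<star> y \<longleftrightarrow> x = (y :: 'n clifford)"
  by (metis pin_conj_left')

lemma pin_cancel_right: "p \<in> pin_set \<Longrightarrow> x \<star> p = y \<star> p \<longleftrightarrow> x = (y :: 'n clifford)"
  by (metis cl_assoc cl_one_right pin_conj_right)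

lemma continuous_pin_mult:
  assumes "continuous_map Y (top_of_set (pin_set :: 'n clifford set)) F" "continuous_map Y (top_of_set pin_set) G"
  shows "continuous_map Y (top_of_set (pin_set :: 'n clifford set)) (\<lambda>y. F y \<star> G y)"
proof -
  have "continuous_on (pin_set \<times> pin_set) (\<lambda>x :: 'n clifford \<times> 'n clifford. fst x \<star> snd x)"
    by (intro cl.continuous_on continuous_intros)
  then have m: "continuous_map (prod_topology (top_of_set pin_set) (top_of_set pin_set)) (top_of_set pin_set)
     (\<lambda>(a, b). a \<star> (b :: 'n clifford))"
    by (auto simp: prod_topology_subtopology_eu case_prod_unfold intro: pin_mult)
  show ?thesis by (rule continuous_map_const_subtopology_pair[OF assms m])
qed

lemma continuous_pin_const: "p \<in> pin_set \<Longrightarrow> continuous_map Y (top_of_set (pin_set :: 'n clifford set)) (\<lambda>y. p)"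
  by simp

lemma continuous_pin_in: "continuous_map (top_of_set A) (top_of_set pin_set) F \<Longrightarrow> x \<in> A \<Longrightarrow> F x \<in> pin_set"
  by (auto simp: Pi_iff)

lemma bloop_map: "continuous_map (top_of_set A) (top_of_set pstar) bloop"
  using bloop_continuous bloop_in by auto

lemma bloop_ends: "bloop 1 = bloop 0"
  by (simp add: bloop_def)

lemma winding_lift:
  assumes f: "continuous_map (top_of_set pstar) PO_topology f"
  obtains F where "pin_path F"
    "\<And>t. t \<in> {0..1} \<Longrightarrow> pin_to_PO (F t) = f (bloop t)"
proof -
  have "continuous_map (top_of_set {0..1}) PO_topology (f \<circ> bloop)"
    by (rule continuous_map_compose[OF bloop_map f])
  from pin.path_lift_exists[OF this] show thesis using that by auto
qed

lemma winding_exists: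
  assumes f: "continuous_map (top_of_set pstar) PO_topology f"
  obtains z where "winding f z"
proof -
  obtain F where F: "pin_path F"
    "\<And>t. t \<in> {0..1} \<Longrightarrow> pin_to_PO (F t) = f (bloop t)" using winding_lift[OF f] by blast
  have "pin_to_PO (F 0) = pin_to_PO (F 1)" using F(2)[of 0] F(2)[of 1] bloop_ends by simp
  then obtain z where "z \<in> pi1_elems" "F 1 = F 0 \<star> z"
    using pin_to_PO_eq_iff[OF continuous_pin_in[OF F(1)] continuous_pin_in[OF F(1)]] by auto
  then show thesis using that F unfolding winding_def by blast
qed

text \<open>If the second lift is the first times w, then w z' = z w at the end point, and the
  kernel is abelian.\<close>

lemma lift_end_unique:
  fixes F F' :: "real \<Rightarrow> 'n clifford"
  assumes F: "continuous_map (top_of_set {0..1}) (top_of_set pin_set) F"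
    and F': "continuous_map (top_of_set {0..1}) (top_of_set pin_set) F'"
    and eq: "\<And>t. t \<in> {0..1} \<Longrightarrow> pin_to_PO (F t) = pin_to_PO (F' t)"
    and e: "F 1 = F 0 \<star> z" "F' 1 = F' 0 \<star> z'" "z \<in> pi1_elems" "z' \<in> pi1_elems"
  shows "z = z'"
proof -
  obtain w where w: "w \<in> pi1_elems" "\<And>t. t \<in> {0..1} \<Longrightarrow> F' t = F t \<star> w"
    using pin_lift_unique[OF _ F F' eq] by auto
  have "F 0 \<star> (w \<star> z') = F' 1" using w(2)[of 0] e(2) by (simp add: cl_assoc)
  also have "\<dots> = F 0 \<star> (z \<star> w)" using w(2)[of 1] e(1) by (simp add: cl_assoc)
  finally have "w \<star> z' = w \<star> z"
    using pin_cancel[OF continuous_pin_in[OF F, of 0]] pi1_commute[OF w(1) e(3)] by auto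
  then show ?thesis using pin_cancel[OF pi1_pin[OF w(1)]] by auto
qed

lemma winding_unique: "winding f z \<Longrightarrow> winding f z' \<Longrightarrow> z = z'"
  unfolding winding_def by (metis (no_types, lifting) lift_end_unique)

lemma winding_in: "winding f z \<Longrightarrow> z \<in> pi1_elems"
  by (simp add: winding_def)

text \<open>The small circle is homotopic to the boundary loop in the punctured polygon. A lift of
  the homotopy to the square has left and right edges over the same path, so they differ by one
  constant kernel element, which is the class of both loops.\<close>

lemma winding_circle:
  assumes f: "continuous_map (top_of_set pstar) PO_topology f"
    and d: "d > 0" "cball 0 d \<subseteq> polygon g"
    and c: "pin_path c"
    and cl: "\<And>t. t \<in> {0..1} \<Longrightarrow> pin_to_PO (c t) = f (of_real d * cis (2 * pi * t))"
    and z: "c 1 = c 0 \<star> z" "z \<in> pi1_elems"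
  shows "winding f z"
proof -
  \<comment> \<open>The straight-line homotopy moves each point along its ray and therefore avoids
    the centre.\<close>
  define G :: "complex \<Rightarrow> complex" where
    "G w = of_real (1 - Im w) * (of_real d * cis (2 * pi * Re w)) + of_real (Im w) * bloop (Re w)" for w
  let ?D = "crect 0 1 0 1"
  have G_cont: "continuous_on A G" for A
  proof -
    have "continuous_on A (bloop \<circ> Re)"
      by (intro continuous_on_compose bloop_continuous continuous_intros)
    then show ?thesis unfolding G_def[abs_def] by (intro continuous_intros) (simp add: o_def)
  qed
  have G_in: "G w \<in> pstar" if w: "w \<in> ?D" for w
  proof -
    obtain e where e: "e > 0" "bloop (Re w) = of_real e * cis (2 * pi * Re w)"
      using bdry_radial(1)[of "cis (2 * pi * Re w)"] by (auto simp: bloop_def)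
    have "(1 - Im w) * d + Im w * e > 0"
    proof (cases "Im w = 0")
      case False
      then have "Im w * e > 0" using w e by (simp add: crect_def)
      moreover have "(1 - Im w) * d \<ge> 0" using w d by (simp add: crect_def)
      ultimately show ?thesis by linarith
    qed (use d in simp)
    moreover have "G w = of_real ((1 - Im w) * d + Im w * e) * cis (2 * pi * Re w)"
      by (simp add: G_def e algebra_simps)
    ultimately have "G w \<noteq> 0" by (metis cis_neq_zero mult_eq_0_iff of_real_eq_0_iff less_irrefl)
    moreover have "of_real d * cis (2 * pi * Re w) \<in> polygon g"
      using d by (auto intro!: subsetD[OF d(2)] simp: norm_mult)
    then have "G w \<in> polygon g"
      using convexD[OF convex_polygon _ _, of _ "bloop (Re w)" "1 - Im w" "Im w"] bloop_in[of "Re w"] w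
      by (auto simp: G_def crect_def scaleR_conv_of_real)
    ultimately show ?thesis by simp
  qed
  have "continuous_map (top_of_set ?D) (top_of_set pstar) G" using G_cont G_in by auto
  from continuous_map_compose[OF this f] have "continuous_map (top_of_set ?D) PO_topology (f \<circ> G)" .
  then obtain L where L: "continuous_map (top_of_set ?D) (top_of_set (pin_set :: 'n clifford set)) L"
    "\<And>w. w \<in> ?D \<Longrightarrow> pin_to_PO (L w) = f (G w)"
    using pin.lift_exists[of ?D "f \<circ> G"] by (auto simp: crect_cbox)
  have restr: "pin_path (\<lambda>t. L (h t))"
    if "continuous_on {0..1} h" "\<And>t. t \<in> {0..1} \<Longrightarrow> h t \<in> ?D" for h :: "real \<Rightarrow> complex"
  proof -
    have "continuous_map (top_of_set {0..1}) (top_of_set ?D) h" using that by auto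
    from continuous_map_compose[OF this L(1)] show ?thesis by (simp add: o_def)
  qed
  have hor: "pin_path (\<lambda>t. L (Complex t s))"
    if "s \<in> {0..1}" for s
    by (rule restr) (use that in \<open>auto simp: Complex_eq crect_def intro!: continuous_intros\<close>)
  have ver: "pin_path (\<lambda>s. L (Complex t s))"
    if "t \<in> {0..1}" for t
    by (rule restr) (use that in \<open>auto simp: Complex_eq crect_def intro!: continuous_intros\<close>)
  have per: "G (Complex 1 s) = G (Complex 0 s)" for s
    using bloop_ends by (simp add: G_def complex_eq_iff)
  obtain z' where z': "z' \<in> pi1_elems" "\<And>s. s \<in> {0..1} \<Longrightarrow> L (Complex 1 s) = L (Complex 0 s) \<star> z'"
    using pin_lift_unique[OF _ ver[of 0] ver[of 1]] L(2) per by (auto simp: crect_def)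
  have "z = z'"
  proof (rule lift_end_unique[OF c hor[of 0] _ z(1) _ z(2) z'(1)])
    show "pin_to_PO (c t) = pin_to_PO (L (Complex t 0))" if "t \<in> {0..1}" for t
      using cl[OF that] L(2)[of "Complex t 0"] that by (simp add: crect_def G_def)
    show "L (Complex 1 0) = L (Complex 0 0) \<star> z'" using z'(2)[of 0] by simp
  qed simp
  then show ?thesis
    unfolding winding_def using z(2) hor[of 1] z'(2)[of 1] L(2)
    by (intro conjI exI[of _ "\<lambda>t. L (Complex t 1)"]) (auto simp: crect_def G_def)
qed

lemma winding_circle_lift:
  assumes f: "continuous_map (top_of_set pstar) PO_topology f"
    and d: "d > 0" "cball 0 d \<subseteq> polygon g" and w: "winding f z"
  obtains c where "pin_path c"
    "\<And>t. t \<in> {0..1} \<Longrightarrow> pin_to_PO (c t) = f (of_real d * cis (2 * pi * t))" "c 1 = c 0 \<star> z"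
proof -
  have "of_real d * cis (2 * pi * t) \<in> pstar" for t
    using d by (auto intro!: subsetD[OF d(2)] simp: norm_mult)
  then have "continuous_map (top_of_set {0..1}) (top_of_set pstar) (\<lambda>t. of_real d * cis (2 * pi * t))"
    by (auto intro!: continuous_intros)
  from continuous_map_compose[OF this f]
  obtain c where c: "pin_path c"
    "\<And>t. t \<in> {0..1} \<Longrightarrow> pin_to_PO (c t) = f (of_real d * cis (2 * pi * t))"
    using pin.path_lift_exists by (auto simp: o_def)
  have "pin_to_PO (c 0) = pin_to_PO (c 1)" using c(2)[of 0] c(2)[of 1] by (simp add: complex_eq_iff)
  then obtain z' where z': "z' \<in> pi1_elems" "c 1 = c 0 \<star> z'"
    using pin_to_PO_eq_iff[OF continuous_pin_in[OF c(1)] continuous_pin_in[OF c(1)]] by auto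
  from winding_circle[OF f d c z'(2,1)] have "z' = z" using winding_unique w by blast
  then show thesis using that c z' by blast
qed

lemma PSO_subset: "PSO \<subseteq> carrier (PO :: 'n sq_matrix set monoid)"
  by (auto simp: PSO_def carrier_PO rotation_matrix_def)

text \<open>In the product of the two lifts, z has to be moved past the lift of k; it is flipped if
  that lift is odd.\<close>

lemma winding_mult:
  assumes "winding f z" "winding k w"
  shows "winding (\<lambda>y. f y \<otimes>\<^bsub>PO\<^esub> k y) ((if k (bloop 0) \<in> PSO then z else pi1_flip z) \<star> w)"
proof -
  from assms(1) obtain F where F: "pin_path F"
    "\<And>t. t \<in> {0..1} \<Longrightarrow> pin_to_PO (F t) = f (bloop t)" "F 1 = F 0 \<star> z" and z: "z \<in> pi1_elems"
    by (auto simp: winding_def)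
  from assms(2) obtain K where K: "pin_path K"
    "\<And>t. t \<in> {0..1} \<Longrightarrow> pin_to_PO (K t) = k (bloop t)" "K 1 = K 0 \<star> w" and w: "w \<in> pi1_elems"
    by (auto simp: winding_def)
  have in0: "F t \<in> pin_set" "K t \<in> pin_set" if "t \<in> {0..1}" for t
    using continuous_pin_in[OF F(1) that] continuous_pin_in[OF K(1) that] by auto
  let ?z = "if k (bloop 0) \<in> PSO then z else pi1_flip z"
  have "K 0 \<in> spin_set \<longleftrightarrow> k (bloop 0) \<in> PSO"
    using PSO_pin_iff[OF in0(2)[of 0]] K(2)[of 0] by auto
  then have zK: "z \<star> K 0 = K 0 \<star> ?z"
    using pi1_commute_pin[OF z in0(2)[of 0]] by auto
  have "F 1 \<star> K 1 = F 0 \<star> ((z \<star> K 0) \<star> w)" by (simp only: F(3) K(3) cl_assoc)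
  also have "\<dots> = F 0 \<star> K 0 \<star> (?z \<star> w)" by (simp only: zK cl_assoc)
  finally have "F 1 \<star> K 1 = F 0 \<star> K 0 \<star> (?z \<star> w)" .
  moreover have "?z \<star> w \<in> pi1_elems" using z w pi1_flip_closed pi1_mult by auto
  moreover have "pin_to_PO (F t \<star> K t) = f (bloop t) \<otimes>\<^bsub>PO\<^esub> k (bloop t)" if "t \<in> {0..1}" for t
    using F(2)[OF that] K(2)[OF that] in0[OF that] by (simp flip: pin_to_PO_mult)
  ultimately show ?thesis
    unfolding winding_def using continuous_pin_mult[OF F(1) K(1)]
    by (intro conjI exI[of _ "\<lambda>t. F t \<star> K t"]) auto
qed

lemma winding_const:
  assumes "a \<in> carrier PO"
  shows "winding (\<lambda>_. a) cl_one"
proof -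
  obtain p :: "'n clifford" where "p \<in> pin_set" "pin_to_PO p = a" using assms by (rule PO_pinE)
  then show ?thesis
    unfolding winding_def by (intro conjI exI[of _ "\<lambda>_. p"]) (auto simp: pi1_elems_def)
qed

lemma winding_cong:
  assumes "\<And>y. y \<in> pstar \<Longrightarrow> f y = f' y"
  shows "winding f z \<longleftrightarrow> winding f' z"
  unfolding winding_def using assms bloop_in by auto

text \<open>A map on the whole polygon lifts to Pin(n) there, and the lift closes up along the
  boundary loop.\<close>

lemma winding_polygon:
  assumes f: "continuous_map (top_of_set (polygon g)) PO_topology f"
  shows "winding f cl_one"
proof -
  obtain S where S: "continuous_map (top_of_set (polygon g)) (top_of_set (pin_set :: 'n clifford set)) S"
    "\<And>y. y \<in> polygon g \<Longrightarrow> pin_to_PO (S y) = f y"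
    using pin.lift_exists[OF compact_polygon convex_polygon f] by blast
  have "continuous_map (top_of_set {0..1}) (top_of_set (polygon g)) bloop"
    using bloop_continuous bloop_in by auto
  from continuous_map_compose[OF this S(1)] show ?thesis
    unfolding winding_def using S(2) bloop_in bloop_ends
    by (intro conjI exI[of _ "\<lambda>t. S (bloop t)"]) (auto simp: pi1_elems_def o_def)
qed

text \<open>The inner product of F with its grade involution is continuous and takes only the values
  1 and -1, according to parity.\<close>

lemma parity_const:
  fixes F :: "'a::topological_space \<Rightarrow> 'n clifford"
  assumes A: "connected A" and F: "continuous_map (top_of_set A) (top_of_set pin_set) F"
    and xy: "x \<in> A" "y \<in> A"
  shows "F x \<in> spin_set \<longleftrightarrow> F y \<in> spin_set"
proof -
  let ?e = "\<lambda>x. cl_grade_involution (F x) \<bullet> F x"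
  have Fp: "F x \<in> pin_set" if "x \<in> A" for x using F that by (auto simp: Pi_iff)
  have val: "?e x = (if F x \<in> spin_set then 1 else -1)" if "x \<in> A" for x
    using Fp[OF that] odd_pin_iff[OF Fp[OF that]] norm_pin[OF Fp[OF that]]
    by (auto simp: spin_set_def dot_square_norm)
  have cF: "continuous_on A F" using F by auto
  have c: "continuous_on A ?e"
    by (intro continuous_intros cF continuous_on_compose2[OF cl_grade_continuous[of UNIV] cF]) auto
  have co: "connected (?e ` A)" by (rule connected_continuous_image[OF c A])
  have "?e ` A \<subseteq> {1, -1}" using val by auto
  then have "finite (?e ` A)" by (rule finite_subset) simp
  then have "?e ` A = {} \<or> (\<exists>w. ?e ` A = {w})" using connected_finite_iff_sing[OF co] by simp
  then obtain w where w: "?e ` A = {w}" using xy by auto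
  have "?e x \<in> ?e ` A" "?e y \<in> ?e ` A" using xy by (auto intro: imageI)
  then have "?e x = ?e y" unfolding w by simp
  then show ?thesis using val[OF xy(1)] val[OF xy(2)] by (auto split: if_splits)
qed

section \<open>Extension of maps with winding 1 over the centre\<close>

lemma circle_loop_map:
  assumes c: "continuous_map (top_of_set {0..1::real}) Y c" and e: "c 1 = c 0"
  obtains h where "continuous_map (top_of_set (sphere (0::complex) 1)) Y h"
    "\<And>t. t \<in> {0..1} \<Longrightarrow> h (cis (2 * pi * t)) = c t"
proof -
  let ?h = "\<lambda>y. c (Arg2pi y / (2 * pi))"
  have h: "?h (cis (2 * pi * t)) = c t" if "t \<in> {0..1}" for t
  proof (cases "t = 1")
    case False
    then have "Arg2pi (cis (2 * pi * t)) = 2 * pi * t"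
      using that Arg2pi_unique[of 1 "2 * pi * t" "cis (2 * pi * t)"] by (simp add: cis_conv_exp)
    then show ?thesis by simp
  qed (use e Arg2pi_unique[of 1 0 1] in simp)
  have im: "(\<lambda>t. cis (2 * pi * t)) ` {0..1} = sphere 0 1"
  proof (intro equalityI subsetI)
    fix y :: complex assume y: "y \<in> sphere 0 1"
    then have "y = cis (2 * pi * (Arg2pi y / (2 * pi)))"
      using Arg2pi_eq[of y] by (simp add: cis_conv_exp)
    moreover have "Arg2pi y / (2 * pi) \<in> {0..1}"
      using Arg2pi_ge_0[of y] Arg2pi_lt_2pi[of y] by (simp add: field_simps)
    ultimately show "y \<in> (\<lambda>t. cis (2 * pi * t)) ` {0..1}" by blast
  qed auto
  have q: "quotient_map (top_of_set {0..1}) (top_of_set (sphere (0::complex) 1)) (\<lambda>t. cis (2 * pi * t))"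
  proof (rule T1_Spaces.continuous_imp_quotient_map)
    show "continuous_map (top_of_set {0..1}) (top_of_set (sphere (0::complex) 1)) (\<lambda>t. cis (2 * pi * t))"
      by (auto intro!: continuous_intros)
  qed (use im in \<open>auto simp: compact_space_subtopology Hausdorff_space_subtopology\<close>)
  have "continuous_map (top_of_set {0..1}) Y (?h \<circ> (\<lambda>t. cis (2 * pi * t)))"
    by (rule continuous_map_eq[OF c]) (use h in auto)
  from continuous_compose_quotient_map[OF q this] h show thesis by (intro that[of ?h]) auto
qed

text \<open>The map f is kept outside a small disc and replaced inside. On the circle it has a
  closed lift, which extends over the disc.\<close>

lemma winding_extend:
  assumes f: "continuous_map (top_of_set pstar) PO_topology f" and w: "winding f cl_one"
  obtains u where "continuous_map (top_of_set (polygon g)) PO_topology u"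
    "\<And>k t. k < 4 * g \<Longrightarrow> t \<in> {0..1} \<Longrightarrow> u (polygon_side g k t) = f (polygon_side g k t)"
proof -
  obtain e where e: "e > 0" "cball 0 e \<subseteq> polygon g" using cball_in_polygon by blast
  \<comment> \<open>Half the radius, so that the closed disc stays in the interior and away from the
    sides.\<close>
  define d where "d = e / 2"
  have d: "d > 0" "cball 0 d \<subseteq> polygon g" using e by (auto simp: d_def)
  have far: "norm (polygon_side g k t) \<ge> d" if "k < 4 * g" "t \<in> {0..1}" for k t
  proof (rule ccontr)
    assume "\<not> norm (polygon_side g k t) \<ge> d"
    then have "polygon_side g k t \<in> ball 0 e" using e by (simp add: d_def)
    moreover have "ball 0 e \<subseteq> interior (polygon g)"
      using e(2) by (intro interior_maximal) auto
    ultimately show False using side_not_interior[OF that] by blast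
  qed
  obtain c where c: "pin_path c"
    "\<And>t. t \<in> {0..1} \<Longrightarrow> pin_to_PO (c t) = f (of_real d * cis (2 * pi * t))" "c 1 = c 0 \<star> cl_one"
    using winding_circle_lift[OF f d w] by blast
  have c0: "c 0 \<in> pin_set" by (rule continuous_pin_in[OF c(1)]) simp
  \<comment> \<open>Division by the initial value moves the closed lift into Spin(n), where loops
    bound discs.\<close>
  have ce: "continuous_map (top_of_set {0..1}) (top_of_set (spin_set :: 'n clifford set)) (\<lambda>t. cl_conj (c 0) \<star> c t)"
  proof -
    have m: "pin_path (\<lambda>t. cl_conj (c 0) \<star> c t)"
      by (intro continuous_pin_mult c(1) continuous_pin_const pin_conj_closed c0)
    have "cl_conj (c 0) \<star> c t \<in> spin_set" if "t \<in> {0..1}" for t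
      using parity_const[OF _ m that, of 0] c0 spin_one by simp
    with m show ?thesis by auto
  qed
  obtain h where h: "continuous_map (top_of_set (sphere (0::complex) 1)) (top_of_set (spin_set :: 'n clifford set)) h"
    "\<And>t. t \<in> {0..1} \<Longrightarrow> h (cis (2 * pi * t)) = cl_conj (c 0) \<star> c t"
    using circle_loop_map[OF ce] c(3) by auto
  have "disc_extensible (spin_set :: 'n clifford set)" using dim_ge by (intro disc_extensible_spin) simp
  from disc_extensibleE[OF this h(1)] obtain H where
    H: "continuous_map (top_of_set (cball 0 1)) (top_of_set (spin_set :: 'n clifford set)) H"
    "\<And>x. x \<in> sphere 0 1 \<Longrightarrow> H x = h x" by blast
  define v where "v y = pin_to_PO (c 0 \<star> H (y / of_real d))" for y
  have v: "continuous_map (top_of_set (cball 0 d)) PO_topology v"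
  proof -
    have "continuous_map (top_of_set (cball 0 d)) (top_of_set (cball 0 1)) (\<lambda>y. y / complex_of_real d)"
      using d by (auto simp: norm_divide intro!: continuous_intros)
    from continuous_map_compose[OF this H(1)]
    have "continuous_map (top_of_set (cball 0 d)) (top_of_set (pin_set :: 'n clifford set)) (\<lambda>y. H (y / of_real d))"
      using spin_subset by (auto simp: o_def Pi_iff)
    then have "continuous_map (top_of_set (cball 0 d)) (top_of_set (pin_set :: 'n clifford set)) (\<lambda>y. c 0 \<star> H (y / of_real d))"
      by (intro continuous_pin_mult continuous_pin_const c0)
    from continuous_map_compose[OF this continuous_pin_to_PO] show ?thesis by (simp add: o_def v_def[abs_def])
  qed
  have vf: "v y = f y" if "norm y = d" for y
  proof -
    have "y / of_real d \<in> sphere 0 1" using that d by (simp add: norm_divide)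
    define t where "t = Arg2pi y / (2 * pi)"
    have t: "t \<in> {0..1}" using Arg2pi_ge_0[of y] Arg2pi_lt_2pi[of y] by (simp add: t_def field_simps)
    have y: "y = of_real d * cis (2 * pi * t)"
      using Arg2pi_eq[of y] that by (simp add: cis_conv_exp t_def)
    then have "y / of_real d = cis (2 * pi * t)" using d by simp
    then have "H (y / of_real d) = cl_conj (c 0) \<star> c t"
      using H(2)[OF \<open>y / of_real d \<in> sphere 0 1\<close>] h(2)[OF t] by simp
    then show ?thesis using c(2)[OF t] c0 by (simp add: v_def y)
  qed
  define u where "u y = (if norm y \<le> d then v y else f y)" for y
  let ?T = "\<lambda>b. if b then cball 0 d else polygon g - ball 0 d"
  have "continuous_map (top_of_set (polygon g)) PO_topology u"
  proof (rule pasting_lemma_closed[of "{True, False}" "top_of_set (polygon g)" ?T PO_topology "\<lambda>b. if b then v else f"])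
    have "closed (polygon g)" using compact_polygon by (rule compact_imp_closed)
    then show "closedin (top_of_set (polygon g)) (?T b)" if "b \<in> {True, False}" for b
      using d(2) by (auto simp: closed_subset closed_Diff)
    show "continuous_map (subtopology (top_of_set (polygon g)) (?T b)) PO_topology (if b then v else f)"
      if "b \<in> {True, False}" for b
    proof (cases b)
      case True
      then show ?thesis using v d(2) by (simp add: subtopology_subtopology Int_absorb1)
    next
      case False
      have "continuous_map (top_of_set (polygon g - ball 0 d)) PO_topology f"
        using f by (rule continuous_map_from_subtopology_mono) (use d in auto)
      moreover have "polygon g \<inter> (polygon g - ball 0 d) = polygon g - ball 0 d" by blast
      ultimately show ?thesis using False by (simp add: subtopology_subtopology)
    qed
    show "(if b then v else f) x = (if b' then v else f) x"
      if "b \<in> {True, False}" "b' \<in> {True, False}" "x \<in> topspace (top_of_set (polygon g)) \<inter> ?T b \<inter> ?T b'" for b b' x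
      using that vf[of x] by (auto split: if_splits)
    show "\<exists>j. j \<in> {True, False} \<and> x \<in> ?T j \<and> u x = (if j then v else f) x"
      if "x \<in> topspace (top_of_set (polygon g))" for x
      using that by (auto simp: u_def)
  qed simp
  moreover have "u (polygon_side g k t) = f (polygon_side g k t)" if "k < 4 * g" "t \<in> {0..1}" for k t
    using far[OF that] vf[of "polygon_side g k t"] by (auto simp: u_def)
  ultimately show thesis by (rule that)
qed

end

section \<open>Maps that are equivariant under the side pairing\<close>

locale reflected_polygon = pin_polygon dummy g
  for dummy :: "'n::{finite,linorder} itself" and g :: nat +
  fixes r :: "'n sq_matrix"
  assumes reflection: "hyperplane_reflection r"
begin

text \<open>An element of Pin(n) above \<open>r\<close>: a unit normal vector of its mirror, chosen
  among the two.\<close>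

definition rpin :: "'n clifford" where
  "rpin = cl_vec (SOME v. norm v = 1 \<and> (\<forall>x. r *v x = x - (2 * (v \<bullet> x)) *\<^sub>R v))"

lemma rpin: "rpin \<in> pin_set" "rpin \<notin> spin_set" "pin_to_PO rpin = PO_class r" "rpin \<star> rpin = - cl_one"
proof -
  define v where "v = (SOME v. norm v = 1 \<and> (\<forall>x. r *v x = x - (2 * (v \<bullet> x)) *\<^sub>R v))"
  have "norm v = 1 \<and> (\<forall>x. r *v x = x - (2 * (v \<bullet> x)) *\<^sub>R v)"
    using reflection unfolding hyperplane_reflection_def v_def by (rule someI_ex)
  then have v: "norm v = 1" "\<And>x. r *v x = x - (2 * (v \<bullet> x)) *\<^sub>R v" by blast+
  have rp: "rpin = cl_vec v" by (simp only: rpin_def v_def)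
  show "rpin \<in> pin_set" "rpin \<notin> spin_set" "rpin \<star> rpin = - cl_one"
    unfolding rp by (rule pin_vec[OF v(1)], rule spin_vec[OF v(1)], rule cl_vec_mult_self[OF v(1)])
  have "refl_matrix v = r"
    by (simp add: matrix_eq refl_matrix_apply hrefl_def v(2))
  then show "pin_to_PO rpin = PO_class r"
    by (simp add: rp pin_to_PO_def pin_to_O_vec[OF v(1)])
qed

text \<open>The identification over the pair of sides carrying \<open>A\<^sub>j\<close> is the transport along a loop
  crossing that pair, which is freely homotopic to \<open>B\<^sub>j\<close>, and vice versa. Hence the index
  \<open>2j + 1 - i\<close> for the sides \<open>4j + i\<close> and \<open>4j + i + 2\<close>.\<close>

definition nontrivial :: "(nat \<Rightarrow> bit) \<Rightarrow> nat \<Rightarrow> bool" where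
  "nontrivial m k \<longleftrightarrow> m (2 * (k div 4) + 1 - k mod 4) \<noteq> 0"

definition glue_pin :: "(nat \<Rightarrow> bit) \<Rightarrow> nat \<Rightarrow> 'n clifford" where
  "glue_pin m k = (if nontrivial m k then rpin else cl_one)"

definition glue :: "(nat \<Rightarrow> bit) \<Rightarrow> nat \<Rightarrow> 'n sq_matrix set" where
  "glue m k = pin_to_PO (glue_pin m k)"

lemma glue_pin_in: "glue_pin m k \<in> pin_set"
  using rpin by (simp add: glue_pin_def pin_set.one)

lemma glue_in: "glue m k \<in> carrier PO"
  by (simp add: glue_def glue_pin_in)

lemma glue_pin_commute: "glue_pin m k \<star> glue_pin m l = glue_pin m l \<star> glue_pin m k"
  by (simp add: glue_pin_def)

lemma glue_commute: "glue m k \<otimes>\<^bsub>PO\<^esub> glue m l = glue m l \<otimes>\<^bsub>PO\<^esub> glue m k"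
  by (simp add: glue_def pin_to_PO_mult glue_pin_in glue_pin_commute)

lemma glue_square: "glue m k \<otimes>\<^bsub>PO\<^esub> glue m k = \<one>\<^bsub>PO\<^esub>"
proof -
  have "glue_pin m k \<star> glue_pin m k \<in> pi1_elems"
    using rpin by (simp add: glue_pin_def pi1_elems_def)
  from pin_to_PO_pi1[OF this] show ?thesis
    by (simp add: glue_def pin_to_PO_mult glue_pin_in pin_to_PO_one)
qed

lemma glue_PSO_iff: "glue m k \<in> PSO \<longleftrightarrow> \<not> nontrivial m k"
  using PSO_pin_iff[OF glue_pin_in[of m k]] rpin spin_one by (auto simp: glue_def glue_pin_def)

text \<open>The condition satisfied by the transition between two trivializations with the same
  constant side identifications.\<close>

definition equivariant :: "(nat \<Rightarrow> bit) \<Rightarrow> (complex \<Rightarrow> 'n sq_matrix set) \<Rightarrow> bool" where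
  "equivariant m f \<longleftrightarrow> (\<forall>j<g. \<forall>i<2. \<forall>t\<in>{0..1}.
     f (polygon_side g (4 * j + i + 2) (1 - t)) =
       inv\<^bsub>PO\<^esub> (glue m (4 * j + i)) \<otimes>\<^bsub>PO\<^esub> f (polygon_side g (4 * j + i) t) \<otimes>\<^bsub>PO\<^esub> glue m (4 * j + i))"

text \<open>The part of a lift that runs over the side k; \<open>segment F k 0\<close> is its value
  at the vertex k.\<close>

definition segment :: "(real \<Rightarrow> 'n clifford) \<Rightarrow> nat \<Rightarrow> real \<Rightarrow> 'n clifford" where
  "segment F k u = F ((real k + u) / real (4 * g))"

lemma g4: "real (4 * g) > 0" using genus by simp

lemma segment_ends: "segment F k 1 = segment F (Suc k) 0" "segment F 0 0 = F 0" "segment F (4 * g) 0 = F 1"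
  using g4 by (simp_all add: segment_def add_ac)

lemma segment_props:
  assumes F: "pin_path F"
    and l: "\<And>t. t \<in> {0..1} \<Longrightarrow> pin_to_PO (F t) = f (bloop t)" and k: "k < 4 * g"
  shows "pin_path (segment F k)"
    "u \<in> {0..1} \<Longrightarrow> pin_to_PO (segment F k u) = f (polygon_side g k (reparam u))"
proof -
  have b: "(real k + u) / real (4 * g) \<in> {0..1}" if "u \<in> {0..1}" for u
  proof -
    have "real k + 1 \<le> real (4 * g)" using k by linarith
    then have "real k + u \<le> real (4 * g)" using that by simp
    then show ?thesis using that g4 by (simp del: of_nat_mult)
  qed
  have "continuous_map (top_of_set {0..1}) (top_of_set {0..1}) (\<lambda>u. (real k + u) / real (4 * g))"
    using b g4 by (auto intro!: continuous_intros)
  from continuous_map_compose[OF this F]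
  show "pin_path (segment F k)"
    by (simp add: o_def segment_def[abs_def])
  show "pin_to_PO (segment F k u) = f (polygon_side g k (reparam u))" if "u \<in> {0..1}"
    using l[OF b[OF that]] bloop_side[OF k that] by (simp add: segment_def)
qed

lemma segment_unique:
  assumes F: "pin_path F"
    and l: "\<And>t. t \<in> {0..1} \<Longrightarrow> pin_to_PO (F t) = f (bloop t)" and k: "k < 4 * g"
    and H: "pin_path H"
    and Hf: "\<And>u. u \<in> {0..1} \<Longrightarrow> pin_to_PO (H u) = f (polygon_side g k (reparam u))"
  obtains z where "z \<in> pi1_elems" "segment F k 0 = H 0 \<star> z" "segment F (Suc k) 0 = H 1 \<star> z"
proof -
  have "\<And>u. u \<in> {0..1} \<Longrightarrow> pin_to_PO (H u) = pin_to_PO (segment F k u)"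
    using segment_props(2)[OF F l k] Hf by simp
  from pin_lift_unique[OF _ H segment_props(1)[OF F l k] this] obtain z where
    "z \<in> pi1_elems" "\<And>u. u \<in> {0..1} \<Longrightarrow> segment F k u = H u \<star> z" by auto
  from this(1) this(2)[of 0] this(2)[of 1] show thesis
    by (intro that[of z]) (simp_all add: segment_ends(1)[symmetric])
qed

text \<open>The reversed lift over the side k, conjugated by \<open>glue_pin\<close>, is a lift over
  the side k + 2 and hence differs from the given one by a single kernel element. Both vertex
  equations contain the same z, and this makes the signs cancel around a block.\<close>

lemma paired_segments:
  assumes F: "pin_path F"
    and l: "\<And>t. t \<in> {0..1} \<Longrightarrow> pin_to_PO (F t) = f (bloop t)"
    and eq: "equivariant m f" and ji: "j < g" "i < 2"
  defines "k \<equiv> 4 * j + i"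
  obtains z where "z \<in> pi1_elems"
    "segment F (k + 3) 0 = cl_conj (glue_pin m k) \<star> segment F k 0 \<star> glue_pin m k \<star> z"
    "segment F (k + 2) 0 = cl_conj (glue_pin m k) \<star> segment F (k + 1) 0 \<star> glue_pin m k \<star> z"
proof -
  have k: "k < 4 * g" "k + 2 < 4 * g" using ji by (auto simp: k_def)
  let ?P = "glue_pin m k"
  define H where "H u = cl_conj ?P \<star> segment F k (1 - u) \<star> ?P" for u
  have m1: "continuous_map (top_of_set {0..1::real}) (top_of_set {0..1}) (\<lambda>u. 1 - u)"
    by (auto intro!: continuous_intros)
  have rev: "pin_path (\<lambda>u. segment F k (1 - u))"
    using continuous_map_compose[OF m1 segment_props(1)[OF F l k(1)]] by (simp add: o_def)
  have H: "pin_path H"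
    unfolding H_def by (intro continuous_pin_mult continuous_pin_const rev pin_conj_closed glue_pin_in)
  have Hf: "pin_to_PO (H u) = f (polygon_side g (k + 2) (reparam u))" if u: "u \<in> {0..1}" for u
  proof -
    have u': "1 - u \<in> {0..1}" using u by simp
    have s: "segment F k (1 - u) \<in> pin_set" by (rule continuous_pin_in[OF segment_props(1)[OF F l k(1)] u'])
    have "pin_to_PO (H u) = inv\<^bsub>PO\<^esub> (glue m k) \<otimes>\<^bsub>PO\<^esub> f (polygon_side g k (reparam (1 - u))) \<otimes>\<^bsub>PO\<^esub> glue m k"
      using s segment_props(2)[where f = f, OF F l k(1) u', symmetric] by (simp add: H_def glue_def pin_to_PO_mult[symmetric] pin_mult pin_conj_closed glue_pin_in inv_PO)
    also have "\<dots> = f (polygon_side g (k + 2) (1 - reparam (1 - u)))"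
      using eq ji reparam_props(3)[OF u'] unfolding equivariant_def k_def by simp
    also have "1 - reparam (1 - u) = reparam u" using reparam_props(4)[OF u] by simp
    finally show ?thesis .
  qed
  from segment_unique[OF F l k(2) H Hf] obtain z where z: "z \<in> pi1_elems" "segment F (k + 2) 0 = H 0 \<star> z"
    "segment F (Suc (k + 2)) 0 = H 1 \<star> z" by blast
  then show thesis
    by (intro that[of z]) (simp_all add: H_def segment_ends(1) add.commute numeral_3_eq_3)
qed

lemma pi1_sign: "z \<in> pi1_elems \<Longrightarrow> \<exists>s. (s = 1 \<or> s = -1) \<and> pin_to_O z = s *\<^sub>R (mat 1 :: 'n sq_matrix)"
  using pin_to_O_one pin_to_O_minus[OF pin_set.one] pin_to_O_omega[OF dim_even] pin_to_O_minus[OF pin_omega]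
  unfolding pi1_elems_def by (metis (no_types, opaque_lifting) insert_iff scaleR_minus1_left scaleR_one singletonD)

text \<open>Here K0, ..., K4 are the images in O(n) of the values of a lift at the vertices of one
  block. Going from K4 through K1 and K2 to K3 uses the sign t twice and BAB = A, so that K3 = s A
  K4 A, which is compared with K3 = s A K0 A.\<close>

lemma block_relation:
  fixes A B :: "'n sq_matrix"
  assumes A: "A ** A = mat 1" and B: "B ** B = mat 1" and AB: "A ** B = B ** A"
    and s: "s = 1 \<or> s = (-1::real)" and t: "t = 1 \<or> t = (-1::real)"
    and 1: "K3 = s *\<^sub>R (A ** K0 ** A)" "K2 = s *\<^sub>R (A ** K1 ** A)"
    and 2: "K4 = t *\<^sub>R (B ** K1 ** B)" "K3 = t *\<^sub>R (B ** K2 ** B)"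
  shows "K4 = K0"
proof -
  have sc: "(c *\<^sub>R M) ** N = c *\<^sub>R (M ** N)" "N ** (c *\<^sub>R M) = c *\<^sub>R (N ** M)" for c and M N :: "'n sq_matrix"
    by (simp_all add: matrix_scalar_ac scalar_matrix_assoc flip: scalar_mult_eq_scaleR)
  have cancel: "X ** (X ** M) = M" if "X ** X = mat 1" for X M :: "'n sq_matrix"
    using that by (simp add: matrix_mul_assoc)
  have cancel': "M ** X ** X = M" if "X ** X = mat 1" for X M :: "'n sq_matrix"
    using that by (simp flip: matrix_mul_assoc)
  have st: "s * s = 1" "t * t = 1" using s t by auto
  have K1: "K1 = t *\<^sub>R (B ** K4 ** B)"
    using cancel[OF B] cancel'[OF B] st by (simp add: 2(1) sc flip: matrix_mul_assoc)
  have "s *\<^sub>R (A ** K0 ** A) = t *\<^sub>R (B ** (s *\<^sub>R (A ** (t *\<^sub>R (B ** K4 ** B)) ** A)) ** B)"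
    using 1 2 K1 by metis
  also have "\<dots> = s *\<^sub>R (B ** A ** B ** K4 ** (B ** A ** B))"
    using st by (simp add: sc matrix_mul_assoc mult.left_commute[of t s t])
  also have "B ** A ** B = A" using AB cancel'[OF B, of A] by metis
  finally have "A ** K0 ** A = A ** K4 ** A" using s by auto
  then have "A ** (A ** K0 ** A) ** A = A ** (A ** K4 ** A) ** A" by simp
  then show ?thesis using A by (simp add: matrix_mul_assoc) (simp add: A flip: matrix_mul_assoc)
qed

lemma pin_to_O_glue:
  "pin_to_O (glue_pin m k) ** pin_to_O (glue_pin m k) = mat 1"
  "pin_to_O (cl_conj (glue_pin m k)) = pin_to_O (glue_pin m k)"
proof -
  show "pin_to_O (glue_pin m k) ** pin_to_O (glue_pin m k) = mat 1" for k
  proof (cases "nontrivial m k")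
    case True
    then have "pin_to_O (glue_pin m k \<star> glue_pin m k) = pin_to_O (- cl_one)"
      using rpin by (simp add: glue_pin_def)
    then show ?thesis
      using pin_to_O_minus[OF pin_set.one] by (simp add: pin_to_O_mult glue_pin_in pin_to_O_one)
  qed (simp add: glue_pin_def pin_to_O_one)
  show "pin_to_O (cl_conj (glue_pin m k)) = pin_to_O (glue_pin m k)"
  proof (cases "nontrivial m k")
    case True
    have "cl_conj rpin = - rpin"
      using pin_conj_left'[OF rpin(1), of rpin] by (simp add: rpin cl.minus_right minus_equation_iff)
    then show ?thesis using True pin_to_O_minus[OF rpin(1)] by (simp add: glue_pin_def)
  qed (simp add: glue_pin_def)
qed

lemma segment_in:
  assumes F: "pin_path F" and k: "k \<le> 4 * g"
  shows "segment F k 0 \<in> pin_set"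
  unfolding segment_def using k g4 by (intro continuous_pin_in[OF F]) (simp add: divide_le_eq_1 del: of_nat_mult)

text \<open>In O(n) the kernel elements become signs and \<open>block_relation\<close> applies, so
  the lift returns after each block to its initial value up to sign. If m vanishes, all gluing lifts
  are 1 and the computation in Pin(n) itself has no sign left.\<close>

lemma equivariant_winding:
  assumes eq: "equivariant m f" and w: "winding f z"
  shows "z = cl_one \<or> z = - cl_one" "(\<And>k. k < 2 * g \<Longrightarrow> m k = 0) \<Longrightarrow> z = cl_one"
proof -
  from w obtain F where F: "pin_path F"
    and l: "\<And>t. t \<in> {0..1} \<Longrightarrow> pin_to_PO (F t) = f (bloop t)" and Fz: "F 1 = F 0 \<star> z" and z: "z \<in> pi1_elems"
    by (auto simp: winding_def)
  let ?K = "\<lambda>k. segment F k 0"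
  have block: "(?K (4 * j + 4) = ?K (4 * j) \<or> ?K (4 * j + 4) = - ?K (4 * j)) \<and>
     ((\<forall>k<2 * g. m k = 0) \<longrightarrow> ?K (4 * j + 4) = ?K (4 * j))" if j: "j < g" for j
  proof -
    let ?A = "glue_pin m (4 * j)" and ?B = "glue_pin m (4 * j + 1)"
    obtain c where c: "c \<in> pi1_elems" "?K (4 * j + 3) = cl_conj ?A \<star> ?K (4 * j) \<star> ?A \<star> c"
      "?K (4 * j + 2) = cl_conj ?A \<star> ?K (4 * j + 1) \<star> ?A \<star> c"
      using paired_segments[OF F l eq j, of 0] by auto
    obtain d where d: "d \<in> pi1_elems" "?K (4 * j + 4) = cl_conj ?B \<star> ?K (4 * j + 1) \<star> ?B \<star> d"
      "?K (4 * j + 3) = cl_conj ?B \<star> ?K (4 * j + 2) \<star> ?B \<star> d"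
      using paired_segments[OF F l eq j, of 1] by (auto simp: add.commute numeral_eq_Suc)
    have K: "?K (4 * j + i) \<in> pin_set" if "i \<le> 4" for i
      using j that by (intro segment_in[OF F]) linarith
    obtain s where s: "s = 1 \<or> s = -1" "pin_to_O c = s *\<^sub>R (mat 1 :: 'n sq_matrix)" using pi1_sign[OF c(1)] by blast
    obtain t where t: "t = 1 \<or> t = -1" "pin_to_O d = t *\<^sub>R (mat 1 :: 'n sq_matrix)" using pi1_sign[OF d(1)] by blast
    have sc: "N ** (c *\<^sub>R mat 1) = c *\<^sub>R N" for c and N :: "'n sq_matrix"
      by (simp add: matrix_scalar_ac flip: scalar_mult_eq_scaleR)
    have rel: "pin_to_O (cl_conj P \<star> K \<star> P \<star> c) = s *\<^sub>R (pin_to_O P ** pin_to_O K ** pin_to_O P)"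
      if "P = ?A \<or> P = ?B" "K \<in> pin_set" "c \<in> pi1_elems" "pin_to_O c = s *\<^sub>R (mat 1 :: 'n sq_matrix)" for P K c s
      using that by (auto simp: pin_to_O_mult pin_mult glue_pin_in pin_conj_closed pi1_pin pin_to_O_glue sc)
    have comm: "pin_to_O ?A ** pin_to_O ?B = pin_to_O ?B ** pin_to_O ?A"
      using glue_pin_commute[of m "4 * j" "4 * j + 1"] pin_to_O_mult[OF glue_pin_in glue_pin_in] by metis
    have r: "pin_to_O (?K (4 * j + 3)) = s *\<^sub>R (pin_to_O ?A ** pin_to_O (?K (4 * j)) ** pin_to_O ?A)"
      "pin_to_O (?K (4 * j + 2)) = s *\<^sub>R (pin_to_O ?A ** pin_to_O (?K (4 * j + 1)) ** pin_to_O ?A)"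
      "pin_to_O (?K (4 * j + 4)) = t *\<^sub>R (pin_to_O ?B ** pin_to_O (?K (4 * j + 1)) ** pin_to_O ?B)"
      unfolding c(2,3) d(2) using K[of 0] K[of 1] by (intro rel c(1) d(1) s(2) t(2); simp)+
    have r4: "pin_to_O (?K (4 * j + 3)) = t *\<^sub>R (pin_to_O ?B ** pin_to_O (?K (4 * j + 2)) ** pin_to_O ?B)"
      unfolding d(3) using K[of 2] by (intro rel d(1) t(2); simp)
    have "pin_to_O (?K (4 * j + 4)) = pin_to_O (?K (4 * j))"
      by (rule block_relation[OF pin_to_O_glue(1) pin_to_O_glue(1) comm s(1) t(1) r r4])
    then have 1: "?K (4 * j) = ?K (4 * j + 4) \<or> ?K (4 * j) = - ?K (4 * j + 4)"
      using pin_to_O_eq_iff[OF K[of 4] K[of 0]] by simp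
    have 2: "?K (4 * j + 4) = ?K (4 * j)" if triv: "\<forall>k<2 * g. m k = 0"
    proof -
      have "(4 * j + 1) div 4 = j" "(4 * j + 1) mod 4 = 1" by simp_all
      then have AB: "?A = cl_one" "?B = cl_one"
        using triv j by (auto simp: glue_pin_def nontrivial_def)
      \<comment> \<open>The value at the third vertex is reached over both pairs: K0 c = K3 = K2 d =
        K1 c d, while K4 = K1 d.\<close>
      have "?K (4 * j) \<star> c = ?K (4 * j + 1) \<star> d \<star> c"
        using c d AB pi1_commute[OF c(1) d(1)] by (simp add: cl_assoc)
      then have "?K (4 * j) \<star> c = ?K (4 * j + 4) \<star> c" using d AB by simp
      then show ?thesis using pin_cancel_right[OF pi1_pin[OF c(1)]] by simp
    qed
    show ?thesis using 1 2 by auto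
  qed
  have all: "(?K (4 * j) = ?K 0 \<or> ?K (4 * j) = - ?K 0) \<and> ((\<forall>k<2 * g. m k = 0) \<longrightarrow> ?K (4 * j) = ?K 0)"
    if "j \<le> g" for j
    using that
  proof (induct j)
    case (Suc j)
    then show ?case using block[of j] by (auto simp: add.commute)
  qed simp
  have "F 0 \<in> pin_set" by (rule continuous_pin_in[OF F]) simp
  then have can: "F 0 \<star> z = F 0 \<star> x \<Longrightarrow> z = x" for x using pin_cancel by blast
  from all[of g] show "z = cl_one \<or> z = - cl_one" "(\<And>k. k < 2 * g \<Longrightarrow> m k = 0) \<Longrightarrow> z = cl_one"
    using can[of cl_one] can[of "- cl_one"] by (auto simp: segment_ends Fz cl.minus_right)
qed

lemma pole_segment_one:
  assumes F: "pin_path F"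
    and l: "\<And>t. t \<in> {0..1} \<Longrightarrow> pin_to_PO (F t) = f (bloop t)" and k: "k < 4 * g"
    and f: "\<And>t. t \<in> {0..1} \<Longrightarrow> f (polygon_side g k t) = \<one>\<^bsub>PO\<^esub>"
  shows "segment F (Suc k) 0 = segment F k 0"
proof -
  have one: "pin_path (\<lambda>_. cl_one)"
    by (rule continuous_pin_const[OF pin_set.one])
  have "pin_to_PO cl_one = f (polygon_side g k (reparam u))" if "u \<in> {0..1}" for u
    using f[OF reparam_props(3)[OF that]] by (simp add: pin_to_PO_one)
  from segment_unique[where f = f, OF F l k one this] show ?thesis by metis
qed

text \<open>The map follows a path from 1 to omega on one side. Equivariance forces on the partner
  side the reversed path conjugated by \<open>rpin\<close>, which runs from -omega to 1 because
  \<open>rpin\<close> is odd; all other sides carry the neutral element. Up to the initial factor,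
  the lift thus goes from 1 to omega and then from omega to -1.\<close>

lemma twist_exists:
  assumes k0: "j0 < g" "i0 < 2" "nontrivial m (4 * j0 + i0)"
  obtains f where "continuous_map (top_of_set pstar) PO_topology f" "equivariant m f"
    "winding f (- cl_one)" "f (bloop 0) \<in> PSO"
proof -
  let ?k = "4 * j0 + i0"
  have k4: "?k < 4 * g" "?k + 2 < 4 * g" using k0 by auto
  have "path_connected (spin_set :: 'n clifford set)" using dim_ge by (intro path_connected_spin) simp
  then obtain \<gamma> where \<gamma>: "path \<gamma>" "path_image \<gamma> \<subseteq> spin_set" "\<gamma> 0 = cl_one" "\<gamma> 1 = (cl_omega :: 'n clifford)"
    using omega_spin spin_one unfolding path_connected_def pathstart_def pathfinish_def by metis
  have gm: "pin_path \<gamma>"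
    using \<gamma>(1,2) spin_subset by (auto simp: path_def path_image_def)
  have rev: "continuous_map (top_of_set {0..1::real}) (top_of_set {0..1}) (\<lambda>u. 1 - u)"
    by (auto intro!: continuous_intros)
  define \<delta> where "\<delta> u = cl_conj rpin \<star> \<gamma> (1 - u) \<star> rpin" for u
  have dm: "pin_path \<delta>"
    unfolding \<delta>_def using continuous_map_compose[OF rev gm]
    by (intro continuous_pin_mult continuous_pin_const pin_conj_closed rpin) (simp add: o_def)
  have \<delta>0: "\<delta> 0 = - cl_omega" "\<delta> 1 = cl_one"
    using \<gamma>(3,4) rpin omega_commute[OF dim_even rpin(1)]
    by (auto simp: \<delta>_def cl_assoc) (metis cl.minus_right minus_minus pin_conj_left' rpin(1))
  define c where "c k = (if k = ?k then pin_to_PO \<circ> \<gamma> else if k = ?k + 2 then pin_to_PO \<circ> \<delta> else (\<lambda>_. \<one>\<^bsub>PO\<^esub>))" for k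
  have ends: "pin_to_PO (cl_omega :: 'n clifford) = \<one>\<^bsub>PO\<^esub>" "pin_to_PO (- cl_omega :: 'n clifford) = \<one>\<^bsub>PO\<^esub>"
    "pin_to_PO (cl_one :: 'n clifford) = \<one>\<^bsub>PO\<^esub>"
    using pin_to_PO_pi1[of cl_omega] pin_to_PO_pi1[of "- cl_omega"] by (auto simp: pi1_elems_def pin_to_PO_one)
  have c01: "c k 0 = \<one>\<^bsub>PO\<^esub>" "c k 1 = \<one>\<^bsub>PO\<^esub>" for k
    by (auto simp: c_def \<gamma> \<delta>0 ends)
  have cc: "continuous_map (top_of_set {0..1}) PO_topology (c k)" for k
    unfolding c_def
    using continuous_map_compose[OF gm continuous_pin_to_PO] continuous_map_compose[OF dm continuous_pin_to_PO]
    by (auto simp: topspace_PO)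
  obtain f where f: "continuous_map (top_of_set (- {0})) PO_topology f"
    "\<And>k y. k < 4 * g \<Longrightarrow> y \<in> sector k \<Longrightarrow> f y = c k (side_param k y)"
    using radial_extension[where c = c, OF cc] c01 by metis
  have fs: "f (polygon_side g k t) = c k t" if "k < 4 * g" "t \<in> {0..1}" for k t
    using f(2)[OF that(1) side_in_sector[OF that(2)]] side_param_side by simp
  have fp: "continuous_map (top_of_set pstar) PO_topology f"
    using f(1) by (rule continuous_map_from_subtopology_mono) auto
  have eqv: "equivariant m f"
    unfolding equivariant_def
  proof (intro allI impI ballI)
    fix j i t assume ji: "j < g" "i < (2::nat)" and t: "t \<in> {0..1::real}"
    let ?l = "4 * j + i"
    have l: "?l < 4 * g" "?l + 2 < 4 * g" using ji by auto
    have t': "1 - t \<in> {0..1}" using t by simp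
    show "f (polygon_side g (?l + 2) (1 - t)) =
       inv\<^bsub>PO\<^esub> (glue m ?l) \<otimes>\<^bsub>PO\<^esub> f (polygon_side g ?l t) \<otimes>\<^bsub>PO\<^esub> glue m ?l"
      unfolding fs[OF l(1) t] fs[OF l(2) t']
    proof (cases "?l = ?k")
      case True
      have "\<gamma> t \<in> pin_set" by (rule continuous_pin_in[OF gm t])
      then show "c (?l + 2) (1 - t) = inv\<^bsub>PO\<^esub> (glue m ?l) \<otimes>\<^bsub>PO\<^esub> c ?l t \<otimes>\<^bsub>PO\<^esub> glue m ?l"
        using k0(3) rpin(1) unfolding True
        by (simp add: c_def \<delta>_def glue_def glue_pin_def inv_PO pin_to_PO_mult[symmetric] pin_mult pin_conj_closed)
    next
      case False
      have "?l \<noteq> ?k + 2" "?k \<noteq> ?l + 2" using ji k0 by presburger+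
      with False show "c (?l + 2) (1 - t) = inv\<^bsub>PO\<^esub> (glue m ?l) \<otimes>\<^bsub>PO\<^esub> c ?l t \<otimes>\<^bsub>PO\<^esub> glue m ?l"
        by (simp add: c_def glue_in)
    qed
  qed
  obtain z where w: "winding f z" using winding_exists[OF fp] by blast
  then obtain F where F: "pin_path F"
    and l: "\<And>t. t \<in> {0..1} \<Longrightarrow> pin_to_PO (F t) = f (bloop t)" and Fz: "F 1 = F 0 \<star> z" and z: "z \<in> pi1_elems"
    by (auto simp: winding_def)
  let ?K = "\<lambda>k. segment F k 0"
  have triv: "?K (Suc k) = ?K k" if "k < 4 * g" "k \<noteq> ?k" "k \<noteq> ?k + 2" for k
    by (rule pole_segment_one[where f = f, OF F l that(1)]) (use that fs in \<open>auto simp: c_def\<close>)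
  have lo: "?K k = ?K 0" if "k \<le> ?k" for k
    using that triv k4 by (induct k) auto
  have hi: "?K (?k + 3 + k) = ?K (?k + 3)" if "?k + 3 + k \<le> 4 * g" for k
    using that
  proof (induct k)
    case (Suc k)
    then show ?case using triv[of "?k + 3 + k"] by simp
  qed simp
  have K4: "?K (4 * g) = ?K (?k + 3)" using hi[of "4 * g - (?k + 3)"] k4 by simp
  have rep: "continuous_map (top_of_set {0..1}) (top_of_set {0..1}) reparam"
    using reparam_props(3,5) by auto
  have g1: "pin_path (\<lambda>u. \<gamma> (reparam u))"
    "pin_path (\<lambda>u. \<delta> (reparam u))"
    using continuous_map_compose[OF rep gm] continuous_map_compose[OF rep dm] by (simp_all add: o_def)
  have "pin_to_PO (\<gamma> (reparam u)) = f (polygon_side g ?k (reparam u))"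
    "pin_to_PO (\<delta> (reparam u)) = f (polygon_side g (?k + 2) (reparam u))" if "u \<in> {0..1}" for u
    using fs[OF k4(1) reparam_props(3)[OF that]] fs[OF k4(2) reparam_props(3)[OF that]] by (auto simp: c_def)
  from segment_unique[where f = f, OF F l k4(1) g1(1) this(1)] segment_unique[where f = f, OF F l k4(2) g1(2) this(2)]
  obtain a b where a: "a \<in> pi1_elems" "?K ?k = \<gamma> (reparam 0) \<star> a" "?K (Suc ?k) = \<gamma> (reparam 1) \<star> a"
    and b: "b \<in> pi1_elems" "?K (?k + 2) = \<delta> (reparam 0) \<star> b" "?K (Suc (?k + 2)) = \<delta> (reparam 1) \<star> b"
    by metis
  \<comment> \<open>The side between the two carries the neutral element, so the lift is constant on
    it.\<close>
  have "?K (?k + 2) = ?K (Suc ?k)" using triv[of "Suc ?k"] k4 by simp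
  then have "- (cl_omega \<star> b) = cl_omega \<star> a"
    using a b by (simp add: reparam_props \<gamma> \<delta>0 cl.minus_left)
  then have "cl_omega \<star> (- b) = cl_omega \<star> a" by (simp add: cl.minus_right)
  then have ab: "- b = a" using pin_cancel[OF pin_omega] by metis
  have "?K (?k + 3) = b" using b by (simp add: reparam_props \<delta>0 numeral_eq_Suc)
  moreover have "?K ?k = a" using a by (simp add: reparam_props \<gamma>)
  ultimately have "F 1 = - F 0" using K4 lo[of ?k] ab by (simp add: segment_ends minus_equation_iff)
  then have "F 0 \<star> z = F 0 \<star> (- cl_one)" by (simp add: Fz cl.minus_right)
  then have "z = - cl_one" using pin_cancel[OF continuous_pin_in[OF F]] by simp
  moreover have "f (bloop 0) \<in> PSO"
  proof -
    have "F 0 = a" using \<open>?K ?k = a\<close> lo[of ?k] by (simp add: segment_ends)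
    then show ?thesis using l[of 0] PSO_pin_iff[OF pi1_pin[OF a(1)]] pi1_spin[OF a(1)] by simp
  qed
  ultimately show thesis using that fp eqv w by blast
qed

end

section \<open>Principal PO(n)-bundles\<close>

lemma trivialization_inverse:
  assumes "trivialization G T X E W \<phi>"
  obtains \<psi> where "homeomorphic_maps (prod_topology (subtopology X W) T)
       (subtopology (total_space E) {e \<in> topspace (total_space E). bundle_proj E e \<in> W}) \<phi> \<psi>"
  using assms unfolding trivialization_def homeomorphic_map_maps by blast

context even_dim
begin

lemma PO_mult_continuous:
  assumes "continuous_map Y PO_topology f" "continuous_map Y PO_topology h"
  shows "continuous_map Y PO_topology (\<lambda>y. f y \<otimes>\<^bsub>(PO :: 'n sq_matrix set monoid)\<^esub> h y)"
  by (rule continuous_map_const_subtopology_pair[OF assms continuous_PO_mult])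

lemma PO_inv_continuous:
  assumes "continuous_map Y PO_topology f"
  shows "continuous_map Y PO_topology (\<lambda>y. inv\<^bsub>(PO :: 'n sq_matrix set monoid)\<^esub> (f y))"
  using continuous_map_compose[OF assms continuous_PO_inv] by (simp add: o_def)

lemma PO_in: "continuous_map Y PO_topology f \<Longrightarrow> y \<in> topspace Y \<Longrightarrow> f y \<in> carrier PO"
  using continuous_map_image_subset_topspace[of Y PO_topology f] by (auto simp: topspace_PO)

end

locale PO_bundle = even_dim dummy
  for dummy :: "'n::{finite,linorder} itself" +
  fixes X :: "'x topology" and E :: "('e, 'x, 'n sq_matrix set) bundle_data"
  assumes is_bundle: "principal_bundle PO PO_topology X E"
begin

abbreviation TE :: "'e topology" where "TE \<equiv> total_space E"
abbreviation prj :: "'e \<Rightarrow> 'x" where "prj \<equiv> bundle_proj E"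
abbreviation act :: "'e \<Rightarrow> 'n sq_matrix set \<Rightarrow> 'e" where "act \<equiv> bundle_act E"

text \<open>The translation function of the bundle; \<open>act_free\<close> and
  \<open>act_transitive\<close> give uniqueness and existence for points of one fibre.\<close>

definition bdiv :: "'e \<Rightarrow> 'e \<Rightarrow> 'n sq_matrix set" where
  "bdiv e e' = (THE a. a \<in> carrier PO \<and> act e a = e')"

lemma bundle_props:
  "continuous_map TE X prj" "continuous_map (prod_topology TE PO_topology) TE (\<lambda>(e, a). act e a)"
  "e \<in> topspace TE \<Longrightarrow> act e \<one>\<^bsub>PO\<^esub> = e"
  "e \<in> topspace TE \<Longrightarrow> a \<in> carrier PO \<Longrightarrow> prj (act e a) = prj e"
  "e \<in> topspace TE \<Longrightarrow> a \<in> carrier PO \<Longrightarrow> b \<in> carrier PO \<Longrightarrow> act (act e a) b = act e (a \<otimes>\<^bsub>PO\<^esub> b)"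
  "x \<in> topspace X \<Longrightarrow> \<exists>W \<phi>. openin X W \<and> x \<in> W \<and> trivialization PO PO_topology X E W \<phi>"
  using is_bundle unfolding principal_bundle_def by auto

lemma act_in: "e \<in> topspace TE \<Longrightarrow> a \<in> carrier PO \<Longrightarrow> act e a \<in> topspace TE"
  using continuous_map_image_subset_topspace[OF bundle_props(2)] by (force simp: topspace_PO)

lemma prj_in: "e \<in> topspace TE \<Longrightarrow> prj e \<in> topspace X"
  using continuous_map_image_subset_topspace[OF bundle_props(1)] by blast

definition local_coord :: "'x set \<Rightarrow> ('x \<times> 'n sq_matrix set \<Rightarrow> 'e) \<Rightarrow> ('e \<Rightarrow> 'n sq_matrix set) \<Rightarrow> bool" where
  "local_coord W \<phi> \<gamma> \<longleftrightarrow>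
    continuous_map (subtopology TE {e \<in> topspace TE. prj e \<in> W}) PO_topology \<gamma> \<and>
    (\<forall>e\<in>topspace TE. prj e \<in> W \<longrightarrow> \<gamma> e \<in> carrier PO \<and> \<phi> (prj e, \<gamma> e) = e) \<and>
    (\<forall>x\<in>W. \<forall>a\<in>carrier PO. \<phi> (x, a) \<in> topspace TE \<and> prj (\<phi> (x, a)) = x \<and> \<gamma> (\<phi> (x, a)) = a \<and>
      (\<forall>b\<in>carrier PO. act (\<phi> (x, a)) b = \<phi> (x, a \<otimes>\<^bsub>PO\<^esub> b)))"

lemma local_coordD:
  assumes "local_coord W \<phi> \<gamma>"
  shows "continuous_map (subtopology TE {e \<in> topspace TE. prj e \<in> W}) PO_topology \<gamma>"
    "\<And>e. e \<in> topspace TE \<Longrightarrow> prj e \<in> W \<Longrightarrow> \<gamma> e \<in> carrier PO \<and> \<phi> (prj e, \<gamma> e) = e"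
    "\<And>x a. x \<in> W \<Longrightarrow> a \<in> carrier PO \<Longrightarrow> \<phi> (x, a) \<in> topspace TE \<and> prj (\<phi> (x, a)) = x \<and> \<gamma> (\<phi> (x, a)) = a"
    "\<And>x a b. x \<in> W \<Longrightarrow> a \<in> carrier PO \<Longrightarrow> b \<in> carrier PO \<Longrightarrow> act (\<phi> (x, a)) b = \<phi> (x, a \<otimes>\<^bsub>PO\<^esub> b)"
  using assms unfolding local_coord_def by blast+

lemma local_coordinate:
  assumes "trivialization PO PO_topology X E W \<phi>"
  obtains \<gamma> where "local_coord W \<phi> \<gamma>"
proof -
  let ?EW = "{e \<in> topspace TE. prj e \<in> W}"
  obtain \<psi> where \<psi>: "homeomorphic_maps (prod_topology (subtopology X W) PO_topology) (subtopology TE ?EW) \<phi> \<psi>"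
    using trivialization_inverse[OF assms] .
  have WX: "W \<subseteq> topspace X"
    and tr: "\<And>x a. x \<in> W \<Longrightarrow> a \<in> carrier PO \<Longrightarrow> prj (\<phi> (x, a)) = x"
    and tm: "\<And>x a b. x \<in> W \<Longrightarrow> a \<in> carrier PO \<Longrightarrow> b \<in> carrier PO \<Longrightarrow> \<phi> (x, a \<otimes>\<^bsub>PO\<^esub> b) = act (\<phi> (x, a)) b"
    using assms unfolding trivialization_def by auto
  have c: "continuous_map (prod_topology (subtopology X W) PO_topology) (subtopology TE ?EW) \<phi>"
    "continuous_map (subtopology TE ?EW) (prod_topology (subtopology X W) PO_topology) \<psi>"
    and inv: "\<And>x a. x \<in> W \<Longrightarrow> a \<in> carrier PO \<Longrightarrow> \<psi> (\<phi> (x, a)) = (x, a)"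
      "\<And>e. e \<in> ?EW \<Longrightarrow> \<phi> (\<psi> e) = e"
    using \<psi> WX by (auto simp: homeomorphic_maps_def topspace_PO)
  have top: "\<phi> (x, a) \<in> topspace TE" if "x \<in> W" "a \<in> carrier PO" for x a
    using continuous_map_image_subset_topspace[OF c(1)] that WX by (force simp: topspace_PO)
  have \<psi>in: "fst (\<psi> e) \<in> W \<and> snd (\<psi> e) \<in> carrier PO" if "e \<in> ?EW" for e
  proof -
    have "\<psi> e \<in> topspace (prod_topology (subtopology X W) PO_topology)"
      using continuous_map_image_subset_topspace[OF c(2)] that by auto
    then show ?thesis by (auto simp: topspace_PO)
  qed
  have "local_coord W \<phi> (snd \<circ> \<psi>)"
    unfolding local_coord_def
  proof (intro conjI ballI impI)
    show "continuous_map (subtopology TE ?EW) PO_topology (snd \<circ> \<psi>)"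
      by (rule continuous_map_compose[OF c(2) continuous_map_snd])
    have "(snd \<circ> \<psi>) e \<in> carrier PO \<and> \<phi> (prj e, (snd \<circ> \<psi>) e) = e" if "e \<in> topspace TE" "prj e \<in> W" for e
    proof -
      have e: "e \<in> ?EW" using that by simp
      have "prj e = fst (\<psi> e)" using tr[of "fst (\<psi> e)" "snd (\<psi> e)"] \<psi>in[OF e] inv(2)[OF e] by simp
      then show ?thesis using \<psi>in[OF e] inv(2)[OF e] by simp
    qed
    then show "(snd \<circ> \<psi>) e \<in> carrier PO" "\<phi> (prj e, (snd \<circ> \<psi>) e) = e"
      if "e \<in> topspace TE" "prj e \<in> W" for e using that by blast+
  qed (use tr tm top inv(1) in auto)
  then show thesis by (rule that)
qed

text \<open>In a local trivialization the action is right translation in PO(n).\<close>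

lemma act_free:
  assumes "e \<in> topspace TE" "a \<in> carrier PO" "b \<in> carrier PO" "act e a = act e b"
  shows "a = b"
proof -
  obtain W \<phi> where W: "prj e \<in> W" "trivialization PO PO_topology X E W \<phi>"
    using bundle_props(6)[OF prj_in[OF assms(1)]] by blast
  obtain \<gamma> where lc: "local_coord W \<phi> \<gamma>" using local_coordinate[OF W(2)] by blast
  note g = local_coordD(2-4)[OF lc]
  have e: "\<gamma> e \<in> carrier PO" "\<phi> (prj e, \<gamma> e) = e" using g(1)[OF assms(1) W(1)] by auto
  have "\<gamma> (act e c) = \<gamma> e \<otimes>\<^bsub>PO\<^esub> c" if "c \<in> carrier PO" for c
    using g(3)[OF W(1) e(1) that] g(2)[OF W(1), of "\<gamma> e \<otimes>\<^bsub>PO\<^esub> c"] e that by simp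
  from this[OF assms(2)] this[OF assms(3)] assms(4) have "\<gamma> e \<otimes>\<^bsub>PO\<^esub> a = \<gamma> e \<otimes>\<^bsub>PO\<^esub> b" by simp
  then show ?thesis using e(1) assms(2,3) by simp
qed

lemma bdiv_eqI:
  assumes "e \<in> topspace TE" "a \<in> carrier PO" "act e a = e'"
  shows "bdiv e e' = a"
  unfolding bdiv_def
proof (rule the_equality)
  show "b = a" if "b \<in> carrier PO \<and> act e b = e'" for b
    using act_free[OF assms(1) _ assms(2), of b] that assms(3) by simp
qed (use assms in simp)

lemma bdiv_act: "e \<in> topspace TE \<Longrightarrow> a \<in> carrier PO \<Longrightarrow> bdiv e (act e a) = a"
  by (rule bdiv_eqI) auto

lemma act_transitive:
  assumes "e \<in> topspace TE" "e' \<in> topspace TE" "prj e = prj e'"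
  shows "bdiv e e' \<in> carrier PO \<and> act e (bdiv e e') = e'"
proof -
  obtain W \<phi> where W: "prj e \<in> W" "trivialization PO PO_topology X E W \<phi>"
    using bundle_props(6)[OF prj_in[OF assms(1)]] by blast
  obtain \<gamma> where lc: "local_coord W \<phi> \<gamma>" using local_coordinate[OF W(2)] by blast
  note g = local_coordD(2-4)[OF lc]
  have e: "\<gamma> e \<in> carrier PO" "\<phi> (prj e, \<gamma> e) = e" "\<gamma> e' \<in> carrier PO" "\<phi> (prj e, \<gamma> e') = e'"
    using g(1)[OF assms(1) W(1)] g(1)[OF assms(2)] W(1) assms(3) by auto
  have "act e (inv\<^bsub>PO\<^esub> (\<gamma> e) \<otimes>\<^bsub>PO\<^esub> \<gamma> e') = e'"
    using g(3)[OF W(1) e(1), of "inv\<^bsub>PO\<^esub> (\<gamma> e) \<otimes>\<^bsub>PO\<^esub> \<gamma> e'"] e by (simp add: PO.inv_solve_left' PO.m_assoc[symmetric])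
  moreover have "inv\<^bsub>PO\<^esub> (\<gamma> e) \<otimes>\<^bsub>PO\<^esub> \<gamma> e' \<in> carrier PO" using e by simp
  ultimately show ?thesis using bdiv_eqI[OF assms(1)] by metis
qed

text \<open>Locally the division is \<open>\<gamma> e\<close> inverted times
  \<open>\<gamma> e'\<close>, for the fibre coordinate \<open>\<gamma>\<close> of a
  trivialization.\<close>

lemma bdiv_continuous:
  "continuous_map (subtopology (prod_topology TE TE) {(e, e'). prj e = prj e'}) PO_topology (\<lambda>(e, e'). bdiv e e')"
proof (rule continuous_map_locally)
  let ?Z = "subtopology (prod_topology TE TE) {(e, e'). prj e = prj e'}"
  fix y assume y: "y \<in> topspace ?Z"
  then have y1: "fst y \<in> topspace TE" by auto
  obtain W \<phi> where W: "openin X W" "prj (fst y) \<in> W" "trivialization PO PO_topology X E W \<phi>"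
    using bundle_props(6)[OF prj_in[OF y1]] by blast
  let ?EW = "{e \<in> topspace TE. prj e \<in> W}"
  obtain \<gamma> where lc: "local_coord W \<phi> \<gamma>" using local_coordinate[OF W(3)] by blast
  note gc = local_coordD(1)[OF lc] and g = local_coordD(2-4)[OF lc]
  let ?U = "{y \<in> topspace ?Z. prj (fst y) \<in> W}"
  have f1: "continuous_map ?Z TE fst" and f2: "continuous_map ?Z TE snd"
    by (rule continuous_map_from_subtopology[OF continuous_map_fst],
        rule continuous_map_from_subtopology[OF continuous_map_snd])
  have "openin ?Z ?U"
    using openin_continuous_map_preimage[OF continuous_map_compose[OF f1 bundle_props(1)] W(1)] by (simp add: o_def)
  moreover have "y \<in> ?U" using y W(2) by simp
  moreover have "continuous_map (subtopology ?Z ?U) PO_topology (\<lambda>(e, e'). bdiv e e')"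
  proof (rule continuous_map_eq)
    have g1: "continuous_map (subtopology ?Z ?U) (subtopology TE ?EW) fst"
      using continuous_map_from_subtopology[OF f1, of ?U] by (auto simp: continuous_map_in_subtopology)
    have g2: "continuous_map (subtopology ?Z ?U) (subtopology TE ?EW) snd"
      using continuous_map_from_subtopology[OF f2, of ?U] by (auto simp: continuous_map_in_subtopology)
    have "continuous_map (subtopology ?Z ?U) PO_topology (\<lambda>y. \<gamma> (fst y))"
      "continuous_map (subtopology ?Z ?U) PO_topology (\<lambda>y. \<gamma> (snd y))"
      using continuous_map_compose[OF g1 gc] continuous_map_compose[OF g2 gc] by (simp_all add: o_def)
    then show "continuous_map (subtopology ?Z ?U) PO_topology (\<lambda>y. inv\<^bsub>PO\<^esub> (\<gamma> (fst y)) \<otimes>\<^bsub>PO\<^esub> \<gamma> (snd y))"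
      by (intro PO_mult_continuous PO_inv_continuous)
    fix z assume "z \<in> topspace (subtopology ?Z ?U)"
    then have z: "fst z \<in> topspace TE" "snd z \<in> topspace TE" "prj (fst z) = prj (snd z)" "prj (fst z) \<in> W" by auto
    have e: "\<gamma> (fst z) \<in> carrier PO" "\<phi> (prj (fst z), \<gamma> (fst z)) = fst z"
      "\<gamma> (snd z) \<in> carrier PO" "\<phi> (prj (fst z), \<gamma> (snd z)) = snd z"
      using g(1)[OF z(1)] g(1)[OF z(2)] z(3,4) by auto
    have "act (fst z) (inv\<^bsub>PO\<^esub> (\<gamma> (fst z)) \<otimes>\<^bsub>PO\<^esub> \<gamma> (snd z)) = snd z"
      using g(3)[OF z(4) e(1), of "inv\<^bsub>PO\<^esub> (\<gamma> (fst z)) \<otimes>\<^bsub>PO\<^esub> \<gamma> (snd z)"] e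
      by (simp add: PO.m_assoc[symmetric])
    from bdiv_eqI[OF z(1) _ this] e
    show "inv\<^bsub>PO\<^esub> (\<gamma> (fst z)) \<otimes>\<^bsub>PO\<^esub> \<gamma> (snd z) = (case z of (e, e') \<Rightarrow> bdiv e e')"
      by (simp add: case_prod_unfold)
  qed
  ultimately show "\<exists>U. openin ?Z U \<and> y \<in> U \<and> continuous_map (subtopology ?Z U) PO_topology (\<lambda>(e, e'). bdiv e e')"
    by blast
qed

lemma trivialization_section:
  assumes "trivialization PO PO_topology X E W \<phi>"
  shows "continuous_map (subtopology X W) TE (\<lambda>x. \<phi> (x, \<one>\<^bsub>PO\<^esub>))" "x \<in> W \<Longrightarrow> prj (\<phi> (x, \<one>\<^bsub>PO\<^esub>)) = x"
proof -
  obtain \<psi> where \<psi>: "homeomorphic_maps (prod_topology (subtopology X W) PO_topology)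
      (subtopology TE {e \<in> topspace TE. prj e \<in> W}) \<phi> \<psi>"
    using trivialization_inverse[OF assms] .
  then have c: "continuous_map (prod_topology (subtopology X W) PO_topology) TE \<phi>"
    by (auto simp: homeomorphic_maps_def continuous_map_in_subtopology)
  have "continuous_map (subtopology X W) (prod_topology (subtopology X W) (PO_topology :: 'n sq_matrix set topology)) (\<lambda>x. (x, \<one>\<^bsub>PO\<^esub>))"
    by (intro continuous_map_pairedI) (auto simp: topspace_PO)
  from continuous_map_compose[OF this c]
  show "continuous_map (subtopology X W) TE (\<lambda>x. \<phi> (x, \<one>\<^bsub>PO\<^esub>))" by (simp add: o_def)
  show "x \<in> W \<Longrightarrow> prj (\<phi> (x, \<one>\<^bsub>PO\<^esub>)) = x"
    using assms by (simp add: trivialization_def)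
qed

sublocale fibred TE X PO_topology prj act bdiv
proof
  fix x assume "x \<in> topspace X"
  then obtain W \<phi> where W: "openin X W" "x \<in> W" "trivialization PO PO_topology X E W \<phi>"
    using bundle_props(6) by blast
  then show "\<exists>W s. openin X W \<and> x \<in> W \<and> continuous_map (subtopology X W) TE s \<and> (\<forall>y\<in>W. prj (s y) = y)"
    using trivialization_section[OF W(3)] by blast
qed (use bundle_props act_transitive bdiv_continuous in \<open>auto simp: topspace_PO\<close>)

lemma section_trivialization:
  assumes W: "W \<subseteq> topspace X" and s: "continuous_map (subtopology X W) TE s" "\<And>x. x \<in> W \<Longrightarrow> prj (s x) = x"
  shows "trivialization PO PO_topology X E W (\<lambda>(x, a). act (s x) a)"
  unfolding trivialization_def
proof (intro conjI ballI W)
  let ?EW = "{e \<in> topspace TE. prj e \<in> W}"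
  let ?P = "prod_topology (subtopology X W) PO_topology"
  have st: "s x \<in> topspace TE" if "x \<in> W" for x
    using continuous_map_image_subset_topspace[OF s(1)] that W by auto
  have "homeomorphic_maps ?P (subtopology TE ?EW) (\<lambda>(x, a). act (s x) a) (\<lambda>e. (prj e, bdiv (s (prj e)) e))"
    unfolding homeomorphic_maps_def
  proof (intro conjI ballI)
    have "continuous_map ?P TE (\<lambda>y. s (fst y))"
      using continuous_map_compose[OF continuous_map_fst s(1)] by (simp add: o_def)
    then have "continuous_map ?P TE (\<lambda>y. act (s (fst y)) (snd y))"
      by (rule act_continuous[OF _ continuous_map_snd])
    then show "continuous_map ?P (subtopology TE ?EW) (\<lambda>(x, a). act (s x) a)"
      using st s(2) W by (auto simp: continuous_map_in_subtopology case_prod_unfold topspace_PO bundle_props(4) act_in)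
    have p: "continuous_map (subtopology TE ?EW) (subtopology X W) prj"
      using continuous_map_from_subtopology[OF bundle_props(1)] by (auto simp: continuous_map_in_subtopology)
    have "continuous_map (subtopology TE ?EW) PO_topology (\<lambda>e. bdiv (s (prj e)) e)"
    proof (rule dv_continuous)
      show "continuous_map (subtopology TE ?EW) TE (\<lambda>e. s (prj e))"
        using continuous_map_compose[OF p s(1)] by (simp add: o_def)
      show "continuous_map (subtopology TE ?EW) TE (\<lambda>e. e)" by (simp add: continuous_map_from_subtopology)
    qed (use s(2) in auto)
    with p show "continuous_map (subtopology TE ?EW) ?P (\<lambda>e. (prj e, bdiv (s (prj e)) e))"
      by (rule continuous_map_pairedI)
    show "(\<lambda>e. (prj e, bdiv (s (prj e)) e)) ((\<lambda>(x, a). act (s x) a) y) = y" if "y \<in> topspace ?P" for y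
      using that st s(2) W by (auto simp: topspace_PO bundle_props(4) bdiv_act)
    show "(\<lambda>(x, a). act (s x) a) (prj e, bdiv (s (prj e)) e) = e" if "e \<in> topspace (subtopology TE ?EW)" for e
      using that st s(2) by (simp add: dv_act)
  qed
  then show "homeomorphic_map ?P (subtopology TE ?EW) (\<lambda>(x, a). act (s x) a)"
    unfolding homeomorphic_map_maps by blast
  show "prj (case (x, a) of (x, a) \<Rightarrow> act (s x) a) = x" if "x \<in> W" "a \<in> carrier PO" for x a
    using that st s(2) by (simp add: bundle_props(4))
  show "(case (x, a \<otimes>\<^bsub>PO\<^esub> b) of (x, a) \<Rightarrow> act (s x) a) = act (case (x, a) of (x, a) \<Rightarrow> act (s x) a) b"
    if "x \<in> W" "a \<in> carrier PO" "b \<in> carrier PO" for x a b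
    using that st by (simp add: bundle_props(5))
qed

text \<open>Sections of the pullback are maps from Y to the total space that cover q.
  Trivializations of pullbacks are replaced by such maps in all later arguments.\<close>

lemma pullback_section_trivialization:
  assumes s: "continuous_map Y TE s" "\<And>y. y \<in> topspace Y \<Longrightarrow> prj (s y) = q y"
  shows "trivialization PO PO_topology Y (pullback_bundle Y q E) (topspace Y) (\<lambda>(y, a). (y, act (s y) a))"
  unfolding trivialization_def
proof (intro conjI ballI order_refl)
  let ?E = "pullback_bundle Y q E"
  let ?P = "prod_topology (subtopology Y (topspace Y)) PO_topology"
  let ?TE = "subtopology (total_space ?E) {e \<in> topspace (total_space ?E). bundle_proj ?E e \<in> topspace Y}"
  have TE: "?TE = subtopology (prod_topology Y TE) {(y, e). q y = prj e}"
  proof -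
    have "{e \<in> topspace (total_space ?E). bundle_proj ?E e \<in> topspace Y} = topspace (total_space ?E)"
      by (auto simp: pullback_bundle_def)
    then have "?TE = total_space ?E" by (simp only: subtopology_topspace)
    then show ?thesis by (simp add: pullback_bundle_def)
  qed
  have st: "s y \<in> topspace TE" if "y \<in> topspace Y" for y
    using continuous_map_image_subset_topspace[OF s(1)] that by auto
  have "homeomorphic_maps ?P ?TE (\<lambda>(y, a). (y, act (s y) a)) (\<lambda>(y, e). (y, bdiv (s y) e))"
    unfolding homeomorphic_maps_def TE
  proof (intro conjI ballI)
    have f: "continuous_map ?P Y fst" by (simp add: continuous_map_fst)
    have "continuous_map ?P TE (\<lambda>y. s (fst y))"
      using continuous_map_compose[OF f s(1)] by (simp add: o_def)
    then have "continuous_map ?P TE (\<lambda>y. act (s (fst y)) (snd y))"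
      by (rule act_continuous[OF _ continuous_map_snd])
    with f have "continuous_map ?P (prod_topology Y TE) (\<lambda>y. (fst y, act (s (fst y)) (snd y)))"
      by (rule continuous_map_pairedI)
    then show "continuous_map ?P (subtopology (prod_topology Y TE) {(y, e). q y = prj e}) (\<lambda>(y, a). (y, act (s y) a))"
      using st s(2) by (auto simp: continuous_map_in_subtopology case_prod_unfold topspace_PO bundle_props(4))
    let ?Z = "subtopology (prod_topology Y TE) {(y, e). q y = prj e}"
    have f1: "continuous_map ?Z Y fst" and f2: "continuous_map ?Z TE snd"
      by (rule continuous_map_from_subtopology[OF continuous_map_fst],
          rule continuous_map_from_subtopology[OF continuous_map_snd])
    have "continuous_map ?Z PO_topology (\<lambda>z. bdiv (s (fst z)) (snd z))"
      by (rule dv_continuous[OF _ f2]) (use continuous_map_compose[OF f1 s(1)] s(2) in \<open>auto simp: o_def\<close>)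
    with f1 show "continuous_map ?Z ?P (\<lambda>(y, e). (y, bdiv (s y) e))"
      by (simp add: case_prod_unfold continuous_map_pairedI)
    show "(\<lambda>(y, e). (y, bdiv (s y) e)) ((\<lambda>(y, a). (y, act (s y) a)) z) = z" if "z \<in> topspace ?P" for z
      using that st by (auto simp: topspace_PO bdiv_act)
    show "(\<lambda>(y, a). (y, act (s y) a)) ((\<lambda>(y, e). (y, bdiv (s y) e)) z) = z" if "z \<in> topspace ?Z" for z
      using that st s(2) by (auto simp: dv_act)
  qed
  then show "homeomorphic_map ?P ?TE (\<lambda>(y, a). (y, act (s y) a))"
    unfolding homeomorphic_map_maps by blast
  show "bundle_proj ?E (case (x, a) of (y, a) \<Rightarrow> (y, act (s y) a)) = x" for x a
    by (simp add: pullback_bundle_def)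
  show "(case (x, a \<otimes>\<^bsub>PO\<^esub> b) of (y, a) \<Rightarrow> (y, act (s y) a)) = bundle_act ?E (case (x, a) of (y, a) \<Rightarrow> (y, act (s y) a)) b"
    if "x \<in> topspace Y" "a \<in> carrier PO" "b \<in> carrier PO" for x a b
    using that st by (simp add: pullback_bundle_def bundle_props(5))
qed

lemma pullback_trivialization_section:
  assumes "trivialization PO PO_topology Y (pullback_bundle Y q E) (topspace Y) \<tau>"
  shows "continuous_map Y TE (\<lambda>y. snd (\<tau> (y, \<one>\<^bsub>PO\<^esub>)))"
    "\<And>y. y \<in> topspace Y \<Longrightarrow> prj (snd (\<tau> (y, \<one>\<^bsub>PO\<^esub>))) = q y"
proof -
  let ?E = "pullback_bundle Y q E"
  obtain \<psi> where \<psi>: "homeomorphic_maps (prod_topology (subtopology Y (topspace Y)) PO_topology)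
      (subtopology (total_space ?E) {e \<in> topspace (total_space ?E). bundle_proj ?E e \<in> topspace Y}) \<tau> \<psi>"
    using trivialization_inverse[OF assms] .
  then have cm: "continuous_map (prod_topology Y PO_topology)
      (subtopology (prod_topology Y TE) {(y, e). q y = prj e}) \<tau>"
    by (auto simp: homeomorphic_maps_def continuous_map_in_subtopology pullback_bundle_def)
  then have c: "continuous_map (prod_topology Y PO_topology) (prod_topology Y TE) \<tau>"
    by (simp add: continuous_map_in_subtopology)
  have im: "\<tau> z \<in> {(y, e). q y = prj e}" if "z \<in> topspace (prod_topology Y PO_topology)" for z
  proof -
    have "\<tau> z \<in> topspace (subtopology (prod_topology Y TE) {(y, e). q y = prj e})"
      using continuous_map_image_subset_topspace[OF cm] that by blast
    then show ?thesis by simp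
  qed
  have "continuous_map Y (prod_topology Y (PO_topology :: 'n sq_matrix set topology)) (\<lambda>x. (x, \<one>\<^bsub>PO\<^esub>))"
    by (intro continuous_map_pairedI) (auto simp: topspace_PO)
  from continuous_map_compose[OF continuous_map_compose[OF this c] continuous_map_snd]
  show "continuous_map Y TE (\<lambda>y. snd (\<tau> (y, \<one>\<^bsub>PO\<^esub>)))" by (simp add: o_def)
  fix y assume y: "y \<in> topspace Y"
  then have "bundle_proj ?E (\<tau> (y, \<one>\<^bsub>PO\<^esub>)) = y"
    using assms by (simp add: trivialization_def)
  moreover have "\<tau> (y, \<one>\<^bsub>PO\<^esub>) \<in> {(y, e). q y = prj e}" using im y by (auto simp: topspace_PO)
  ultimately show "prj (snd (\<tau> (y, \<one>\<^bsub>PO\<^esub>))) = q y"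
    by (auto simp: pullback_bundle_def split: prod.splits)
qed

end

context PO_bundle
begin

lemma bdiv_trans:
  assumes "e \<in> topspace TE" "e' \<in> topspace TE" "e'' \<in> topspace TE" "prj e = prj e'" "prj e' = prj e''"
  shows "bdiv e e'' = bdiv e e' \<otimes>\<^bsub>PO\<^esub> bdiv e' e''"
  using assms act_transitive[OF assms(1,2,4)] act_transitive[OF assms(2,3,5)]
  by (intro bdiv_eqI) (auto simp flip: bundle_props(5))

lemma bdiv_self: "e \<in> topspace TE \<Longrightarrow> bdiv e e = \<one>\<^bsub>PO\<^esub>"
  by (intro bdiv_eqI) (auto simp: bundle_props(3))

lemma bdiv_sym:
  assumes "e \<in> topspace TE" "e' \<in> topspace TE" "prj e = prj e'"
  shows "bdiv e' e = inv\<^bsub>PO\<^esub> (bdiv e e')"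
proof -
  have "bdiv e e' \<otimes>\<^bsub>PO\<^esub> bdiv e' e = \<one>\<^bsub>PO\<^esub>"
    using bdiv_trans[OF assms(1,2,1) assms(3) assms(3)[symmetric]] bdiv_self[OF assms(1)] by simp
  moreover have "bdiv e e' \<in> carrier PO" "bdiv e' e \<in> carrier PO"
    using act_transitive[OF assms] act_transitive[OF assms(2,1) assms(3)[symmetric]] by auto
  ultimately have "inv\<^bsub>PO\<^esub> (bdiv e' e) = bdiv e e'" by (intro PO.inv_equality)
  then show ?thesis using PO.inv_inv[OF \<open>bdiv e' e \<in> carrier PO\<close>] by simp
qed

end

section \<open>Bundles over the presented surface, seen from the polygon\<close>

locale presented_surface = reflected_polygon dummy g r
  for dummy :: "'n::{finite,linorder} itself" and g :: nat and r :: "'n sq_matrix" +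
  fixes X :: "'x topology" and q :: "complex \<Rightarrow> 'x"
  assumes presentation: "closed_surface_presentation g X q"
begin

abbreviation side :: "nat \<Rightarrow> real \<Rightarrow> complex" where "side \<equiv> polygon_side g"

lemma q_quotient: "quotient_map (top_of_set (polygon g)) X q"
  and q_eq_iff: "x \<in> polygon g \<Longrightarrow> y \<in> polygon g \<Longrightarrow>
    q x = q y \<longleftrightarrow> (x, y) \<in> (side_pairing g \<union> (side_pairing g)\<inverse>)\<^sup>*"
  using presentation unfolding closed_surface_presentation_def by auto

lemma q_cont: "continuous_map (top_of_set (polygon g)) X q"
  by (rule quotient_imp_continuous_map[OF q_quotient])

lemma q_image: "q ` polygon g = topspace X"
  using quotient_imp_surjective_map[OF q_quotient] by simp

lemma q_in: "y \<in> polygon g \<Longrightarrow> q y \<in> topspace X"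
  using q_image by blast

lemma side_pairing_iff:
  "(x, y) \<in> side_pairing g \<longleftrightarrow> (\<exists>j<g. \<exists>i<2. \<exists>t\<in>{0..1}. x = side (4 * j + i) t \<and> y = side (4 * j + i + 2) (1 - t))"
  unfolding side_pairing_def by blast

lemma side_pairing_polygon: "(x, y) \<in> side_pairing g \<Longrightarrow> x \<in> polygon g \<and> y \<in> polygon g"
  unfolding side_pairing_iff using side_in_polygon by auto

lemma q_side:
  assumes "j < g" "i < 2" "t \<in> {0..1}"
  shows "q (side (4 * j + i + 2) (1 - t)) = q (side (4 * j + i) t)"
proof -
  have "(side (4 * j + i) t, side (4 * j + i + 2) (1 - t)) \<in> side_pairing g"
    using assms unfolding side_pairing_iff by blast
  moreover have "side (4 * j + i) t \<in> polygon g" "side (4 * j + i + 2) (1 - t) \<in> polygon g"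
    using assms(3) by (auto intro!: side_in_polygon)
  ultimately show ?thesis using q_eq_iff by (metis UnCI r_into_rtrancl)
qed

text \<open>The fibres of q are the classes of the generated equivalence relation, so a property
  closed under its axioms has to be checked only on the side pairing.\<close>

lemma q_induct:
  assumes "x \<in> polygon g" "y \<in> polygon g" "q x = q y"
    and refl: "\<And>x. x \<in> polygon g \<Longrightarrow> P x x"
    and pair: "\<And>j i t. j < g \<Longrightarrow> i < 2 \<Longrightarrow> t \<in> {0..1} \<Longrightarrow>
      P (side (4 * j + i) t) (side (4 * j + i + 2) (1 - t))"
    and sym: "\<And>x y. x \<in> polygon g \<Longrightarrow> y \<in> polygon g \<Longrightarrow> q x = q y \<Longrightarrow> P x y \<Longrightarrow> P y x"
    and trans: "\<And>x y z. x \<in> polygon g \<Longrightarrow> y \<in> polygon g \<Longrightarrow> z \<in> polygon g \<Longrightarrow> q x = q y \<Longrightarrow> q y = q z \<Longrightarrow>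
      P x y \<Longrightarrow> P y z \<Longrightarrow> P x z"
  shows "P x y"
proof -
  have "(x, y) \<in> (side_pairing g \<union> (side_pairing g)\<inverse>)\<^sup>*" using q_eq_iff assms(1-3) by blast
  then have "y \<in> polygon g \<and> q x = q y \<and> P x y"
  proof (induct rule: rtrancl_induct)
    case base
    then show ?case using refl assms(1) by blast
  next
    case (step y z)
    have yz: "y \<in> polygon g" "z \<in> polygon g" using step(2) side_pairing_polygon by auto
    have qyz: "q y = q z" using step(2) q_eq_iff[OF yz] by (simp add: r_into_rtrancl)
    have "P y z"
    proof (cases "(y, z) \<in> side_pairing g")
      case True
      then show ?thesis unfolding side_pairing_iff using pair by blast
    next
      case False
      then have "(z, y) \<in> side_pairing g" using step(2) by blast
      then have "P z y" unfolding side_pairing_iff using pair by blast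
      then show ?thesis using sym yz qyz by metis
    qed
    then show ?case using trans[OF assms(1) yz] step(3) qyz yz by auto
  qed
  then show ?thesis by blast
qed

text \<open>Any nontrivial chain of identifications starts on a side, and sides do not meet the
  interior.\<close>

lemma q_interior_inj:
  assumes "x \<in> interior (polygon g)" "y \<in> polygon g" "q x = q y"
  shows "x = y"
proof -
  have "x \<in> polygon g" using assms(1) interior_subset by blast
  then have "(x, y) \<in> (side_pairing g \<union> (side_pairing g)\<inverse>)\<^sup>*" using q_eq_iff assms(2,3) by blast
  then show ?thesis
  proof (cases rule: converse_rtranclE)
    case (step z)
    from step(1) have "\<exists>k<4 * g. \<exists>t\<in>{0..1}. x = side k t"
    proof
      assume "(x, z) \<in> side_pairing g"
      then obtain j i t where "j < g" "i < (2::nat)" "t \<in> {0..1}" "x = side (4 * j + i) t"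
        unfolding side_pairing_iff by blast
      then show ?thesis by (intro exI[of _ "4 * j + i"]) auto
    next
      assume "(x, z) \<in> (side_pairing g)\<inverse>"
      then obtain j i t where "j < g" "i < (2::nat)" "t \<in> {0..1}" "x = side (4 * j + i + 2) (1 - t)"
        unfolding converse_iff side_pairing_iff by blast
      then show ?thesis by (intro exI[of _ "4 * j + i + 2"] conjI bexI[of _ "1 - t"]) auto
    qed
    then show ?thesis using assms(1) side_not_interior by blast
  qed
qed

text \<open>F sends S y a to S' y a; equal transition elements make this independent of the
  representative y. For continuity, a local section s reduces F to F o s, and that is tested after
  composition with q, which remains a quotient map over open sets.\<close>

lemma bundle_map_exists:
  fixes E :: "('e, 'x, 'n sq_matrix set) bundle_data" and E' :: "('f, 'x, 'n sq_matrix set) bundle_data"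
  assumes E: "principal_bundle PO PO_topology X E" and E': "principal_bundle PO PO_topology X E'"
    and S: "continuous_map (top_of_set (polygon g)) (total_space E) S" "\<And>y. y \<in> polygon g \<Longrightarrow> bundle_proj E (S y) = q y"
    and S': "continuous_map (top_of_set (polygon g)) (total_space E') S'" "\<And>y. y \<in> polygon g \<Longrightarrow> bundle_proj E' (S' y) = q y"
    and eq: "\<And>x y. x \<in> polygon g \<Longrightarrow> y \<in> polygon g \<Longrightarrow> q x = q y \<Longrightarrow>
      PO_bundle.bdiv E (S x) (S y) = PO_bundle.bdiv E' (S' x) (S' y)"
  obtains F where "continuous_map (total_space E) (total_space E') F"
    "\<And>y a. y \<in> polygon g \<Longrightarrow> a \<in> carrier PO \<Longrightarrow> F (bundle_act E (S y) a) = bundle_act E' (S' y) a"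
proof -
  interpret E: PO_bundle dummy X E by unfold_locales (rule E)
  interpret E': PO_bundle dummy X E' by unfold_locales (rule E')
  have St: "S y \<in> topspace E.TE" "S' y \<in> topspace E'.TE" if "y \<in> polygon g" for y
    using continuous_map_image_subset_topspace[OF S(1)] continuous_map_image_subset_topspace[OF S'(1)] that by auto
  define rep where "rep x = (SOME y. y \<in> polygon g \<and> q y = x)" for x
  have rep: "rep x \<in> polygon g" "q (rep x) = x" if "x \<in> topspace X" for x
  proof -
    have "\<exists>y. y \<in> polygon g \<and> q y = x" using that q_image by force
    from someI_ex[OF this] show "rep x \<in> polygon g" "q (rep x) = x" by (auto simp: rep_def)
  qed
  define F where "F e = E'.act (S' (rep (E.prj e))) (E.bdiv (S (rep (E.prj e))) e)" for e
  have F: "F (E.act (S y) a) = E'.act (S' y) a" if y: "y \<in> polygon g" and a: "a \<in> carrier PO" for y a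
  proof -
    let ?x = "q y"
    have x: "?x \<in> topspace X" by (rule q_in[OF y])
    note rx = rep[OF x]
    have p: "E.prj (E.act (S y) a) = ?x" using E.bundle_props(4) St y a S(2) by simp
    have f: "E.prj (S (rep ?x)) = E.prj (S y)" "E'.prj (S' (rep ?x)) = E'.prj (S' y)" using S(2) S'(2) rx y by simp_all
    have "E.prj (S y) = E.prj (E.act (S y) a)" using p S(2)[OF y] by simp
    from E.bdiv_trans[OF St(1)[OF rx(1)] St(1)[OF y] E.act_in[OF St(1)[OF y] a] f(1) this]
    have "E.bdiv (S (rep ?x)) (E.act (S y) a) = E.bdiv (S (rep ?x)) (S y) \<otimes>\<^bsub>PO\<^esub> a"
      by (simp add: E.bdiv_act[OF St(1)[OF y] a])
    also have "E.bdiv (S (rep ?x)) (S y) = E'.bdiv (S' (rep ?x)) (S' y)" by (rule eq[OF rx(1) y rx(2)])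
    finally have "F (E.act (S y) a) = E'.act (S' (rep ?x)) (E'.bdiv (S' (rep ?x)) (S' y) \<otimes>\<^bsub>PO\<^esub> a)"
      by (simp add: F_def p)
    also have "\<dots> = E'.act (S' y) a"
      using E'.act_transitive[OF St(2)[OF rx(1)] St(2)[OF y] f(2)] E'.bundle_props(5)[OF St(2)[OF rx(1)] _ a]
      by metis
    finally show ?thesis .
  qed
  have decomp: "\<exists>y a. y \<in> polygon g \<and> a \<in> carrier PO \<and> q y = E.prj e \<and> e = E.act (S y) a" if "e \<in> topspace E.TE" for e
  proof -
    let ?y = "rep (E.prj e)"
    have y: "?y \<in> polygon g" "q ?y = E.prj e" using rep[OF E.prj_in[OF that]] by auto
    then have "E.bdiv (S ?y) e \<in> carrier PO" "E.act (S ?y) (E.bdiv (S ?y) e) = e"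
      using E.act_transitive[of "S ?y" e] St that S(2) by auto
    then show ?thesis using y by metis
  qed
  have F_in: "F e \<in> topspace E'.TE" "F (E.act e b) = E'.act (F e) b" if e: "e \<in> topspace E.TE" and b: "b \<in> carrier PO" for e b
  proof -
    obtain y a where ya: "y \<in> polygon g" "a \<in> carrier PO" "e = E.act (S y) a" using decomp[OF e] by blast
    show "F e \<in> topspace E'.TE" using F ya E'.act_in St by simp
    show "F (E.act e b) = E'.act (F e) b"
      using F ya b St E.bundle_props(5)[of "S y" a b] E'.bundle_props(5)[of "S' y" a b] by simp
  qed
  have "continuous_map E.TE E'.TE F"
  proof (rule continuous_map_locally)
    fix e assume e: "e \<in> topspace E.TE"
    obtain W s where W: "openin X W" "E.prj e \<in> W" "continuous_map (subtopology X W) E.TE s" "\<And>y. y \<in> W \<Longrightarrow> E.prj (s y) = y"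
      using E.local_section[OF E.prj_in[OF e]] by metis
    have WX: "W \<subseteq> topspace X" by (rule openin_subset[OF W(1)])
    let ?Q = "{y \<in> topspace (top_of_set (polygon g)). q y \<in> W}"
    have Q: "quotient_map (subtopology (top_of_set (polygon g)) ?Q) (subtopology X W) q"
      by (rule quotient_map_restriction[OF q_quotient]) (use W(1) in auto)
    have st: "s x \<in> topspace E.TE" if "x \<in> W" for x
      using continuous_map_image_subset_topspace[OF W(3)] that WX by auto
    have cq: "continuous_map (subtopology (top_of_set (polygon g)) ?Q) E.TE (\<lambda>y. s (q y))"
      using continuous_map_compose[OF quotient_imp_continuous_map[OF Q] W(3)] by (simp add: o_def)
    have "continuous_map (subtopology (top_of_set (polygon g)) ?Q) E'.TE (\<lambda>y. E'.act (S' y) (E.bdiv (S y) (s (q y))))"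
      by (intro E'.act_continuous E.dv_continuous cq continuous_map_from_subtopology S(1) S'(1))
        (use S(2) W(4) in auto)
    then have "continuous_map (subtopology (top_of_set (polygon g)) ?Q) E'.TE ((F \<circ> s) \<circ> q)"
    proof (rule continuous_map_eq)
      fix y assume "y \<in> topspace (subtopology (top_of_set (polygon g)) ?Q)"
      then have y: "y \<in> polygon g" "q y \<in> W" by auto
      have "E.prj (S y) = E.prj (s (q y))" using y S(2) W(4) by simp
      from E.act_transitive[OF St(1)[OF y(1)] st[OF y(2)] this]
      show "E'.act (S' y) (E.bdiv (S y) (s (q y))) = (F \<circ> s \<circ> q) y"
        using F[OF y(1), of "E.bdiv (S y) (s (q y))"] by simp
    qed
    then have Fs: "continuous_map (subtopology X W) E'.TE (F \<circ> s)"
      by (rule continuous_compose_quotient_map[OF Q])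
    let ?U = "{e \<in> topspace E.TE. E.prj e \<in> W}"
    have U: "openin E.TE ?U" by (rule openin_continuous_map_preimage[OF E.bundle_props(1) W(1)])
    have p: "continuous_map (subtopology E.TE ?U) (subtopology X W) E.prj"
      using continuous_map_from_subtopology[OF E.bundle_props(1)] by (auto simp: continuous_map_in_subtopology)
    have "continuous_map (subtopology E.TE ?U) E'.TE (\<lambda>e. E'.act (F (s (E.prj e))) (E.bdiv (s (E.prj e)) e))"
    proof (intro E'.act_continuous E.dv_continuous)
      show "continuous_map (subtopology E.TE ?U) E'.TE (\<lambda>e. F (s (E.prj e)))"
        using continuous_map_compose[OF p Fs] by (simp add: o_def)
      show "continuous_map (subtopology E.TE ?U) E.TE (\<lambda>e. s (E.prj e))"
        using continuous_map_compose[OF p W(3)] by (simp add: o_def)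
      show "continuous_map (subtopology E.TE ?U) E.TE (\<lambda>e. e)" by (simp add: continuous_map_from_subtopology)
    qed (use W(4) in auto)
    then have "continuous_map (subtopology E.TE ?U) E'.TE F"
    proof (rule continuous_map_eq)
      fix e assume "e \<in> topspace (subtopology E.TE ?U)"
      then have e: "e \<in> topspace E.TE" "E.prj e \<in> W" by auto
      have "E.prj (s (E.prj e)) = E.prj e" using e W(4) by simp
      from E.act_transitive[OF st[OF e(2)] e(1) this]
      show "E'.act (F (s (E.prj e))) (E.bdiv (s (E.prj e)) e) = F e"
        using F_in(2)[OF st[OF e(2)], of "E.bdiv (s (E.prj e)) e"] by simp
    qed
    then show "\<exists>U. openin E.TE U \<and> e \<in> U \<and> continuous_map (subtopology E.TE U) E'.TE F"
      using U e W(2) by blast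
  qed
  then show thesis using that F by blast
qed

lemma isomorphic_if_same_cocycle:
  fixes E :: "('e, 'x, 'n sq_matrix set) bundle_data" and E' :: "('f, 'x, 'n sq_matrix set) bundle_data"
  assumes E: "principal_bundle PO PO_topology X E" and E': "principal_bundle PO PO_topology X E'"
    and S: "continuous_map (top_of_set (polygon g)) (total_space E) S" "\<And>y. y \<in> polygon g \<Longrightarrow> bundle_proj E (S y) = q y"
    and S': "continuous_map (top_of_set (polygon g)) (total_space E') S'" "\<And>y. y \<in> polygon g \<Longrightarrow> bundle_proj E' (S' y) = q y"
    and eq: "\<And>x y. x \<in> polygon g \<Longrightarrow> y \<in> polygon g \<Longrightarrow> q x = q y \<Longrightarrow>
      PO_bundle.bdiv E (S x) (S y) = PO_bundle.bdiv E' (S' x) (S' y)"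
  shows "bundle_isomorphic PO E E'"
proof -
  interpret E: PO_bundle dummy X E by unfold_locales (rule E)
  interpret E': PO_bundle dummy X E' by unfold_locales (rule E')
  have St: "S y \<in> topspace E.TE" "S' y \<in> topspace E'.TE" if "y \<in> polygon g" for y
    using continuous_map_image_subset_topspace[OF S(1)] continuous_map_image_subset_topspace[OF S'(1)] that by auto
  obtain F where F: "continuous_map E.TE E'.TE F"
    "\<And>y a. y \<in> polygon g \<Longrightarrow> a \<in> carrier PO \<Longrightarrow> F (E.act (S y) a) = E'.act (S' y) a"
    using bundle_map_exists[OF E E' S S' eq] by blast
  obtain F' where F': "continuous_map E'.TE E.TE F'"
    "\<And>y a. y \<in> polygon g \<Longrightarrow> a \<in> carrier PO \<Longrightarrow> F' (E'.act (S' y) a) = E.act (S y) a"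
    using bundle_map_exists[OF E' E S' S eq[symmetric]] by blast
  have dec: "\<exists>y a. y \<in> polygon g \<and> a \<in> carrier PO \<and> e = E.act (S y) a" if e: "e \<in> topspace E.TE" for e
  proof -
    obtain y where y: "y \<in> polygon g" "q y = E.prj e" using E.prj_in[OF e] q_image by (metis imageE)
    then show ?thesis using E.act_transitive[of "S y" e] St e S(2) by metis
  qed
  have dec': "\<exists>y a. y \<in> polygon g \<and> a \<in> carrier PO \<and> e = E'.act (S' y) a" if e: "e \<in> topspace E'.TE" for e
  proof -
    obtain y where y: "y \<in> polygon g" "q y = E'.prj e" using E'.prj_in[OF e] q_image by (metis imageE)
    then show ?thesis using E'.act_transitive[of "S' y" e] St e S'(2) by metis
  qed
  have "homeomorphic_maps E.TE E'.TE F F'"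
    unfolding homeomorphic_maps_def using F F' dec dec' by metis
  moreover have "E'.prj (F e) = E.prj e \<and> (\<forall>a\<in>carrier PO. F (E.act e a) = E'.act (F e) a)" if e: "e \<in> topspace E.TE" for e
  proof -
    obtain y b where yb: "y \<in> polygon g" "b \<in> carrier PO" "e = E.act (S y) b" using dec[OF e] by blast
    then show ?thesis using F(2) St S(2) S'(2) E.bundle_props(4,5) E'.bundle_props(4,5) by simp
  qed
  ultimately show ?thesis
    unfolding bundle_isomorphic_def homeomorphic_map_maps by blast
qed

end

section \<open>Bundles clutched over the polygon\<close>

context pin_polygon
begin

lemma PSO_mult_iff:
  assumes "a \<in> carrier PO" "b \<in> carrier (PO :: 'n sq_matrix set monoid)"
  shows "a \<otimes>\<^bsub>PO\<^esub> b \<in> PSO \<longleftrightarrow> (a \<in> PSO \<longleftrightarrow> b \<in> PSO)"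
proof -
  obtain p where p: "p \<in> pin_set" "pin_to_PO p = a" using assms(1) by (rule PO_pinE)
  obtain s where s: "s \<in> pin_set" "pin_to_PO s = b" using assms(2) by (rule PO_pinE)
  have "a \<otimes>\<^bsub>PO\<^esub> b = pin_to_PO (p \<star> s)" using p s by (simp add: pin_to_PO_mult[symmetric])
  then show ?thesis
    using PSO_pin_iff[OF pin_mult[OF p(1) s(1)]] PSO_pin_iff[OF p(1)] PSO_pin_iff[OF s(1)] p s
    by (simp add: spin_mult_iff)
qed

lemma PSO_one: "\<one>\<^bsub>PO\<^esub> \<in> (PSO :: 'n sq_matrix set set)"
  using PSO_pin_iff[OF pin_set.one] spin_one by (simp add: pin_to_PO_one)

lemma PSO_path_const:
  assumes f: "continuous_map (top_of_set {0..1::real}) (PO_topology :: 'n sq_matrix set topology) f"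
    and st: "s \<in> {0..1}" "t \<in> {0..1}"
  shows "f s \<in> PSO \<longleftrightarrow> f t \<in> PSO"
proof -
  obtain F where F: "pin_path F"
    "\<And>t. t \<in> {0..1} \<Longrightarrow> pin_to_PO (F t) = f t" using pin.path_lift_exists[OF f] by blast
  have "F s \<in> spin_set \<longleftrightarrow> F t \<in> spin_set" by (rule parity_const[OF _ F(1) st]) simp
  then show ?thesis
    using PSO_pin_iff[OF continuous_pin_in[OF F(1) st(1)]] PSO_pin_iff[OF continuous_pin_in[OF F(1) st(2)]] F(2) st
    by simp
qed

end

context presented_surface
begin

text \<open>The trivialization in question is y -> S y acted on by f y. Splitting off S, which is
  defined at the centre as well, leaves the whole twisting in f.\<close>

definition adapted_pair ::
    "('e, 'x, 'n sq_matrix set) bundle_data \<Rightarrow> (nat \<Rightarrow> bit) \<Rightarrow> (complex \<Rightarrow> 'e) \<Rightarrow> (complex \<Rightarrow> 'n sq_matrix set) \<Rightarrow> bool" where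
  "adapted_pair E m S f \<longleftrightarrow>
     continuous_map (top_of_set (polygon g)) (total_space E) S \<and> (\<forall>y\<in>polygon g. bundle_proj E (S y) = q y) \<and>
     continuous_map (top_of_set pstar) PO_topology f \<and>
     (\<forall>j<g. \<forall>i<2. \<forall>t\<in>{0..1}.
        bundle_act E (S (side (4 * j + i + 2) (1 - t))) (f (side (4 * j + i + 2) (1 - t))) =
        bundle_act E (bundle_act E (S (side (4 * j + i) t)) (f (side (4 * j + i) t))) (glue m (4 * j + i)))"

text \<open>A relation and not a function: m turns out to be \<open>mu1 g q E\<close>, but z is
  determined only up to what \<open>mu2_class\<close> forgets.\<close>

definition clutched ::
    "('e, 'x, 'n sq_matrix set) bundle_data \<Rightarrow> (nat \<Rightarrow> bit) \<Rightarrow> 'n clifford \<Rightarrow> bool" where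
  "clutched E m z \<longleftrightarrow> m \<in> Z2_tuples g \<and> (\<exists>S f. adapted_pair E m S f \<and> winding f z)"

lemma side_pstar: "t \<in> {0..1} \<Longrightarrow> side k t \<in> pstar"
  using side_in_polygon side_in_sector[of t k] by (auto simp: sector_def)

lemma side_map: "continuous_map (top_of_set {0..1}) (top_of_set (polygon g)) (side k)"
  using side_in_polygon by (auto simp: polygon_side_def)

lemma rev_map: "continuous_map (top_of_set {0..1::real}) (top_of_set {0..1}) (\<lambda>t. 1 - t)"
  by (auto intro!: continuous_intros)

lemma nontrivial_index:
  assumes "i < 2"
  shows "nontrivial m (4 * j + i) \<longleftrightarrow> m (2 * j + 1 - i) \<noteq> 0"
proof -
  have "(4 * j + i) div 4 = j" "(4 * j + i) mod 4 = i" using assms by auto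
  then show ?thesis by (simp add: nontrivial_def)
qed

lemma tuple_exists: "\<exists>m\<in>Z2_tuples g. \<forall>j<g. \<forall>i<2. nontrivial m (4 * j + i) \<longleftrightarrow> P (4 * j + i)"
proof
  \<comment> \<open>The inverse of the index change in \<open>nontrivial\<close>.\<close>
  let ?m = "\<lambda>l\<in>{..<2 * g}. if P (4 * (l div 2) + (1 - l mod 2)) then 1 else (0::bit)"
  show "?m \<in> Z2_tuples g" by (simp add: Z2_tuples_def)
  show "\<forall>j<g. \<forall>i<2. nontrivial ?m (4 * j + i) \<longleftrightarrow> P (4 * j + i)"
  proof (intro allI impI)
    fix j i assume ji: "j < g" "i < (2::nat)"
    have "i = 0 \<or> i = 1" using ji by auto
    then have e: "(2 * j + 1 - i) div 2 = j" "1 - (2 * j + 1 - i) mod 2 = i" "2 * j + 1 - i < 2 * g"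
      using ji by auto
    have "?m (2 * j + 1 - i) = (if P (4 * j + i) then 1 else 0)"
      by (simp only: restrict_apply lessThan_iff e if_True)
    then show "nontrivial ?m (4 * j + i) \<longleftrightarrow> P (4 * j + i)"
      unfolding nontrivial_index[OF ji(2)] by simp
  qed
qed

text \<open>A section S over the polygon has transition elements T over the pairs of sides, whose
  components determine m. The map f has to turn T into the constants \<open>glue\<close>; its values
  at the vertices are fixed beforehand, then joined by paths on two sides of each block and
  transported to the other two.\<close>

lemma adapted_pair_exists:
  fixes E :: "('e, 'x, 'n sq_matrix set) bundle_data"
  assumes E: "principal_bundle PO PO_topology X E"
  shows "\<exists>m\<in>Z2_tuples g. \<exists>S f. adapted_pair E m S f"
proof -
  interpret E: PO_bundle dummy X E by unfold_locales (rule E)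
  obtain S where S: "continuous_map (top_of_set (polygon g)) E.TE S" "\<And>y. y \<in> polygon g \<Longrightarrow> E.prj (S y) = q y"
    using E.lift_exists[OF compact_polygon convex_polygon q_cont] by blast
  have St: "S y \<in> topspace E.TE" if "y \<in> polygon g" for y
    using continuous_map_image_subset_topspace[OF S(1)] that by auto
  define T where "T k t = E.bdiv (S (side k t)) (S (side (k + 2) (1 - t)))" for k t
  have fib: "E.prj (S (side k t)) = E.prj (S (side (k + 2) (1 - t)))" if k: "j < g" "i < 2" "k = 4 * j + i" and t: "t \<in> {0..1}" for j i k t
    using q_side[OF k(1,2) t] S(2) side_in_polygon[of t] side_in_polygon[of "1 - t"] t k(3) by simp
  have T_in: "T k t \<in> carrier PO" "E.act (S (side k t)) (T k t) = S (side (k + 2) (1 - t))"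
    if k: "j < g" "i < 2" "k = 4 * j + i" and t: "t \<in> {0..1}" for j i k t
    unfolding T_def using E.act_transitive[OF St St fib[OF k t]] side_in_polygon t by auto
  have T_cont: "continuous_map (top_of_set {0..1}) PO_topology (T k)" if k: "j < g" "i < 2" "k = 4 * j + i" for j i k
  proof -
    have "continuous_map (top_of_set {0..1}) E.TE (\<lambda>t. S (side k t))"
      using continuous_map_compose[OF side_map S(1)] by (simp add: o_def)
    moreover have "continuous_map (top_of_set {0..1}) E.TE (\<lambda>t. S (side (k + 2) (1 - t)))"
      using continuous_map_compose[OF continuous_map_compose[OF rev_map side_map] S(1)] by (simp add: o_def)
    ultimately show ?thesis
      unfolding T_def by (rule E.dv_continuous) (use fib[OF k] in auto)
  qed
  obtain m where m: "m \<in> Z2_tuples g" "\<And>j i. j < g \<Longrightarrow> i < 2 \<Longrightarrow> nontrivial m (4 * j + i) \<longleftrightarrow> T (4 * j + i) 0 \<notin> PSO"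
    using tuple_exists[of "\<lambda>k. T k 0 \<notin> PSO"] by blast
  have T_PSO: "T (4 * j + i) t \<in> PSO \<longleftrightarrow> glue m (4 * j + i) \<in> PSO" if "j < g" "i < 2" "t \<in> {0..1}" for j i t
    using PSO_path_const[OF T_cont[OF that(1,2) refl] that(3), of 0] m(2)[OF that(1,2)] glue_PSO_iff by simp
  \<comment> \<open>A reference point over the common image of all vertices; \<open>u k\<close>
    compares S at the vertex k with it.\<close>
  define e where "e = S (polygon_vertex g 0)"
  \<comment> \<open>The solution of the vertex equations without T: around a block it takes the
    values 1, b, ab, a, 1, where a and b are the gluing elements of the two pairs. It closes up
    because they are commuting involutions.\<close>
  define w where "w k = (let j = k div 4 in if k mod 4 = 0 then \<one>\<^bsub>PO\<^esub> else if k mod 4 = 1 then glue m (4 * j + 1)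
     else if k mod 4 = 2 then glue m (4 * j) \<otimes>\<^bsub>PO\<^esub> glue m (4 * j + 1) else glue m (4 * j))" for k
  have w: "w (4 * j) = \<one>\<^bsub>PO\<^esub>" "w (4 * j + 1) = glue m (4 * j + 1)"
    "w (4 * j + 2) = glue m (4 * j) \<otimes>\<^bsub>PO\<^esub> glue m (4 * j + 1)" "w (4 * j + 3) = glue m (4 * j)" "w (4 * j + 4) = \<one>\<^bsub>PO\<^esub>" for j
  proof -
    have "(4 * j + 1) div 4 = j" "(4 * j + 1) mod 4 = 1" "(4 * j + 2) div 4 = j" "(4 * j + 2) mod 4 = 2"
      "(4 * j + 3) div 4 = j" "(4 * j + 3) mod 4 = 3" by presburger+
    then show "w (4 * j) = \<one>\<^bsub>PO\<^esub>" "w (4 * j + 1) = glue m (4 * j + 1)"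
      "w (4 * j + 2) = glue m (4 * j) \<otimes>\<^bsub>PO\<^esub> glue m (4 * j + 1)" "w (4 * j + 3) = glue m (4 * j)" "w (4 * j + 4) = \<one>\<^bsub>PO\<^esub>"
      by (simp_all add: w_def Let_def)
  qed
  have w_in: "w k \<in> carrier PO" for k by (auto simp: w_def Let_def glue_in)
  have w_rel: "w (4 * j + i + 1) \<otimes>\<^bsub>PO\<^esub> glue m (4 * j + i) = w (4 * j + i + 2)"
    "w (4 * j + i) \<otimes>\<^bsub>PO\<^esub> glue m (4 * j + i) = w (4 * j + i + 3)" if "i < 2" for j i
  proof -
    have "i = 0 \<or> i = 1" using that by auto
    then have "w (4 * j + i + 1) \<otimes>\<^bsub>PO\<^esub> glue m (4 * j + i) = w (4 * j + i + 2) \<and>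
      w (4 * j + i) \<otimes>\<^bsub>PO\<^esub> glue m (4 * j + i) = w (4 * j + i + 3)"
    proof
      assume "i = 0"
      then show ?thesis using w[of j] glue_commute[of m "4 * j + 1" "4 * j"] glue_in by (simp add: numeral_eq_Suc)
    next
      assume i: "i = 1"
      have "glue m (4 * j) \<otimes>\<^bsub>PO\<^esub> glue m (4 * j + 1) \<otimes>\<^bsub>PO\<^esub> glue m (4 * j + 1) = glue m (4 * j)"
        using glue_square[of m "4 * j + 1"] glue_in by (simp add: PO.m_assoc)
      then show ?thesis using w[of j] glue_square[of m "4 * j + 1"] unfolding i by (simp add: add.assoc numeral_eq_Suc)
    qed
    then show "w (4 * j + i + 1) \<otimes>\<^bsub>PO\<^esub> glue m (4 * j + i) = w (4 * j + i + 2)"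
      "w (4 * j + i) \<otimes>\<^bsub>PO\<^esub> glue m (4 * j + i) = w (4 * j + i + 3)" by auto
  qed
  have qv: "q (polygon_vertex g k) = q (polygon_vertex g 0)" if "k \<le> 4 * g" for k
  proof -
    have rel: "q (polygon_vertex g (4 * j + i + 3)) = q (polygon_vertex g (4 * j + i))"
      "q (polygon_vertex g (4 * j + i + 2)) = q (polygon_vertex g (4 * j + i + 1))" if "j < g" "i < 2" for j i
      using q_side[OF that, of 0] q_side[OF that, of 1] by (simp_all add: side_ends numeral_eq_Suc)
    have block: "q (polygon_vertex g (4 * j + l)) = q (polygon_vertex g (4 * j))" if "j < g" "l \<le> 4" for j l
    proof -
      have "l = 0 \<or> l = 1 \<or> l = 2 \<or> l = 3 \<or> l = 4" using that(2) by auto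
      then show ?thesis using rel[OF that(1), of 0] rel[OF that(1), of 1] by (auto simp: numeral_eq_Suc)
    qed
    have base: "q (polygon_vertex g (4 * j)) = q (polygon_vertex g 0)" if "j \<le> g" for j
      using that
    proof (induct j)
      case (Suc j)
      then show ?case using block[of j 4] by (simp add: add.commute)
    qed simp
    have "k = 4 * (k div 4) + k mod 4" by simp
    show ?thesis
    proof (cases "k = 4 * g")
      case True
      then show ?thesis using base[of g] by simp
    next
      case False
      then have "k div 4 < g" using that by auto
      then show ?thesis using block[of "k div 4" "k mod 4"] base[of "k div 4"] by simp
    qed
  qed
  define u where "u k = E.bdiv (S (polygon_vertex g k)) e" for k
  have u: "u k \<in> carrier PO" "E.act (S (polygon_vertex g k)) (u k) = e" if "k \<le> 4 * g" for k
    unfolding u_def e_def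
    using E.act_transitive[OF St[OF vertex_in_polygon] St[OF vertex_in_polygon], of k 0] qv[OF that] S(2) vertex_in_polygon
    by auto
  have u_rel: "u (k + 3) = inv\<^bsub>PO\<^esub> (T k 0) \<otimes>\<^bsub>PO\<^esub> u k" "u (k + 2) = inv\<^bsub>PO\<^esub> (T k 1) \<otimes>\<^bsub>PO\<^esub> u (k + 1)"
    if k: "j < g" "i < 2" "k = 4 * j + i" for j i k
  proof -
    have le: "k \<le> 4 * g" "k + 1 \<le> 4 * g" "k + 2 \<le> 4 * g" "k + 3 \<le> 4 * g" using k by auto
    have gen: "u l' = inv\<^bsub>PO\<^esub> t \<otimes>\<^bsub>PO\<^esub> u l" if t: "t \<in> carrier PO"
      "E.act (S (polygon_vertex g l)) t = S (polygon_vertex g l')" and l: "l \<le> 4 * g" "l' \<le> 4 * g" for l l' t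
    proof -
      have "E.act (S (polygon_vertex g l)) (t \<otimes>\<^bsub>PO\<^esub> u l') = e"
        using E.bundle_props(5)[OF St[OF vertex_in_polygon] t(1) u(1)[OF l(2)], of l] t(2) u(2)[OF l(2)] by simp
      then have "u l = t \<otimes>\<^bsub>PO\<^esub> u l'"
        unfolding u_def[of l] using t(1) u(1)[OF l(2)] by (intro E.bdiv_eqI St vertex_in_polygon) auto
      then show ?thesis using t(1) u(1)[OF l(2)] by (simp add: PO.m_assoc[symmetric])
    qed
    show "u (k + 3) = inv\<^bsub>PO\<^esub> (T k 0) \<otimes>\<^bsub>PO\<^esub> u k"
      using T_in[OF k, of 0] by (intro gen le) (simp_all add: side_ends numeral_eq_Suc)
    show "u (k + 2) = inv\<^bsub>PO\<^esub> (T k 1) \<otimes>\<^bsub>PO\<^esub> u (k + 1)"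
      using T_in[OF k, of 1] by (intro gen le) (simp_all add: side_ends numeral_eq_Suc)
  qed
  \<comment> \<open>The values of f at the vertices: u absorbs the transition elements, w the gluing
    elements.\<close>
  define x where "x k = u k \<otimes>\<^bsub>PO\<^esub> w k" for k
  have x_in: "x k \<in> carrier PO" if "k \<le> 4 * g" for k using u(1)[OF that] w_in by (simp add: x_def)
  have inv_PSO: "inv\<^bsub>PO\<^esub> a \<in> PSO \<longleftrightarrow> a \<in> PSO" if "a \<in> carrier PO" for a :: "'n sq_matrix set"
    using PSO_mult_iff[of "inv\<^bsub>PO\<^esub> a" a] that PSO_one by simp
  have u_par: "u (k + 3) \<in> PSO \<longleftrightarrow> (glue m k \<in> PSO \<longleftrightarrow> u k \<in> PSO)"
    "u (k + 2) \<in> PSO \<longleftrightarrow> (glue m k \<in> PSO \<longleftrightarrow> u (k + 1) \<in> PSO)"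
    if k: "j < g" "i < 2" "k = 4 * j + i" for j i k
  proof -
    have le: "u k \<in> carrier PO" "u (k + 1) \<in> carrier PO" using u(1)[of k] u(1)[of "k + 1"] k by auto
    have T: "T k 0 \<in> carrier PO" "T k 1 \<in> carrier PO" "T k 0 \<in> PSO \<longleftrightarrow> glue m k \<in> PSO" "T k 1 \<in> PSO \<longleftrightarrow> glue m k \<in> PSO"
      using T_in(1)[OF k, of 0] T_in(1)[OF k, of 1] T_PSO[OF k(1,2), of 0] T_PSO[OF k(1,2), of 1] k(3) by auto
    show "u (k + 3) \<in> PSO \<longleftrightarrow> (glue m k \<in> PSO \<longleftrightarrow> u k \<in> PSO)"
      "u (k + 2) \<in> PSO \<longleftrightarrow> (glue m k \<in> PSO \<longleftrightarrow> u (k + 1) \<in> PSO)"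
      unfolding u_rel[OF k] using T le by (simp_all add: PSO_mult_iff inv_PSO)
  qed
  \<comment> \<open>Modulo PSO(n), u and w satisfy the same relations around a block, so their
    product stays in one component.\<close>
  have x_par: "x k \<in> PSO \<longleftrightarrow> x (k + 1) \<in> PSO" if k: "j < g" "i < 2" "k = 4 * j + i" for j i k
  proof -
    have j4: "4 * j + 4 \<le> 4 * g" using k by simp
    have idx: "4 * j + 1 + 2 = 4 * j + 3" "4 * j + 1 + 1 = 4 * j + 2" by simp_all
    have P: "u (4 * j + 3) \<in> PSO \<longleftrightarrow> (glue m (4 * j) \<in> PSO \<longleftrightarrow> u (4 * j) \<in> PSO)"
      "u (4 * j + 2) \<in> PSO \<longleftrightarrow> (glue m (4 * j) \<in> PSO \<longleftrightarrow> u (4 * j + 1) \<in> PSO)"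
      "u (4 * j + 3) \<in> PSO \<longleftrightarrow> (glue m (4 * j + 1) \<in> PSO \<longleftrightarrow> u (4 * j + 2) \<in> PSO)"
      using u_par[OF k(1), of 0 "4 * j"] u_par(2)[OF k(1), of 1 "4 * j + 1", unfolded idx] by simp_all
    have xp: "x l \<in> PSO \<longleftrightarrow> (u l \<in> PSO \<longleftrightarrow> w l \<in> PSO)" if "l \<le> 4 * g" for l
      unfolding x_def by (rule PSO_mult_iff[OF u(1)[OF that] w_in])
    have "i = 0 \<or> i = 1" using k(2) by auto
    then show ?thesis
    proof
      assume "i = 0"
      then show ?thesis using P xp[of "4 * j"] xp[of "4 * j + 1"] j4 w[of j] PSO_one k(3) by auto
    next
      assume i: "i = 1"
      have "w (4 * j + 2) \<in> PSO \<longleftrightarrow> (glue m (4 * j) \<in> PSO \<longleftrightarrow> glue m (4 * j + 1) \<in> PSO)"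
        using w(3)[of j] PSO_mult_iff[OF glue_in glue_in] by simp
      moreover have "k + 1 = 4 * j + 2" "k = 4 * j + 1" using k(3) i by auto
      ultimately show ?thesis using P xp[of "4 * j + 1"] xp[of "4 * j + 2"] j4 w(2)[of j] by auto
    qed
  qed
  have "\<exists>p. continuous_map (top_of_set {0..1::real}) PO_topology p \<and> p 0 = x k \<and> p 1 = x (k + 1)"
    if "k < 4 * g" "k mod 4 < 2" for k
  proof -
    have k: "k div 4 < g" "k mod 4 < 2" "k = 4 * (k div 4) + k mod 4" using that by auto
    have "x k \<in> carrier PO" "x (k + 1) \<in> carrier PO" using x_in that(1) by auto
    from PO_path_exists[OF this x_par[OF k]] show ?thesis by metis
  qed
  then obtain p where p: "continuous_map (top_of_set {0..1::real}) PO_topology (p k)" "p k 0 = x k" "p k 1 = x (k + 1)"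
    if "k < 4 * g" "k mod 4 < 2" for k
    by metis
  \<comment> \<open>Free on the first two sides of a block, forced on their partners by the
    adaptedness condition.\<close>
  define c where "c k = (if k mod 4 < 2 then p k
    else (\<lambda>t. inv\<^bsub>PO\<^esub> (T (k - 2) (1 - t)) \<otimes>\<^bsub>PO\<^esub> p (k - 2) (1 - t) \<otimes>\<^bsub>PO\<^esub> glue m (k - 2)))" for k
  have block: "\<exists>j i. j < g \<and> i < 2 \<and> (k = 4 * j + i \<or> k = 4 * j + i + 2)" if "k < 4 * g" for k
  proof (cases "k mod 4 < 2")
    case True
    with that show ?thesis by (intro exI[of _ "k div 4"] exI[of _ "k mod 4"]) auto
  next
    case False
    with that show ?thesis by (intro exI[of _ "k div 4"] exI[of _ "k mod 4 - 2"]) auto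
  qed
  have md: "(4 * j + i) mod 4 < 2" "\<not> (4 * j + i + 2) mod 4 < 2" "4 * j + i < 4 * g" "4 * j + i + 2 < 4 * g"
    if "j < g" "i < 2" for j i
    using that mod_mult_self4[of 4 j i] mod_mult_self4[of 4 j "i + 2"] by (auto simp: add.assoc mult.commute)
  have c_props: "continuous_map (top_of_set {0..1}) PO_topology (c k) \<and> c k 0 = x k \<and> c k 1 = x (k + 1)" if k4: "k < 4 * g" for k
  proof -
    obtain j i where ji: "j < g" "i < 2" "k = 4 * j + i \<or> k = 4 * j + i + 2" using block[OF k4] by blast
    from ji(3) show ?thesis
    proof
      assume k: "k = 4 * j + i"
      then show ?thesis using p[of k] md[OF ji(1,2)] by (simp add: c_def)
    next
      assume k: "k = 4 * j + i + 2"
      let ?l = "4 * j + i"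
      have ck: "c k = (\<lambda>t. inv\<^bsub>PO\<^esub> (T ?l (1 - t)) \<otimes>\<^bsub>PO\<^esub> p ?l (1 - t) \<otimes>\<^bsub>PO\<^esub> glue m ?l)"
        using md[OF ji(1,2)] by (simp add: c_def k)
      note pl = p[OF md(3)[OF ji(1,2)] md(1)[OF ji(1,2)]]
      have "continuous_map (top_of_set {0..1}) PO_topology (c k)"
        unfolding ck
      proof (intro PO_mult_continuous PO_inv_continuous)
        show "continuous_map (top_of_set {0..1}) PO_topology (\<lambda>t. T ?l (1 - t))"
          using continuous_map_compose[OF rev_map T_cont[OF ji(1,2) refl]] by (simp add: o_def)
        show "continuous_map (top_of_set {0..1}) PO_topology (\<lambda>t. p ?l (1 - t))"
          using continuous_map_compose[OF rev_map pl(1)] by (simp add: o_def)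
        show "continuous_map (top_of_set {0..1}) PO_topology (\<lambda>t. glue m ?l)"
          using glue_in by (simp add: topspace_PO)
      qed
      have le: "?l \<le> 4 * g" "?l + 1 \<le> 4 * g" using md[OF ji(1,2)] by auto
      have "c k 0 = inv\<^bsub>PO\<^esub> (T ?l 1) \<otimes>\<^bsub>PO\<^esub> u (?l + 1) \<otimes>\<^bsub>PO\<^esub> (w (?l + 1) \<otimes>\<^bsub>PO\<^esub> glue m ?l)"
        using T_in(1)[OF ji(1,2) refl, of 1] u(1)[OF le(2)] w_in glue_in by (simp add: ck pl x_def PO.m_assoc)
      then have "c k 0 = x k"
        unfolding w_rel(1)[OF ji(2)] u_rel(2)[OF ji(1,2) refl, symmetric] by (simp add: x_def k)
      have "c k 1 = inv\<^bsub>PO\<^esub> (T ?l 0) \<otimes>\<^bsub>PO\<^esub> u ?l \<otimes>\<^bsub>PO\<^esub> (w ?l \<otimes>\<^bsub>PO\<^esub> glue m ?l)"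
        using T_in(1)[OF ji(1,2) refl, of 0] u(1)[OF le(1)] w_in glue_in by (simp add: ck pl x_def PO.m_assoc)
      then have "c k 1 = x (k + 1)"
        unfolding w_rel(2)[OF ji(2)] u_rel(1)[OF ji(1,2) refl, symmetric] by (simp add: x_def k numeral_eq_Suc)
      with \<open>c k 0 = x k\<close> \<open>continuous_map _ _ (c k)\<close> show ?thesis by blast
    qed
  qed
  have "x (4 * g) = x 0"
    using w(1)[of g] w(1)[of 0] by (simp add: x_def u_def vertex_4g)
  then have match: "c k 1 = c (Suc k mod (4 * g)) 0" if "k < 4 * g" for k
    using c_props[OF that] c_props[of "Suc k mod (4 * g)"] that by (cases "Suc k = 4 * g") auto
  obtain f where f: "continuous_map (top_of_set (- {0})) PO_topology f"
    "\<And>k y. k < 4 * g \<Longrightarrow> y \<in> sector k \<Longrightarrow> f y = c k (side_param k y)"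
    using radial_extension[where c = c and Y = PO_topology] c_props match by metis
  have fs: "f (side k t) = c k t" if "k < 4 * g" "t \<in> {0..1}" for k t
    using f(2)[OF that(1) side_in_sector[OF that(2)]] side_param_side by simp
  have fp: "continuous_map (top_of_set pstar) PO_topology f"
    using f(1) by (rule continuous_map_from_subtopology_mono) auto
  have "adapted_pair E m S f"
    unfolding adapted_pair_def
  proof (intro conjI S(1) fp ballI allI impI)
    fix j i t assume ji: "j < g" "i < (2::nat)" and t: "t \<in> {0..1::real}"
    let ?k = "4 * j + i"
    have t': "1 - t \<in> {0..1}" using t by simp
    have pin: "p ?k t \<in> carrier PO" using PO_in[OF p(1)[OF md(3)[OF ji] md(1)[OF ji]]] t by simp
    note Tk = T_in[OF ji refl t]
    have "E.act (S (side (?k + 2) (1 - t))) (f (side (?k + 2) (1 - t)))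
       = E.act (E.act (S (side ?k t)) (T ?k t)) (inv\<^bsub>PO\<^esub> (T ?k t) \<otimes>\<^bsub>PO\<^esub> p ?k t \<otimes>\<^bsub>PO\<^esub> glue m ?k)"
    proof -
      have "c (?k + 2) (1 - t) = inv\<^bsub>PO\<^esub> (T ?k t) \<otimes>\<^bsub>PO\<^esub> p ?k t \<otimes>\<^bsub>PO\<^esub> glue m ?k"
        using md(2)[OF ji] by (simp add: c_def)
      then show ?thesis unfolding fs[OF md(4)[OF ji] t'] Tk(2) by metis
    qed
    also have "\<dots> = E.act (S (side ?k t)) (p ?k t \<otimes>\<^bsub>PO\<^esub> glue m ?k)"
      using E.bundle_props(5)[OF St[OF side_in_polygon[OF t]] Tk(1)] Tk(1) pin glue_in
      by (simp add: PO.m_assoc[symmetric])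
    also have "\<dots> = E.act (E.act (S (side ?k t)) (f (side ?k t))) (glue m ?k)"
      using E.bundle_props(5)[OF St[OF side_in_polygon[OF t]] pin glue_in] md[OF ji]
      by (simp add: fs[OF md(3)[OF ji] t] c_def)
    finally show "E.act (S (side (?k + 2) (1 - t))) (f (side (?k + 2) (1 - t)))
      = E.act (E.act (S (side ?k t)) (f (side ?k t))) (glue m ?k)" .
  qed (use S(2) in simp)
  then show ?thesis using m(1) by blast
qed

lemma clutched_exists:
  fixes E :: "('e, 'x, 'n sq_matrix set) bundle_data"
  assumes "principal_bundle PO PO_topology X E"
  obtains m z where "clutched E m z"
  using adapted_pair_exists[OF assms] winding_exists unfolding clutched_def adapted_pair_def by metis

lemma adapted_pairD:
  assumes "adapted_pair E m S f"
  shows "continuous_map (top_of_set (polygon g)) (total_space E) S" "\<And>y. y \<in> polygon g \<Longrightarrow> bundle_proj E (S y) = q y"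
    "continuous_map (top_of_set pstar) PO_topology f"
    "\<And>j i t. j < g \<Longrightarrow> i < 2 \<Longrightarrow> t \<in> {0..1} \<Longrightarrow>
        bundle_act E (S (side (4 * j + i + 2) (1 - t))) (f (side (4 * j + i + 2) (1 - t))) =
        bundle_act E (bundle_act E (S (side (4 * j + i) t)) (f (side (4 * j + i) t))) (glue m (4 * j + i))"
  using assms unfolding adapted_pair_def by auto

section \<open>Dependence of the winding on the choices\<close>

lemma pstar_cont: "continuous_map (top_of_set (polygon g)) Y h \<Longrightarrow> continuous_map (top_of_set pstar) Y h"
  by (erule continuous_map_from_subtopology_mono) auto

text \<open>The transition k between the two trivializations is equivariant, which limits its
  winding. It satisfies f k = d f', where d compares the two sections over the whole polygon and
  therefore has winding 1. The windings of both sides are compared.\<close>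

lemma adapted_pair_winding_unique:
  fixes E :: "('e, 'x, 'n sq_matrix set) bundle_data"
  assumes E: "principal_bundle PO PO_topology X E"
    and A: "adapted_pair E m S f" "winding f z" and A': "adapted_pair E m S' f'" "winding f' z'"
  obtains w where "w = cl_one \<or> w = - cl_one" "(\<And>k. k < 2 * g \<Longrightarrow> m k = 0) \<Longrightarrow> w = cl_one"
    "z' = z \<star> w \<or> z' = pi1_flip z \<star> w"
proof -
  interpret E: PO_bundle dummy X E by unfold_locales (rule E)
  note S = adapted_pairD[OF A(1)] and S' = adapted_pairD[OF A'(1)]
  have St: "S y \<in> topspace E.TE" "S' y \<in> topspace E.TE" "E.prj (S y) = E.prj (S' y)" if "y \<in> polygon g" for y
    using continuous_map_image_subset_topspace[OF S(1)] continuous_map_image_subset_topspace[OF S'(1)] that S(2) S'(2) by auto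
  define d where "d y = E.bdiv (S y) (S' y)" for y
  have d_cont: "continuous_map (top_of_set (polygon g)) PO_topology d"
    unfolding d_def by (rule E.dv_continuous[OF S(1) S'(1)]) (use S(2) S'(2) in auto)
  have d: "d y \<in> carrier PO" "E.act (S y) (d y) = S' y" if "y \<in> polygon g" for y
    unfolding d_def using E.act_transitive[OF St[OF that]] by auto
  have fi: "f y \<in> carrier PO" "f' y \<in> carrier PO" if "y \<in> pstar" for y
    using PO_in[OF S(3)] PO_in[OF S'(3)] that by auto
  define k where "k y = inv\<^bsub>PO\<^esub> (f y) \<otimes>\<^bsub>PO\<^esub> (d y \<otimes>\<^bsub>PO\<^esub> f' y)" for y
  have k_cont: "continuous_map (top_of_set pstar) PO_topology k"
    unfolding k_def by (intro PO_mult_continuous PO_inv_continuous S(3) S'(3) pstar_cont[OF d_cont])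
  have k_in: "k y \<in> carrier PO" if "y \<in> pstar" for y using PO_in[OF k_cont] that by auto
  have fk: "f y \<otimes>\<^bsub>PO\<^esub> k y = d y \<otimes>\<^bsub>PO\<^esub> f' y" if "y \<in> pstar" for y
    unfolding k_def using fi[OF that] d[of y] that by (simp add: PO.m_assoc[symmetric])
  have kS: "E.act (E.act (S y) (f y)) (k y) = E.act (S' y) (f' y)" if "y \<in> pstar" for y
  proof -
    have y: "y \<in> polygon g" using that by simp
    have "E.act (E.act (S y) (f y)) (k y) = E.act (S y) (d y \<otimes>\<^bsub>PO\<^esub> f' y)"
      using E.bundle_props(5)[OF St(1)[OF y] fi(1)[OF that] k_in[OF that]] fk[OF that] by simp
    also have "\<dots> = E.act (E.act (S y) (d y)) (f' y)"
      using E.bundle_props(5)[OF St(1)[OF y] d(1)[OF y] fi(2)[OF that]] by simp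
    finally show ?thesis using d(2)[OF y] by simp
  qed
  have "equivariant m k"
    unfolding equivariant_def
  proof (intro allI impI ballI)
    fix j i t assume ji: "j < g" "i < (2::nat)" and t: "t \<in> {0..1::real}"
    let ?l = "4 * j + i"
    let ?y = "side ?l t" and ?y' = "side (?l + 2) (1 - t)" and ?h = "glue m ?l"
    have y: "?y \<in> pstar" "?y' \<in> pstar" using t by (auto intro!: side_pstar simp del: Diff_iff)
    then have yp: "?y \<in> polygon g" "?y' \<in> polygon g" by auto
    let ?e = "E.act (S ?y) (f ?y)"
    have e: "?e \<in> topspace E.TE" by (rule E.act_in[OF St(1)[OF yp(1)] fi(1)[OF y(1)]])
    have "E.act ?e (?h \<otimes>\<^bsub>PO\<^esub> k ?y') = E.act (E.act ?e ?h) (k ?y')"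
      using E.bundle_props(5)[OF e glue_in k_in[OF y(2)]] by simp
    also have "\<dots> = E.act (S' ?y') (f' ?y')" using S(4)[OF ji t] kS[OF y(2)] by simp
    also have "\<dots> = E.act (E.act (S' ?y) (f' ?y)) ?h" by (rule S'(4)[OF ji t])
    also have "\<dots> = E.act (E.act ?e (k ?y)) ?h" using kS[OF y(1)] by simp
    also have "\<dots> = E.act ?e (k ?y \<otimes>\<^bsub>PO\<^esub> ?h)" using E.bundle_props(5)[OF e k_in[OF y(1)] glue_in] by simp
    finally have "?h \<otimes>\<^bsub>PO\<^esub> k ?y' = k ?y \<otimes>\<^bsub>PO\<^esub> ?h"
      by (rule E.act_free[OF e, rotated 2]) (use glue_in k_in y in auto)
    then have "inv\<^bsub>PO\<^esub> ?h \<otimes>\<^bsub>PO\<^esub> (?h \<otimes>\<^bsub>PO\<^esub> k ?y') = inv\<^bsub>PO\<^esub> ?h \<otimes>\<^bsub>PO\<^esub> (k ?y \<otimes>\<^bsub>PO\<^esub> ?h)" by simp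
    then show "k ?y' = inv\<^bsub>PO\<^esub> ?h \<otimes>\<^bsub>PO\<^esub> k ?y \<otimes>\<^bsub>PO\<^esub> ?h"
      using glue_in[of m ?l] k_in[OF y(1)] k_in[OF y(2)] by (simp add: PO.m_assoc[symmetric])
  qed
  moreover obtain w where w: "winding k w" using winding_exists[OF k_cont] by blast
  ultimately have w1: "w = cl_one \<or> w = - cl_one" "(\<And>k. k < 2 * g \<Longrightarrow> m k = 0) \<Longrightarrow> w = cl_one"
    using equivariant_winding by blast+
  have "winding (\<lambda>y. d y \<otimes>\<^bsub>PO\<^esub> f' y) ((if f' (bloop 0) \<in> PSO then cl_one else pi1_flip cl_one) \<star> z')"
    by (rule winding_mult[OF winding_polygon[OF d_cont] A'(2)])
  then have "winding (\<lambda>y. d y \<otimes>\<^bsub>PO\<^esub> f' y) z'" by (simp split: if_splits)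
  moreover have "winding (\<lambda>y. d y \<otimes>\<^bsub>PO\<^esub> f' y) ((if k (bloop 0) \<in> PSO then z else pi1_flip z) \<star> w)"
    using winding_mult[OF A(2) w] winding_cong[of "\<lambda>y. f y \<otimes>\<^bsub>PO\<^esub> k y" "\<lambda>y. d y \<otimes>\<^bsub>PO\<^esub> f' y"] fk by blast
  ultimately have "z' = (if k (bloop 0) \<in> PSO then z else pi1_flip z) \<star> w" by (rule winding_unique)
  then show thesis using that[of w] w1 by (auto split: if_splits)
qed

lemma adapted_pair_mult:
  fixes E :: "('e, 'x, 'n sq_matrix set) bundle_data"
  assumes E: "principal_bundle PO PO_topology X E"
    and A: "adapted_pair E m S f" and k: "continuous_map (top_of_set pstar) PO_topology k" "equivariant m k"
  shows "adapted_pair E m S (\<lambda>y. f y \<otimes>\<^bsub>PO\<^esub> k y)"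
proof -
  interpret E: PO_bundle dummy X E by unfold_locales (rule E)
  note S = adapted_pairD[OF A]
  have St: "S y \<in> topspace E.TE" if "y \<in> polygon g" for y
    using continuous_map_image_subset_topspace[OF S(1)] that by auto
  have fi: "f y \<in> carrier PO" "k y \<in> carrier PO" if "y \<in> pstar" for y
    using PO_in[OF S(3)] PO_in[OF k(1)] that by auto
  show ?thesis
    unfolding adapted_pair_def
  proof (intro conjI S(1) PO_mult_continuous S(3) k(1) ballI allI impI)
    fix j i t assume ji: "j < g" "i < (2::nat)" and t: "t \<in> {0..1::real}"
    let ?l = "4 * j + i"
    let ?y = "side ?l t" and ?y' = "side (?l + 2) (1 - t)" and ?h = "glue m ?l"
    have y: "?y \<in> pstar" "?y' \<in> pstar" using t by (auto intro!: side_pstar simp del: Diff_iff)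
    then have yp: "?y \<in> polygon g" "?y' \<in> polygon g" by auto
    let ?e = "E.act (S ?y) (f ?y)"
    have e: "?e \<in> topspace E.TE" by (rule E.act_in[OF St(1)[OF yp(1)] fi(1)[OF y(1)]])
    have kk: "k ?y' = inv\<^bsub>PO\<^esub> ?h \<otimes>\<^bsub>PO\<^esub> k ?y \<otimes>\<^bsub>PO\<^esub> ?h"
      using k(2) ji t unfolding equivariant_def by blast
    have "E.act (S ?y') (f ?y' \<otimes>\<^bsub>PO\<^esub> k ?y') = E.act (E.act (S ?y') (f ?y')) (k ?y')"
      using E.bundle_props(5)[OF St[OF yp(2)] fi[OF y(2)]] by simp
    also have "\<dots> = E.act ?e (?h \<otimes>\<^bsub>PO\<^esub> k ?y')"
      unfolding S(4)[OF ji t] using E.bundle_props(5)[OF e glue_in fi(2)[OF y(2)]] by simp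
    also have "?h \<otimes>\<^bsub>PO\<^esub> k ?y' = k ?y \<otimes>\<^bsub>PO\<^esub> ?h"
      unfolding kk using glue_in[of m ?l] fi(2)[OF y(1)] by (simp add: PO.m_assoc[symmetric])
    also have "E.act ?e (k ?y \<otimes>\<^bsub>PO\<^esub> ?h) = E.act (E.act ?e (k ?y)) ?h"
      using E.bundle_props(5)[OF e fi(2)[OF y(1)] glue_in] by simp
    also have "E.act ?e (k ?y) = E.act (S ?y) (f ?y \<otimes>\<^bsub>PO\<^esub> k ?y)"
      using E.bundle_props(5)[OF St[OF yp(1)] fi[OF y(1)]] by simp
    finally show "E.act (S ?y') (f ?y' \<otimes>\<^bsub>PO\<^esub> k ?y') = E.act (E.act (S ?y) (f ?y \<otimes>\<^bsub>PO\<^esub> k ?y)) ?h" .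
  qed (use S(2) in simp)
qed

text \<open>The constant map with value \<open>[r]\<close> is equivariant, since it commutes with
  the gluing elements, and odd, so right multiplication by it flips the winding.\<close>

lemma clutched_flip:
  fixes E :: "('e, 'x, 'n sq_matrix set) bundle_data"
  assumes E: "principal_bundle PO PO_topology X E" and c: "clutched E m z"
  shows "clutched E m (pi1_flip z)"
proof -
  obtain S f where A: "adapted_pair E m S f" "winding f z" and m: "m \<in> Z2_tuples g"
    using c by (auto simp: clutched_def)
  let ?r = "pin_to_PO rpin"
  have "continuous_map (top_of_set pstar) PO_topology (\<lambda>_. ?r)" using rpin(1) by (simp add: topspace_PO)
  moreover have "equivariant m (\<lambda>_. ?r)"
  proof -
    have "?r \<otimes>\<^bsub>PO\<^esub> glue m k = glue m k \<otimes>\<^bsub>PO\<^esub> ?r" for k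
      using rpin(1) by (simp add: glue_def glue_pin_def pin_to_PO_mult pin_set.one)
    then have "inv\<^bsub>PO\<^esub> (glue m k) \<otimes>\<^bsub>PO\<^esub> ?r \<otimes>\<^bsub>PO\<^esub> glue m k = ?r" for k
      using glue_in[of m k] rpin(1) by (simp add: PO.m_assoc) (simp add: PO.m_assoc[symmetric])
    then show ?thesis by (simp add: equivariant_def)
  qed
  ultimately have "adapted_pair E m S (\<lambda>y. f y \<otimes>\<^bsub>PO\<^esub> ?r)" by (rule adapted_pair_mult[OF E A(1)])
  moreover have "winding (\<lambda>y. f y \<otimes>\<^bsub>PO\<^esub> ?r) (pi1_flip z)"
    using winding_mult[OF A(2) winding_const[OF pin_to_PO_closed[OF rpin(1)]]] rpin(2) PSO_pin_iff[OF rpin(1)] by simp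
  ultimately show ?thesis using m by (auto simp: clutched_def)
qed

text \<open>A nonzero entry of m provides a pair of sides identified by \<open>r\<close>, and the
  map from \<open>twist_exists\<close> changes the sign of the winding.\<close>

lemma clutched_neg:
  fixes E :: "('e, 'x, 'n sq_matrix set) bundle_data"
  assumes E: "principal_bundle PO PO_topology X E" and c: "clutched E m z" and k: "k < 2 * g" "m k \<noteq> 0"
  shows "clutched E m (- z)"
proof -
  obtain S f where A: "adapted_pair E m S f" "winding f z" and m: "m \<in> Z2_tuples g"
    using c by (auto simp: clutched_def)
  \<comment> \<open>The pair of sides with 2j + 1 - i = k, the index used in
    \<open>nontrivial\<close>.\<close>
  define j i where "j = k div 2" and "i = 1 - k mod 2"
  have ji: "j < g" "i < 2" "2 * j + 1 - i = k" using k by (auto simp: j_def i_def)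
  then have "nontrivial m (4 * j + i)" using k(2) nontrivial_index by metis
  then obtain t where t: "continuous_map (top_of_set pstar) PO_topology t" "equivariant m t"
    "winding t (- cl_one)" "t (bloop 0) \<in> PSO" using twist_exists[OF ji(1,2)] by blast
  have "winding (\<lambda>y. f y \<otimes>\<^bsub>PO\<^esub> t y) (- z)"
    using winding_mult[OF A(2) t(3)] t(4) by (simp add: cl.minus_right)
  then show ?thesis using adapted_pair_mult[OF E A(1) t(1,2)] m by (auto simp: clutched_def)
qed

text \<open>Equal windings of f and f' force the winding 1 for v. The boundary values of v therefore
  extend to a map u on the whole polygon, and S' changed by u has the same transition elements as
  S.\<close>

lemma clutched_isomorphic:
  fixes E :: "('e, 'x, 'n sq_matrix set) bundle_data" and E' :: "('f, 'x, 'n sq_matrix set) bundle_data"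
  assumes E: "principal_bundle PO PO_topology X E" and E': "principal_bundle PO PO_topology X E'"
    and c: "clutched E m z" and c': "clutched E' m z"
  shows "bundle_isomorphic PO E E'"
proof -
  interpret E: PO_bundle dummy X E by unfold_locales (rule E)
  interpret E': PO_bundle dummy X E' by unfold_locales (rule E')
  obtain S f where A: "adapted_pair E m S f" "winding f z" using c by (auto simp: clutched_def)
  obtain S' f' where A': "adapted_pair E' m S' f'" "winding f' z" using c' by (auto simp: clutched_def)
  note S = adapted_pairD[OF A(1)] and S' = adapted_pairD[OF A'(1)]
  have St: "S y \<in> topspace E.TE" "S' y \<in> topspace E'.TE" if "y \<in> polygon g" for y
    using continuous_map_image_subset_topspace[OF S(1)] continuous_map_image_subset_topspace[OF S'(1)] that by auto
  have fi: "f y \<in> carrier PO" "f' y \<in> carrier PO" if "y \<in> pstar" for y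
    using PO_in[OF S(3)] PO_in[OF S'(3)] that by auto
  \<comment> \<open>On the sides this is the change of S' needed to match S, because the two
    trivializations have the same gluing elements.\<close>
  define v where "v y = f' y \<otimes>\<^bsub>PO\<^esub> inv\<^bsub>PO\<^esub> (f y)" for y
  have v_cont: "continuous_map (top_of_set pstar) PO_topology v"
    unfolding v_def by (intro PO_mult_continuous PO_inv_continuous S(3) S'(3))
  obtain x where x: "winding v x" using winding_exists[OF v_cont] by blast
  have vf: "v y \<otimes>\<^bsub>PO\<^esub> f y = f' y" if "y \<in> pstar" for y
    unfolding v_def using fi[OF that] by (simp add: PO.m_assoc)
  define x' where "x' = (if f (bloop 0) \<in> PSO then x else pi1_flip x)"
  have "winding (\<lambda>y. v y \<otimes>\<^bsub>PO\<^esub> f y) (x' \<star> z)"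
    unfolding x'_def by (rule winding_mult[OF x A(2)])
  then have "winding f' (x' \<star> z)"
    using winding_cong[of "\<lambda>y. v y \<otimes>\<^bsub>PO\<^esub> f y" f' "x' \<star> z"] vf by simp
  from winding_unique[OF this A'(2)] have "x' \<star> z = cl_one \<star> z" by simp
  then have "x' = cl_one"
    using pin_cancel_right[OF pi1_pin[OF winding_in[OF A(2)]]] by blast
  then have "x = cl_one"
    using pi1_flip_flip[OF winding_in[OF x]] by (cases "f (bloop 0) \<in> PSO") (auto simp: x'_def)
  then obtain u where u: "continuous_map (top_of_set (polygon g)) PO_topology u"
    "\<And>k t. k < 4 * g \<Longrightarrow> t \<in> {0..1} \<Longrightarrow> u (side k t) = v (side k t)"
    using winding_extend[OF v_cont] x by metis
  have ui: "u y \<in> carrier PO" if "y \<in> polygon g" for y using PO_in[OF u(1)] that by auto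
  define S'' where "S'' y = E'.act (S' y) (u y)" for y
  have S''c: "continuous_map (top_of_set (polygon g)) E'.TE S''"
    unfolding S''_def by (rule E'.act_continuous[OF S'(1) u(1)])
  have S''t: "S'' y \<in> topspace E'.TE" "E'.prj (S'' y) = q y" if "y \<in> polygon g" for y
    unfolding S''_def using E'.act_in[OF St(2) ui] E'.bundle_props(4)[OF St(2) ui] S'(2) that by auto
  have eq: "E.bdiv (S x) (S y) = E'.bdiv (S'' x) (S'' y)"
    if "x \<in> polygon g" "y \<in> polygon g" "q x = q y" for x y
    using that
  proof (rule q_induct)
    show "E.bdiv (S x) (S x) = E'.bdiv (S'' x) (S'' x)" if "x \<in> polygon g" for x
      using that E.bdiv_self E'.bdiv_self St S''t by simp
    show "E.bdiv (S y) (S x) = E'.bdiv (S'' y) (S'' x)"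
      if "x \<in> polygon g" "y \<in> polygon g" "q x = q y" "E.bdiv (S x) (S y) = E'.bdiv (S'' x) (S'' y)" for x y
      using E.bdiv_sym[of "S x" "S y"] E'.bdiv_sym[of "S'' x" "S'' y"] that St S''t S(2) by simp
    show "E.bdiv (S x) (S z) = E'.bdiv (S'' x) (S'' z)"
      if "x \<in> polygon g" "y \<in> polygon g" "z \<in> polygon g" "q x = q y" "q y = q z"
        "E.bdiv (S x) (S y) = E'.bdiv (S'' x) (S'' y)" "E.bdiv (S y) (S z) = E'.bdiv (S'' y) (S'' z)" for x y z
      using E.bdiv_trans[of "S x" "S y" "S z"] E'.bdiv_trans[of "S'' x" "S'' y" "S'' z"] that St S''t S(2) by simp
    fix j i t assume ji: "j < g" "i < (2::nat)" and t: "t \<in> {0..1::real}"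
    let ?l = "4 * j + i"
    let ?y = "side ?l t" and ?y' = "side (?l + 2) (1 - t)" and ?h = "glue m ?l"
    have y: "?y \<in> pstar" "?y' \<in> pstar" using t by (auto intro!: side_pstar simp del: Diff_iff)
    then have yp: "?y \<in> polygon g" "?y' \<in> polygon g" by auto
    let ?T = "f ?y \<otimes>\<^bsub>PO\<^esub> ?h \<otimes>\<^bsub>PO\<^esub> inv\<^bsub>PO\<^esub> (f ?y')"
    have T: "?T \<in> carrier PO" using fi y glue_in by simp
    have "E.act (S ?y) ?T = E.act (E.act (E.act (S ?y) (f ?y)) ?h) (inv\<^bsub>PO\<^esub> (f ?y'))"
      using E.bundle_props(5) E.act_in St[OF yp(1)] fi[OF y(1)] fi[OF y(2)] glue_in by simp
    also have "\<dots> = E.act (E.act (S ?y') (f ?y')) (inv\<^bsub>PO\<^esub> (f ?y'))" using S(4)[OF ji t] by simp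
    also have "\<dots> = S ?y'"
      using E.bundle_props(5)[OF St(1)[OF yp(2)] fi(1)[OF y(2)], of "inv\<^bsub>PO\<^esub> (f ?y')"] E.bundle_props(3)[OF St(1)[OF yp(2)]] fi(1)[OF y(2)]
      by simp
    finally have 1: "E.bdiv (S ?y) (S ?y') = ?T" by (rule E.bdiv_eqI[OF St(1)[OF yp(1)] T])
    have l4: "?l < 4 * g" "?l + 2 < 4 * g" using ji by auto
    have u1: "u ?y = f' ?y \<otimes>\<^bsub>PO\<^esub> inv\<^bsub>PO\<^esub> (f ?y)" "u ?y' = f' ?y' \<otimes>\<^bsub>PO\<^esub> inv\<^bsub>PO\<^esub> (f ?y')"
      using u(2)[OF l4(1) t] u(2)[OF l4(2), of "1 - t"] t by (auto simp: v_def)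
    have "E'.act (S'' ?y) ?T = E'.act (S' ?y) (u ?y \<otimes>\<^bsub>PO\<^esub> ?T)"
      unfolding S''_def by (rule E'.bundle_props(5)[OF St(2)[OF yp(1)] ui[OF yp(1)] T])
    also have "u ?y \<otimes>\<^bsub>PO\<^esub> ?T = f' ?y \<otimes>\<^bsub>PO\<^esub> ?h \<otimes>\<^bsub>PO\<^esub> inv\<^bsub>PO\<^esub> (f ?y')"
    proof -
      have "inv\<^bsub>PO\<^esub> (f ?y) \<otimes>\<^bsub>PO\<^esub> (f ?y \<otimes>\<^bsub>PO\<^esub> (?h \<otimes>\<^bsub>PO\<^esub> inv\<^bsub>PO\<^esub> (f ?y'))) = ?h \<otimes>\<^bsub>PO\<^esub> inv\<^bsub>PO\<^esub> (f ?y')"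
        using fi[OF y(1)] fi[OF y(2)] glue_in by (simp add: PO.m_assoc[symmetric])
      then show ?thesis using fi[OF y(1)] fi[OF y(2)] glue_in by (simp add: u1 PO.m_assoc)
    qed
    also have "E'.act (S' ?y) (f' ?y \<otimes>\<^bsub>PO\<^esub> ?h \<otimes>\<^bsub>PO\<^esub> inv\<^bsub>PO\<^esub> (f ?y'))
       = E'.act (E'.act (E'.act (S' ?y) (f' ?y)) ?h) (inv\<^bsub>PO\<^esub> (f ?y'))"
      using E'.bundle_props(5) E'.act_in St[OF yp(1)] fi[OF y(1)] fi[OF y(2)] glue_in by simp
    also have "\<dots> = E'.act (E'.act (S' ?y') (f' ?y')) (inv\<^bsub>PO\<^esub> (f ?y'))" using S'(4)[OF ji t] by simp
    also have "\<dots> = S'' ?y'"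
      unfolding S''_def u1 using E'.bundle_props(5)[OF St(2)[OF yp(2)] fi(2)[OF y(2)], of "inv\<^bsub>PO\<^esub> (f ?y')"] fi(1)[OF y(2)] by simp
    finally have "E'.bdiv (S'' ?y) (S'' ?y') = ?T" by (rule E'.bdiv_eqI[OF S''t(1)[OF yp(1)] T])
    with 1 show "E.bdiv (S ?y) (S ?y') = E'.bdiv (S'' ?y) (S'' ?y')" by simp
  qed
  show ?thesis
    by (rule isomorphic_if_same_cocycle[OF E E' S(1,2) S''c S''t(2) eq])
qed

lemma clutched_transport:
  fixes E :: "('e, 'x, 'n sq_matrix set) bundle_data" and E' :: "('f, 'x, 'n sq_matrix set) bundle_data"
  assumes E: "principal_bundle PO PO_topology X E"
    and iso: "bundle_isomorphic PO E E'" and c: "clutched E m z"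
  shows "clutched E' m z"
proof -
  interpret E: PO_bundle dummy X E by unfold_locales (rule E)
  obtain F where F: "homeomorphic_map E.TE (total_space E') F"
    "\<And>e. e \<in> topspace E.TE \<Longrightarrow> bundle_proj E' (F e) = E.prj e"
    "\<And>e a. e \<in> topspace E.TE \<Longrightarrow> a \<in> carrier PO \<Longrightarrow> F (E.act e a) = bundle_act E' (F e) a"
    using iso unfolding bundle_isomorphic_def by blast
  obtain S f where A: "adapted_pair E m S f" "winding f z" and m: "m \<in> Z2_tuples g"
    using c by (auto simp: clutched_def)
  note S = adapted_pairD[OF A(1)]
  have St: "S y \<in> topspace E.TE" if "y \<in> polygon g" for y
    using continuous_map_image_subset_topspace[OF S(1)] that by auto
  have fi: "f y \<in> carrier PO" if "y \<in> pstar" for y using PO_in[OF S(3)] that by auto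
  have "adapted_pair E' m (F \<circ> S) f"
    unfolding adapted_pair_def
  proof (intro conjI S(3) ballI allI impI)
    show "continuous_map (top_of_set (polygon g)) (total_space E') (F \<circ> S)"
      by (rule continuous_map_compose[OF S(1) homeomorphic_imp_continuous_map[OF F(1)]])
    show "bundle_proj E' ((F \<circ> S) y) = q y" if "y \<in> polygon g" for y using F(2) St S(2) that by simp
    fix j i t assume ji: "j < g" "i < (2::nat)" and t: "t \<in> {0..1::real}"
    let ?l = "4 * j + i"
    let ?y = "side ?l t" and ?y' = "side (?l + 2) (1 - t)" and ?h = "glue m ?l"
    have y: "?y \<in> pstar" "?y' \<in> pstar" using t by (auto intro!: side_pstar simp del: Diff_iff)
    then have yp: "?y \<in> polygon g" "?y' \<in> polygon g" by auto
    have "bundle_act E' (F (S ?y')) (f ?y') = F (E.act (S ?y') (f ?y'))"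
      using F(3)[OF St[OF yp(2)] fi[OF y(2)]] by simp
    also have "\<dots> = bundle_act E' (F (E.act (S ?y) (f ?y))) ?h"
      unfolding S(4)[OF ji t] by (rule F(3)[OF E.act_in[OF St[OF yp(1)] fi[OF y(1)]] glue_in])
    also have "\<dots> = bundle_act E' (bundle_act E' (F (S ?y)) (f ?y)) ?h"
      using F(3)[OF St[OF yp(1)] fi[OF y(1)]] by simp
    finally show "bundle_act E' ((F \<circ> S) ?y') (f ?y') = bundle_act E' (bundle_act E' ((F \<circ> S) ?y) (f ?y)) ?h" by simp
  qed
  then show ?thesis using A(2) m by (auto simp: clutched_def)
qed

section \<open>Gluing loops and windings\<close>

lemma glue_value: "glue m k = (if nontrivial m k then PO_class r else PO_class (mat 1))"
  using rpin(3) by (simp add: glue_def glue_pin_def pin_to_PO_one PO_one)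

lemma adapted_trivialization_section:
  fixes E :: "('e, 'x, 'n sq_matrix set) bundle_data"
  assumes E: "principal_bundle PO PO_topology X E" and \<tau>: "adapted_trivialization g q r E \<tau>"
  obtains m where "m \<in> Z2_tuples g"
    "continuous_map (top_of_set pstar) (total_space E) (\<lambda>y. snd (\<tau> (y, \<one>\<^bsub>PO\<^esub>)))"
    "\<And>y. y \<in> pstar \<Longrightarrow> bundle_proj E (snd (\<tau> (y, \<one>\<^bsub>PO\<^esub>))) = q y"
    "\<And>j i t. j < g \<Longrightarrow> i < 2 \<Longrightarrow> t \<in> {0..1} \<Longrightarrow> snd (\<tau> (side (4 * j + i + 2) (1 - t), \<one>\<^bsub>PO\<^esub>)) =
      bundle_act E (snd (\<tau> (side (4 * j + i) t, \<one>\<^bsub>PO\<^esub>))) (glue m (4 * j + i))"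
proof -
  interpret E: PO_bundle dummy X E by unfold_locales (rule E)
  define A where "A y = snd (\<tau> (y, \<one>\<^bsub>PO\<^esub>))" for y
  have tr: "trivialization PO PO_topology (top_of_set pstar) (pullback_bundle (top_of_set pstar) q E) (topspace (top_of_set pstar)) \<tau>"
    using \<tau> by (simp add: adapted_trivialization_def)
  have Ac: "continuous_map (top_of_set pstar) E.TE A" and Ap: "\<And>y. y \<in> pstar \<Longrightarrow> E.prj (A y) = q y"
    using E.pullback_trivialization_section[OF tr] by (simp_all add: A_def[abs_def])
  have Ah: "\<exists>h\<in>{PO_class (mat 1), PO_class r}. \<forall>t\<in>{0..1}. A (side (4 * j + i + 2) (1 - t)) = E.act (A (side (4 * j + i) t)) h"
    if "j < g" "i < 2" for j i
    using \<tau> that unfolding adapted_trivialization_def A_def by blast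
  \<comment> \<open>An entry records whether the identification by \<open>[I]\<close> fails; the
    constant is then \<open>[r]\<close>.\<close>
  obtain m where m: "m \<in> Z2_tuples g" "\<And>j i. j < g \<Longrightarrow> i < 2 \<Longrightarrow> nontrivial m (4 * j + i) \<longleftrightarrow>
      \<not> (\<forall>t\<in>{0..1}. A (side (4 * j + i + 2) (1 - t)) = E.act (A (side (4 * j + i) t)) (PO_class (mat 1)))"
    using tuple_exists[of "\<lambda>k. \<not> (\<forall>t\<in>{0..1}. A (side (k + 2) (1 - t)) = E.act (A (side k t)) (PO_class (mat 1)))"] by blast
  have Ag: "A (side (4 * j + i + 2) (1 - t)) = E.act (A (side (4 * j + i) t)) (glue m (4 * j + i))"
    if "j < g" "i < 2" "t \<in> {0..1}" for j i t
    using Ah[OF that(1,2)] m(2)[OF that(1,2)] that(3) unfolding glue_value by auto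
  show thesis by (rule that[OF m(1) Ac[unfolded A_def] Ap[unfolded A_def] Ag[unfolded A_def]])
qed

text \<open>A criterion common to the analysis of gluing loops and to the construction of bundles.
  Over the disc \<open>\<sigma>\<close> differs from S by a map that lifts to Pin(n) on the disc, so
  it contributes no winding and the class of f on the circle is that of c.\<close>

lemma sections_clutched:
  fixes E :: "('e, 'x, 'n sq_matrix set) bundle_data"
  assumes E: "principal_bundle PO PO_topology X E" and m: "m \<in> Z2_tuples g"
    and Ac: "continuous_map (top_of_set pstar) (total_space E) A" and Ap: "\<And>y. y \<in> pstar \<Longrightarrow> bundle_proj E (A y) = q y"
    and Ag: "\<And>j i t. j < g \<Longrightarrow> i < 2 \<Longrightarrow> t \<in> {0..1} \<Longrightarrow>
      A (side (4 * j + i + 2) (1 - t)) = bundle_act E (A (side (4 * j + i) t)) (glue m (4 * j + i))"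
    and d: "0 < \<delta>" and cp: "cball 0 \<delta> \<subseteq> polygon g"
    and sc: "continuous_map (top_of_set (cball 0 \<delta>)) (total_space E) \<sigma>"
    and sp: "\<And>y. y \<in> cball 0 \<delta> \<Longrightarrow> bundle_proj E (\<sigma> y) = q y"
    and c: "pin_path c"
    and loop: "\<And>t. t \<in> {0..1} \<Longrightarrow> A (of_real \<delta> * cis (2 * pi * t)) =
      bundle_act E (\<sigma> (of_real \<delta> * cis (2 * pi * t))) (pin_to_PO (c t))"
    and c01: "c 1 = c 0 \<star> z" and z: "z \<in> pi1_elems"
  shows "clutched E m z"
proof -
  interpret E: PO_bundle dummy X E by unfold_locales (rule E)
  obtain S where S: "continuous_map (top_of_set (polygon g)) E.TE S" "\<And>y. y \<in> polygon g \<Longrightarrow> E.prj (S y) = q y"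
    using E.lift_exists[OF compact_polygon convex_polygon q_cont] by blast
  define f where "f y = E.bdiv (S y) (A y)" for y
  have St: "S y \<in> topspace E.TE" if "y \<in> polygon g" for y
    using continuous_map_image_subset_topspace[OF S(1)] that by auto
  have At: "A y \<in> topspace E.TE" if "y \<in> pstar" for y
    using continuous_map_image_subset_topspace[OF Ac] that by auto
  have fA: "f y \<in> carrier PO" "E.act (S y) (f y) = A y" if "y \<in> pstar" for y
    unfolding f_def using E.act_transitive[of "S y" "A y"] St At[OF that] Ap[OF that] S(2) that by auto
  have fc: "continuous_map (top_of_set pstar) PO_topology f"
    unfolding f_def by (rule E.dv_continuous[OF pstar_cont[OF S(1)] Ac]) (use S(2) Ap in auto)
  have ad: "adapted_pair E m S f"
    unfolding adapted_pair_def
  proof (intro conjI S(1) fc ballI allI impI)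
    fix j i t assume ji: "j < g" "i < (2::nat)" and t: "t \<in> {0..1::real}"
    have y: "side (4 * j + i) t \<in> pstar" "side (4 * j + i + 2) (1 - t) \<in> pstar"
      using t by (auto intro!: side_pstar simp del: Diff_iff)
    show "E.act (S (side (4 * j + i + 2) (1 - t))) (f (side (4 * j + i + 2) (1 - t))) =
        E.act (E.act (S (side (4 * j + i) t)) (f (side (4 * j + i) t))) (glue m (4 * j + i))"
      unfolding fA(2)[OF y(1)] fA(2)[OF y(2)] by (rule Ag[OF ji t])
  qed (use S(2) in simp)
  define b where "b y = E.bdiv (S y) (\<sigma> y)" for y
  have Sd: "continuous_map (top_of_set (cball 0 \<delta>)) E.TE S"
    using S(1) by (rule continuous_map_from_subtopology_mono) (use cp in auto)
  have bc: "continuous_map (top_of_set (cball 0 \<delta>)) PO_topology b"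
    unfolding b_def by (rule E.dv_continuous[OF Sd sc]) (use S(2) sp cp in auto)
  have st: "\<sigma> y \<in> topspace E.TE" if "y \<in> cball 0 \<delta>" for y
    using continuous_map_image_subset_topspace[OF sc] that by auto
  have bS: "b y \<in> carrier PO" "E.act (S y) (b y) = \<sigma> y" if "y \<in> cball 0 \<delta>" for y
    unfolding b_def using E.act_transitive[of "S y" "\<sigma> y"] St st[OF that] S(2) sp[OF that] cp that by auto
  obtain B where B: "continuous_map (top_of_set (cball 0 \<delta>)) (top_of_set (pin_set :: 'n clifford set)) B"
    "\<And>y. y \<in> cball 0 \<delta> \<Longrightarrow> pin_to_PO (B y) = b y"
    using pin.lift_exists[OF compact_cball convex_cball bc] by blast
  let ?y = "\<lambda>t. complex_of_real \<delta> * cis (2 * pi * t)"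
  have yin: "?y t \<in> cball 0 \<delta>" "?y t \<in> pstar" for t
    using d cp by (auto simp: norm_mult intro!: subsetD[OF cp])
  have yc: "continuous_map (top_of_set {0..1}) (top_of_set (cball 0 \<delta>)) ?y"
    using yin by (auto intro!: continuous_intros)
  have Bc: "pin_path (\<lambda>t. B (?y t))"
    using continuous_map_compose[OF yc B(1)] by (simp add: o_def)
  have "winding f z"
  proof (rule winding_circle[OF fc d cp])
    show "pin_path (\<lambda>t. B (?y t) \<star> c t)"
      by (rule continuous_pin_mult[OF Bc c])
    show "pin_to_PO (B (?y t) \<star> c t) = f (?y t)" if t: "t \<in> {0..1}" for t
    proof -
      have ct: "c t \<in> pin_set" by (rule continuous_pin_in[OF c t])
      have yp: "?y t \<in> polygon g" using yin(2)[of t] by blast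
      have "E.act (S (?y t)) (f (?y t)) = E.act (\<sigma> (?y t)) (pin_to_PO (c t))"
        using fA[OF yin(2)] loop[OF t] by simp
      also have "\<dots> = E.act (S (?y t)) (b (?y t) \<otimes>\<^bsub>PO\<^esub> pin_to_PO (c t))"
        unfolding bS(2)[OF yin(1), symmetric]
        by (rule E.bundle_props(5)[OF St[OF yp] bS(1)[OF yin(1)] pin_to_PO_closed[OF ct]])
      finally have "f (?y t) = b (?y t) \<otimes>\<^bsub>PO\<^esub> pin_to_PO (c t)"
        by (rule E.act_free[OF St[OF yp] fA(1)[OF yin(2)] PO.m_closed[OF bS(1)[OF yin(1)] pin_to_PO_closed[OF ct]]])
      then show ?thesis
        using B(2)[OF yin(1)] continuous_pin_in[OF B(1) yin(1)] ct by (simp add: pin_to_PO_mult[symmetric])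
    qed
    show "B (?y 1) \<star> c 1 = B (?y 0) \<star> c 0 \<star> z" by (simp add: c01 cl_assoc)
  qed (rule z)
  then show ?thesis using ad m by (auto simp: clutched_def)
qed

lemma gluing_loop_clutched:
  fixes E :: "('e, 'x, 'n sq_matrix set) bundle_data"
  assumes E: "principal_bundle PO PO_topology X E" and \<rho>: "gluing_loop g X q r E \<rho>" "represents_pi1 \<rho> z"
  obtains m where "clutched E m z"
proof -
  interpret E: PO_bundle dummy X E by unfold_locales (rule E)
  obtain \<tau> \<sigma> \<epsilon> \<delta> where \<tau>: "adapted_trivialization g q r E \<tau>" and d: "0 < \<delta>" "\<delta> < \<epsilon>" "ball 0 \<epsilon> \<subseteq> interior (polygon g)"
    and \<sigma>: "trivialization PO PO_topology X E (q ` ball 0 \<epsilon>) \<sigma>"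
    and loop: "\<And>t. t \<in> {0..1} \<Longrightarrow> \<rho> t \<in> PSO \<and> snd (\<tau> (\<delta> *\<^sub>R cis (2 * pi * t), \<one>\<^bsub>PO\<^esub>)) =
           E.act (\<sigma> (q (\<delta> *\<^sub>R cis (2 * pi * t)), \<one>\<^bsub>PO\<^esub>)) (\<rho> t)"
    using \<rho>(1) unfolding gluing_loop_def by blast
  obtain c where c: "pin_path c"
    "\<And>t. t \<in> {0..1} \<Longrightarrow> pin_to_PO (c t) = \<rho> t" "c 1 = c 0 \<star> z" and z: "z \<in> pi1_elems"
    using \<rho>(2) unfolding represents_pi1_def pathin_def by (auto simp: pi1_PO_eq)
  obtain m where m: "m \<in> Z2_tuples g"
    "continuous_map (top_of_set pstar) E.TE (\<lambda>y. snd (\<tau> (y, \<one>\<^bsub>PO\<^esub>)))"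
    "\<And>y. y \<in> pstar \<Longrightarrow> E.prj (snd (\<tau> (y, \<one>\<^bsub>PO\<^esub>))) = q y"
    "\<And>j i t. j < g \<Longrightarrow> i < 2 \<Longrightarrow> t \<in> {0..1} \<Longrightarrow> snd (\<tau> (side (4 * j + i + 2) (1 - t), \<one>\<^bsub>PO\<^esub>)) =
      E.act (snd (\<tau> (side (4 * j + i) t, \<one>\<^bsub>PO\<^esub>))) (glue m (4 * j + i))"
    using adapted_trivialization_section[OF E \<tau>] by blast
  have bp: "ball 0 \<epsilon> \<subseteq> polygon g" using d(3) interior_subset by blast
  have cb: "cball 0 \<delta> \<subseteq> ball 0 \<epsilon>" using d by auto
  have cp: "cball 0 \<delta> \<subseteq> polygon g" using bp cb by blast
  have "clutched E m z"
  proof (rule sections_clutched[OF E m d(1) cp _ _ c(1) _ c(3) z])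
    have "continuous_map (top_of_set (cball 0 \<delta>)) X q"
      using q_cont by (rule continuous_map_from_subtopology_mono) (use cp in auto)
    then have "continuous_map (top_of_set (cball 0 \<delta>)) (subtopology X (q ` ball 0 \<epsilon>)) q"
      using cb by (auto simp: continuous_map_in_subtopology)
    from continuous_map_compose[OF this E.trivialization_section(1)[OF \<sigma>]]
    show "continuous_map (top_of_set (cball 0 \<delta>)) E.TE (\<lambda>y. \<sigma> (q y, \<one>\<^bsub>PO\<^esub>))" by (simp add: o_def)
    show "E.prj (\<sigma> (q y, \<one>\<^bsub>PO\<^esub>)) = q y" if "y \<in> cball 0 \<delta>" for y
      using E.trivialization_section(2)[OF \<sigma>] cb that by blast
    show "snd (\<tau> (of_real \<delta> * cis (2 * pi * t), \<one>\<^bsub>PO\<^esub>)) =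
        E.act (\<sigma> (q (of_real \<delta> * cis (2 * pi * t)), \<one>\<^bsub>PO\<^esub>)) (pin_to_PO (c t))" if "t \<in> {0..1}" for t
      using loop[OF that] c(2)[OF that] by (simp add: scaleR_conv_of_real)
  qed
  then show thesis by (rule that)
qed

text \<open>The loop must take values in PSO(n), whereas f may be odd near the centre; the
  trivialization over the disc is adjusted accordingly.\<close>

lemma clutched_gluing_loop:
  fixes E :: "('e, 'x, 'n sq_matrix set) bundle_data"
  assumes E: "principal_bundle PO PO_topology X E" and c: "clutched E m z"
  obtains \<rho> where "gluing_loop g X q r E \<rho>" "represents_pi1 \<rho> z"
proof -
  interpret E: PO_bundle dummy X E by unfold_locales (rule E)
  obtain S f where A: "adapted_pair E m S f" "winding f z" using c by (auto simp: clutched_def)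
  note S = adapted_pairD[OF A(1)]
  have St: "S y \<in> topspace E.TE" if "y \<in> polygon g" for y
    using continuous_map_image_subset_topspace[OF S(1)] that by auto
  have fi: "f y \<in> carrier PO" if "y \<in> pstar" for y using PO_in[OF S(3)] that by auto
  define B where "B y = E.act (S y) (f y)" for y
  have Bc: "continuous_map (top_of_set pstar) E.TE B"
    unfolding B_def by (rule E.act_continuous[OF pstar_cont[OF S(1)] S(3)])
  have Bp: "E.prj (B y) = q y" "B y \<in> topspace E.TE" if "y \<in> pstar" for y
    unfolding B_def using E.bundle_props(4) E.act_in St fi[OF that] S(2) that by auto
  define \<tau> where "\<tau> = (\<lambda>(y :: complex, a). (y, E.act (B y) a))"
  have \<tau>1: "snd (\<tau> (y, \<one>\<^bsub>PO\<^esub>)) = B y" if "y \<in> pstar" for y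
    using E.bundle_props(3)[OF Bp(2)[OF that]] by (simp add: \<tau>_def)
  have "trivialization PO PO_topology (top_of_set pstar) (pullback_bundle (top_of_set pstar) q E) (topspace (top_of_set pstar)) \<tau>"
    unfolding \<tau>_def by (rule E.pullback_section_trivialization[OF Bc]) (use Bp in auto)
  moreover have "\<exists>h\<in>{PO_class (mat 1), PO_class r}. \<forall>t\<in>{0..1}.
        snd (\<tau> (side (4 * j + i + 2) (1 - t), \<one>\<^bsub>PO\<^esub>)) = E.act (snd (\<tau> (side (4 * j + i) t, \<one>\<^bsub>PO\<^esub>))) h" if ji: "j < g" "i < 2" for j i
  proof (intro bexI[of _ "glue m (4 * j + i)"] ballI)
    fix t assume t: "t \<in> {0..1::real}"
    have y: "side (4 * j + i) t \<in> pstar" "side (4 * j + i + 2) (1 - t) \<in> pstar"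
      using t by (auto intro!: side_pstar simp del: Diff_iff)
    show "snd (\<tau> (side (4 * j + i + 2) (1 - t), \<one>\<^bsub>PO\<^esub>)) = E.act (snd (\<tau> (side (4 * j + i) t, \<one>\<^bsub>PO\<^esub>))) (glue m (4 * j + i))"
      unfolding \<tau>1[OF y(1)] \<tau>1[OF y(2)] unfolding B_def by (rule S(4)[OF ji t])
  qed (simp add: glue_value)
  ultimately have ad: "adapted_trivialization g q r E \<tau>"
    unfolding adapted_trivialization_def by simp
  obtain e where e: "e > 0" "cball 0 e \<subseteq> polygon g" using cball_in_polygon by blast
  define \<delta> where "\<delta> = e / 2"
  have d: "0 < \<delta>" "\<delta> < e" "ball 0 e \<subseteq> interior (polygon g)" "cball 0 \<delta> \<subseteq> polygon g"
  proof -
    have "ball 0 e \<subseteq> polygon g" using e(2) ball_subset_cball by blast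
    then show "ball 0 e \<subseteq> interior (polygon g)" by (rule interior_maximal[OF _ open_ball])
    have "cball (0 :: complex) \<delta> \<subseteq> cball 0 e" using e(1) by (intro subset_cball) (simp add: \<delta>_def)
    then show "cball 0 \<delta> \<subseteq> polygon g" using e(2) by blast
  qed (use e(1) in \<open>simp_all add: \<delta>_def\<close>)
  obtain c where c: "pin_path c"
    "\<And>t. t \<in> {0..1} \<Longrightarrow> pin_to_PO (c t) = f (of_real \<delta> * cis (2 * pi * t))" "c 1 = c 0 \<star> z"
    using winding_circle_lift[OF S(3) d(1,4) A(2)] by blast
  \<comment> \<open>An element with the parity of f on the circle. Put into the trivialization over
    the disc, it divides the lift from the left, which makes the loop even and leaves z
    unchanged.\<close>
  define P where "P = (if c 0 \<in> spin_set then cl_one else rpin)"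
  have P: "P \<in> pin_set" "P \<in> spin_set \<longleftrightarrow> c 0 \<in> spin_set"
    using rpin spin_one pin_set.one by (auto simp: P_def)
  have bp: "y \<in> polygon g" if "y \<in> ball 0 e" for y using e(2) that by auto
  have W: "q ` ball 0 e \<subseteq> topspace X" using q_in bp by blast
  \<comment> \<open>The ball lies in the interior, where q is injective, so it is saturated and its
    image is open.\<close>
  have sat: "{y \<in> topspace (top_of_set (polygon g)). q y \<in> q ` ball 0 e} = ball 0 e"
  proof -
    have "y \<in> ball 0 e" if y: "y \<in> polygon g" "q y = q x" "x \<in> ball 0 e" for x y
      using q_interior_inj[of x y] d(3) y by auto
    moreover have "ball 0 e \<subseteq> polygon g" using e(2) by auto
    ultimately show ?thesis by auto
  qed
  have oB: "openin (top_of_set (polygon g)) (ball 0 e)"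
    using e(2) by (auto simp: openin_open intro!: exI[of _ "ball 0 e"])
  have oW: "openin X (q ` ball 0 e)"
    using q_quotient W oB sat unfolding quotient_map_def by metis
  have Q: "quotient_map (subtopology (top_of_set (polygon g)) (ball 0 e)) (subtopology X (q ` ball 0 e)) q"
    using quotient_map_restriction[OF q_quotient sat] oW by blast
  define rep where "rep x = (SOME y. y \<in> ball 0 e \<and> q y = x)" for x
  have rep: "rep (q y) = y" if y: "y \<in> ball 0 e" for y
  proof -
    have "\<exists>y'. y' \<in> ball 0 e \<and> q y' = q y" using y by blast
    from someI_ex[OF this] have r: "rep (q y) \<in> ball 0 e" "q (rep (q y)) = q y" by (auto simp: rep_def)
    then show ?thesis using q_interior_inj[of "rep (q y)" y] d(3) y interior_subset[of "polygon g"] by blast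
  qed
  define s where "s x = E.act (S (rep x)) (pin_to_PO P)" for x
  have sq: "s (q y) = E.act (S y) (pin_to_PO P)" if "y \<in> ball 0 e" for y by (simp add: s_def rep[OF that])
  have "continuous_map (subtopology X (q ` ball 0 e)) E.TE s"
  proof (rule continuous_compose_quotient_map[OF Q])
    have "continuous_map (subtopology (top_of_set (polygon g)) (ball 0 e)) E.TE (\<lambda>y. E.act (S y) (pin_to_PO P))"
      by (intro E.act_continuous continuous_map_from_subtopology S(1)) (simp add: topspace_PO P(1))
    then show "continuous_map (subtopology (top_of_set (polygon g)) (ball 0 e)) E.TE (s \<circ> q)"
      by (rule continuous_map_eq) (use sq in auto)
  qed
  moreover have "E.prj (s x) = x" if "x \<in> q ` ball 0 e" for x
    using that sq St S(2) bp P(1) E.bundle_props(4) by auto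
  ultimately have triv: "trivialization PO PO_topology X E (q ` ball 0 e) (\<lambda>(x, a). E.act (s x) a)"
    by (rule E.section_trivialization[OF W])
  let ?y = "\<lambda>t. complex_of_real \<delta> * cis (2 * pi * t)"
  have yin: "?y t \<in> pstar" "?y t \<in> ball 0 e" for t
    using d(1,2) by (auto simp: norm_mult intro!: subsetD[OF d(4)])
  define \<rho> where "\<rho> t = pin_to_PO (cl_conj P \<star> c t)" for t
  have lift: "pin_path (\<lambda>t. cl_conj P \<star> c t)"
    by (intro continuous_pin_mult continuous_pin_const pin_conj_closed P(1) c(1))
  have ct: "c t \<in> pin_set" if "t \<in> {0..1}" for t by (rule continuous_pin_in[OF c(1) that])
  have Pc: "cl_conj P \<in> spin_set \<longleftrightarrow> P \<in> spin_set"
    using spin_mult_iff[OF pin_conj_closed[OF P(1)] P(1)] P(1) spin_one by auto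
  have \<rho>PSO: "\<rho> t \<in> PSO" if t: "t \<in> {0..1}" for t
  proof -
    have "c t \<in> spin_set \<longleftrightarrow> c 0 \<in> spin_set" by (rule parity_const[OF _ c(1) t]) auto
    then have "cl_conj P \<star> c t \<in> spin_set"
      using spin_mult_iff[OF pin_conj_closed[OF P(1)] ct[OF t]] Pc P(2) by blast
    then show ?thesis
      unfolding \<rho>_def using PSO_pin_iff[OF continuous_pin_in[OF lift t]] by blast
  qed
  have "gluing_loop g X q r E \<rho>"
    unfolding gluing_loop_def
  proof (intro exI conjI ballI)
    show "adapted_trivialization g q r E \<tau>" by (rule ad)
    show "0 < \<delta>" "\<delta> < e" "ball 0 e \<subseteq> interior (polygon g)" by (rule d)+
    show "trivialization PO PO_topology X E (q ` ball 0 e) (\<lambda>(x, a). E.act (s x) a)" by (rule triv)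
    fix t assume t: "t \<in> {0..1::real}"
    show "\<rho> t \<in> PSO" by (rule \<rho>PSO[OF t])
    have yp: "?y t \<in> polygon g" using yin by blast
    have \<rho>in: "\<rho> t \<in> carrier PO" using \<rho>PSO[OF t] PSO_subset by blast
    have sy: "s (q (?y t)) \<in> topspace E.TE"
      using sq[OF yin(2)] E.act_in[OF St[OF yp]] P(1) by simp
    have "E.act (case (q (?y t), \<one>\<^bsub>PO\<^esub>) of (x, a) \<Rightarrow> E.act (s x) a) (\<rho> t) = E.act (E.act (S (?y t)) (pin_to_PO P)) (\<rho> t)"
      using E.bundle_props(3)[OF sy] sq[OF yin(2)] by simp
    also have "\<dots> = E.act (S (?y t)) (pin_to_PO P \<otimes>\<^bsub>PO\<^esub> \<rho> t)"
      using E.bundle_props(5)[OF St[OF yp] _ \<rho>in] P(1) by simp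
    also have "pin_to_PO P \<otimes>\<^bsub>PO\<^esub> \<rho> t = f (?y t)"
      using c(2)[OF t] P(1) ct[OF t] by (simp add: \<rho>_def pin_to_PO_mult pin_mult pin_conj_closed)
    finally show "snd (\<tau> (\<delta> *\<^sub>R cis (2 * pi * t), \<one>\<^bsub>PO\<^esub>)) =
         E.act (case (q (\<delta> *\<^sub>R cis (2 * pi * t)), \<one>\<^bsub>PO\<^esub>) of (x, a) \<Rightarrow> E.act (s x) a) (\<rho> t)"
      using \<tau>1[OF yin(1)[of t]] by (simp add: B_def scaleR_conv_of_real)
  qed
  moreover have "represents_pi1 \<rho> z"
    unfolding represents_pi1_def pathin_def pi1_PO_eq
    using winding_in[OF A(2)] lift c(3)
    by (intro conjI exI[of _ "\<lambda>t. cl_conj P \<star> c t"]) (auto simp: \<rho>_def cl_assoc)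
  ultimately show thesis by (rule that)
qed

end

section \<open>The monodromy of the double covering\<close>

context presented_surface
begin

lemma PSO_open: "openin PO_topology (PSO :: 'n sq_matrix set set)" "openin PO_topology (carrier PO - (PSO :: 'n sq_matrix set set))"
proof -
  have odd: "p \<in> spin_set \<longleftrightarrow> cl_grade_involution p \<noteq> - p" if "p \<in> pin_set" for p :: "'n clifford"
    using odd_pin_iff[OF that] by blast
  have 1: "spin_set = pin_set \<inter> {p :: 'n clifford. cl_grade_involution p \<noteq> - p}"
    using odd spin_subset by blast
  have 2: "pin_set - spin_set = pin_set \<inter> {p :: 'n clifford. cl_grade_involution p \<noteq> p}"
    by (auto simp: spin_set_def)
  have "openin (top_of_set pin_set) (spin_set :: 'n clifford set)"
    unfolding 1 by (intro openin_open_Int open_Collect_neq continuous_intros cl_grade_continuous)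
  moreover have "pin_to_PO ` spin_set = (PSO :: 'n sq_matrix set set)"
  proof (intro equalityI subsetI)
    show "a \<in> PSO" if "a \<in> pin_to_PO ` (spin_set :: 'n clifford set)" for a
      using that PSO_pin_iff spin_subset by blast
    fix a :: "'n sq_matrix set" assume a: "a \<in> PSO"
    then have "a \<in> carrier PO" using PSO_subset by blast
    then obtain p where p: "p \<in> pin_set" "pin_to_PO p = a" by (rule PO_pinE)
    then have "p \<in> spin_set" using PSO_pin_iff[OF p(1)] a by simp
    then show "a \<in> pin_to_PO ` (spin_set :: 'n clifford set)" using p(2) by blast
  qed
  ultimately show "openin PO_topology (PSO :: 'n sq_matrix set set)" using openin_pin_to_PO_image by metis
  have "openin (top_of_set pin_set) (pin_set - spin_set :: 'n clifford set)"
    unfolding 2 by (intro openin_open_Int open_Collect_neq continuous_intros cl_grade_continuous)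
  moreover have "pin_to_PO ` (pin_set - spin_set) = carrier PO - (PSO :: 'n sq_matrix set set)"
  proof (intro equalityI subsetI)
    show "a \<in> carrier PO - PSO" if "a \<in> pin_to_PO ` (pin_set - spin_set :: 'n clifford set)" for a
      using that PSO_pin_iff by auto
    fix a :: "'n sq_matrix set" assume a: "a \<in> carrier PO - PSO"
    then have "a \<in> carrier PO" by blast
    then obtain p where p: "p \<in> pin_set" "pin_to_PO p = a" by (rule PO_pinE)
    then have "p \<notin> spin_set" using PSO_pin_iff[OF p(1)] a by simp
    then show "a \<in> pin_to_PO ` (pin_set - spin_set :: 'n clifford set)" using p by blast
  qed
  ultimately show "openin PO_topology (carrier PO - (PSO :: 'n sq_matrix set set))" using openin_pin_to_PO_image by metis
qed

text \<open>For h in PSO(n) the image of A in the double covering is closed. Conversely, for a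
  closed lift c, whether A t lies in the orbit c t is locally constant in t. The answers at 0 and 1
  agree, whichever they are, and this forces h into PSO(n).\<close>

lemma component_monodromy_section:
  fixes E :: "('e, 'x, 'n sq_matrix set) bundle_data"
  assumes E: "principal_bundle PO PO_topology X E"
    and A: "continuous_map (top_of_set {0..1}) (total_space E) A" "\<And>t. t \<in> {0..1} \<Longrightarrow> bundle_proj E (A t) = \<gamma> t"
    and h: "h \<in> carrier PO" "A 1 = bundle_act E (A 0) h"
  shows "component_monodromy E \<gamma> = (if h \<in> PSO then 0 else 1)"
proof -
  interpret E: PO_bundle dummy X E by unfold_locales (rule E)
  define Q where "Q e = E.act e ` (PSO :: 'n sq_matrix set set)" for e
  have PSOin: "a \<in> carrier PO" if "a \<in> PSO" for a :: "'n sq_matrix set" using that PSO_subset by blast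
  have Q_in: "E.act e a \<in> Q e \<longleftrightarrow> a \<in> PSO" if e: "e \<in> topspace E.TE" "a \<in> carrier PO" for e a
  proof
    assume "E.act e a \<in> Q e"
    then obtain p where p: "p \<in> PSO" "E.act e a = E.act e p" by (auto simp: Q_def)
    then show "a \<in> PSO" using E.act_free[OF e PSOin[OF p(1)] p(2)] by simp
  qed (auto simp: Q_def)
  have Q_self: "e \<in> Q e" if "e \<in> topspace E.TE" for e
    using Q_in[OF that PO.one_closed] PSO_one E.bundle_props(3)[OF that] by simp
  have Q_sub: "Q (E.act e a) \<subseteq> Q e" if e: "e \<in> topspace E.TE" "a \<in> PSO" for e a
  proof
    fix x assume "x \<in> Q (E.act e a)"
    then obtain p where p: "p \<in> PSO" "x = E.act (E.act e a) p" by (auto simp: Q_def)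
    have "x = E.act e (a \<otimes>\<^bsub>PO\<^esub> p)" using p(2) E.bundle_props(5)[OF e(1) PSOin[OF e(2)] PSOin[OF p(1)]] by simp
    moreover have "a \<otimes>\<^bsub>PO\<^esub> p \<in> PSO" using PSO_mult_iff[OF PSOin[OF e(2)] PSOin[OF p(1)]] e(2) p(1) by blast
    ultimately show "x \<in> Q e" by (auto simp: Q_def)
  qed
  have Q_eq: "Q (E.act e a) = Q e" if e: "e \<in> topspace E.TE" "a \<in> PSO" for e a
  proof (rule equalityI[OF Q_sub[OF e]])
    have ac: "a \<in> carrier PO" "inv\<^bsub>PO\<^esub> a \<in> carrier PO" using PSOin[OF e(2)] by auto
    have "inv\<^bsub>PO\<^esub> a \<in> PSO" using PSO_mult_iff[OF ac] PSO_one ac e(2) by simp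
    from Q_sub[OF E.act_in[OF e(1) ac(1)] this] show "Q e \<subseteq> Q (E.act e a)"
      using E.bundle_props(5)[OF e(1) ac] E.bundle_props(3)[OF e(1)] ac by simp
  qed
  have Q_cont: "continuous_map E.TE (PSO_quotient E) Q"
    unfolding continuous_map_def PSO_quotient_def Q_def[symmetric]
    by (auto simp: topspace_quotient_topology openin_quotient_topology)
  have Q_proj: "E.prj ` Q e = {E.prj e}" if "e \<in> topspace E.TE" for e
    using E.bundle_props(4)[OF that PSOin] PSO_one by (auto simp: Q_def image_iff)
  have At: "A t \<in> topspace E.TE" if "t \<in> {0..1}" for t
    using continuous_map_image_subset_topspace[OF A(1)] that by auto
  have "h \<in> PSO \<longleftrightarrow> (\<exists>c. pathin (PSO_quotient E) c \<and> (\<forall>t\<in>{0..1}. E.prj ` c t = {\<gamma> t}) \<and> c 1 = c 0)"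
  proof
    assume hP: "h \<in> PSO"
    have "pathin (PSO_quotient E) (Q \<circ> A)" unfolding pathin_def by (rule continuous_map_compose[OF A(1) Q_cont])
    moreover have "E.prj ` (Q \<circ> A) t = {\<gamma> t}" if "t \<in> {0..1}" for t using Q_proj[OF At[OF that]] A(2)[OF that] by simp
    moreover have "(Q \<circ> A) 1 = (Q \<circ> A) 0" using Q_eq[OF At hP, of 0] h(2) by simp
    ultimately show "\<exists>c. pathin (PSO_quotient E) c \<and> (\<forall>t\<in>{0..1}. E.prj ` c t = {\<gamma> t}) \<and> c 1 = c 0" by blast
  next
    assume "\<exists>c. pathin (PSO_quotient E) c \<and> (\<forall>t\<in>{0..1}. E.prj ` c t = {\<gamma> t}) \<and> c 1 = c 0"
    then obtain c where c: "continuous_map (top_of_set {0..1}) (PSO_quotient E) c" "\<And>t. t \<in> {0..1} \<Longrightarrow> E.prj ` c t = {\<gamma> t}" "c 1 = c 0"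
      unfolding pathin_def by auto
    have ce: "\<exists>e a. e \<in> topspace E.TE \<and> c t = Q e \<and> E.prj e = \<gamma> t \<and> a \<in> carrier PO \<and> A t = E.act e a" if t: "t \<in> {0..1}" for t
    proof -
      have "c t \<in> topspace (PSO_quotient E)" using continuous_map_image_subset_topspace[OF c(1)] t by auto
      then obtain e where e: "e \<in> topspace E.TE" "c t = Q e"
        by (auto simp: PSO_quotient_def topspace_quotient_topology Q_def)
      have "E.prj e = \<gamma> t" using c(2)[OF t] Q_proj[OF e(1)] e(2) by simp
      then show ?thesis using E.act_transitive[OF e(1) At[OF t]] e A(2)[OF t] by metis
    qed
    have loc: "eventually (\<lambda>t. (A t0 \<in> c t0) = (A t \<in> c t)) (at t0 within {0..1})" if t0: "t0 \<in> {0..1}" for t0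
    proof -
      have "\<gamma> t0 \<in> topspace X" using E.prj_in[OF At[OF t0]] A(2)[OF t0] by simp
      then obtain W \<phi> where W: "openin X W" "\<gamma> t0 \<in> W" "trivialization PO PO_topology X E W \<phi>"
        using E.bundle_props(6) by blast
      obtain \<kappa> where lc: "E.local_coord W \<phi> \<kappa>" using E.local_coordinate[OF W(3)] by blast
      note l = E.local_coordD[OF lc]
      have \<kappa>in: "\<kappa> e \<in> carrier PO" if "e \<in> topspace E.TE" "E.prj e \<in> W" for e using l(2)[OF that] by blast
      have \<kappa>act: "\<kappa> (E.act e a) = \<kappa> e \<otimes>\<^bsub>PO\<^esub> a" if e: "e \<in> topspace E.TE" "E.prj e \<in> W" "a \<in> carrier PO" for e a
        using l(2)[OF e(1,2)] l(4)[OF e(2) _ e(3), of "\<kappa> e"] l(3)[OF e(2), of "\<kappa> e \<otimes>\<^bsub>PO\<^esub> a"] e(3) by simp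
      \<comment> \<open>The part of the bundle over W on which the fibre coordinate has a given
        parity. Both parts are open unions of orbits, so their images in the quotient are
        open.\<close>
      define U where "U b = {e \<in> topspace E.TE. E.prj e \<in> W \<and> (\<kappa> e \<in> PSO \<longleftrightarrow> b)}" for b
      have oW: "openin E.TE {e \<in> topspace E.TE. E.prj e \<in> W}"
        using E.bundle_props(1) W(1) by (rule openin_continuous_map_preimage)
      have oU: "openin E.TE (U b)" for b
      proof -
        define R where "R = (if b then PSO else carrier PO - (PSO :: 'n sq_matrix set set))"
        have "openin PO_topology R" using PSO_open by (simp add: R_def)
        from openin_continuous_map_preimage[OF l(1) this]
        have "openin (subtopology E.TE {e \<in> topspace E.TE. E.prj e \<in> W})
           {e \<in> topspace (subtopology E.TE {e \<in> topspace E.TE. E.prj e \<in> W}). \<kappa> e \<in> R}" .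
        moreover have "{e \<in> topspace (subtopology E.TE {e \<in> topspace E.TE. E.prj e \<in> W}). \<kappa> e \<in> R} = U b"
          using \<kappa>in by (auto simp: U_def R_def)
        ultimately show ?thesis using openin_trans_full[OF _ oW] by metis
      qed
      have satU: "Q e \<in> Q ` U b \<longleftrightarrow> e \<in> U b" if e: "e \<in> topspace E.TE" for e b
      proof
        assume "Q e \<in> Q ` U b"
        then obtain e' where e': "e' \<in> U b" "Q e = Q e'" by blast
        then have "e' \<in> Q e" using Q_self by (auto simp: U_def)
        then obtain p where p: "p \<in> PSO" "e' = E.act e p" by (auto simp: Q_def)
        have pr: "E.prj e \<in> W" using e'(1) p E.bundle_props(4)[OF e PSOin[OF p(1)]] by (simp add: U_def)
        show "e \<in> U b"
          using e'(1) \<kappa>act[OF e pr PSOin[OF p(1)]] PSO_mult_iff[OF \<kappa>in[OF e pr] PSOin[OF p(1)]] p e pr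
          by (simp add: U_def)
      qed blast
      have oQU: "openin (PSO_quotient E) (Q ` U b)" for b
      proof -
        have "{e \<in> topspace E.TE. Q e \<in> Q ` U b} = U b" using satU openin_subset[OF oU] by blast
        then show ?thesis
          using oU openin_subset[OF oU] unfolding PSO_quotient_def openin_quotient_topology Q_def[symmetric] by auto
      qed
      have P: "A t \<in> c t \<longleftrightarrow> (b \<longleftrightarrow> b')" if t: "t \<in> {0..1}" and "A t \<in> U b" "c t \<in> Q ` U b'" for t b b'
      proof -
        obtain e a where e: "e \<in> topspace E.TE" "c t = Q e" "E.prj e = \<gamma> t" "a \<in> carrier PO" "A t = E.act e a"
          using ce[OF t] by blast
        have "e \<in> U b'" using satU[OF e(1)] that(3) e(2) by simp
        moreover from this have "E.prj e \<in> W" by (simp add: U_def)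
        ultimately show ?thesis
          using that(2) Q_in[OF e(1,4)] \<kappa>act[OF e(1) _ e(4)] PSO_mult_iff[OF \<kappa>in[OF e(1)] e(4)] e(2,5)
          by (auto simp: U_def)
      qed
      obtain b where b: "A t0 \<in> U b" using At[OF t0] A(2)[OF t0] W(2) by (auto simp: U_def)
      obtain e where e: "e \<in> topspace E.TE" "c t0 = Q e" "E.prj e = \<gamma> t0" using ce[OF t0] by blast
      obtain b' where b': "c t0 \<in> Q ` U b'"
      proof
        show "c t0 \<in> Q ` U (\<kappa> e \<in> PSO)" unfolding e(2) using e(1,3) W(2) by (auto simp: U_def)
      qed
      have "openin (top_of_set {0..1}) {t \<in> {0..1}. A t \<in> U b}" "openin (top_of_set {0..1}) {t \<in> {0..1}. c t \<in> Q ` U b'}"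
        using openin_continuous_map_preimage[OF A(1) oU] openin_continuous_map_preimage[OF c(1) oQU] by auto
      from openin_Int[OF this] obtain V where V: "open V" "{t \<in> {0..1}. A t \<in> U b} \<inter> {t \<in> {0..1}. c t \<in> Q ` U b'} = {0..1} \<inter> V"
        by (auto simp: openin_open)
      have "(A t0 \<in> c t0) = (A t \<in> c t)" if "t \<in> V" "t \<in> {0..1}" for t
      proof -
        have "t \<in> {t \<in> {0..1}. A t \<in> U b} \<inter> {t \<in> {0..1}. c t \<in> Q ` U b'}" using V(2) that by blast
        then show ?thesis using P[OF t0 b b'] P[OF that(2), of b b'] by blast
      qed
      moreover have "t0 \<in> V" using V(2) b b' t0 by blast
      ultimately show ?thesis unfolding eventually_at_topological using V(1) by blast
    qed
    have "(A 0 \<in> c 0) = (A 1 \<in> c 1)"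
    proof (rule connected_local_const[of "{0..1::real}" 0 1 "\<lambda>t. A t \<in> c t"])
      show "\<forall>a\<in>{0..1}. eventually (\<lambda>t. (A a \<in> c a) = (A t \<in> c t)) (at a within {0..1})" using loc by blast
    qed auto
    moreover obtain e a where e: "e \<in> topspace E.TE" "c 0 = Q e" "a \<in> carrier PO" "A 0 = E.act e a"
      using ce[of 0] by auto
    moreover have "A 1 = E.act e (a \<otimes>\<^bsub>PO\<^esub> h)" using h e(4) E.bundle_props(5)[OF e(1,3) h(1)] by simp
    ultimately show "h \<in> PSO"
      using Q_in[OF e(1,3)] Q_in[OF e(1), of "a \<otimes>\<^bsub>PO\<^esub> h"] PSO_mult_iff[OF e(3) h(1)] h(1) c(3) by auto
  qed
  then show ?thesis by (simp add: component_monodromy_def)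
qed

text \<open>The end points of a side lie over one point of X and are compared by the gluing
  relations at the vertices of the block. The parity found along one generator is that of the gluing
  element of the other pair, in accordance with the index in \<open>nontrivial\<close>.\<close>

lemma clutched_mu1:
  fixes E :: "('e, 'x, 'n sq_matrix set) bundle_data"
  assumes E: "principal_bundle PO PO_topology X E" and c: "clutched E m z"
  shows "mu1 g q E = m"
proof (rule extensionalityI)
  show "mu1 g q E \<in> extensional {..<2 * g}" by (simp add: mu1_def)
  show "m \<in> extensional {..<2 * g}" using c by (simp add: clutched_def Z2_tuples_def PiE_def)
  interpret E: PO_bundle dummy X E by unfold_locales (rule E)
  obtain S f where A: "adapted_pair E m S f" using c by (auto simp: clutched_def)
  note S = adapted_pairD[OF A]
  define B where "B y = E.act (S y) (f y)" for y
  have Bc: "continuous_map (top_of_set pstar) E.TE B"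
    unfolding B_def by (rule E.act_continuous[OF pstar_cont[OF S(1)] S(3)])
  have fi: "f y \<in> carrier PO" if "y \<in> pstar" for y using PO_in[OF S(3)] that by auto
  have St: "S y \<in> topspace E.TE" if "y \<in> polygon g" for y
    using continuous_map_image_subset_topspace[OF S(1)] that by auto
  have Bp: "E.prj (B y) = q y" "B y \<in> topspace E.TE" if "y \<in> pstar" for y
    unfolding B_def using E.bundle_props(4) E.act_in St fi[OF that] S(2) that by auto
  fix l assume "l \<in> {..<2 * g}"
  then have l: "l < 2 * g" by simp
  define j i where "j = l div 2" and "i = l mod 2"
  have ji: "j < g" "i < 2" "l = 2 * j + i" using l by (auto simp: j_def i_def)
  let ?k = "4 * j + i"
  have sc: "continuous_map (top_of_set {0..1}) (top_of_set pstar) (side ?k)"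
    using side_map[of ?k] side_pstar[of _ ?k] by auto
  have Ac: "continuous_map (top_of_set {0..1}) E.TE (\<lambda>t. B (side ?k t))"
    using continuous_map_compose[OF sc Bc] by (simp add: o_def)
  have Ap: "E.prj (B (side ?k t)) = generator_loop g q l t" if "t \<in> {0..1}" for t
    using Bp(1)[OF side_pstar[OF that]] by (simp add: generator_loop_def j_def i_def)
  let ?v = "\<lambda>k. B (polygon_vertex g (4 * j + k))" and ?h = "\<lambda>k. glue m (4 * j + k)"
  have rel: "B (side (4 * j + i' + 2) (1 - t)) = E.act (B (side (4 * j + i') t)) (?h i')" if "i' < 2" "t \<in> {0..1}" for i' t
    using S(4)[OF ji(1) that] unfolding B_def .
  have v: "polygon_vertex g (4 * j + k) \<in> pstar" for k
    using side_pstar[of 0 "4 * j + k"] by (simp add: side_ends)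
  have r: "?v 3 = E.act (?v 0) (?h 0)" "?v 2 = E.act (?v 1) (?h 0)" "?v 3 = E.act (?v 2) (?h 1)"
    using rel[of 0 0] rel[of 0 1] rel[of 1 1] by (simp_all add: side_ends numeral_3_eq_3 numeral_2_eq_2)
  obtain h where h: "h \<in> carrier PO" "B (side ?k 1) = E.act (B (side ?k 0)) h" "h \<in> PSO \<longleftrightarrow> ?h (1 - i) \<in> PSO"
  proof (cases "i = 0")
    case True
    \<comment> \<open>From v3 = v0 h0, v3 = v2 h1 and v2 = v1 h0, with involutions h0 and h1, it
      follows that v1 = v0 h0 h1 h0; modulo PSO(n) only h1 remains.\<close>
    let ?w = "?h 0 \<otimes>\<^bsub>PO\<^esub> (?h 1 \<otimes>\<^bsub>PO\<^esub> ?h 0)"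
    have "E.act (?v 0) ?w = E.act (?v 3) (?h 1 \<otimes>\<^bsub>PO\<^esub> ?h 0)"
      unfolding r(1) by (rule E.bundle_props(5)[symmetric, OF Bp(2)[OF v] glue_in PO.m_closed[OF glue_in glue_in]])
    also have "\<dots> = E.act (?v 1) ((?h 0 \<otimes>\<^bsub>PO\<^esub> ?h 1) \<otimes>\<^bsub>PO\<^esub> (?h 1 \<otimes>\<^bsub>PO\<^esub> ?h 0))"
      unfolding r(3) r(2) E.bundle_props(5)[OF Bp(2)[OF v] glue_in glue_in]
      by (rule E.bundle_props(5)[OF Bp(2)[OF v] PO.m_closed[OF glue_in glue_in] PO.m_closed[OF glue_in glue_in]])
    also have "(?h 0 \<otimes>\<^bsub>PO\<^esub> ?h 1) \<otimes>\<^bsub>PO\<^esub> (?h 1 \<otimes>\<^bsub>PO\<^esub> ?h 0) = ?h 0 \<otimes>\<^bsub>PO\<^esub> (?h 1 \<otimes>\<^bsub>PO\<^esub> ?h 1) \<otimes>\<^bsub>PO\<^esub> ?h 0"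
      by (simp add: PO.m_assoc glue_in del: glue_square)
    also have "\<dots> = \<one>\<^bsub>PO\<^esub>" by (simp add: glue_square glue_in)
    finally have "E.act (?v 0) ?w = ?v 1" unfolding E.bundle_props(3)[OF Bp(2)[OF v]] .
    moreover have "?w \<in> PSO \<longleftrightarrow> ?h 1 \<in> PSO" using PSO_mult_iff glue_in by auto
    ultimately show thesis using that[of ?w] glue_in True by (simp add: side_ends)
  next
    case False
    then have "i = 1" using ji(2) by simp
    then show thesis using that[of "?h 0"] r(2) glue_in by (simp add: side_ends numeral_2_eq_2)
  qed
  have "nontrivial m (4 * j + (1 - i)) \<longleftrightarrow> m l \<noteq> 0"
    using nontrivial_index[of "1 - i" m j] ji less_2_cases[OF ji(2)] by auto
  then have "component_monodromy E (generator_loop g q l) = (if m l = 0 then 0 else 1)"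
    using component_monodromy_section[OF E Ac Ap h(1,2)] h(3) glue_PSO_iff by auto
  then show "mu1 g q E l = m l" using l by (cases "m l") (auto simp: mu1_def)
qed

end

section \<open>Construction of bundles\<close>

text \<open>The functions \<open>\<phi> i\<close> need not be continuous, only their ratios on overlaps are.\<close>

locale chart_bundle = even_dim dummy
  for dummy :: "'n::{finite,linorder} itself" +
  fixes X :: "'x topology" and I :: "'i set" and W :: "'i \<Rightarrow> 'x set"
    and \<phi> :: "'i \<Rightarrow> 'x \<Rightarrow> 'n sq_matrix set" and \<iota> :: "'x \<times> 'n sq_matrix set \<Rightarrow> 'e"
  assumes inj: "inj_on \<iota> (topspace X \<times> carrier PO)"
    and W_open: "i \<in> I \<Longrightarrow> openin X (W i)"
    and W_cover: "topspace X \<subseteq> (\<Union>i\<in>I. W i)"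
    and \<phi>_in: "i \<in> I \<Longrightarrow> x \<in> W i \<Longrightarrow> \<phi> i x \<in> carrier PO"
    and ratio: "i \<in> I \<Longrightarrow> j \<in> I \<Longrightarrow> continuous_map (subtopology X (W i \<inter> W j)) PO_topology
      (\<lambda>x. inv\<^bsub>PO\<^esub> (\<phi> i x) \<otimes>\<^bsub>PO\<^esub> \<phi> j x)"
begin

abbreviation points :: "('x \<times> 'n sq_matrix set) set" where "points \<equiv> topspace X \<times> carrier PO"

definition chart :: "'i \<Rightarrow> 'x \<times> 'n sq_matrix set \<Rightarrow> 'e" where
  "chart i p = \<iota> (fst p, \<phi> i (fst p) \<otimes>\<^bsub>PO\<^esub> snd p)"

definition dom :: "'i \<Rightarrow> ('x \<times> 'n sq_matrix set) topology" where
  "dom i = prod_topology (subtopology X (W i)) PO_topology"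

text \<open>As a set with projection and action this is the product of X and PO(n), transferred to
  the type \<open>'e\<close> by \<open>\<iota>\<close>. Only the topology, which is glued from the
  charts, can be nontrivial.\<close>

definition glued :: "('e, 'x, 'n sq_matrix set) bundle_data" where
  "glued = \<lparr> total_space = quotient_topology (sum_topology dom I) (\<lambda>(i, p). chart i p),
     bundle_proj = (\<lambda>e. fst (inv_into points \<iota> e)),
     bundle_act = (\<lambda>e a. \<iota> (fst (inv_into points \<iota> e), snd (inv_into points \<iota> e) \<otimes>\<^bsub>PO\<^esub> a)) \<rparr>"

abbreviation TE :: "'e topology" where "TE \<equiv> total_space glued"
abbreviation prj :: "'e \<Rightarrow> 'x" where "prj \<equiv> bundle_proj glued"
abbreviation act :: "'e \<Rightarrow> 'n sq_matrix set \<Rightarrow> 'e" where "act \<equiv> bundle_act glued"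

lemma W_sub: "i \<in> I \<Longrightarrow> W i \<subseteq> topspace X"
  using W_open openin_subset by blast

lemma topspace_dom: "i \<in> I \<Longrightarrow> topspace (dom i) = W i \<times> carrier PO"
  using W_sub by (auto simp: dom_def topspace_PO)

lemma point: "x \<in> topspace X \<Longrightarrow> a \<in> carrier PO \<Longrightarrow> prj (\<iota> (x, a)) = x"
  "x \<in> topspace X \<Longrightarrow> a \<in> carrier PO \<Longrightarrow> act (\<iota> (x, a)) b = \<iota> (x, a \<otimes>\<^bsub>PO\<^esub> b)"
  by (simp_all add: glued_def inj inv_into_f_f)

lemma chart_point:
  assumes "i \<in> I" "x \<in> W i" "a \<in> carrier PO"
  shows "chart i (x, a) \<in> \<iota> ` points" "prj (chart i (x, a)) = x" "act (chart i (x, a)) b = \<iota> (x, \<phi> i x \<otimes>\<^bsub>PO\<^esub> a \<otimes>\<^bsub>PO\<^esub> b)"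
  using assms W_sub[OF assms(1)] \<phi>_in[OF assms(1,2)] by (auto simp: chart_def point)

lemma point_chart:
  assumes "i \<in> I" "x \<in> W i" "a \<in> carrier PO"
  shows "\<iota> (x, a) = chart i (x, inv\<^bsub>PO\<^esub> (\<phi> i x) \<otimes>\<^bsub>PO\<^esub> a)"
  using assms \<phi>_in[OF assms(1,2)] by (simp add: chart_def PO.m_assoc[symmetric])

lemma chart_eq_iff:
  assumes "i \<in> I" "j \<in> I" "x \<in> W i" "a \<in> carrier PO" "y \<in> W j" "b \<in> carrier PO"
  shows "chart i (x, a) = chart j (y, b) \<longleftrightarrow> x = y \<and> a = inv\<^bsub>PO\<^esub> (\<phi> i x) \<otimes>\<^bsub>PO\<^esub> \<phi> j x \<otimes>\<^bsub>PO\<^esub> b"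
proof -
  have "\<phi> i x \<otimes>\<^bsub>PO\<^esub> a = \<phi> j x \<otimes>\<^bsub>PO\<^esub> b \<longleftrightarrow> a = inv\<^bsub>PO\<^esub> (\<phi> i x) \<otimes>\<^bsub>PO\<^esub> \<phi> j x \<otimes>\<^bsub>PO\<^esub> b" if "x = y"
    using \<phi>_in[OF assms(1,3)] \<phi>_in[OF assms(2,5)] assms(4,6) that
    by (metis PO.inv_closed PO.inv_solve_left' PO.m_assoc PO.m_closed)
  moreover have "chart i (x, a) = chart j (y, b) \<longleftrightarrow> (x, \<phi> i x \<otimes>\<^bsub>PO\<^esub> a) = (y, \<phi> j y \<otimes>\<^bsub>PO\<^esub> b)"
    unfolding chart_def fst_conv snd_conv
    by (rule inj_on_eq_iff[OF inj]) (use assms \<phi>_in[OF assms(1,3)] \<phi>_in[OF assms(2,5)] W_sub in auto)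
  ultimately show ?thesis by auto
qed

lemma topspace_TE: "topspace TE = \<iota> ` points"
proof -
  have "topspace TE = (\<lambda>(i, p). chart i p) ` Sigma I (topspace \<circ> dom)"
    by (simp add: glued_def topspace_quotient_topology)
  also have "\<dots> = \<iota> ` points"
  proof (intro equalityI subsetI)
    fix e assume "e \<in> \<iota> ` points"
    then obtain x a where e: "x \<in> topspace X" "a \<in> carrier PO" "e = \<iota> (x, a)" by blast
    then obtain i where i: "i \<in> I" "x \<in> W i" using W_cover by blast
    have "(x, inv\<^bsub>PO\<^esub> (\<phi> i x) \<otimes>\<^bsub>PO\<^esub> a) \<in> topspace (dom i)"
      using topspace_dom[OF i(1)] i e(2) \<phi>_in by simp
    then show "e \<in> (\<lambda>(i, p). chart i p) ` Sigma I (topspace \<circ> dom)"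
      using point_chart[OF i e(2)] i(1) e(3) by force
  qed (auto simp: topspace_dom chart_point)
  finally show ?thesis .
qed

lemma openin_TE:
  "openin TE U \<longleftrightarrow> U \<subseteq> \<iota> ` points \<and> (\<forall>i\<in>I. openin (dom i) {p \<in> topspace (dom i). chart i p \<in> U})"
proof -
  have im: "(\<lambda>(i, p). chart i p) ` topspace (sum_topology dom I) = \<iota> ` points"
    using topspace_TE by (simp add: glued_def topspace_quotient_topology)
  have "{x. (i, x) \<in> {x \<in> topspace (sum_topology dom I). (case x of (i, p) \<Rightarrow> chart i p) \<in> U}} =
      {p \<in> topspace (dom i). chart i p \<in> U}" if "i \<in> I" for i
    using that by auto
  moreover have "{x \<in> topspace (sum_topology dom I). (case x of (i, p) \<Rightarrow> chart i p) \<in> U} \<subseteq> Sigma I (topspace \<circ> dom)"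
    by auto
  ultimately have "openin (sum_topology dom I) {x \<in> topspace (sum_topology dom I). (case x of (i, p) \<Rightarrow> chart i p) \<in> U} \<longleftrightarrow>
      (\<forall>i\<in>I. openin (dom i) {p \<in> topspace (dom i). chart i p \<in> U})"
    unfolding openin_sum_topology by simp
  then show ?thesis using im by (simp add: glued_def openin_quotient_topology)
qed

lemma continuous_TE:
  assumes "\<And>i. i \<in> I \<Longrightarrow> continuous_map (dom i) Z (\<lambda>p. f (chart i p))"
  shows "continuous_map TE Z f"
  unfolding continuous_map_def
proof (intro conjI allI impI funcsetI)
  fix e assume "e \<in> topspace TE"
  then obtain x a where e: "x \<in> topspace X" "a \<in> carrier PO" "e = \<iota> (x, a)" unfolding topspace_TE by blast
  then obtain i where i: "i \<in> I" "x \<in> W i" using W_cover by blast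
  have "(x, inv\<^bsub>PO\<^esub> (\<phi> i x) \<otimes>\<^bsub>PO\<^esub> a) \<in> topspace (dom i)"
    using topspace_dom[OF i(1)] i e(2) \<phi>_in by simp
  then show "f e \<in> topspace Z"
    using continuous_map_image_subset_topspace[OF assms[OF i(1)]] point_chart[OF i e(2)] e(3) by auto
next
  fix U assume U: "openin Z U"
  show "openin TE {e \<in> topspace TE. f e \<in> U}"
    unfolding openin_TE topspace_TE
  proof (intro conjI ballI)
    fix i assume i: "i \<in> I"
    have "{p \<in> topspace (dom i). chart i p \<in> {e \<in> \<iota> ` points. f e \<in> U}} = {p \<in> topspace (dom i). f (chart i p) \<in> U}"
      using chart_point(1)[OF i] topspace_dom[OF i] by auto
    then show "openin (dom i) {p \<in> topspace (dom i). chart i p \<in> {e \<in> \<iota> ` points. f e \<in> U}}"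
      using openin_continuous_map_preimage[OF assms[OF i] U] by simp
  qed blast
qed

text \<open>Seen in another chart, the image is the preimage of U under a transition map, whose
  continuity is the assumption \<open>ratio\<close>.\<close>

lemma chart_open:
  assumes i: "i \<in> I" and U: "openin (dom i) U"
  shows "openin TE (chart i ` U)"
  unfolding openin_TE
proof (intro conjI ballI)
  have UW: "U \<subseteq> W i \<times> carrier PO" using openin_subset[OF U] topspace_dom[OF i] by simp
  then show "chart i ` U \<subseteq> \<iota> ` points" using chart_point(1)[OF i] by auto
  fix j assume j: "j \<in> I"
  define D where "D = {p \<in> topspace (dom j). fst p \<in> W i}"
  have f1: "continuous_map (dom j) (subtopology X (W j)) fst" unfolding dom_def by (rule continuous_map_fst)
  then have "continuous_map (dom j) X fst" by (simp add: continuous_map_in_subtopology)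
  then have oD: "openin (dom j) D" unfolding D_def using W_open[OF i] by (rule openin_continuous_map_preimage)
  define t where "t p = (fst p, (inv\<^bsub>PO\<^esub> (\<phi> i (fst p)) \<otimes>\<^bsub>PO\<^esub> \<phi> j (fst p)) \<otimes>\<^bsub>PO\<^esub> snd p)" for p
  have Dtop: "topspace (subtopology (dom j) D) = D" unfolding D_def by auto
  have f2: "continuous_map (subtopology (dom j) D) (subtopology X (W i \<inter> W j)) fst"
    using continuous_map_from_subtopology[OF f1, of D] by (auto simp: continuous_map_in_subtopology D_def topspace_dom[OF j])
  then have f3: "continuous_map (subtopology (dom j) D) (subtopology X (W i)) fst"
    by (auto simp: continuous_map_in_subtopology)
  have "continuous_map (subtopology (dom j) D) PO_topology snd"
    unfolding dom_def by (rule continuous_map_from_subtopology[OF continuous_map_snd])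
  moreover have "continuous_map (subtopology (dom j) D) PO_topology (\<lambda>p. inv\<^bsub>PO\<^esub> (\<phi> i (fst p)) \<otimes>\<^bsub>PO\<^esub> \<phi> j (fst p))"
    using continuous_map_compose[OF f2 ratio[OF i j]] by (simp add: o_def)
  ultimately have "continuous_map (subtopology (dom j) D) (dom i) t"
    unfolding t_def dom_def[of i] continuous_map_paired using f3 PO_mult_continuous by blast
  note openin_continuous_map_preimage[OF this U]
  then have "openin (dom j) {p \<in> D. t p \<in> U}" unfolding Dtop by (rule openin_trans_full[OF _ oD])
  moreover have "{p \<in> topspace (dom j). chart j p \<in> chart i ` U} = {p \<in> D. t p \<in> U}"
  proof (intro equalityI subsetI)
    fix p assume "p \<in> {p \<in> topspace (dom j). chart j p \<in> chart i ` U}"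
    then obtain x a y b where p: "p = (x, a)" "x \<in> W j" "a \<in> carrier PO" "(y, b) \<in> U" "chart i (y, b) = chart j (x, a)"
      by (cases p) (auto simp: topspace_dom[OF j])
    have yb: "y \<in> W i" "b \<in> carrier PO" using UW p(4) by auto
    then have "y = x \<and> b = inv\<^bsub>PO\<^esub> (\<phi> i y) \<otimes>\<^bsub>PO\<^esub> \<phi> j y \<otimes>\<^bsub>PO\<^esub> a"
      using chart_eq_iff[OF i j yb p(2,3)] p(5) by simp
    then show "p \<in> {p \<in> D. t p \<in> U}" using p yb by (auto simp: D_def t_def topspace_dom[OF j])
  next
    fix p assume p: "p \<in> {p \<in> D. t p \<in> U}"
    then obtain x a where xa: "p = (x, a)" "x \<in> W j" "a \<in> carrier PO" "x \<in> W i" "t (x, a) \<in> U"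
      by (cases p) (auto simp: D_def topspace_dom[OF j])
    have tin: "snd (t (x, a)) \<in> carrier PO" using xa(5) UW by auto
    have "chart i (t (x, a)) = chart j (x, a)"
      using chart_eq_iff[OF i j xa(4) tin xa(2,3)] by (simp add: t_def)
    then show "p \<in> {p \<in> topspace (dom j). chart j p \<in> chart i ` U}"
      using xa by (auto simp: topspace_dom[OF j] intro: rev_image_eqI)
  qed
  ultimately show "openin (dom j) {p \<in> topspace (dom j). chart j p \<in> chart i ` U}" by simp
qed

lemma chart_continuous: "i \<in> I \<Longrightarrow> continuous_map (dom i) TE (chart i)"
  unfolding continuous_map_def using openin_TE topspace_TE chart_point(1) by (auto simp: topspace_dom)

lemma chart_trivialization:
  assumes i: "i \<in> I"
  shows "trivialization PO PO_topology X glued (W i) (chart i)"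
  unfolding trivialization_def dom_def[symmetric]
proof (intro conjI ballI W_sub[OF i])
  let ?EW = "{e \<in> topspace TE. prj e \<in> W i}"
  show "homeomorphic_map (dom i) (subtopology TE ?EW) (chart i)"
  proof (rule bijective_open_imp_homeomorphic_map)
    show "continuous_map (dom i) (subtopology TE ?EW) (chart i)"
      using chart_continuous[OF i] chart_point[OF i] topspace_TE by (auto simp: continuous_map_in_subtopology topspace_dom[OF i])
    show "open_map (dom i) (subtopology TE ?EW) (chart i)"
      unfolding open_map_def
    proof (intro allI impI)
      fix U assume U: "openin (dom i) U"
      have "chart i ` U \<subseteq> ?EW"
        using openin_subset[OF U] chart_point[OF i] topspace_TE by (auto simp: topspace_dom[OF i])
      then show "openin (subtopology TE ?EW) (chart i ` U)"
        using chart_open[OF i U] by (auto simp: openin_subtopology intro!: exI[of _ "chart i ` U"])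
    qed
    show "chart i ` topspace (dom i) = topspace (subtopology TE ?EW)"
    proof (intro equalityI subsetI)
      fix e assume "e \<in> topspace (subtopology TE ?EW)"
      then obtain x a where e: "x \<in> topspace X" "a \<in> carrier PO" "e = \<iota> (x, a)" "prj e \<in> W i"
        by (auto simp: topspace_TE)
      then have x: "x \<in> W i" using point(1) by simp
      then show "e \<in> chart i ` topspace (dom i)"
        using point_chart[OF i x e(2)] e(2,3) \<phi>_in[OF i x] by (auto simp: topspace_dom[OF i])
    qed (use chart_point[OF i] topspace_TE in \<open>auto simp: topspace_dom[OF i]\<close>)
    show "inj_on (chart i) (topspace (dom i))"
      using chart_eq_iff[OF i i] \<phi>_in[OF i] by (auto simp: inj_on_def topspace_dom[OF i])
  qed
  fix x a assume x: "x \<in> W i" and a: "a \<in> carrier (PO :: 'n sq_matrix set monoid)"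
  show "prj (chart i (x, a)) = x" by (rule chart_point(2)[OF i x a])
  fix b assume "b \<in> carrier (PO :: 'n sq_matrix set monoid)"
  then show "chart i (x, a \<otimes>\<^bsub>PO\<^esub> b) = act (chart i (x, a)) b"
    using chart_point(3)[OF i x a] \<phi>_in[OF i x] a by (simp add: chart_def PO.m_assoc)
qed

lemma glued_principal: "principal_bundle PO PO_topology X glued"
  unfolding principal_bundle_def
proof (intro conjI ballI)
  show "continuous_map TE X prj"
  proof (rule continuous_TE)
    fix i assume i: "i \<in> I"
    have "continuous_map (dom i) (subtopology X (W i)) fst" unfolding dom_def by (rule continuous_map_fst)
    then have "continuous_map (dom i) X fst" by (simp add: continuous_map_in_subtopology)
    then show "continuous_map (dom i) X (\<lambda>p. prj (chart i p))"
      by (rule continuous_map_eq) (use chart_point(2)[OF i] in \<open>auto simp: topspace_dom[OF i]\<close>)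
  qed
  then have prj_cont: "continuous_map (prod_topology TE (PO_topology :: 'n sq_matrix set topology)) X (\<lambda>y. prj (fst y))"
    using continuous_map_compose[OF continuous_map_fst] by (fastforce simp: o_def)
  show "continuous_map (prod_topology TE PO_topology) TE (\<lambda>(e, a). act e a)"
  proof (rule continuous_map_locally)
    fix y :: "'e \<times> 'n sq_matrix set" assume y: "y \<in> topspace (prod_topology TE PO_topology)"
    then have "prj (fst y) \<in> topspace X" using continuous_map_image_subset_topspace[OF prj_cont] by blast
    then obtain i where i: "i \<in> I" "prj (fst y) \<in> W i" using W_cover by blast
    let ?EW = "{e \<in> topspace TE. prj e \<in> W i}"
    let ?U = "{y \<in> topspace (prod_topology TE (PO_topology :: 'n sq_matrix set topology)). prj (fst y) \<in> W i}"
    have oU: "openin (prod_topology TE PO_topology) ?U"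
      using prj_cont W_open[OF i(1)] by (rule openin_continuous_map_preimage)
    obtain \<psi> where \<psi>: "homeomorphic_maps (dom i) (subtopology TE ?EW) (chart i) \<psi>"
      using trivialization_inverse[OF chart_trivialization[OF i(1)]] unfolding dom_def[symmetric] by blast
    let ?Y = "subtopology (prod_topology TE PO_topology) ?U"
    have f: "continuous_map ?Y (subtopology TE ?EW) fst"
      unfolding continuous_map_in_subtopology
      by (auto intro!: continuous_map_from_subtopology[OF continuous_map_fst])
    have s: "continuous_map ?Y PO_topology snd" by (rule continuous_map_from_subtopology[OF continuous_map_snd])
    have "continuous_map (subtopology TE ?EW) (dom i) \<psi>" using \<psi> by (simp add: homeomorphic_maps_def)
    then have p: "continuous_map ?Y (dom i) (\<lambda>y. \<psi> (fst y))"
      using continuous_map_compose[OF f] by (simp add: o_def)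
    then have p12: "continuous_map ?Y (subtopology X (W i)) (\<lambda>y. fst (\<psi> (fst y)))" "continuous_map ?Y PO_topology (\<lambda>y. snd (\<psi> (fst y)))"
      unfolding dom_def using continuous_map_compose[OF p[unfolded dom_def] continuous_map_fst]
        continuous_map_compose[OF p[unfolded dom_def] continuous_map_snd] by (simp_all add: o_def)
    have "continuous_map ?Y (dom i) (\<lambda>y. (fst (\<psi> (fst y)), snd (\<psi> (fst y)) \<otimes>\<^bsub>PO\<^esub> snd y))"
      unfolding dom_def continuous_map_paired using p12 PO_mult_continuous[OF p12(2) s] by blast
    from continuous_map_compose[OF this chart_continuous[OF i(1)]]
    have "continuous_map ?Y TE (\<lambda>y. chart i (fst (\<psi> (fst y)), snd (\<psi> (fst y)) \<otimes>\<^bsub>PO\<^esub> snd y))" by (simp add: o_def)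
    then have "continuous_map ?Y TE (\<lambda>(e, a). act e a)"
    proof (rule continuous_map_eq)
      fix y assume "y \<in> topspace ?Y"
      then have ea: "fst y \<in> topspace TE" "snd y \<in> carrier PO" "prj (fst y) \<in> W i" by (auto simp: topspace_PO)
      then have e': "fst y \<in> topspace (subtopology TE ?EW)" by auto
      then have "\<psi> (fst y) \<in> topspace (dom i)" "chart i (\<psi> (fst y)) = fst y"
        using \<psi> by (auto simp: homeomorphic_maps_def continuous_map_def)
      then obtain x b where xb: "\<psi> (fst y) = (x, b)" "x \<in> W i" "b \<in> carrier PO" "chart i (x, b) = fst y"
        by (auto simp: topspace_dom[OF i(1)])
      show "chart i (fst (\<psi> (fst y)), snd (\<psi> (fst y)) \<otimes>\<^bsub>PO\<^esub> snd y) = (case y of (e, a) \<Rightarrow> act e a)"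
        using chart_point(3)[OF i(1) xb(2,3), of "snd y"] xb \<phi>_in[OF i(1) xb(2)] ea(2)
        by (simp add: chart_def PO.m_assoc split_beta)
    qed
    then show "\<exists>U. openin (prod_topology TE PO_topology) U \<and> y \<in> U \<and>
        continuous_map (subtopology (prod_topology TE PO_topology) U) TE (\<lambda>(e, a). act e a)"
      using oU y i(2) by blast
  qed
  show "\<exists>W \<phi>. openin X W \<and> x \<in> W \<and> trivialization PO PO_topology X glued W \<phi>" if "x \<in> topspace X" for x
    using that W_cover W_open chart_trivialization by blast
next
  fix e assume "e \<in> topspace TE"
  then obtain x c where e: "x \<in> topspace X" "c \<in> carrier PO" "e = \<iota> (x, c)" unfolding topspace_TE by blast
  show "act e \<one>\<^bsub>PO\<^esub> = e" using e point(2) by simp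
  fix a assume a: "a \<in> carrier (PO :: 'n sq_matrix set monoid)"
  show "prj (act e a) = prj e" using e a point by simp
  fix b assume b: "b \<in> carrier (PO :: 'n sq_matrix set monoid)"
  show "act (act e a) b = act e (a \<otimes>\<^bsub>PO\<^esub> b)" using e a b point(2) by (simp add: PO.m_assoc)
qed

end

section \<open>A bundle with prescribed invariants\<close>

context presented_surface
begin

text \<open>The height \<open>\<Theta>\<close> develops the class \<open>m\<close> over the punctured surface: its values at the
  vertices of the block \<open>j\<close> are \<open>0, -b, a - b, a, 0\<close>, where \<open>a\<close> and \<open>b\<close> are the jumps prescribed
  over the two pairs of sides.\<close>

lemma height_exists:
  obtains \<Theta> :: "complex \<Rightarrow> real" where "continuous_on pstar \<Theta>"
    "\<And>j i t. j < g \<Longrightarrow> i < 2 \<Longrightarrow> t \<in> {0..1} \<Longrightarrow>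
      \<Theta> (side (4 * j + i + 2) (1 - t)) = \<Theta> (side (4 * j + i) t) + of_bool (nontrivial m (4 * j + i))"
proof -
  define \<mu> :: "nat \<Rightarrow> real" where "\<mu> k = of_bool (nontrivial m k)" for k
  define V where "V k = (let a = \<mu> (4 * (k div 4)); b = \<mu> (4 * (k div 4) + 1) in
    if k mod 4 = 0 then 0 else if k mod 4 = 1 then - b else if k mod 4 = 2 then a - b else a)" for k
  define c where "c k t = (1 - t) * V k + t * V (Suc k)" for k t
  have V0: "V (4 * g) = V 0" by (simp add: V_def)
  obtain \<Theta> where \<Theta>: "continuous_map (top_of_set (- {0})) euclideanreal \<Theta>"
    "\<And>k y. k < 4 * g \<Longrightarrow> y \<in> sector k \<Longrightarrow> \<Theta> y = c k (side_param k y)"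
  proof (rule radial_extension)
    show "continuous_map (top_of_set {0..1}) euclideanreal (c k)" for k
      unfolding c_def by (auto intro!: continuous_intros)
    show "c k 1 = c (Suc k mod (4 * g)) 0" if "k < 4 * g" for k
    proof (cases "Suc k = 4 * g")
      case False
      then show ?thesis using that by (simp add: c_def)
    qed (use V0 in \<open>simp add: c_def\<close>)
  qed blast
  have side: "\<Theta> (side k t) = c k t" if "k < 4 * g" "t \<in> {0..1}" for k t
    using \<Theta>(2)[OF that(1) side_in_sector[OF that(2)]] by (simp add: side_param_side)
  have V: "V (4 * j) = 0" "V (4 * j + 1) = - \<mu> (4 * j + 1)" "V (4 * j + 2) = \<mu> (4 * j) - \<mu> (4 * j + 1)"
    "V (4 * j + 3) = \<mu> (4 * j)" "V (4 * j + 4) = 0" for j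
  proof -
    have d: "(4 * j + l) div 4 = j" "(4 * j + l) mod 4 = l" if "l < 4" for l using that by auto
    have "V (4 * j + 4) = V (4 * (j + 1))" by (rule arg_cong[where f = V]) simp
    also have "\<dots> = 0" unfolding V_def by simp
    finally show "V (4 * j + 4) = 0" .
    show "V (4 * j) = 0" "V (4 * j + 1) = - \<mu> (4 * j + 1)" "V (4 * j + 2) = \<mu> (4 * j) - \<mu> (4 * j + 1)"
      "V (4 * j + 3) = \<mu> (4 * j)"
      using d[of 1] d[of 2] d[of 3] by (simp_all add: V_def)
  qed
  show thesis
  proof (rule that)
    show "continuous_on pstar \<Theta>" using \<Theta>(1) by (auto intro: continuous_on_subset)
    fix j i t assume h: "j < g" "i < (2::nat)" "t \<in> {0..1::real}"
    have k: "4 * j + i + 2 < 4 * g" "4 * j + i < 4 * g" using h by auto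
    have t: "1 - t \<in> {0..1}" using h(3) by auto
    have "c (4 * j + i + 2) (1 - t) = c (4 * j + i) t + \<mu> (4 * j + i)"
    proof (cases "i = 0")
      case True
      have "c (4 * j + 2) (1 - t) = t * V (4 * j + 2) + (1 - t) * V (4 * j + 3)"
        "c (4 * j) t = (1 - t) * V (4 * j) + t * V (4 * j + 1)" by (simp_all add: c_def eval_nat_numeral)
      then show ?thesis unfolding True V by (simp add: algebra_simps)
    next
      case False
      then have i: "i = 1" using h(2) by simp
      have "c (4 * j + 3) (1 - t) = t * V (4 * j + 3) + (1 - t) * V (4 * j + 4)"
        "c (4 * j + 1) t = (1 - t) * V (4 * j + 1) + t * V (4 * j + 2)" by (simp_all add: c_def eval_nat_numeral)
      moreover have "4 * j + 1 + 2 = 4 * j + 3" by simp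
      ultimately show ?thesis unfolding i V by (simp only:) (simp add: algebra_simps)
    qed
    then show "\<Theta> (side (4 * j + i + 2) (1 - t)) = \<Theta> (side (4 * j + i) t) + of_bool (nontrivial m (4 * j + i))"
      unfolding side[OF k(1) t] side[OF k(2) h(3)] \<mu>_def .
  qed
qed

definition refl_power :: "int \<Rightarrow> 'n sq_matrix set" where
  "refl_power k = (if even k then \<one>\<^bsub>PO\<^esub> else PO_class r)"

lemma refl_class: "PO_class r \<in> carrier PO" "PO_class r \<otimes>\<^bsub>PO\<^esub> PO_class r = \<one>\<^bsub>PO\<^esub>"
proof -
  show "PO_class r \<in> carrier PO" using pin_to_PO_closed[OF rpin(1)] rpin(3) by simp
  have "PO_class r \<otimes>\<^bsub>PO\<^esub> PO_class r = pin_to_PO (rpin \<star> rpin)"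
    unfolding rpin(3)[symmetric] using rpin(1) by (simp add: pin_to_PO_mult)
  also have "\<dots> = pin_to_PO (cl_one :: 'n clifford)"
    unfolding rpin(4) pin_to_PO_def by (simp add: pin_to_O_minus pin_set.one)
  also have "\<dots> = \<one>\<^bsub>PO\<^esub>" by (rule pin_to_PO_one)
  finally show "PO_class r \<otimes>\<^bsub>PO\<^esub> PO_class r = \<one>\<^bsub>PO\<^esub>" .
qed

lemma refl_power_in: "refl_power k \<in> carrier PO"
  using refl_class(1) by (simp add: refl_power_def)

lemma refl_power_add: "refl_power k \<otimes>\<^bsub>PO\<^esub> refl_power l = refl_power (k + l)"
  using refl_class by (simp add: refl_power_def)

lemma refl_power_cong: "even (k - l) \<Longrightarrow> refl_power k = refl_power l"
  by (auto simp: refl_power_def)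

lemma inv_refl_power: "inv\<^bsub>PO\<^esub> (refl_power k) = refl_power k"
  by (rule PO.inv_equality) (simp_all add: refl_power_add refl_power_in, simp add: refl_power_def)

lemma glue_refl_power: "glue m k = refl_power (of_bool (nontrivial m k))"
  by (simp add: glue_value refl_power_def PO_one)

text \<open>The floor is locally constant away from the integers.\<close>

lemma refl_power_floor_continuous:
  assumes c: "continuous_on D h" and D: "\<And>y. y \<in> D \<Longrightarrow> h y \<notin> \<int>"
  shows "continuous_map (top_of_set D) PO_topology (\<lambda>y. refl_power \<lfloor>h y :: real\<rfloor>)"
proof (rule continuous_map_locally)
  fix y assume "y \<in> topspace (top_of_set D)"
  then have y: "y \<in> D" by simp
  let ?V = "{of_int \<lfloor>h y\<rfloor> <..< of_int \<lfloor>h y\<rfloor> + 1 :: real}"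
  let ?U = "D \<inter> h -` ?V"
  have "of_int \<lfloor>h y\<rfloor> < h y" using D[OF y] floor_le_iff[of "h y" "\<lfloor>h y\<rfloor>"] by (metis Ints_of_int of_int_floor_le order_le_less)
  then have yU: "y \<in> ?U" using y by auto
  have "openin (top_of_set D) ?U" using continuous_openin_preimage_gen[OF c, of ?V] by simp
  moreover have "continuous_map (subtopology (top_of_set D) ?U) PO_topology (\<lambda>y. refl_power \<lfloor>h y\<rfloor>)"
  proof (rule continuous_map_eq)
    show "continuous_map (subtopology (top_of_set D) ?U) PO_topology (\<lambda>_. refl_power \<lfloor>h y\<rfloor>)"
      using refl_power_in by (simp add: topspace_PO)
    fix x assume "x \<in> topspace (subtopology (top_of_set D) ?U)"
    then have "h x \<in> ?V" by auto
    then have "\<lfloor>h x\<rfloor> = \<lfloor>h y\<rfloor>" by (intro floor_unique) auto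
    then show "refl_power \<lfloor>h y\<rfloor> = refl_power \<lfloor>h x\<rfloor>" by simp
  qed
  ultimately show "\<exists>U. openin (top_of_set D) U \<and> y \<in> U \<and>
      continuous_map (subtopology (top_of_set D) U) PO_topology (\<lambda>y. refl_power \<lfloor>h y\<rfloor>)" using yU by blast
qed

lemma saturated_image:
  assumes D: "openin (top_of_set (polygon g)) D" and sat: "\<And>x y. x \<in> D \<Longrightarrow> y \<in> polygon g \<Longrightarrow> q x = q y \<Longrightarrow> y \<in> D"
  shows "openin X (q ` D)" "quotient_map (top_of_set D) (subtopology X (q ` D)) q"
proof -
  have sub: "D \<subseteq> polygon g" using openin_imp_subset[OF D] .
  have pre: "{y \<in> topspace (top_of_set (polygon g)). q y \<in> q ` D} = D" using sat sub by force
  have "q ` D \<subseteq> topspace X" using sub q_in by blast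
  then show o: "openin X (q ` D)" using q_quotient D pre unfolding quotient_map_def by metis
  have "subtopology (top_of_set (polygon g)) D = top_of_set D" using sub by (simp add: subtopology_subtopology Int_absorb1)
  then show "quotient_map (top_of_set D) (subtopology X (q ` D)) q"
    using quotient_map_restriction[OF q_quotient pre] o by auto
qed

text \<open>Away from the centre the bundle is flat: its charts are the regions where the floor of
  \<open>\<Theta> + a\<close> is locally constant, and its transition functions are powers of
  \<open>[r]\<close>. The chart \<open>None\<close> around the centre is attached through a loop
  that represents z.\<close>

lemma clutched_bundle_exists:
  fixes \<iota> :: "'x \<times> 'n sq_matrix set \<Rightarrow> 'e"
  assumes m: "m \<in> Z2_tuples g" and z: "z \<in> pi1_elems" and inj: "inj_on \<iota> (topspace X \<times> carrier PO)"
  obtains E :: "('e, 'x, 'n sq_matrix set) bundle_data" where "principal_bundle PO PO_topology X E" "clutched E m z"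
proof -
  obtain e where e: "e > 0" "cball 0 e \<subseteq> polygon g" using cball_in_polygon by blast
  define \<delta> where "\<delta> = e / 2"
  have d: "0 < \<delta>" "cball (0 :: complex) \<delta> \<subseteq> ball 0 e" using e(1) by (auto simp: \<delta>_def)
  have bp: "ball 0 e \<subseteq> polygon g" using e(2) ball_subset_cball by blast
  have bi: "ball 0 e \<subseteq> interior (polygon g)" by (rule interior_maximal[OF bp open_ball])
  have cp: "cball 0 \<delta> \<subseteq> polygon g" using d(2) bp by blast
  \<comment> \<open>A path from 1 to z in Spin(n) becomes a loop in PO(n), because z lies in the
    kernel.\<close>
  obtain c where c: "continuous_map (top_of_set {0..1::real}) (top_of_set (pin_set :: 'n clifford set)) c" "c 0 = cl_one" "c 1 = z"
  proof -
    have "CARD('n) \<ge> 2" using dim_ge by simp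
    then have "path_connected (spin_set :: 'n clifford set)" by (rule path_connected_spin)
    moreover have "z \<in> spin_set" using z pi1_spin by blast
    ultimately obtain p where "path p" "path_image p \<subseteq> spin_set" "pathstart p = cl_one" "pathfinish p = z"
      using spin_one unfolding path_connected_def by blast
    then show thesis using that[of p] spin_subset
      by (force simp: path_def path_image_def pathstart_def pathfinish_def)
  qed
  have pc: "continuous_map (top_of_set {0..1}) PO_topology (\<lambda>t. pin_to_PO (c t))"
    using continuous_map_compose[OF c(1) continuous_pin_to_PO] by (simp add: o_def)
  have "pin_to_PO (c 1) = pin_to_PO (c 0)"
    unfolding c(2,3) using pin_to_PO_eq_iff[OF pin_set.one pi1_pin[OF z]] z by auto
  then obtain h where h: "continuous_map (top_of_set (sphere (0::complex) 1)) (PO_topology :: 'n sq_matrix set topology) h"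
    "\<And>t. t \<in> {0..1} \<Longrightarrow> h (cis (2 * pi * t)) = pin_to_PO (c t)"
    using circle_loop_map[OF pc] by blast
  define F where "F y = h (sgn y)" for y :: complex
  have Fc: "continuous_map (top_of_set (- {0})) PO_topology F"
  proof -
    have "continuous_map (top_of_set (- {0})) (top_of_set (sphere (0::complex) 1)) sgn"
      by (auto simp: norm_sgn intro!: continuous_on_sgn continuous_on_id)
    from continuous_map_compose[OF this h(1)] show ?thesis by (simp add: F_def[abs_def] o_def)
  qed
  have Fin: "F y \<in> carrier PO" if "y \<noteq> 0" for y using PO_in[OF Fc] that by simp
  obtain \<Theta> :: "complex \<Rightarrow> real" where \<Theta>: "continuous_on pstar \<Theta>"
    "\<And>j i t. j < g \<Longrightarrow> i < 2 \<Longrightarrow> t \<in> {0..1} \<Longrightarrow>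
      \<Theta> (side (4 * j + i + 2) (1 - t)) = \<Theta> (side (4 * j + i) t) + of_bool (nontrivial m (4 * j + i))"
    using height_exists by blast
  have \<Theta>_int: "\<Theta> y - \<Theta> x \<in> \<int>" if "x \<in> polygon g" "y \<in> polygon g" "q x = q y" for x y
    using that
  proof (rule q_induct)
    show "\<Theta> (side (4 * j + i + 2) (1 - t)) - \<Theta> (side (4 * j + i) t) \<in> \<int>" if "j < g" "i < 2" "t \<in> {0..1}" for j i t
      using \<Theta>(2)[OF that] by simp
    show "\<Theta> x - \<Theta> y \<in> \<int>" if "\<Theta> y - \<Theta> x \<in> \<int>" for x y
      using Ints_minus[OF that] by simp
    show "\<Theta> z - \<Theta> x \<in> \<int>" if "\<Theta> y - \<Theta> x \<in> \<int>" "\<Theta> z - \<Theta> y \<in> \<int>" for x y z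
      using Ints_add[OF that] by simp
  qed simp
  define rep where "rep x = (SOME y. y \<in> polygon g \<and> q y = x)" for x
  have rep: "rep (q y) \<in> polygon g" "q (rep (q y)) = q y" if "y \<in> polygon g" for y
    using someI_ex[of "\<lambda>y'. y' \<in> polygon g \<and> q y' = q y"] that unfolding rep_def by blast+
  have rep_ball: "rep (q y) = y" if "y \<in> ball 0 e" for y
    using q_interior_inj[OF subsetD[OF bi that] rep(1)] rep(2)[symmetric] subsetD[OF bp that] by metis
  have floor_shift: "\<exists>k. \<lfloor>\<Theta> y + a\<rfloor> = \<lfloor>\<Theta> x + a\<rfloor> + k \<and> \<Theta> y - \<Theta> x = of_int k" if xy: "x \<in> polygon g" "y \<in> polygon g" "q x = q y" for x y a
  proof -
    obtain k where k: "\<Theta> y - \<Theta> x = of_int k" using \<Theta>_int[OF xy] by (auto elim: Ints_cases)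
    then have "\<Theta> y + a = (\<Theta> x + a) + of_int k" by simp
    then have "\<lfloor>\<Theta> y + a\<rfloor> = \<lfloor>\<Theta> x + a\<rfloor> + k" by (simp only: floor_add_int)
    then show ?thesis using k by blast
  qed
  have half: "(of_int k + 1 / 2 :: real) \<notin> \<int>" for k
  proof
    assume "(of_int k + 1 / 2 :: real) \<in> \<int>"
    then obtain l where "of_int k + 1 / 2 = (of_int l :: real)" by (auto elim: Ints_cases)
    then have "of_int (2 * k + 1) = (of_int (2 * l) :: real)" by simp
    then have "2 * k + 1 = 2 * l" by (simp only: of_int_eq_iff)
    then show False by presburger
  qed
  \<comment> \<open>No real number is integral both with 0 and with 1/2 added, so two flat charts
    cover the punctured polygon.\<close>
  define I :: "real option set" where "I = {None, Some 0, Some (1/2)}"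
  define D where "D w = (case w of None \<Rightarrow> ball 0 e | Some a \<Rightarrow> {y \<in> pstar. \<Theta> y + a \<notin> \<int>})" for w :: "real option"
  \<comment> \<open>The inverse of the radially extended loop is the twist around the centre. At the
    centre itself the value is filled in by the neutral element; no other chart contains that
    point.\<close>
  define \<phi> where "\<phi> w x = (case w of None \<Rightarrow> (if rep x = 0 then \<one>\<^bsub>PO\<^esub> else inv\<^bsub>PO\<^esub> (F (rep x)))
      | Some a \<Rightarrow> refl_power \<lfloor>\<Theta> (rep x) + a\<rfloor>)" for w :: "real option" and x
  have D_sub: "D w \<subseteq> polygon g" for w using bp by (auto simp: D_def split: option.split)
  have zero_iff: "x = 0 \<longleftrightarrow> y = 0" if "x \<in> polygon g" "y \<in> polygon g" "q x = q y" for x y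
  proof -
    have "0 \<in> interior (polygon g)" using bi e(1) by auto
    then show ?thesis using q_interior_inj[of 0 x] q_interior_inj[of 0 y] that by metis
  qed
  have D_open: "openin (top_of_set (polygon g)) (D w)" for w
  proof (cases w)
    case None
    have "openin (top_of_set (polygon g)) (polygon g \<inter> ball 0 e)" by (rule openin_open_Int) simp
    then show ?thesis using None bp by (simp add: D_def Int_absorb1)
  next
    case (Some a)
    have "continuous_on pstar (\<lambda>y. \<Theta> y + a)" using \<Theta>(1) by (intro continuous_intros)
    then have "openin (top_of_set pstar) (pstar \<inter> (\<lambda>y. \<Theta> y + a) -` (- \<int>))"
      by (rule continuous_openin_preimage_gen) (simp add: open_Compl)
    moreover have "pstar \<inter> (\<lambda>y. \<Theta> y + a) -` (- \<int>) = D w" using Some by (auto simp: D_def)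
    moreover have "openin (top_of_set (polygon g)) pstar"
      unfolding Diff_eq by (rule openin_open_Int[OF open_Compl[OF closed_singleton]])
    ultimately show ?thesis using openin_trans by metis
  qed
  have D_sat: "y \<in> D w" if xy: "x \<in> D w" "y \<in> polygon g" "q x = q y" for w x y
  proof (cases w)
    case None
    then have "x \<in> interior (polygon g)" using xy(1) bi by (auto simp: D_def)
    then show ?thesis using q_interior_inj[OF _ xy(2,3)] xy(1) by simp
  next
    case (Some a)
    have x: "x \<in> polygon g" using D_sub xy(1) by blast
    have "\<Theta> x + a \<notin> \<int>" "x \<noteq> 0" using xy(1) Some by (auto simp: D_def)
    moreover have "\<Theta> x + a = (\<Theta> y + a) - (\<Theta> y - \<Theta> x)" by simp
    ultimately have "\<Theta> y + a \<notin> \<int>" using Ints_diff[OF _ \<Theta>_int[OF x xy(2,3)]] by metis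
    then show ?thesis using Some xy(2) zero_iff[OF x xy(2,3)] \<open>x \<noteq> 0\<close> by (simp add: D_def)
  qed
  have F_ball: "continuous_map (top_of_set (D None \<inter> D (Some a))) PO_topology F" for a
    using Fc by (rule continuous_map_from_subtopology_mono) (auto simp: D_def)
  have R: "continuous_map (top_of_set (D (Some a))) PO_topology (\<lambda>y. refl_power \<lfloor>\<Theta> y + a\<rfloor>)" for a
  proof (rule refl_power_floor_continuous)
    show "continuous_on (D (Some a)) (\<lambda>y. \<Theta> y + a)"
      using \<Theta>(1) by (intro continuous_intros) (auto simp: D_def intro: continuous_on_subset)
  qed (auto simp: D_def)
  have \<phi>_in: "\<phi> w x \<in> carrier PO" for w x
    using Fin refl_power_in by (auto simp: \<phi>_def split: option.split)
  have \<phi>_ball: "\<phi> None (q y) = inv\<^bsub>PO\<^esub> (F y)" "\<phi> (Some a) (q y) = refl_power \<lfloor>\<Theta> y + a\<rfloor>" if "y \<in> ball 0 e" "y \<noteq> 0" for y a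
    using rep_ball[OF that(1)] that(2) by (simp_all add: \<phi>_def)
  have pre_ratio: "continuous_map (top_of_set (D w \<inter> D w')) PO_topology (\<lambda>y. inv\<^bsub>PO\<^esub> (\<phi> w (q y)) \<otimes>\<^bsub>PO\<^esub> \<phi> w' (q y))" for w w'
  proof -
    have mixed: "continuous_map (top_of_set (D None \<inter> D (Some a))) PO_topology (\<lambda>y. inv\<^bsub>PO\<^esub> (\<phi> None (q y)) \<otimes>\<^bsub>PO\<^esub> \<phi> (Some a) (q y))" for a
    proof (rule continuous_map_eq)
      have "continuous_map (top_of_set (D None \<inter> D (Some a))) PO_topology (\<lambda>y. refl_power \<lfloor>\<Theta> y + a\<rfloor>)"
        using R by (rule continuous_map_from_subtopology_mono) auto
      then show "continuous_map (top_of_set (D None \<inter> D (Some a))) PO_topology (\<lambda>y. F y \<otimes>\<^bsub>PO\<^esub> refl_power \<lfloor>\<Theta> y + a\<rfloor>)"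
        by (rule PO_mult_continuous[OF F_ball])
      show "F y \<otimes>\<^bsub>PO\<^esub> refl_power \<lfloor>\<Theta> y + a\<rfloor> = inv\<^bsub>PO\<^esub> (\<phi> None (q y)) \<otimes>\<^bsub>PO\<^esub> \<phi> (Some a) (q y)"
        if "y \<in> topspace (top_of_set (D None \<inter> D (Some a)))" for y
      proof -
        have "y \<in> ball 0 e" "y \<noteq> 0" using that by (auto simp: D_def)
        then show ?thesis using \<phi>_ball(1)[of y] \<phi>_ball(2)[of y a] Fin by simp
      qed
    qed
    show ?thesis
    proof (cases w)
      case None
      show ?thesis
      proof (cases w')
        case None
        then show ?thesis using \<open>w = None\<close> \<phi>_in[of None] by (simp add: topspace_PO)
      next
        case (Some a)
        then show ?thesis using \<open>w = None\<close> mixed[of a] by simp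
      qed
    next
      case (Some a)
      show ?thesis
      proof (cases w')
        case None
        have "continuous_map (top_of_set (D w \<inter> D w')) PO_topology
            (\<lambda>y. inv\<^bsub>PO\<^esub> (inv\<^bsub>PO\<^esub> (\<phi> None (q y)) \<otimes>\<^bsub>PO\<^esub> \<phi> (Some a) (q y)))"
          using PO_inv_continuous[OF mixed[of a]] unfolding Some None by (simp only: Int_commute)
        then show ?thesis
          unfolding Some None using \<phi>_in by (simp add: PO.inv_mult_group)
      next
        case (Some a')
        show ?thesis
        proof (rule continuous_map_eq)
          have "continuous_map (top_of_set (D w \<inter> D w')) PO_topology (\<lambda>y. refl_power \<lfloor>\<Theta> y + a\<rfloor>)"
            "continuous_map (top_of_set (D w \<inter> D w')) PO_topology (\<lambda>y. refl_power \<lfloor>\<Theta> y + a'\<rfloor>)"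
            using R[of a] R[of a'] by (auto intro: continuous_map_from_subtopology_mono simp: Some \<open>w = Some a\<close>)
          then show "continuous_map (top_of_set (D w \<inter> D w')) PO_topology (\<lambda>y. refl_power \<lfloor>\<Theta> y + a\<rfloor> \<otimes>\<^bsub>PO\<^esub> refl_power \<lfloor>\<Theta> y + a'\<rfloor>)"
            by (rule PO_mult_continuous)
          show "refl_power \<lfloor>\<Theta> y + a\<rfloor> \<otimes>\<^bsub>PO\<^esub> refl_power \<lfloor>\<Theta> y + a'\<rfloor> = inv\<^bsub>PO\<^esub> (\<phi> w (q y)) \<otimes>\<^bsub>PO\<^esub> \<phi> w' (q y)"
            if "y \<in> topspace (top_of_set (D w \<inter> D w'))" for y
          proof -
            have y: "y \<in> polygon g" using that D_sub by auto
            obtain k where k: "\<lfloor>\<Theta> y + a\<rfloor> = \<lfloor>\<Theta> (rep (q y)) + a\<rfloor> + k" "\<Theta> y - \<Theta> (rep (q y)) = of_int k"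
              using floor_shift[OF rep(1)[OF y] y rep(2)[OF y], of a] by blast
            obtain k' where k': "\<lfloor>\<Theta> y + a'\<rfloor> = \<lfloor>\<Theta> (rep (q y)) + a'\<rfloor> + k'" "\<Theta> y - \<Theta> (rep (q y)) = of_int k'"
              using floor_shift[OF rep(1)[OF y] y rep(2)[OF y], of a'] by blast
            \<comment> \<open>Passing from y to its representative shifts both floors by the same
              integer, which cancels modulo 2 in the ratio.\<close>
            have "k = k'" using k(2) k'(2) by simp
            then show ?thesis
              unfolding \<open>w = Some a\<close> Some \<phi>_def option.case inv_refl_power refl_power_add k(1) k'(1)
              by (intro refl_power_cong) simp
          qed
        qed
      qed
    qed
  qed
  have ratio: "continuous_map (subtopology X (q ` D w \<inter> q ` D w')) PO_topology (\<lambda>x. inv\<^bsub>PO\<^esub> (\<phi> w x) \<otimes>\<^bsub>PO\<^esub> \<phi> w' x)" for w w'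
  proof -
    have im: "q ` D w \<inter> q ` D w' = q ` (D w \<inter> D w')"
    proof (intro equalityI subsetI)
      fix x assume "x \<in> q ` D w \<inter> q ` D w'"
      then obtain y y' where y: "y \<in> D w" "x = q y" "y' \<in> D w'" "x = q y'" by blast
      then have "y \<in> D w'" using D_sat[OF y(3), of y] D_sub[of w] by auto
      then show "x \<in> q ` (D w \<inter> D w')" using y by blast
    qed blast
    have "quotient_map (top_of_set (D w \<inter> D w')) (subtopology X (q ` (D w \<inter> D w'))) q"
      by (rule saturated_image(2)[OF openin_Int[OF D_open D_open]]) (use D_sat in blast)
    then show ?thesis unfolding im
      by (rule continuous_compose_quotient_map) (use pre_ratio in \<open>simp add: o_def\<close>)
  qed
  have cover: "topspace X \<subseteq> (\<Union>w\<in>I. q ` D w)"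
  proof
    fix x assume "x \<in> topspace X"
    then obtain y where y: "y \<in> polygon g" "x = q y" using q_image by blast
    have "y \<in> D None \<or> y \<in> D (Some 0) \<or> y \<in> D (Some (1/2))"
    proof (cases "y = 0 \<or> \<Theta> y \<notin> \<int>")
      case False
      then obtain k where "\<Theta> y = of_int k" by (auto elim: Ints_cases)
      then show ?thesis using half[of k] y False by (simp add: D_def)
    qed (use y e(1) in \<open>auto simp: D_def\<close>)
    then show "x \<in> (\<Union>w\<in>I. q ` D w)" using y(2) by (auto simp: I_def)
  qed
  interpret C: chart_bundle dummy X I "\<lambda>w. q ` D w" \<phi> \<iota>
  proof unfold_locales
    show "openin X (q ` D w)" for w by (rule saturated_image(1)[OF D_open D_sat])
  qed (use inj cover \<phi>_in ratio in auto)
  have ID: "None \<in> I" "Some 0 \<in> I" "Some (1/2) \<in> I" by (auto simp: I_def)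
  \<comment> \<open>The difference of heights is an integer, so the floor only converts its type.
    Across a pair of sides it jumps by 0 or 1, as \<open>glue\<close> prescribes.\<close>
  define A where "A y = \<iota> (q y, refl_power \<lfloor>\<Theta> y - \<Theta> (rep (q y))\<rfloor>)" for y
  \<comment> \<open>The constant frame of the central chart. Compared with the flat frame A it
    differs by F, hence on the circle by the given loop.\<close>
  define \<sigma> where "\<sigma> y = C.chart None (q y, \<one>\<^bsub>PO\<^esub>)" for y
  have chart_section: "continuous_map (top_of_set B) C.TE (\<lambda>y. C.chart w (q y, u y))"
    if B: "B \<subseteq> D w" "w \<in> I" and u: "continuous_map (top_of_set B) PO_topology u" for B w u
  proof -
    have "continuous_map (top_of_set B) X q"
      using q_cont by (rule continuous_map_from_subtopology_mono) (use B(1) D_sub in blast)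
    then have "continuous_map (top_of_set B) (subtopology X (q ` D w)) q"
      using B(1) by (auto simp: continuous_map_in_subtopology)
    then have "continuous_map (top_of_set B) (C.dom w) (\<lambda>y. (q y, u y))"
      unfolding C.dom_def continuous_map_paired using u by blast
    from continuous_map_compose[OF this C.chart_continuous[OF B(2)]] show ?thesis by (simp add: o_def)
  qed
  have "clutched C.glued m z"
  proof (rule sections_clutched[OF C.glued_principal m _ _ _ d(1) cp _ _ c(1) _ _ z])
    show "continuous_map (top_of_set pstar) C.TE A"
    proof (rule continuous_map_locally)
      fix y assume "y \<in> topspace (top_of_set pstar)"
      then have y: "y \<in> pstar" by simp
      then have "q y \<in> topspace X" "y \<noteq> 0" using q_in by auto
      obtain a where a: "Some a \<in> I" "y \<in> D (Some a)"
      proof (cases "\<Theta> y \<in> \<int>")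
        case True
        then obtain k where "\<Theta> y = of_int k" by (auto elim: Ints_cases)
        then show thesis using half[of k] that[of "1/2"] ID y by (simp add: D_def)
      qed (use that[of 0] ID y in \<open>simp add: D_def\<close>)
      have "continuous_map (top_of_set (D (Some a))) C.TE (\<lambda>y. C.chart (Some a) (q y, refl_power \<lfloor>\<Theta> y + a\<rfloor>))"
        by (rule chart_section[OF order_refl a(1) R])
      then have "continuous_map (top_of_set (D (Some a))) C.TE A"
      proof (rule continuous_map_eq)
        fix x assume "x \<in> topspace (top_of_set (D (Some a)))"
        then have x: "x \<in> polygon g" using D_sub by auto
        obtain k where k: "\<lfloor>\<Theta> x + a\<rfloor> = \<lfloor>\<Theta> (rep (q x)) + a\<rfloor> + k" "\<Theta> x - \<Theta> (rep (q x)) = of_int k"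
          using floor_shift[OF rep(1)[OF x] x rep(2)[OF x], of a] by blast
        \<comment> \<open>The floor at the representative occurs twice, once from the chart and once
          from its argument, and drops out modulo 2.\<close>
        have "refl_power (\<lfloor>\<Theta> (rep (q x)) + a\<rfloor> + (\<lfloor>\<Theta> (rep (q x)) + a\<rfloor> + k)) = refl_power k"
          by (rule refl_power_cong) simp
        then show "C.chart (Some a) (q x, refl_power \<lfloor>\<Theta> x + a\<rfloor>) = A x"
          unfolding C.chart_def A_def \<phi>_def option.case fst_conv snd_conv refl_power_add k(1) k(2) floor_of_int by simp
      qed
      moreover have "openin (top_of_set pstar) (D (Some a))"
        using D_open by (rule openin_subset_trans) (auto simp: D_def)
      moreover have "subtopology (top_of_set pstar) (D (Some a)) = top_of_set (D (Some a))"
        by (simp add: subtopology_subtopology Int_absorb1 D_def subset_iff)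
      ultimately show "\<exists>U. openin (top_of_set pstar) U \<and> y \<in> U \<and> continuous_map (subtopology (top_of_set pstar) U) C.TE A"
        using a(2) by metis
    qed
    show "C.prj (A y) = q y" if "y \<in> pstar" for y
      unfolding A_def by (rule C.point(1)[OF q_in refl_power_in]) (use that in auto)
    show "A (side (4 * j + i + 2) (1 - t)) = C.act (A (side (4 * j + i) t)) (glue m (4 * j + i))"
      if h: "j < g" "i < 2" "t \<in> {0..1}" for j i t
    proof -
      let ?x = "side (4 * j + i) t"
      have x: "?x \<in> polygon g" by (rule side_in_polygon[OF h(3)])
      have "\<Theta> (side (4 * j + i + 2) (1 - t)) - \<Theta> (rep (q ?x)) = \<Theta> ?x - \<Theta> (rep (q ?x)) + of_int (of_bool (nontrivial m (4 * j + i)))"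
        using \<Theta>(2)[OF h] by simp
      then have "\<lfloor>\<Theta> (side (4 * j + i + 2) (1 - t)) - \<Theta> (rep (q ?x))\<rfloor> =
          \<lfloor>\<Theta> ?x - \<Theta> (rep (q ?x))\<rfloor> + of_bool (nontrivial m (4 * j + i))" by (simp only: floor_add_int)
      then show ?thesis
        unfolding A_def q_side[OF h] C.point(2)[OF q_in[OF x] refl_power_in] glue_refl_power refl_power_add by simp
    qed
    show "continuous_map (top_of_set (cball 0 \<delta>)) C.TE \<sigma>"
      unfolding \<sigma>_def by (rule chart_section[OF _ ID(1)]) (use d(2) in \<open>auto simp: D_def topspace_PO\<close>)
    show "C.prj (\<sigma> y) = q y" if "y \<in> cball 0 \<delta>" for y
    proof -
      have "q y \<in> q ` D None" using that d(2) by (auto simp: D_def)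
      then show ?thesis unfolding \<sigma>_def by (rule C.chart_point(2)[OF ID(1) _ PO.one_closed])
    qed
    show "A (of_real \<delta> * cis (2 * pi * t)) = C.act (\<sigma> (of_real \<delta> * cis (2 * pi * t))) (pin_to_PO (c t))"
      if t: "t \<in> {0..1}" for t
    proof -
      let ?y = "of_real \<delta> * cis (2 * pi * t)"
      have y: "?y \<in> ball 0 e" "?y \<noteq> 0" using d(1,2) by (auto simp: norm_mult \<delta>_def)
      have "sgn ?y = cis (2 * pi * t)" using d(1) by (simp add: sgn_mult sgn_of_real)
      then have F: "F ?y = pin_to_PO (c t)" using h(2)[OF t] by (simp add: F_def)
      have qD: "q ?y \<in> q ` D None" using y by (auto simp: D_def)
      have "C.act (\<sigma> ?y) (F ?y) = \<iota> (q ?y, inv\<^bsub>PO\<^esub> (F ?y) \<otimes>\<^bsub>PO\<^esub> \<one>\<^bsub>PO\<^esub> \<otimes>\<^bsub>PO\<^esub> F ?y)"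
        unfolding \<sigma>_def C.chart_point(3)[OF ID(1) qD PO.one_closed] \<phi>_ball(1)[OF y] ..
      also have "\<dots> = \<iota> (q ?y, \<one>\<^bsub>PO\<^esub>)" using Fin[OF y(2)] by simp
      also have "\<dots> = A ?y" unfolding A_def rep_ball[OF y(1)] by (simp add: refl_power_def)
      finally show ?thesis unfolding F ..
    qed
    show "c 1 = c 0 \<star> z" using c by simp
  qed
  then show thesis using that C.glued_principal by blast
qed

end

section \<open>Classification\<close>

lemma bij_betw_classes:
  fixes f :: "'a \<Rightarrow> 'b"
  assumes R: "R = {(a, b). a \<in> P \<and> b \<in> P \<and> f a = f b}"
  shows "\<exists>F. bij_betw F (P // R) (f ` P) \<and> (\<forall>a\<in>P. F (R `` {a}) = f a)"
proof -
  let ?F = "\<lambda>C. the_elem (f ` C)"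
  have F: "?F (R `` {a}) = f a" if "a \<in> P" for a
  proof -
    have "f ` (R `` {a}) = {f a}" using that unfolding R by auto
    then show ?thesis by simp
  qed
  have "inj_on ?F (P // R)"
  proof (rule inj_onI)
    fix C C' assume "C \<in> P // R" "C' \<in> P // R" and eq: "?F C = ?F C'"
    then obtain a a' where a: "a \<in> P" "C = R `` {a}" "a' \<in> P" "C' = R `` {a'}" by (auto elim!: quotientE)
    then have "f a = f a'" using F eq by metis
    then show "C = C'" using a by (auto simp: R)
  qed
  moreover have "?F ` (P // R) = f ` P"
  proof -
    have "P // R = (\<lambda>a. R `` {a}) ` P" by (auto simp: quotient_def)
    then show ?thesis by (simp add: image_image F cong: image_cong)
  qed
  ultimately show ?thesis using F by (intro exI[of _ ?F]) (simp add: bij_betw_def)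
qed

section \<open>The group \<open>Gamma_mu1\<close> and the orbits of its cosets\<close>

context pin_polygon
begin

lemma pin_conj_pi1:
  assumes "p \<in> pin_set" "z \<in> pi1_elems"
  shows "pin_conj p z = (if p \<in> spin_set then z else pi1_flip z)"
proof (cases "p \<in> spin_set")
  case True
  then have "p \<star> z = z \<star> p" using pi1_commute_pin[OF assms(2,1)] by simp
  then have "p \<star> z \<star> cl_conj p = z \<star> (p \<star> cl_conj p)" by (simp only: cl_assoc)
  then show ?thesis using True assms(1) by (simp add: pin_conj_def inv_Pin)
next
  case False
  then have "p \<star> z = pi1_flip z \<star> p"
    using pi1_commute_pin[OF pi1_flip_closed[OF assms(2)] assms(1)] pi1_flip_flip[OF assms(2)] by simp
  then have "p \<star> z \<star> cl_conj p = pi1_flip z \<star> (p \<star> cl_conj p)" by (simp only: cl_assoc)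
  then show ?thesis using False assms(1) by (simp add: pin_conj_def inv_Pin)
qed

lemma Gamma_trivial:
  assumes "\<And>k. k < 2 * g \<Longrightarrow> m k = 0"
  shows "Gamma_mu1 g m = {cl_one :: 'n clifford}"
  unfolding Gamma_mu1_def
proof (rule group.generateI[OF group_Pin, symmetric])
  show "subgroup {cl_one :: 'n clifford} Pin"
    using group.triv_subgroup[OF group_Pin] by simp
  have "z \<star> inv\<^bsub>Pin\<^esub> (pin_conj p z) = cl_one"
    if z: "z \<in> pi1_PO" and p: "p \<in> pin_set" and c: "PO_component (pin_to_PO p) \<in> mu1_image g m" for z p :: "'n clifford"
  proof -
    have z': "z \<in> pi1_elems" using z by (simp add: pi1_PO_eq)
    have "mu1_image g m \<subseteq> {0}" using assms by (auto simp: mu1_image_def)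
    then have "PO_component (pin_to_PO p) = 0" using c by blast
    then have "p \<in> spin_set" using PSO_pin_iff[OF p] by (simp add: PO_component_def split: if_splits)
    then show ?thesis using pin_conj_pi1[OF p z'] pi1_pin[OF z'] by (simp add: inv_Pin)
  qed
  then show "{z \<otimes>\<^bsub>Pin\<^esub> inv\<^bsub>Pin\<^esub> (pin_conj p z) | z p :: 'n clifford.
      z \<in> pi1_PO \<and> p \<in> carrier Pin \<and> PO_component (pin_to_PO p) \<in> mu1_image g m} \<subseteq> {cl_one}" by auto
  show "{cl_one} \<subseteq> K" if "subgroup K Pin" for K :: "'n clifford set"
    using subgroup.one_closed[OF that] by simp
qed

text \<open>All generators are signs, since conjugation changes a kernel element at most by a sign;
  an odd element conjugating omega gives the generator -1.\<close>

lemma Gamma_nontrivial: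
  assumes k: "k < 2 * g" "m k \<noteq> 0" and odd: "s \<in> pin_set" "s \<notin> (spin_set :: 'n clifford set)"
  shows "Gamma_mu1 g m = {cl_one, - cl_one :: 'n clifford}"
  unfolding Gamma_mu1_def
proof (rule group.generateI[OF group_Pin, symmetric])
  have m1: "(- cl_one :: 'n clifford) \<in> pin_set" by (rule pin_minus[OF pin_set.one])
  have neg: "inv\<^bsub>Pin\<^esub> (- cl_one) = (- cl_one :: 'n clifford)"
    using m1 by (simp add: inv_Pin cl_conj_minus)
  show "subgroup {cl_one, - cl_one :: 'n clifford} Pin"
    using m1 pin_set.one neg
    by (intro group.subgroupI[OF group_Pin]) (auto simp: cl.minus_left cl.minus_right inv_Pin)
  have "z \<star> inv\<^bsub>Pin\<^esub> (pin_conj p z) \<in> {cl_one, - cl_one}"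
    if z: "z \<in> pi1_PO" and p: "p \<in> pin_set" for z p :: "'n clifford"
  proof -
    have z': "z \<in> pi1_elems" using z by (simp add: pi1_PO_eq)
    have "pi1_flip z = z \<or> pi1_flip z = - z" by (simp add: pi1_flip_def)
    then have "pin_conj p z = z \<or> pin_conj p z = - z" using pin_conj_pi1[OF p z'] by auto
    then show ?thesis
      using pi1_pin[OF z'] pin_minus[OF pi1_pin[OF z']] by (auto simp: inv_Pin cl_conj_minus cl.minus_right)
  qed
  then show "{z \<otimes>\<^bsub>Pin\<^esub> inv\<^bsub>Pin\<^esub> (pin_conj p z) | z p :: 'n clifford.
      z \<in> pi1_PO \<and> p \<in> carrier Pin \<and> PO_component (pin_to_PO p) \<in> mu1_image g m} \<subseteq> {cl_one, - cl_one}" by auto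
  fix K :: "'n clifford set"
  assume K: "subgroup K Pin" and H: "{z \<otimes>\<^bsub>Pin\<^esub> inv\<^bsub>Pin\<^esub> (pin_conj p z) | z p :: 'n clifford.
      z \<in> pi1_PO \<and> p \<in> carrier Pin \<and> PO_component (pin_to_PO p) \<in> mu1_image g m} \<subseteq> K"
  have w: "(cl_omega :: 'n clifford) \<in> pi1_elems" by (simp add: pi1_elems_def)
  have "m k = 1" using k(2) by simp
  then have "1 \<in> mu1_image g m" using k(1) by (auto simp: mu1_image_def intro!: image_eqI[of _ _ k])
  then have "PO_component (pin_to_PO s) \<in> mu1_image g m" using PSO_pin_iff[OF odd(1)] odd(2) by (simp add: PO_component_def)
  \<comment> \<open>Conjugation by the odd s turns omega into -omega, so this generator is omega
    times the inverse of -omega.\<close>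
  then have "cl_omega \<otimes>\<^bsub>Pin\<^esub> inv\<^bsub>Pin\<^esub> (pin_conj s cl_omega) \<in> K"
    using H odd(1) w by (auto simp: pi1_PO_eq)
  moreover have "cl_omega \<otimes>\<^bsub>Pin\<^esub> inv\<^bsub>Pin\<^esub> (pin_conj s cl_omega) = - cl_one"
    using pin_conj_pi1[OF odd(1) w] odd(2) pi1_pin[OF pi1_flip_closed[OF w]] pi1_pin[OF w] by (simp add: inv_Pin cl_conj_minus cl.minus_right)
  ultimately show "{cl_one, - cl_one} \<subseteq> K" using subgroup.one_closed[OF K] by simp
qed

lemma mu2_class_trivial:
  assumes m: "\<And>k. k < 2 * g \<Longrightarrow> m k = 0" and odd: "s \<in> pin_set" "s \<notin> (spin_set :: 'n clifford set)" and z: "(z :: 'n clifford) \<in> pi1_elems"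
  shows "mu2_class g m z = {{z}, {pi1_flip z}}"
proof -
  have "Gamma_mu1 g m #>\<^bsub>Pin\<^esub> z = {z}" by (simp add: Gamma_trivial[OF m] r_coset_def)
  then have mu2: "mu2_class g m z = (\<lambda>p. {pin_conj p z}) ` pin_set" by (auto simp: mu2_class_def)
  have "pin_conj cl_one z = z" "pin_conj s z = pi1_flip z"
    using pin_conj_pi1[OF pin_set.one z] pin_conj_pi1[OF odd(1) z] odd(2) by (simp_all add: spin_one)
  then have "{{z}, {pi1_flip z}} \<subseteq> mu2_class g m z"
    unfolding mu2 using imageI[OF odd(1), of "\<lambda>p. {pin_conj p z}"]
      imageI[OF pin_set.one, of "\<lambda>p. {pin_conj p z}"] by simp
  moreover have "mu2_class g m z \<subseteq> {{z}, {pi1_flip z}}" unfolding mu2 using pin_conj_pi1[OF _ z] by auto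
  ultimately show ?thesis by blast
qed

text \<open>The coset already contains z and -z, and flipping preserves it, so its orbit is a single
  coset.\<close>

lemma mu2_class_nontrivial:
  assumes k: "k < 2 * g" "m k \<noteq> 0" and odd: "s \<in> pin_set" "s \<notin> (spin_set :: 'n clifford set)" and z: "(z :: 'n clifford) \<in> pi1_elems"
  shows "mu2_class g m z = {{z, - z}}"
proof -
  have G: "Gamma_mu1 g m #>\<^bsub>Pin\<^esub> z = {z, - z}"
    by (auto simp: Gamma_nontrivial[where m = m, OF k odd] r_coset_def cl.minus_left)
  have mz: "- z \<in> pi1_elems" using z by (auto simp: pi1_elems_def)
  have "pi1_flip z = z \<and> pi1_flip (- z) = - z \<or> pi1_flip z = - z \<and> pi1_flip (- z) = z"
    using z by (auto simp: pi1_elems_def)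
  then have "pin_conj p ` {z, - z} = {z, - z}" if "p \<in> pin_set" for p
    using pin_conj_pi1[OF that z] pin_conj_pi1[OF that mz] by auto
  then show ?thesis unfolding mu2_class_def G using odd(1) by auto
qed

end

section \<open>The invariants determine the bundle and take all values\<close>

context presented_surface
begin

text \<open>The right-hand side is the ambiguity found in
  \<open>adapted_pair_winding_unique\<close>; thus \<open>mu2_class\<close> forgets exactly the
  choices.\<close>

lemma mu2_class_eq_iff:
  assumes "z \<in> pi1_elems" "z' \<in> pi1_elems"
  shows "mu2_class g m z = mu2_class g m z' \<longleftrightarrow>
    (\<exists>w. (w = cl_one \<or> w = - cl_one) \<and> ((\<forall>k<2 * g. m k = 0) \<longrightarrow> w = cl_one) \<and> (z' = z \<star> w \<or> z' = pi1_flip z \<star> w))"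
proof (cases "\<forall>k<2 * g. m k = 0")
  case True
  then have "mu2_class g m z = {{z}, {pi1_flip z}}" "mu2_class g m z' = {{z'}, {pi1_flip z'}}"
    using mu2_class_trivial[OF _ rpin(1,2)] assms by simp_all
  then show ?thesis using True assms pi1_flip_flip by (auto simp: doubleton_eq_iff)
next
  case False
  then obtain k where k: "k < 2 * g" "m k \<noteq> 0" by blast
  have "mu2_class g m z = {{z, - z}}" "mu2_class g m z' = {{z', - z'}}"
    using mu2_class_nontrivial[where m = m, OF k rpin(1,2)] assms by simp_all
  moreover have "pi1_flip z = z \<or> pi1_flip z = - z" by (simp add: pi1_flip_def)
  ultimately show ?thesis using False by (auto simp: doubleton_eq_iff cl.minus_right)
qed

text \<open>The description in \<open>mu2\<close> is legitimate: a gluing loop exists by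
  \<open>clutched_gluing_loop\<close>, and any other one yields a winding of the same bundle, hence
  the same class.\<close>

lemma clutched_mu2:
  fixes E :: "('e, 'x, 'n sq_matrix set) bundle_data"
  assumes E: "principal_bundle PO PO_topology X E" and c: "clutched E m z"
  shows "mu2 g X q r E = mu2_class g m z"
  unfolding mu2_def clutched_mu1[OF E c]
proof (rule the_equality)
  show "\<exists>\<rho> z'. gluing_loop g X q r E \<rho> \<and> represents_pi1 \<rho> z' \<and> mu2_class g m z = mu2_class g m z'"
    using clutched_gluing_loop[OF E c] by blast
  fix y assume "\<exists>\<rho> z'. gluing_loop g X q r E \<rho> \<and> represents_pi1 \<rho> z' \<and> y = mu2_class g m z'"
  then obtain \<rho> z' where \<rho>: "gluing_loop g X q r E \<rho>" "represents_pi1 \<rho> z'" "y = mu2_class g m z'" by blast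
  obtain m' where c': "clutched E m' z'" using gluing_loop_clutched[OF E \<rho>(1,2)] .
  \<comment> \<open>Each gluing loop comes with its own side identifications, but these are all
    equal to the monodromy \<open>mu1\<close>.\<close>
  have "m' = m" using clutched_mu1[OF E c] clutched_mu1[OF E c'] by simp
  then obtain S f S' f' where A: "adapted_pair E m S f" "winding f z" "adapted_pair E m S' f'" "winding f' z'"
    using c c' unfolding clutched_def by blast
  obtain w where "w = cl_one \<or> w = - cl_one" "(\<forall>k<2 * g. m k = 0) \<longrightarrow> w = cl_one"
    "z' = z \<star> w \<or> z' = pi1_flip z \<star> w" using adapted_pair_winding_unique[OF E A] by blast
  then have "mu2_class g m z = mu2_class g m z'"
    unfolding mu2_class_eq_iff[OF winding_in[OF A(2)] winding_in[OF A(4)]] by blast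
  then show "y = mu2_class g m z" using \<rho>(3) by simp
qed

text \<open>Equal classes mean that the two windings differ by a flip and, if m is nonzero, by a
  sign. \<open>clutched_flip\<close> and \<open>clutched_neg\<close> change the choices for E until
  the windings agree.\<close>

lemma isomorphic_iff_invariants:
  fixes E E' :: "('e, 'x, 'n sq_matrix set) bundle_data"
  assumes E: "principal_bundle PO PO_topology X E" and E': "principal_bundle PO PO_topology X E'"
  shows "bundle_isomorphic PO E E' \<longleftrightarrow> (mu1 g q E, mu2 g X q r E) = (mu1 g q E', mu2 g X q r E')"
proof
  obtain m z where c: "clutched E m z" using clutched_exists[OF E] .
  note inv = clutched_mu1[OF E c] clutched_mu2[OF E c]
  show "(mu1 g q E, mu2 g X q r E) = (mu1 g q E', mu2 g X q r E')" if "bundle_isomorphic PO E E'"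
    using clutched_transport[OF E that c] clutched_mu1[OF E'] clutched_mu2[OF E'] inv by metis
  assume eq: "(mu1 g q E, mu2 g X q r E) = (mu1 g q E', mu2 g X q r E')"
  obtain m' z' where c': "clutched E' m' z'" using clutched_exists[OF E'] .
  have m: "m' = m" and cl: "mu2_class g m z = mu2_class g m z'"
    using eq unfolding inv clutched_mu1[OF E' c'] clutched_mu2[OF E' c'] by auto
  have zz: "z \<in> pi1_elems" "z' \<in> pi1_elems" using c c' winding_in unfolding clutched_def by blast+
  obtain w where w: "w = cl_one \<or> w = - cl_one" "(\<forall>k<2 * g. m k = 0) \<longrightarrow> w = cl_one"
    "z' = z \<star> w \<or> z' = pi1_flip z \<star> w" using cl mu2_class_eq_iff[OF zz] by blast
  obtain y where y: "clutched E m y" "z' = y \<star> w" using w(3) c clutched_flip[OF E c] by blast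
  have "clutched E m z'"
  proof (cases "w = cl_one")
    case False
    then obtain k where k: "k < 2 * g" "m k \<noteq> 0" using w(2) by blast
    have "z' = - y" using False w(1) y(2) by (simp add: cl.minus_right)
    then show ?thesis using clutched_neg[OF E y(1) k] by simp
  qed (use y in simp)
  then show "bundle_isomorphic PO E E'" using clutched_isomorphic[OF E E'] c' m by blast
qed

text \<open>The injection \<open>\<iota>\<close> provides room in the type \<open>'e\<close> for the
  bundles constructed by gluing, so that every value is attained there.\<close>

lemma invariants_image:
  fixes \<iota> :: "'x \<times> 'n sq_matrix set \<Rightarrow> 'e"
  assumes inj: "inj_on \<iota> (topspace X \<times> carrier PO)"
  shows "(\<lambda>E :: ('e, 'x, 'n sq_matrix set) bundle_data. (mu1 g q E, mu2 g X q r E)) ` {E. principal_bundle PO PO_topology X E} =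
    (invariant_values g :: ((nat \<Rightarrow> bit) \<times> 'n clifford set set) set)"
proof -
  have zero: "m = Z2_zero g \<longleftrightarrow> (\<forall>k<2 * g. m k = 0)" if "m \<in> Z2_tuples g" for m
    using that by (auto simp: Z2_zero_def Z2_tuples_def PiE_def extensional_def fun_eq_iff)
  have z0: "Z2_zero g \<in> Z2_tuples g" by (simp add: Z2_zero_def Z2_tuples_def)
  have om: "mu2_class g m (- cl_omega) = mu2_class g m (cl_omega :: 'n clifford)" for m
    by (subst mu2_class_eq_iff) (auto simp: pi1_elems_def)
  have one: "mu2_class g m (- cl_one) = mu2_class g m (cl_one :: 'n clifford)" if "m \<in> Z2_tuples g" "m \<noteq> Z2_zero g" for m
    by (subst mu2_class_eq_iff) (use that zero in \<open>auto simp: pi1_elems_def cl.minus_left cl.minus_right\<close>)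
  \<comment> \<open>Letting z range over the whole kernel adds no values: omega and -omega always
    have the same class, and so have 1 and -1 when m is nonzero.\<close>
  have inv: "invariant_values g = (\<Union>m\<in>Z2_tuples g. {m} \<times> mu2_class g m ` (pi1_elems :: 'n clifford set))"
    unfolding invariant_values_def pi1_elems_def
    using z0 om one by (auto simp: image_iff)
  show ?thesis
  proof (intro equalityI subsetI)
    fix v assume "v \<in> (\<lambda>E :: ('e, 'x, 'n sq_matrix set) bundle_data. (mu1 g q E, mu2 g X q r E)) ` {E. principal_bundle PO PO_topology X E}"
    then obtain E :: "('e, 'x, 'n sq_matrix set) bundle_data"
      where E: "principal_bundle PO PO_topology X E" "v = (mu1 g q E, mu2 g X q r E)" by blast
    obtain m z where c: "clutched E m z" using clutched_exists[OF E(1)] .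
    then have "m \<in> Z2_tuples g" "z \<in> pi1_elems" using winding_in unfolding clutched_def by blast+
    then show "v \<in> invariant_values g"
      unfolding inv E(2) clutched_mu1[OF E(1) c] clutched_mu2[OF E(1) c] by blast
  next
    fix v assume "v \<in> (invariant_values g :: ((nat \<Rightarrow> bit) \<times> 'n clifford set set) set)"
    then obtain m and z :: "'n clifford" where v: "m \<in> Z2_tuples g" "z \<in> pi1_elems" "v = (m, mu2_class g m z)"
      unfolding inv by blast
    obtain E :: "('e, 'x, 'n sq_matrix set) bundle_data" where E: "principal_bundle PO PO_topology X E" "clutched E m z"
      using clutched_bundle_exists[OF v(1,2) inj] .
    then show "v \<in> (\<lambda>E :: ('e, 'x, 'n sq_matrix set) bundle_data. (mu1 g q E, mu2 g X q r E)) ` {E. principal_bundle PO PO_topology X E}"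
      using v(3) clutched_mu1[OF E] clutched_mu2[OF E] by (intro image_eqI[of _ _ E]) auto
  qed
qed

end

theorem theorem3p13:
  fixes g :: nat
    and X :: "'x topology"
    and q :: "complex \<Rightarrow> 'x"
    and r :: "'n::{finite,linorder} sq_matrix"
  assumes "CARD('n) \<ge> 4" and "even CARD('n)"
    and "g \<ge> 2" and "closed_surface_presentation g X q"
    and "hyperplane_reflection r"
    \<comment> \<open>the points of total spaces are taken from a type large enough to represent every
        isomorphism class of bundles\<close>
    and "topspace X \<times> carrier (PO :: 'n sq_matrix set monoid) \<lesssim> (UNIV :: 'e set)"
  shows "\<exists>F. bij_betw F
               ({E :: ('e, 'x, 'n sq_matrix set) bundle_data. principal_bundle PO PO_topology X E}
                  // bundle_iso_rel PO PO_topology X)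
               (invariant_values g :: ((nat \<Rightarrow> bit) \<times> 'n clifford set set) set) \<and>
             (\<forall>E. principal_bundle PO PO_topology X E \<longrightarrow>
                F (bundle_iso_rel PO PO_topology X `` {E}) = (mu1 g q E, mu2 g X q r E))"
proof -
  interpret presented_surface "TYPE('n)" g r X q by unfold_locales (use assms in auto)
  obtain \<iota> :: "'x \<times> 'n sq_matrix set \<Rightarrow> 'e" where inj: "inj_on \<iota> (topspace X \<times> carrier PO)"
    using assms(6) unfolding lepoll_def by blast
  let ?P = "{E :: ('e, 'x, 'n sq_matrix set) bundle_data. principal_bundle PO PO_topology X E}"
  have "bundle_iso_rel PO PO_topology X =
      {(E, E'). E \<in> ?P \<and> E' \<in> ?P \<and> (mu1 g q E, mu2 g X q r E) = (mu1 g q E', mu2 g X q r E')}"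
    unfolding bundle_iso_rel_def using isomorphic_iff_invariants by blast
  from bij_betw_classes[OF this] show ?thesis unfolding invariants_image[OF inj] by simp
qed

end
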